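(* Let $\varphi\in\mathcal{S}$ with $F(\varphi)=\{\zeta_1,\dots,\zeta_r\}$, and let $n_j=2m_j$ be the order of contact of $\varphi$ with $\partial\mathbb{D}$ at $\zeta_j$. Then there exist, for $j=1,\dots,r$, basic functions $\varphi_j$ of degree $m_j+1$ with contact at $\zeta_j$, each having order of contact $n_j$ with $\partial\mathbb{D}$ at $\zeta_j$ and satisfying $D_{n_j}(\varphi_j,\zeta_j)=D_{n_j}(\varphi,\zeta_j)$, such that $C_\varphi-(C_{\varphi_1}+\dots+C_{\varphi_r})$ is compact on $H^2$.
   Context: $C_\varphi f=f\circ\varphi$ on the Hardy space $H^2$. Class $\mathcal{S}$: analytic self-maps $\varphi$ of $\mathbb{D}$ with (1) $|\varphi|<1$ a.e. on $\partial\mathbb{D}$; (2) $E(\varphi)$ finite, where $E(\varphi)$ is the closure of the union of the supports of the singular parts of the Clark measures $\mu_\alpha$ ($|\alpha|=1$; $\mathrm{Re}\frac{\alpha+\varphi(z)}{\alpha-\varphi(z)}=\int P_z\,d\mu_\alpha$), in which case $E(\varphi)=F(\varphi)$, the set of boundary points where $\varphi$ has a finite angular derivative; (3) at each $\zeta\in F(\varphi)$, $\varphi$ has an even order of contact $n$ with $\partial\mathbb{D}$ ($\varphi(\zeta)\in\partial\mathbb{D}$ and $\frac{1-|\varphi(e^{i\theta})|^2}{|\varphi(\zeta)-\varphi(e^{i\theta})|^n}$ essentially bounded above and away from $0$ as $e^{i\theta}\to\zeta$) and $\varphi(z)=\sum_{k=0}^na_k(z-\zeta)^k+o(|z-\zeta|^n)$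 as $z\to\zeta$ unrestrictedly in $\mathbb{D}$; set $\varphi^{(k)}(\zeta):=k!a_k$ and $D_n(\varphi,\zeta)=(\varphi(\zeta),\varphi'(\zeta),\dots,\varphi^{(n)}(\zeta))$ (for analytic functions these are ordinary derivatives). Basic function with contact at $\zeta$: a rational $\varphi$ with $\varphi(\mathbb{D})\subset\mathbb{D}$, $\varphi(\zeta)\in\partial\mathbb{D}$, $\varphi(\partial\mathbb{D}\setminus\{\zeta\})\subset\mathbb{D}$, and $\varphi(\zeta)$ a regular value of $\varphi$ (its preimage consists of $\deg\varphi$ distinct points of the Riemann sphere). *)

theory Defs
  imports "HOL-Analysis.Analysis" "HOL-Computational_Algebra.Polynomial_Factorial"
begin

definition H2 :: "(complex \<Rightarrow> complex) set" where
  "H2 = {f. f holomorphic_on ball 0 1 \<and>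
             summable (\<lambda>k. (cmod ((deriv ^^ k) f 0 / fact k))\<^sup>2)}"

definition h2norm :: "(complex \<Rightarrow> complex) \<Rightarrow> real" where
  "h2norm f = sqrt (\<Sum>k. (cmod ((deriv ^^ k) f 0 / fact k))\<^sup>2)"

text \<open>Compact operator on H^2: maps H^2 into H^2, and the image of every bounded
  sequence has a Cauchy (hence, H^2 being complete, convergent) subsequence.\<close>
definition H2_compact_op :: "((complex \<Rightarrow> complex) \<Rightarrow> (complex \<Rightarrow> complex)) \<Rightarrow> bool" where
  "H2_compact_op T \<longleftrightarrow>
     (\<forall>f\<in>H2. T f \<in> H2) \<and>
     (\<forall>s :: nat \<Rightarrow> complex \<Rightarrow> complex. (\<forall>k. s k \<in> H2) \<and> (\<exists>B. \<forall>k. h2norm (s k) \<le> B) \<longrightarrow>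
        (\<exists>r :: nat \<Rightarrow> nat. strict_mono r \<and>
           (\<forall>e>0. \<exists>N. \<forall>k\<ge>N. \<forall>l\<ge>N. h2norm (\<lambda>z. T (s (r k)) z - T (s (r l)) z) < e)))"

definition radial_lim :: "(complex \<Rightarrow> complex) \<Rightarrow> real \<Rightarrow> complex \<Rightarrow> bool" where
  "radial_lim \<phi> \<theta> v \<longleftrightarrow> ((\<lambda>r::real. \<phi> (of_real r * cis \<theta>)) \<longlongrightarrow> v) (at_left 1)"

definition stolz :: "complex \<Rightarrow> real \<Rightarrow> complex set" where
  "stolz \<zeta> M = {z. cmod z < 1 \<and> cmod (z - \<zeta>) < M * (1 - cmod z)}"

definition angular_lim :: "(complex \<Rightarrow> complex) \<Rightarrow> complex \<Rightarrow> complex \<Rightarrow> bool" where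
  "angular_lim f \<zeta> L \<longleftrightarrow> (\<forall>M>1. (f \<longlongrightarrow> L) (at \<zeta> within stolz \<zeta> M))"

definition F_set :: "(complex \<Rightarrow> complex) \<Rightarrow> complex set" where
  "F_set \<phi> = {\<zeta>. cmod \<zeta> = 1 \<and> (\<exists>\<omega> d. cmod \<omega> = 1 \<and> angular_lim \<phi> \<zeta> \<omega> \<and>
                   angular_lim (\<lambda>z. (\<phi> z - \<omega>) / (z - \<zeta>)) \<zeta> d)}"

definition clark_measure :: "(complex \<Rightarrow> complex) \<Rightarrow> complex \<Rightarrow> complex measure \<Rightarrow> bool" where
  "clark_measure \<phi> \<alpha> M \<longleftrightarrow> sets M = sets borel \<and> finite_measure M \<and>
     emeasure M (- sphere 0 1) = 0 \<and>
     (\<forall>z\<in>ball 0 1. Re ((\<alpha> + \<phi> z) / (\<alpha> - \<phi> z)) =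
        (\<integral>\<zeta>. (1 - (cmod z)\<^sup>2) / (cmod (\<zeta> - z))\<^sup>2 \<partial>M))"

definition arc_null :: "complex set \<Rightarrow> bool" where
  "arc_null N \<longleftrightarrow> cis -` N \<in> null_sets lborel"

text \<open>Support of the singular part of M w.r.t. arc length: the singular part is M
  restricted to an arc-null Borel set N carrying everything not absolutely
  continuous (N is unique up to M-null sets, so the support is well defined).\<close>
definition sing_supp :: "complex measure \<Rightarrow> complex set" where
  "sing_supp M = {\<zeta>. \<exists>N \<in> sets borel. arc_null N \<and>
       (\<forall>A \<in> sets borel. arc_null A \<longrightarrow> emeasure M (A - N) = 0) \<and>
       (\<forall>e>0. emeasure M (ball \<zeta> e \<inter> N) > 0)}"

definition E_set :: "(complex \<Rightarrow> complex) \<Rightarrow> complex set" where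
  "E_set \<phi> = closure (\<Union>\<alpha>\<in>sphere 0 1. \<Union>{sing_supp M | M. clark_measure \<phi> \<alpha> M})"

definition bdry_expansion :: "(complex \<Rightarrow> complex) \<Rightarrow> complex \<Rightarrow> nat \<Rightarrow> (nat \<Rightarrow> complex) \<Rightarrow> bool" where
  "bdry_expansion \<phi> \<zeta> n a \<longleftrightarrow>
     ((\<lambda>z. cmod (\<phi> z - (\<Sum>k\<le>n. a k * (z - \<zeta>) ^ k)) / (cmod (z - \<zeta>)) ^ n) \<longlongrightarrow> 0)
        (at \<zeta> within ball 0 1)"

definition bdry_deriv :: "(complex \<Rightarrow> complex) \<Rightarrow> complex \<Rightarrow> nat \<Rightarrow> nat \<Rightarrow> complex" where
  "bdry_deriv \<phi> \<zeta> n k = fact k * (THE a. (\<forall>i>n. a i = 0) \<and> bdry_expansion \<phi> \<zeta> n a) k"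

definition contact_order :: "(complex \<Rightarrow> complex) \<Rightarrow> complex \<Rightarrow> nat \<Rightarrow> bool" where
  "contact_order \<phi> \<zeta> n \<longleftrightarrow> (\<exists>w. cmod w = 1 \<and> (\<phi> \<longlongrightarrow> w) (at \<zeta> within ball 0 1) \<and>
     (\<exists>c C \<delta>. c > 0 \<and> C > 0 \<and> \<delta> > 0 \<and>
        (AE \<theta> in lborel. 0 < cmod (cis \<theta> - \<zeta>) \<and> cmod (cis \<theta> - \<zeta>) < \<delta> \<longrightarrow>
           (\<exists>v. radial_lim \<phi> \<theta> v \<and>
                c \<le> (1 - (cmod v)\<^sup>2) / (cmod (w - v)) ^ n \<and>
                (1 - (cmod v)\<^sup>2) / (cmod (w - v)) ^ n \<le> C))))"

definition class_S :: "(complex \<Rightarrow> complex) \<Rightarrow> bool" where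
  "class_S \<phi> \<longleftrightarrow> \<phi> holomorphic_on ball 0 1 \<and> \<phi> ` ball 0 1 \<subseteq> ball 0 1 \<and>
     (AE \<theta> in lborel. \<exists>v. radial_lim \<phi> \<theta> v \<and> cmod v < 1) \<and>
     finite (E_set \<phi>) \<and>
     (\<forall>\<zeta>\<in>F_set \<phi>. \<exists>n. even n \<and> contact_order \<phi> \<zeta> n \<and> (\<exists>a. bdry_expansion \<phi> \<zeta> n a))"

definition rat_fun :: "complex poly \<Rightarrow> complex poly \<Rightarrow> complex \<Rightarrow> complex" where
  "rat_fun p q = (\<lambda>z. poly p z / poly q z)"

text \<open>Degree of p/q (p, q coprime).\<close>
definition rat_deg :: "complex poly \<Rightarrow> complex poly \<Rightarrow> nat" where
  "rat_deg p q = max (degree p) (degree q)"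

text \<open>Number of distinct preimages of a finite value w on the Riemann sphere:
  finite roots of p - w q, plus the point at infinity iff deg (p - w q) < deg (p/q).\<close>
definition num_preimages :: "complex poly \<Rightarrow> complex poly \<Rightarrow> complex \<Rightarrow> nat" where
  "num_preimages p q w = card {z. poly (p - smult w q) z = 0} +
      (if degree (p - smult w q) < rat_deg p q then 1 else 0)"

definition basic_fun :: "complex poly \<Rightarrow> complex poly \<Rightarrow> complex \<Rightarrow> bool" where
  "basic_fun p q \<zeta> \<longleftrightarrow> q \<noteq> 0 \<and> coprime p q \<and>
     (\<forall>z. cmod z \<le> 1 \<longrightarrow> poly q z \<noteq> 0) \<and>
     rat_fun p q ` ball 0 1 \<subseteq> ball 0 1 \<and>
     cmod (rat_fun p q \<zeta>) = 1 \<and>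
     rat_fun p q ` (sphere 0 1 - {\<zeta>}) \<subseteq> ball 0 1 \<and>
     p - smult (rat_fun p q \<zeta>) q \<noteq> 0 \<and>
     num_preimages p q (rat_fun p q \<zeta>) = rat_deg p q"

end

theory Submission
  imports Defs "HOL-Complex_Analysis.Complex_Analysis" "HOL-Probability.Probability"
    "HOL-Computational_Algebra.Computational_Algebra"
begin

text \<open>
  Compactness. For a polynomial \<open>f\<close> of unit norm that is divisible by \<open>z^N\<close>, the norm of
  \<open>f \<circ> \<phi> - (\<Sum>j. f \<circ> \<phi>\<^sub>j)\<close> is estimated on the circle, and it has to be small uniformly in \<open>f\<close>.
  Near \<open>\<zeta>\<^sub>j\<close> agreement of the jets up to the order of contact makes \<open>\<bar>\<phi> - \<phi>\<^sub>j\<bar>\<^sup>2\<close> small compared with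
  \<open>(1 - \<bar>\<phi>\<bar>\<^sup>2) (1 - \<bar>\<phi>\<^sub>j\<bar>\<^sup>2)\<close>, which controls \<open>f \<circ> \<phi> - f \<circ> \<phi>\<^sub>j\<close> by Cauchy-Schwarz against Cauchy kernels.
  Away from the \<open>\<zeta>\<^sub>j\<close> every Clark measure is absolutely continuous: a singular part would live on the finite
  set \<open>E\<close>, hence be atomic, and an atom forces a finite angular derivative. So the integral of a weight
  vanishing on \<open>F\<close> against the Clark measure at \<open>\<alpha>\<close> equals its integral against the Poisson kernel of the
  boundary function at \<open>\<alpha>\<close>; this is continuous in \<open>\<alpha>\<close>, and Dini's argument gives uniform decay of the part
  weighted by \<open>\<bar>\<phi>\<bar>^(2 N)\<close>.

  Basic functions. In Cayley coordinates \<open>\<phi>\<close> becomes a self-map \<open>h\<close> of the upper half plane with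
  \<open>h = p (t) + \<i> \<kappa> t^(2 m) + o (t^(2 m))\<close>, \<open>p\<close> real and \<open>\<kappa> > 0\<close>. Passing from \<open>h\<close> to \<open>A / t - \<beta> - 1 / h\<close> lowers
  \<open>m\<close> by one. After \<open>m\<close> steps the limit is \<open>\<i> \<kappa>'\<close>; replacing the last map by a generic Moebius transformation
  with this value and unrolling the continued fraction gives a rational map of degree \<open>m + 1\<close> with the same
  expansion, and genericity makes the contact value regular.
\<close>

section \<open>Fourier analysis on the circle\<close>

text \<open>Away from the contact points the values of phi may still come arbitrarily close to the
  circle, so no bound |phi| <= s < 1 is available there. Finiteness of E is the only information,
  and it has to be used for all Clark parameters at once. The weight is the product of the distances
  to the contact points: it vanishes where the Clark measures may have atoms, is bounded below on
  far arcs, and is Lipschitz, so that its Poisson averages converge at a rate independent of the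
  parameter. Near a contact point jets up to order n = 2m suffice: the difference is o(x^n), with x
  the distance to the point, while 1 - |phi|^2 and 1 - |phi_j|^2 are both of size x^n. The last map
  of the continued fraction is w + c (1 - z) / (z - rho). Its value at 1 is w for every c, so c
  stays free. Preimages of the contact value are the zeros of (1 - z) times a pencil in c, which has
  distinct roots for all but finitely many c. General functions of H^2 enter only through their
  Taylor polynomials, on circles of radius r < 1, so no boundary values are taken of them.\<close>

definition circ :: "real measure" where
  "circ = uniform_measure lborel {0..2*pi}"

lemma prob_space_circ: "prob_space circ"
  unfolding circ_def by (rule prob_space_uniform_measure) auto

interpretation circ: prob_space circ
  by (rule prob_space_circ)

lemma sets_circ [measurable_cong, simp]: "sets circ = sets borel"
  by (simp add: circ_def)

lemma space_circ [simp]: "space circ = UNIV"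
  by (simp add: circ_def)

lemma measure_circ_UNIV [simp]: "measure circ UNIV = 1"
  using circ.prob_space by simp

lemma measurable_cnj [measurable]: "cnj \<in> borel_measurable borel"
  by (intro borel_measurable_continuous_onI continuous_intros)

lemma measurable_cis [measurable]: "cis \<in> borel_measurable borel"
  by (intro borel_measurable_continuous_onI continuous_intros)

lemma integrable_circ_bounded:
  fixes f :: "real \<Rightarrow> 'a::{banach, second_countable_topology}"
  assumes "f \<in> borel_measurable borel" "\<And>x. norm (f x) \<le> B"
  shows "integrable circ f"
  using assms by (intro circ.integrable_const_bound[where B = B]) auto

lemma integral_circ_continuous:
  fixes f :: "real \<Rightarrow> complex"
  assumes "continuous_on UNIV f" "\<And>x. (F has_vector_derivative f x) (at x)"
  shows "(\<integral>\<theta>. f \<theta> \<partial>circ) = (F (2*pi) - F 0) /\<^sub>R (2*pi)"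
proof -
  have [measurable]: "f \<in> borel_measurable borel"
    by (intro borel_measurable_continuous_onI assms)
  have e: "indicator {0..2*pi} x / emeasure lborel {0..2*pi} = ennreal (indicator {0..2*pi} x / (2*pi))" for x :: real
    using divide_ennreal[of 1 "2*pi"] by (auto simp: indicator_def ennreal_1[symmetric] simp del: ennreal_1)
  have "(\<integral>\<theta>. f \<theta> \<partial>circ) = (\<integral>x. (indicator {0..2*pi} x / (2*pi)) *\<^sub>R f x \<partial>lborel)"
    unfolding circ_def uniform_measure_def e by (subst integral_density) (auto simp: indicator_def)
  also have "\<dots> = (\<integral>x. (1/(2*pi)) *\<^sub>R (indicator {0..2*pi} x *\<^sub>R f x) \<partial>lborel)"
    by (intro Bochner_Integration.integral_cong) (auto simp: indicator_def)
  also have "\<dots> = (1/(2*pi)) *\<^sub>R (\<integral>x. indicator {0..2*pi} x *\<^sub>R f x \<partial>lborel)"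
    by (rule integral_scaleR_right)
  also have "(\<integral>x. indicator {0..2*pi} x *\<^sub>R f x \<partial>lborel) = F (2*pi) - F 0"
    using assms by (intro integral_FTC_Icc) 
      (auto intro: continuous_on_subset has_vector_derivative_at_within)
  finally show ?thesis by (simp add: field_simps)
qed

text \<open>The two trigonometric hypotheses encode that \<open>a\<close> is an integer: the
  antiderivative then takes the same value at both ends of the interval.\<close>

lemma integral_circ_cis:
  assumes "a \<noteq> 0" "sin (2*pi*a) = 0" "cos (2*pi*a) = 1"
  shows "(\<integral>\<theta>. cis (a * \<theta>) \<partial>circ) = 0"
proof -
  have "(\<integral>\<theta>. cis (a * \<theta>) \<partial>circ) = (cis (a * (2*pi)) / (\<i> * of_real a) - cis (a * 0) / (\<i> * of_real a)) /\<^sub>R (2*pi)"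
  proof (rule integral_circ_continuous)
    show "continuous_on UNIV (\<lambda>\<theta>. cis (a * \<theta>))" by (intro continuous_intros)
    show "((\<lambda>\<theta>. cis (a * \<theta>) / (\<i> * of_real a)) has_vector_derivative cis (a * x)) (at x)" for x
    proof -
      have "((\<lambda>z. exp (\<i> * (of_real a * z)) / (\<i> * of_real a)) has_field_derivative exp (\<i> * (of_real a * of_real x))) (at (of_real x))"
        using assms by (auto intro!: derivative_eq_intros simp: field_simps)
      from has_vector_derivative_real_field[OF this] show ?thesis by (simp add: cis_conv_exp)
    qed
  qed
  also have "cis (a * (2*pi)) = 1" using assms by (simp add: complex_eq_iff mult_ac)
  finally show ?thesis by simp
qed

lemma integral_circ_power:
  "(\<integral>\<theta>. cis \<theta> ^ j * cnj (cis \<theta>) ^ k \<partial>circ) = of_bool (j = k)"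
proof -
  have e: "cis \<theta> ^ j * cnj (cis \<theta>) ^ k = cis ((real j - real k) * \<theta>)" for \<theta>
    by (simp only: cis_cnj Complex.DeMoivre cis_mult) (simp add: algebra_simps)
  show ?thesis
  proof (cases "j = k")
    case True then show ?thesis unfolding e by simp
  next
    case False
    have s: "2*pi*(real j - real k) = (2*pi) * of_int (int j - int k)" by simp
    have "sin (2*pi*(real j - real k)) = 0" "cos (2*pi*(real j - real k)) = 1"
      unfolding s by (rule sin_int_2pin) (rule cos_int_2pin)
    then have "(\<integral>\<theta>. cis ((real j - real k) * \<theta>) \<partial>circ) = 0"
      using False by (intro integral_circ_cis) auto
    then show ?thesis using False unfolding e by simp
  qed
qed

text \<open>Absolute summability dominates both exchanges of sum and integral: \<open>step\<close>
  first isolates the Fourier coefficient of index \<open>k\<close> of \<open>f\<close>, and then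
  \<open>g\<close> is expanded.\<close>

lemma circ_pairing:
  assumes a: "summable (\<lambda>j. norm (a j))" and b: "summable (\<lambda>j. norm (b j))"
    and f: "\<And>\<theta>. (\<lambda>j. a j * cis \<theta> ^ j) sums f \<theta>"
    and g: "\<And>\<theta>. (\<lambda>j. b j * cnj (cis \<theta>) ^ j) sums g \<theta>"
  shows "(\<integral>\<theta>. f \<theta> * g \<theta> \<partial>circ) = (\<Sum>j. a j * b j)"
proof -
  define A where "A = (\<Sum>j. norm (a j))"
  have fm: "f \<in> borel_measurable borel"
  proof -
    have "f = (\<lambda>\<theta>. \<Sum>j. a j * cis \<theta> ^ j)" using f by (auto simp: sums_iff)
    then show ?thesis by simp
  qed
  have fb: "norm (f \<theta>) \<le> A" for \<theta>
    using f[of \<theta>] norm_suminf_le[of "\<lambda>j. a j * cis \<theta> ^ j" "\<lambda>j. norm (a j)"] a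
    by (auto simp: A_def sums_iff norm_mult norm_power)
  have step: "(\<integral>\<theta>. f \<theta> * cnj (cis \<theta>) ^ k \<partial>circ) = a k" for k
  proof -
    have "(\<integral>\<theta>. f \<theta> * cnj (cis \<theta>) ^ k \<partial>circ) = (\<integral>\<theta>. (\<Sum>j. a j * cis \<theta> ^ j * cnj (cis \<theta>) ^ k) \<partial>circ)"
      using sums_mult2[OF f] by (intro Bochner_Integration.integral_cong refl) (simp add: sums_iff)
    also have "\<dots> = (\<Sum>j. \<integral>\<theta>. a j * cis \<theta> ^ j * cnj (cis \<theta>) ^ k \<partial>circ)"
    proof (rule integral_suminf)
      show "integrable circ (\<lambda>\<theta>. a j * cis \<theta> ^ j * cnj (cis \<theta>) ^ k)" for j
        by (rule integrable_circ_bounded[where B = "norm (a j)"]) (auto simp: norm_mult norm_power)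
    qed (use a in \<open>auto simp: norm_mult norm_power\<close>)
    also have "\<dots> = (\<Sum>j. a j * of_bool (j = k))"
      by (simp add: mult.assoc integral_circ_power)
    also have "\<dots> = a k"
      using suminf_finite[of "{k}" "\<lambda>j. a j * of_bool (j = k)"] by auto
    finally show ?thesis .
  qed
  have "(\<integral>\<theta>. f \<theta> * g \<theta> \<partial>circ) = (\<integral>\<theta>. (\<Sum>k. b k * (f \<theta> * cnj (cis \<theta>) ^ k)) \<partial>circ)"
  proof (intro Bochner_Integration.integral_cong refl)
    fix \<theta>
    have "(\<lambda>k. f \<theta> * (b k * cnj (cis \<theta>) ^ k)) sums (f \<theta> * g \<theta>)"
      by (rule sums_mult[OF g])
    then show "f \<theta> * g \<theta> = (\<Sum>k. b k * (f \<theta> * cnj (cis \<theta>) ^ k))"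
      by (simp add: sums_iff mult_ac)
  qed
  also have "\<dots> = (\<Sum>k. \<integral>\<theta>. b k * (f \<theta> * cnj (cis \<theta>) ^ k) \<partial>circ)"
  proof (rule integral_suminf)
    have bd: "norm (b k * (f \<theta> * cnj (cis \<theta>) ^ k)) \<le> norm (b k) * A" for k \<theta>
      using fb[of \<theta>] by (auto simp: norm_mult norm_power intro!: mult_left_mono)
    show i: "integrable circ (\<lambda>\<theta>. b k * (f \<theta> * cnj (cis \<theta>) ^ k))" for k
      using fm bd by (intro integrable_circ_bounded[where B = "norm (b k) * A"]) auto
    have sb: "summable (\<lambda>k. norm (b k) * A)" using b by (rule summable_mult2)
    show "AE \<theta> in circ. summable (\<lambda>k. norm (b k * (f \<theta> * cnj (cis \<theta>) ^ k)))"
      using bd sb by (intro AE_I2 summable_comparison_test'[OF sb]) auto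
    show "summable (\<lambda>k. \<integral>\<theta>. norm (b k * (f \<theta> * cnj (cis \<theta>) ^ k)) \<partial>circ)"
    proof (rule summable_comparison_test'[OF sb])
      fix k
      have "(\<integral>\<theta>. norm (b k * (f \<theta> * cnj (cis \<theta>) ^ k)) \<partial>circ) \<le> (\<integral>\<theta>. norm (b k) * A \<partial>circ)"
        using i bd by (intro integral_mono) (auto simp: circ.integrable_const)
      then show "norm (\<integral>\<theta>. norm (b k * (f \<theta> * cnj (cis \<theta>) ^ k)) \<partial>circ) \<le> norm (b k) * A"
        by simp
    qed
  qed
  also have "\<dots> = (\<Sum>j. a j * b j)" by (simp add: step mult.commute)
  finally show ?thesis .
qed

lemma circ_parseval_series:
  assumes a: "summable (\<lambda>j. norm (a j))" and f: "\<And>\<theta>. (\<lambda>j. a j * cis \<theta> ^ j) sums f \<theta>"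
  shows "(\<integral>\<theta>. (cmod (f \<theta>))\<^sup>2 \<partial>circ) = (\<Sum>k. (cmod (a k))\<^sup>2)"
    "summable (\<lambda>k. (cmod (a k))\<^sup>2)"
proof -
  show s: "summable (\<lambda>k. (cmod (a k))\<^sup>2)"
  proof (rule summable_comparison_test_ev[OF _ a])
    have "(\<lambda>k. norm (a k)) \<longlonglongrightarrow> 0" using a by (rule summable_LIMSEQ_zero)
    then have "eventually (\<lambda>k. norm (a k) < 1) sequentially" by (auto dest: order_tendstoD(2)[where a=1])
    then show "eventually (\<lambda>k. norm ((cmod (a k))\<^sup>2) \<le> norm (a k)) sequentially"
      by eventually_elim (simp add: power2_eq_square mult_left_le)
  qed
  have "(\<integral>\<theta>. f \<theta> * cnj (f \<theta>) \<partial>circ) = (\<Sum>k. a k * cnj (a k))"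
  proof (rule circ_pairing)
    show "(\<lambda>j. cnj (a j) * cnj (cis \<theta>) ^ j) sums cnj (f \<theta>)" for \<theta>
      using sums_cnj[THEN iffD2, OF f[of \<theta>]] by simp
  qed (use a f in auto)
  moreover have "(\<Sum>k. a k * cnj (a k)) = of_real (\<Sum>k. (cmod (a k))\<^sup>2)"
    using suminf_of_real[OF s, where 'a = complex] by (simp only: complex_norm_square)
  moreover have "(\<integral>\<theta>. f \<theta> * cnj (f \<theta>) \<partial>circ) = of_real (\<integral>\<theta>. (cmod (f \<theta>))\<^sup>2 \<partial>circ)"
    unfolding complex_norm_square[symmetric] by (rule integral_complex_of_real)
  ultimately show "(\<integral>\<theta>. (cmod (f \<theta>))\<^sup>2 \<partial>circ) = (\<Sum>k. (cmod (a k))\<^sup>2)"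
    by (simp only: of_real_eq_iff)
qed

section \<open>Taylor series and Cauchy's formula on the circle\<close>

abbreviation taylor :: "(complex \<Rightarrow> complex) \<Rightarrow> nat \<Rightarrow> complex" where
  "taylor f k \<equiv> (deriv ^^ k) f 0 / fact k"

lemma taylor_sums:
  assumes "g holomorphic_on ball 0 R" "cmod z < R"
  shows "(\<lambda>k. taylor g k * z ^ k) sums g z"
  using holomorphic_power_series[of g 0 R z] assms by simp

lemma taylor_summable_norm:
  assumes "g holomorphic_on ball 0 R" "cmod z < R"
  shows "summable (\<lambda>k. norm (taylor g k * z ^ k))"
proof -
  obtain r where r: "cmod z < r" "r < R" using dense[OF assms(2)] by blast
  then have "r \<ge> 0" using norm_ge_zero[of z] by linarith
  with r have "summable (\<lambda>k. taylor g k * of_real r ^ k)"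
    using taylor_sums[OF assms(1), of "of_real r"] by (simp add: sums_iff)
  then show ?thesis using r \<open>r \<ge> 0\<close> powser_insidea by fastforce
qed

lemma taylor_sums_dilate:
  assumes "g holomorphic_on ball 0 1" "0 \<le> r" "r < 1"
  shows "(\<lambda>k. (taylor g k * of_real r ^ k) * cis \<theta> ^ k) sums g (of_real r * cis \<theta>)"
    "summable (\<lambda>k. norm (taylor g k * of_real r ^ k))"
  using taylor_sums[OF assms(1), of "of_real r * cis \<theta>"] taylor_summable_norm[OF assms(1), of "of_real r"] assms
  by (auto simp: norm_mult power_mult_distrib mult_ac)

context
  fixes g R assumes hol: "g holomorphic_on ball 0 R" and R: "1 < R"
begin

lemma taylor_sums_circle:
  "(\<lambda>k. taylor g k * cis \<theta> ^ k) sums g (cis \<theta>)" "summable (\<lambda>k. norm (taylor g k))"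
  using taylor_sums[OF hol, of "cis \<theta>"] taylor_summable_norm[OF hol, of 1] R by auto

text \<open>On the circle the kernel is the geometric series in
  \<open>w * cnj (cis \<theta>)\<close>, so pairing it with \<open>g\<close> sums the Taylor series
  of \<open>g\<close> at \<open>w\<close>.\<close>

lemma circ_cauchy:
  assumes "cmod w < 1"
  shows "(\<integral>\<theta>. g (cis \<theta>) * (1 / (1 - w * cnj (cis \<theta>))) \<partial>circ) = g w"
proof -
  have "(\<integral>\<theta>. g (cis \<theta>) * (1 / (1 - w * cnj (cis \<theta>))) \<partial>circ) = (\<Sum>j. taylor g j * w ^ j)"
  proof (rule circ_pairing)
    show "(\<lambda>j. w ^ j * cnj (cis \<theta>) ^ j) sums (1 / (1 - w * cnj (cis \<theta>)))" for \<theta>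
      using geometric_sums[of "w * cnj (cis \<theta>)"] assms by (simp add: norm_mult power_mult_distrib)
  qed (use taylor_sums_circle assms in \<open>auto simp: norm_power summable_geometric\<close>)
  also have "\<dots> = g w" using taylor_sums[OF hol, of w] assms R by (simp add: sums_iff)
  finally show ?thesis .
qed

lemma circ_mean: "(\<integral>\<theta>. g (cis \<theta>) \<partial>circ) = g 0"
  using circ_cauchy[of 0] by simp

end


section \<open>The Poisson kernel, the Schwarz formula and Harnack's inequality\<close>

definition poisson :: "complex \<Rightarrow> complex \<Rightarrow> real" where
  "poisson w \<xi> = (1 - (cmod w)\<^sup>2) / (cmod (\<xi> - w))\<^sup>2"

lemma poisson_eq_Re:
  assumes "cmod \<xi> = 1" "\<xi> \<noteq> w"
  shows "poisson w \<xi> = Re ((\<xi> + w) / (\<xi> - w))"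
proof -
  have "(cmod (\<xi> - w))\<^sup>2 \<noteq> 0" using assms by simp
  moreover have "Re (\<xi> + w) * Re (\<xi> - w) + Im (\<xi> + w) * Im (\<xi> - w) = (cmod \<xi>)\<^sup>2 - (cmod w)\<^sup>2"
    unfolding cmod_power2 by (simp add: algebra_simps power2_eq_square)
  ultimately show ?thesis
    unfolding poisson_def Re_divide cmod_power2[of "\<xi> - w", symmetric] using assms by simp
qed

lemma poisson_nonneg: "cmod w \<le> 1 \<Longrightarrow> 0 \<le> poisson w \<xi>"
  by (simp add: poisson_def power_le_one)

lemma poisson_pos: "cmod w < 1 \<Longrightarrow> cmod \<xi> = 1 \<Longrightarrow> 0 < poisson w \<xi>"
  by (auto simp: poisson_def power_less_one_iff intro!: divide_pos_pos)

text \<open>Moves a dilation from one circle variable to the other. This is what lets averages of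
  \<open>\<phi>\<close> over a smaller circle be rewritten as Poisson averages of a weight against a
  Clark measure.\<close>

lemma poisson_symmetric:
  assumes "cmod \<xi> = 1" "cmod \<eta> = 1"
  shows "poisson (of_real r * \<eta>) \<xi> = poisson (of_real r * \<xi>) \<eta>"
proof -
  have "(cmod (\<xi> - of_real r * \<eta>))\<^sup>2 = (cmod (\<eta> - of_real r * \<xi>))\<^sup>2"
  proof -
    have "(Re \<xi>)\<^sup>2 + (Im \<xi>)\<^sup>2 = 1" "(Re \<eta>)\<^sup>2 + (Im \<eta>)\<^sup>2 = 1"
      using assms cmod_power2[of \<xi>] cmod_power2[of \<eta>] by auto
    then show ?thesis unfolding cmod_power2 by simp algebra
  qed
  then show ?thesis using assms by (simp add: poisson_def norm_mult)
qed

lemma norm_circle_diff_ge: "cmod \<xi> = 1 \<Longrightarrow> 1 - cmod w \<le> cmod (\<xi> - w)"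
  using norm_triangle_ineq2[of \<xi> w] by simp

lemma poisson_le:
  assumes "cmod w < 1" "cmod \<xi> = 1"
  shows "poisson w \<xi> \<le> (1 + cmod w) / (1 - cmod w)"
proof -
  have "poisson w \<xi> \<le> (1 - (cmod w)\<^sup>2) / (1 - cmod w)\<^sup>2"
    unfolding poisson_def using norm_circle_diff_ge[of \<xi> w] assms
    by (intro divide_left_mono power_mono mult_pos_pos zero_less_power) (auto simp: power_le_one)
  also have "\<dots> = (1 + cmod w) / (1 - cmod w)"
  proof -
    have "(1 - (cmod w)\<^sup>2) = (1 + cmod w) * (1 - cmod w)" "1 - cmod w \<noteq> 0"
      using assms by (auto simp: algebra_simps power2_eq_square)
    then show ?thesis by (simp add: power2_eq_square)
  qed
  finally show ?thesis .
qed

lemma poisson_ge: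
  assumes "cmod w < 1" "cmod \<xi> = 1"
  shows "(1 - cmod w) / (1 + cmod w) \<le> poisson w \<xi>"
proof -
  have "cmod (\<xi> - w) \<le> 1 + cmod w" using norm_triangle_ineq4[of \<xi> w] assms by simp
  moreover have "0 < cmod (\<xi> - w)" using assms by auto
  ultimately have "(1 - (cmod w)\<^sup>2) / (1 + cmod w)\<^sup>2 \<le> poisson w \<xi>"
    unfolding poisson_def using assms
    by (intro divide_left_mono power_mono mult_pos_pos zero_less_power) (auto simp: power_le_one add_pos_nonneg)
  moreover have "(1 - (cmod w)\<^sup>2) / (1 + cmod w)\<^sup>2 = (1 - cmod w) / (1 + cmod w)"
  proof -
    have "(1 - (cmod w)\<^sup>2) = (1 - cmod w) * (1 + cmod w)" "1 + cmod w \<noteq> 0"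
      using add_pos_nonneg[of 1 "cmod w"] by (auto simp: algebra_simps power2_eq_square)
    then show ?thesis by (simp add: power2_eq_square)
  qed
  ultimately show ?thesis by simp
qed

text \<open>The first summand is the Cauchy kernel, which reproduces analytic functions. The second
  is analytic in \<xi> and vanishes at 0, so it integrates to zero against them.\<close>

lemma poisson_decomp:
  assumes "cmod \<xi> = 1" "cmod w < 1"
  shows "complex_of_real (poisson w \<xi>) = 1 / (1 - w * cnj \<xi>) + cnj w * \<xi> / (1 - cnj w * \<xi>)"
proof -
  have x: "\<xi> * cnj \<xi> = 1" using assms by (simp add: complex_norm_square[symmetric])
  have "1 - w * cnj \<xi> \<noteq> 0" "1 - cnj w * \<xi> \<noteq> 0"
    using assms norm_mult[of w "cnj \<xi>"] norm_mult[of "cnj w" \<xi>] by auto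
  moreover have "of_real ((cmod (\<xi> - w))\<^sup>2) = (1 - w * cnj \<xi>) * (1 - cnj w * \<xi>)"
    unfolding complex_norm_square using x by simp algebra
  moreover have "complex_of_real (1 - (cmod w)\<^sup>2) = 1 - w * cnj w"
    by (simp only: of_real_diff of_real_1 complex_norm_square)
  ultimately show ?thesis
    using x unfolding poisson_def of_real_divide by (simp add: divide_simps) algebra
qed

lemma measurable_poisson [measurable]: "(\<lambda>x. poisson (f x) (g x)) \<in> borel_measurable M"
  if "f \<in> borel_measurable M" "g \<in> borel_measurable M"
  unfolding poisson_def using that by measurable

context
  fixes g R assumes hol: "g holomorphic_on ball 0 R" and R: "1 < R"
begin

lemma continuous_on_circle: "continuous_on UNIV (\<lambda>\<theta>. g (cis \<theta>))"
  using R by (intro continuous_on_compose2[OF holomorphic_on_imp_continuous_on[OF hol]] continuous_intros) auto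

lemma measurable_circle: "(\<lambda>\<theta>. g (cis \<theta>)) \<in> borel_measurable borel"
  by (intro borel_measurable_continuous_onI continuous_on_circle)

lemma bounded_circle: "\<exists>B. \<forall>\<theta>. cmod (g (cis \<theta>)) \<le> B"
proof -
  have "continuous_on (sphere 0 1) g"
    using R by (intro continuous_on_subset[OF holomorphic_on_imp_continuous_on[OF hol]]) auto
  then have "bounded (g ` sphere 0 1)"
    by (intro compact_imp_bounded compact_continuous_image) auto
  then obtain B where "\<forall>x\<in>sphere 0 1. cmod (g x) \<le> B" unfolding bounded_iff by auto
  then show ?thesis by (intro exI[of _ B]) auto
qed

lemma circ_poisson_complex:
  assumes w: "cmod w < 1"
  shows "(\<integral>\<theta>. of_real (poisson w (cis \<theta>)) * g (cis \<theta>) \<partial>circ) = g w"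
proof -
  obtain B where B: "\<And>\<theta>. cmod (g (cis \<theta>)) \<le> B" using bounded_circle by blast
  have bd: "cmod (1 / (1 - v * cis x)) \<le> 1 / (1 - cmod w)" if "cmod v = cmod w" for v x
    unfolding norm_divide using norm_triangle_ineq2[of 1 "v * cis x"] w that
    by (intro frac_le) (auto simp: norm_mult)
  \<comment> \<open>The second kernel has its only pole at modulus 1 / |w|. For \<open>w = 0\<close>
    there is no pole, and 1/2 in place of |w| yields a radius above 1.\<close>
  define R' where "R' = min R (1 / (if w = 0 then 1/2 else cmod w))"
  have R': "1 < R'" "R' \<le> R" using R w by (auto simp: R'_def)
  have nz: "1 - cnj w * z \<noteq> 0" if "cmod z < R'" for z
  proof
    assume "1 - cnj w * z = 0"
    then have "cmod w * cmod z = 1" by (metis complex_mod_cnj norm_mult norm_one right_minus_eq)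
    then show False using that w by (cases "w = 0") (auto simp: R'_def field_simps)
  qed
  have "(\<lambda>z. g z * (cnj w * z / (1 - cnj w * z))) holomorphic_on ball 0 R'"
    using nz R' by (intro holomorphic_intros holomorphic_on_subset[OF hol]) auto
  from circ_mean[OF this R'(1)]
  have 2: "(\<integral>\<theta>. g (cis \<theta>) * (cnj w * cis \<theta> / (1 - cnj w * cis \<theta>)) \<partial>circ) = 0" by simp
  have "(\<integral>\<theta>. of_real (poisson w (cis \<theta>)) * g (cis \<theta>) \<partial>circ)
      = (\<integral>\<theta>. g (cis \<theta>) * (1 / (1 - w * cnj (cis \<theta>))) + g (cis \<theta>) * (cnj w * cis \<theta> / (1 - cnj w * cis \<theta>)) \<partial>circ)"
    using w by (intro Bochner_Integration.integral_cong) (auto simp: poisson_decomp algebra_simps)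
  also have "\<dots> = (\<integral>\<theta>. g (cis \<theta>) * (1 / (1 - w * cnj (cis \<theta>))) \<partial>circ) + (\<integral>\<theta>. g (cis \<theta>) * (cnj w * cis \<theta> / (1 - cnj w * cis \<theta>)) \<partial>circ)"
  proof (rule Bochner_Integration.integral_add)
    show "integrable circ (\<lambda>\<theta>. g (cis \<theta>) * (1 / (1 - w * cnj (cis \<theta>))))"
    proof (rule integrable_circ_bounded[where B = "B * (1 / (1 - cmod w))"])
      show "(\<lambda>\<theta>. g (cis \<theta>) * (1 / (1 - w * cnj (cis \<theta>)))) \<in> borel_measurable borel"
        using measurable_circle by measurable
      show "cmod (g (cis x) * (1 / (1 - w * cnj (cis x)))) \<le> B * (1 / (1 - cmod w))" for x
        unfolding norm_mult[of "g (cis x)"] cis_cnj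
        by (intro mult_mono B order_trans[OF norm_ge_zero B] bd) auto
    qed
    show "integrable circ (\<lambda>\<theta>. g (cis \<theta>) * (cnj w * cis \<theta> / (1 - cnj w * cis \<theta>)))"
    proof (rule integrable_circ_bounded[where B = "B * (1 * (1 / (1 - cmod w)))"])
      show "(\<lambda>\<theta>. g (cis \<theta>) * (cnj w * cis \<theta> / (1 - cnj w * cis \<theta>))) \<in> borel_measurable borel"
        using measurable_circle by measurable
      fix x
      have "cmod (cnj w * cis x / (1 - cnj w * cis x)) \<le> 1 * (1 / (1 - cmod w))"
        using mult_mono[OF _ bd[of "cnj w" x], of "cmod (cnj w * cis x)" 1] w
        by (simp add: norm_mult norm_divide)
      then show "cmod (g (cis x) * (cnj w * cis x / (1 - cnj w * cis x))) \<le> B * (1 * (1 / (1 - cmod w)))"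
        unfolding norm_mult[of "g (cis x)"] by (intro mult_mono B order_trans[OF norm_ge_zero B]) auto
    qed
  qed
  also have "\<dots> = g w" using 2 circ_cauchy[OF hol R w] by simp
  finally show ?thesis .
qed

lemma circ_poisson_Re:
  assumes w: "cmod w < 1"
  shows "(\<integral>\<theta>. poisson w (cis \<theta>) * Re (g (cis \<theta>)) \<partial>circ) = Re (g w)"
proof -
  obtain B where B: "\<And>\<theta>. cmod (g (cis \<theta>)) \<le> B" using bounded_circle by blast
  have "integrable circ (\<lambda>\<theta>. of_real (poisson w (cis \<theta>)) * g (cis \<theta>))"
  proof (rule integrable_circ_bounded[where B = "(1 + cmod w) / (1 - cmod w) * B"])
    show "(\<lambda>\<theta>. of_real (poisson w (cis \<theta>)) * g (cis \<theta>)) \<in> borel_measurable borel"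
      using measurable_circle by measurable
    show "cmod (of_real (poisson w (cis x)) * g (cis x)) \<le> (1 + cmod w) / (1 - cmod w) * B" for x
      unfolding norm_mult using poisson_le[OF w, of "cis x"] poisson_nonneg[of w "cis x"] w
      by (intro mult_mono B) auto
  qed
  from integral_Re[OF this] show ?thesis by (simp add: circ_poisson_complex[OF w])
qed

text \<open>Recovers an analytic function from its real part on the circle. The kernel is twice the
  Cauchy kernel minus 1; against the conjugate of \<open>g\<close> it leaves only the conjugate of
  \<open>g 0\<close>, whence the imaginary constant.\<close>

lemma circ_schwarz:
  assumes w: "cmod w < 1"
  shows "(\<integral>\<theta>. (cis \<theta> + w) / (cis \<theta> - w) * of_real (Re (g (cis \<theta>))) \<partial>circ) = g w - \<i> * of_real (Im (g 0))"
proof -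
  obtain B where B: "\<And>\<theta>. cmod (g (cis \<theta>)) \<le> B" using bounded_circle by blast
  define K where "K = (\<lambda>\<theta>. 2 * (1 / (1 - w * cnj (cis \<theta>))) - 1)"
  have K: "(cis \<theta> + w) / (cis \<theta> - w) = K \<theta>" for \<theta>
  proof -
    have x: "cis \<theta> * cnj (cis \<theta>) = 1" by (simp add: complex_norm_square[symmetric])
    have "cis \<theta> - w \<noteq> 0" using w by auto
    moreover have "1 - w * cnj (cis \<theta>) \<noteq> 0" using w norm_mult[of w "cnj (cis \<theta>)"] by auto
    moreover have "(c + w) * (1 - w * d) = (1 + w * d) * (c - w)" if "c * d = 1" for c d :: complex
      using that by algebra
    ultimately show ?thesis using x by (simp add: K_def divide_simps)
  qed
  have Kb: "cmod (K \<theta>) \<le> 2 / (1 - cmod w)" for \<theta>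
    unfolding K[symmetric] norm_divide using norm_circle_diff_ge[of "cis \<theta>" w] w norm_triangle_ineq[of "cis \<theta>" w]
    by (intro frac_le) auto
  have Km: "K \<in> borel_measurable borel" unfolding K_def by measurable
  have i1: "integrable circ (\<lambda>\<theta>. g (cis \<theta>) * K \<theta>)" "integrable circ (\<lambda>\<theta>. cnj (g (cis \<theta>)) * K \<theta>)"
    using Km measurable_circle w
    by (auto intro!: integrable_circ_bounded[where B = "B * (2 / (1 - cmod w))"] mult_mono Kb B order_trans[OF norm_ge_zero B] simp: norm_mult simp del: times_divide_eq_right)
  have ig: "integrable circ (\<lambda>\<theta>. g (cis \<theta>))" using measurable_circle B by (intro integrable_circ_bounded) auto
  have ic: "integrable circ (\<lambda>\<theta>. g (cis \<theta>) * (1 / (1 - w * cnj (cis \<theta>))))"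
  proof -
    have "integrable circ (\<lambda>\<theta>. (g (cis \<theta>) * K \<theta> + g (cis \<theta>)) / 2)" using i1 ig by auto
    moreover have "(a * (2 * x - 1) + a) / 2 = a * x" for a x :: complex by (simp add: field_simps)
    ultimately show ?thesis by (simp only: K_def)
  qed
  have 1: "(\<integral>\<theta>. g (cis \<theta>) * K \<theta> \<partial>circ) = 2 * g w - g 0"
  proof -
    have "(\<integral>\<theta>. g (cis \<theta>) * K \<theta> \<partial>circ) = (\<integral>\<theta>. 2 * (g (cis \<theta>) * (1 / (1 - w * cnj (cis \<theta>)))) - g (cis \<theta>) \<partial>circ)"
      by (intro Bochner_Integration.integral_cong) (auto simp: K_def algebra_simps)
    also have "\<dots> = 2 * (\<integral>\<theta>. g (cis \<theta>) * (1 / (1 - w * cnj (cis \<theta>))) \<partial>circ) - (\<integral>\<theta>. g (cis \<theta>) \<partial>circ)"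
      by (subst Bochner_Integration.integral_diff[OF integrable_mult_right[OF ic] ig]) (simp only: integral_mult_right_zero)
    finally show ?thesis by (simp only: circ_cauchy[OF hol R w] circ_mean[OF hol R])
  qed
  have 2: "(\<integral>\<theta>. cnj (g (cis \<theta>)) * K \<theta> \<partial>circ) = cnj (g 0)"
  proof -
    define R' where "R' = min R (1 / (if w = 0 then 1/2 else cmod w))"
    have R': "1 < R'" "R' \<le> R" using R w by (auto simp: R'_def)
    have nz: "1 - cnj w * z \<noteq> 0" if "cmod z < R'" for z
    proof
      assume "1 - cnj w * z = 0"
      then have "cmod w * cmod z = 1" by (metis complex_mod_cnj norm_mult norm_one right_minus_eq)
      then show False using that w by (cases "w = 0") (auto simp: R'_def field_simps)
    qed
    have "(\<lambda>z. g z * (2 * (1 / (1 - cnj w * z)) - 1)) holomorphic_on ball 0 R'"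
      using nz R' by (intro holomorphic_intros holomorphic_on_subset[OF hol]) auto
    from circ_mean[OF this R'(1)]
    have "(\<integral>\<theta>. g (cis \<theta>) * (2 * (1 / (1 - cnj w * cis \<theta>)) - 1) \<partial>circ) = g 0" by simp
    moreover have "(\<integral>\<theta>. cnj (g (cis \<theta>)) * K \<theta> \<partial>circ) = (\<integral>\<theta>. cnj (g (cis \<theta>) * (2 * (1 / (1 - cnj w * cis \<theta>)) - 1)) \<partial>circ)"
      by (simp add: K_def)
    ultimately show ?thesis by (simp only: Bochner_Integration.integral_cnj)
  qed
  have "(\<integral>\<theta>. K \<theta> * of_real (Re (g (cis \<theta>))) \<partial>circ) = (\<integral>\<theta>. (g (cis \<theta>) * K \<theta> + cnj (g (cis \<theta>)) * K \<theta>) / 2 \<partial>circ)"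
  proof (intro Bochner_Integration.integral_cong refl)
    fix \<theta>
    have "complex_of_real (Re (g (cis \<theta>))) = (g (cis \<theta>) + cnj (g (cis \<theta>))) / 2"
      by (simp add: complex_add_cnj)
    then show "K \<theta> * of_real (Re (g (cis \<theta>))) = (g (cis \<theta>) * K \<theta> + cnj (g (cis \<theta>)) * K \<theta>) / 2"
      by (simp only:) (simp add: field_simps)
  qed
  also have "\<dots> = (2 * g w - g 0 + cnj (g 0)) / 2"
    using i1 by (simp add: 1 2)
  also have "\<dots> = g w - \<i> * of_real (Im (g 0))"
    by (simp add: complex_eq_iff)
  finally show ?thesis unfolding K .
qed

end

lemma circ_poisson_1:
  assumes "cmod w < 1"
  shows "(\<integral>\<theta>. poisson w (cis \<theta>) \<partial>circ) = 1"
  using circ_poisson_Re[of "\<lambda>_. 1" 2 w] assms by simp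

text \<open>The Poisson kernel is at least (1 - |z|) / (1 + |z|), weakened here to (1 - |z|) / 2. As
  \<open>g\<close> need not extend past the disc, the estimate is made for the dilates of
  \<open>g\<close> and the radius then tends to 1.\<close>

lemma circ_harnack:
  assumes g: "g holomorphic_on ball 0 1" and pos: "\<And>z. cmod z < 1 \<Longrightarrow> 0 \<le> Re (g z)" and z: "cmod z < 1"
  shows "(1 - cmod z) / 2 * Re (g 0) \<le> Re (g z)"
proof -
  have r: "(1 - cmod z) / 2 * Re (g 0) \<le> Re (g (of_real r * z))" if "0 < r" "r < 1" for r
  proof -
    have h: "(\<lambda>z. g (of_real r * z)) holomorphic_on ball 0 (1/r)"
      using that by (intro holomorphic_on_compose_gen[OF _ g, unfolded o_def] holomorphic_intros)
        (auto simp: norm_mult field_simps)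
    have R: "1 < 1/r" using that by simp
    have Rp: "0 \<le> Re (g (of_real r * cis \<theta>))" for \<theta> using that by (intro pos) (auto simp: norm_mult)
    obtain B where B: "\<And>\<theta>. cmod (g (of_real r * cis \<theta>)) \<le> B" using bounded_circle[OF h R] by blast
    have B': "\<bar>Re (g (of_real r * cis \<theta>))\<bar> \<le> B" for \<theta> using B[of \<theta>] abs_Re_le_cmod order_trans by blast
    note [measurable] = measurable_circle[OF h R]
    have ig: "integrable circ (\<lambda>\<theta>. g (of_real r * cis \<theta>))" using B by (intro integrable_circ_bounded) auto
    have "(1 - cmod z) / 2 * Re (g 0) = (1 - cmod z) / 2 * (\<integral>\<theta>. Re (g (of_real r * cis \<theta>)) \<partial>circ)"
      using circ_mean[OF h R] integral_Re[OF ig] by simp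
    also have "\<dots> = (\<integral>\<theta>. (1 - cmod z) / 2 * Re (g (of_real r * cis \<theta>)) \<partial>circ)" by simp
    also have "\<dots> \<le> (\<integral>\<theta>. poisson z (cis \<theta>) * Re (g (of_real r * cis \<theta>)) \<partial>circ)"
    proof (rule integral_mono)
      show "integrable circ (\<lambda>\<theta>. (1 - cmod z) / 2 * Re (g (of_real r * cis \<theta>)))"
        using ig by (intro integrable_mult_right integrable_Re)
      show "integrable circ (\<lambda>\<theta>. poisson z (cis \<theta>) * Re (g (of_real r * cis \<theta>)))"
        using poisson_le[OF z] poisson_nonneg[of z] z B'
        by (intro integrable_circ_bounded[where B = "(1 + cmod z) / (1 - cmod z) * B"])
          (auto simp: abs_mult simp del: times_divide_eq_left intro!: mult_mono)
      fix \<theta>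
      have "(1 - cmod z) / 2 \<le> (1 - cmod z) / (1 + cmod z)" using z by (intro divide_left_mono) (auto intro: add_pos_nonneg)
      also have "\<dots> \<le> poisson z (cis \<theta>)" using z by (intro poisson_ge) auto
      finally show "(1 - cmod z) / 2 * Re (g (of_real r * cis \<theta>)) \<le> poisson z (cis \<theta>) * Re (g (of_real r * cis \<theta>))"
        by (rule mult_right_mono[OF _ Rp])
    qed
    also have "\<dots> = Re (g (of_real r * z))" by (rule circ_poisson_Re[OF h R z])
    finally show ?thesis .
  qed
  have "isCont g z" using holomorphic_on_imp_continuous_on[OF g] z by (simp add: continuous_on_eq_continuous_at)
  then have "((\<lambda>r. g (of_real r * z)) \<longlongrightarrow> g z) (at_left (1::real))"
    by (intro isCont_tendsto_compose[of z g]) (auto intro!: tendsto_eq_intros)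
  then have "((\<lambda>r. Re (g (of_real r * z))) \<longlongrightarrow> Re (g z)) (at_left (1::real))" by (rule tendsto_Re)
  moreover have "eventually (\<lambda>r::real. (1 - cmod z) / 2 * Re (g 0) \<le> Re (g (of_real r * z))) (at_left 1)"
    using eventually_at_left_real[of 0 "1::real"] by (rule eventually_mono) (use r in auto)
  ultimately show ?thesis
    by (intro tendsto_lowerbound[where F = "at_left (1::real)" and f = "\<lambda>r. Re (g (of_real r * z))"]) auto
qed

section \<open>The Hardy space\<close>

lemma taylor_unique:
  assumes g: "g holomorphic_on ball 0 1" and a: "\<And>z. cmod z < 1 \<Longrightarrow> (\<lambda>k. a k * z ^ k) sums g z"
  shows "taylor g k = a k"
proof -
  have co: "(\<integral>\<theta>. g (of_real (1/2) * cis \<theta>) * cnj (cis \<theta>) ^ k \<partial>circ) = b k * (1/2) ^ k"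
    if b: "\<And>z. cmod z < 1 \<Longrightarrow> (\<lambda>k. b k * z ^ k) sums g z" for b
  proof -
    \<comment> \<open>Convergence at the larger radius 3/4 makes the series absolutely convergent at
      1/2, where the coefficients are compared.\<close>
    have "summable (\<lambda>k. b k * of_real (3/4) ^ k)" using b[of "of_real (3/4)"] by (simp add: sums_iff)
    then have "summable (\<lambda>k. norm (b k * (1/2) ^ k))"
      by (rule powser_insidea) (simp add: norm_divide)
    then have "(\<integral>\<theta>. g (of_real (1/2) * cis \<theta>) * cnj (cis \<theta>) ^ k \<partial>circ) = (\<Sum>j. (b j * (1/2) ^ j) * of_bool (j = k))"
    proof (rule circ_pairing)
      show "summable (\<lambda>j. norm (of_bool (j = k) :: complex))"
        by (rule summable_finite[of "{k}"]) auto
      show "(\<lambda>j. b j * (1/2) ^ j * cis \<theta> ^ j) sums g (of_real (1/2) * cis \<theta>)" for \<theta>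
        using b[of "of_real (1/2) * cis \<theta>"] by (simp add: norm_mult power_mult_distrib mult_ac norm_divide power_divide)
      show "(\<lambda>j. of_bool (j = k) * cnj (cis \<theta>) ^ j) sums (cnj (cis \<theta>) ^ k)" for \<theta>
        using sums_If_finite_set[of "{k}" "\<lambda>j. cnj (cis \<theta>) ^ j"]
        by (simp add: of_bool_def if_distribR if_distrib[of "\<lambda>x. x * _"] cong: if_cong)
    qed
    also have "\<dots> = b k * (1/2) ^ k"
      using suminf_finite[of "{k}" "\<lambda>j. (b j * (1/2) ^ j) * of_bool (j = k)"] by auto
    finally show ?thesis .
  qed
  show ?thesis using co[OF a] co[OF taylor_sums[OF g]] by (simp only: mult_cancel_right) auto
qed

lemma circ_parseval_dilate:
  assumes "g holomorphic_on ball 0 1" "0 \<le> r" "r < 1"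
  shows "(\<lambda>k. (cmod (taylor g k))\<^sup>2 * r ^ (2*k)) sums (\<integral>\<theta>. (cmod (g (of_real r * cis \<theta>)))\<^sup>2 \<partial>circ)"
proof -
  have e: "(cmod (taylor g k * of_real r ^ k))\<^sup>2 = (cmod (taylor g k))\<^sup>2 * r ^ (2*k)" for k
  proof -
    have "cmod (taylor g k * of_real r ^ k) = cmod (taylor g k) * r ^ k"
      unfolding norm_mult norm_power using assms(2) by simp
    then show ?thesis by (simp only: power_mult_distrib power_even_eq)
  qed
  show ?thesis
    using circ_parseval_series[OF taylor_sums_dilate(2)[OF assms] taylor_sums_dilate(1)[OF assms]]
    unfolding e by (simp add: sums_iff)
qed

lemma H2_holomorphic: "f \<in> H2 \<Longrightarrow> f holomorphic_on ball 0 1"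
  by (simp add: H2_def)

lemma H2_norm_sums: "f \<in> H2 \<Longrightarrow> (\<lambda>k. (cmod (taylor f k))\<^sup>2) sums (h2norm f)\<^sup>2"
  by (simp add: H2_def h2norm_def sums_iff suminf_nonneg)

lemma h2norm_nonneg: "f \<in> H2 \<Longrightarrow> 0 \<le> h2norm f"
  by (simp add: H2_def h2norm_def suminf_nonneg)

lemma H2_circle_mean_le:
  assumes "f \<in> H2" "0 \<le> r" "r < 1"
  shows "(\<integral>\<theta>. (cmod (f (of_real r * cis \<theta>)))\<^sup>2 \<partial>circ) \<le> (h2norm f)\<^sup>2"
proof (rule sums_le[OF _ circ_parseval_dilate[OF H2_holomorphic[OF assms(1)] assms(2,3)] H2_norm_sums[OF assms(1)]])
  show "(cmod (taylor f k))\<^sup>2 * r ^ (2*k) \<le> (cmod (taylor f k))\<^sup>2" for k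
    using assms by (intro mult_left_le power_le_one) auto
qed

text \<open>Parseval on each circle bounds every partial sum of the squared coefficients. The bounds
  \<open>K j\<close> may vary with the radius, so that their limit can be supplied by dominated
  convergence.\<close>

lemma H2_boundI:
  fixes \<rho> :: "nat \<Rightarrow> real"
  assumes g: "g holomorphic_on ball 0 1" and \<rho>: "\<And>j. 0 \<le> \<rho> j" "\<And>j. \<rho> j < 1" "\<rho> \<longlonglongrightarrow> 1"
    and le: "\<And>j. (\<integral>\<theta>. (cmod (g (of_real (\<rho> j) * cis \<theta>)))\<^sup>2 \<partial>circ) \<le> K j" and K: "K \<longlonglongrightarrow> L"
  shows "g \<in> H2" "(h2norm g)\<^sup>2 \<le> L"
proof -
  have part: "(\<Sum>k<n. (cmod (taylor g k))\<^sup>2) \<le> L" for n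
  proof (rule LIMSEQ_le[OF _ K])
    show "(\<lambda>j. \<Sum>k<n. (cmod (taylor g k))\<^sup>2 * \<rho> j ^ (2*k)) \<longlonglongrightarrow> (\<Sum>k<n. (cmod (taylor g k))\<^sup>2)"
      by (auto intro!: tendsto_eq_intros \<rho>)
    have "(\<Sum>k<n. (cmod (taylor g k))\<^sup>2 * \<rho> j ^ (2*k)) \<le> K j" for j
    proof -
      have s: "(\<lambda>k. (cmod (taylor g k))\<^sup>2 * \<rho> j ^ (2*k)) sums (\<integral>\<theta>. (cmod (g (of_real (\<rho> j) * cis \<theta>)))\<^sup>2 \<partial>circ)"
        by (rule circ_parseval_dilate[OF g \<rho>(1,2)])
      have "(\<Sum>k<n. (cmod (taylor g k))\<^sup>2 * \<rho> j ^ (2*k)) \<le> (\<Sum>k. (cmod (taylor g k))\<^sup>2 * \<rho> j ^ (2*k))"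
        using s \<rho>(1) by (intro sum_le_suminf) (auto simp: sums_iff)
      then show ?thesis using le[of j] s by (simp add: sums_iff)
    qed
    then show "\<exists>N. \<forall>j\<ge>N. (\<Sum>k<n. (cmod (taylor g k))\<^sup>2 * \<rho> j ^ (2*k)) \<le> K j" by blast
  qed
  then have s: "summable (\<lambda>k. (cmod (taylor g k))\<^sup>2)"
    by (intro summableI_nonneg_bounded[where x = L]) auto
  then show "g \<in> H2" using g by (simp add: H2_def)
  then show "(h2norm g)\<^sup>2 \<le> L"
    using suminf_le_const[OF s part] H2_norm_sums[of g] by (simp add: sums_iff)
qed

text \<open>A crude substitute for the triangle inequality, phrased coefficientwise so that it
  serves sums and differences alike.\<close>

lemma H2_combination:
  assumes f: "f \<in> H2" and g: "g \<in> H2" and h: "h holomorphic_on ball 0 1"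
    and le: "\<And>k. (cmod (taylor h k))\<^sup>2 \<le> 2 * (cmod (taylor f k))\<^sup>2 + 2 * (cmod (taylor g k))\<^sup>2"
  shows "h \<in> H2" "(h2norm h)\<^sup>2 \<le> 2 * (h2norm f)\<^sup>2 + 2 * (h2norm g)\<^sup>2"
proof -
  have s: "(\<lambda>k. 2 * (cmod (taylor f k))\<^sup>2 + 2 * (cmod (taylor g k))\<^sup>2) sums (2 * (h2norm f)\<^sup>2 + 2 * (h2norm g)\<^sup>2)"
    by (intro sums_add sums_mult H2_norm_sums f g)
  have "summable (\<lambda>k. (cmod (taylor h k))\<^sup>2)"
    by (rule summable_comparison_test'[where N = 0, OF sums_summable[OF s]]) (use le in auto)
  then show H: "h \<in> H2" using h by (simp add: H2_def)
  show "(h2norm h)\<^sup>2 \<le> 2 * (h2norm f)\<^sup>2 + 2 * (h2norm g)\<^sup>2"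
    by (rule sums_le[OF le H2_norm_sums[OF H] s])
qed

lemma square_norm_sum_le:
  fixes a b :: "'a::real_normed_vector"
  shows "(norm (a + b))\<^sup>2 \<le> 2 * (norm a)\<^sup>2 + 2 * (norm b)\<^sup>2"
proof -
  have "(norm (a + b))\<^sup>2 \<le> (norm a + norm b)\<^sup>2" by (intro power_mono norm_triangle_ineq) auto
  also have "\<dots> \<le> 2 * (norm a)\<^sup>2 + 2 * (norm b)\<^sup>2"
    using zero_le_power2[of "norm a - norm b"] by (simp add: power2_eq_square algebra_simps)
  finally show ?thesis .
qed

lemma H2_add:
  assumes f: "f \<in> H2" and g: "g \<in> H2"
  shows "(\<lambda>z. f z + g z) \<in> H2" "(h2norm (\<lambda>z. f z + g z))\<^sup>2 \<le> 2 * (h2norm f)\<^sup>2 + 2 * (h2norm g)\<^sup>2"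
proof -
  have "taylor (\<lambda>z. f z + g z) k = taylor f k + taylor g k" for k
    using higher_deriv_add[OF H2_holomorphic[OF f] H2_holomorphic[OF g], of 0 k] by (simp add: add_divide_distrib)
  then have "(cmod (taylor (\<lambda>z. f z + g z) k))\<^sup>2 \<le> 2 * (cmod (taylor f k))\<^sup>2 + 2 * (cmod (taylor g k))\<^sup>2" for k
    using square_norm_sum_le[of "taylor f k" "taylor g k"] by (simp only:)
  from H2_combination[OF f g holomorphic_on_add[OF H2_holomorphic[OF f] H2_holomorphic[OF g]] this]
  show "(\<lambda>z. f z + g z) \<in> H2" "(h2norm (\<lambda>z. f z + g z))\<^sup>2 \<le> 2 * (h2norm f)\<^sup>2 + 2 * (h2norm g)\<^sup>2"
    by auto
qed

lemma taylor_diff: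
  assumes "f holomorphic_on ball 0 1" "g holomorphic_on ball 0 1"
  shows "taylor (\<lambda>z. f z - g z) k = taylor f k - taylor g k"
  using higher_deriv_diff[OF assms, of 0 k] by (simp add: diff_divide_distrib)

lemma H2_diff:
  assumes f: "f \<in> H2" and g: "g \<in> H2"
  shows "(\<lambda>z. f z - g z) \<in> H2" "(h2norm (\<lambda>z. f z - g z))\<^sup>2 \<le> 2 * (h2norm f)\<^sup>2 + 2 * (h2norm g)\<^sup>2"
proof -
  have "(cmod (taylor (\<lambda>z. f z - g z) k))\<^sup>2 \<le> 2 * (cmod (taylor f k))\<^sup>2 + 2 * (cmod (taylor g k))\<^sup>2" for k
    using square_norm_sum_le[of "taylor f k" "- taylor g k"]
    unfolding taylor_diff[OF H2_holomorphic[OF f] H2_holomorphic[OF g]] norm_minus_cancel by (simp only: diff_conv_add_uminus)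
  from H2_combination[OF f g holomorphic_on_diff[OF H2_holomorphic[OF f] H2_holomorphic[OF g]] this]
  show "(\<lambda>z. f z - g z) \<in> H2" "(h2norm (\<lambda>z. f z - g z))\<^sup>2 \<le> 2 * (h2norm f)\<^sup>2 + 2 * (h2norm g)\<^sup>2"
    by auto
qed

section \<open>Taylor sections and composition with self-maps of the disc\<close>

definition coeff_poly :: "(nat \<Rightarrow> complex) \<Rightarrow> nat \<Rightarrow> complex poly" where
  "coeff_poly a n = (\<Sum>k<n. monom (a k) k)"

lemma poly_coeff_poly: "poly (coeff_poly a n) z = (\<Sum>k<n. a k * z ^ k)"
  by (simp add: coeff_poly_def poly_sum poly_monom)

definition circ_norm2 :: "complex poly \<Rightarrow> real" where
  "circ_norm2 q = (\<integral>\<theta>. (cmod (poly q (cis \<theta>)))\<^sup>2 \<partial>circ)"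

lemma taylor_coeff_poly: "taylor (poly (coeff_poly a n)) k = (if k < n then a k else 0)"
proof (rule taylor_unique)
  show "(\<lambda>k. (if k < n then a k else 0) * z ^ k) sums poly (coeff_poly a n) z" for z
    using sums_If_finite_set[of "{..<n}" "\<lambda>k. a k * z ^ k"]
    by (simp add: poly_coeff_poly if_distrib[of "\<lambda>x. x * _"] cong: if_cong)
qed (intro holomorphic_intros)

lemma circ_norm2_coeff_poly: "circ_norm2 (coeff_poly a n) = (\<Sum>k<n. (cmod (a k))\<^sup>2)"
proof -
  have "circ_norm2 (coeff_poly a n) = (\<Sum>k. (cmod (if k < n then a k else 0))\<^sup>2)"
    unfolding circ_norm2_def
  proof (rule circ_parseval_series(1))
    show "summable (\<lambda>j. cmod (if j < n then a j else 0))"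
      by (rule summable_finite[of "{..<n}"]) auto
    show "(\<lambda>j. (if j < n then a j else 0) * cis \<theta> ^ j) sums poly (coeff_poly a n) (cis \<theta>)" for \<theta>
      using sums_If_finite_set[of "{..<n}" "\<lambda>k. a k * cis \<theta> ^ k"]
      by (simp add: poly_coeff_poly if_distrib[of "\<lambda>x. x * _"] cong: if_cong)
  qed
  also have "\<dots> = (\<Sum>k<n. (cmod (a k))\<^sup>2)"
    by (subst suminf_finite[of "{..<n}"]) auto
  finally show ?thesis .
qed

lemma coeff_poly_H2: "poly (coeff_poly a n) \<in> H2"
    "(h2norm (poly (coeff_poly a n)))\<^sup>2 = (\<Sum>k<n. (cmod (a k))\<^sup>2)"
proof -
  have "summable (\<lambda>k. (cmod (taylor (poly (coeff_poly a n)) k))\<^sup>2)"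
    unfolding taylor_coeff_poly by (rule summable_finite[of "{..<n}"]) auto
  then show H: "poly (coeff_poly a n) \<in> H2"
    unfolding H2_def by (auto intro!: holomorphic_intros)
  have "(\<Sum>k. (cmod (taylor (poly (coeff_poly a n)) k))\<^sup>2) = (\<Sum>k<n. (cmod (a k))\<^sup>2)"
    unfolding taylor_coeff_poly by (subst suminf_finite[of "{..<n}"]) auto
  then show "(h2norm (poly (coeff_poly a n)))\<^sup>2 = (\<Sum>k<n. (cmod (a k))\<^sup>2)"
    using H2_norm_sums[OF H] by (simp add: sums_iff)
qed

definition self_map :: "(complex \<Rightarrow> complex) \<Rightarrow> bool" where
  "self_map \<phi> \<longleftrightarrow> \<phi> holomorphic_on ball 0 1 \<and> \<phi> ` ball 0 1 \<subseteq> ball 0 1"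

lemma self_map_norm: "self_map \<phi> \<Longrightarrow> cmod z < 1 \<Longrightarrow> cmod (\<phi> z) < 1"
  unfolding self_map_def by force

lemma self_map_holomorphic: "self_map \<phi> \<Longrightarrow> \<phi> holomorphic_on ball 0 1"
  by (simp add: self_map_def)

lemma holomorphic_compose_self_map:
  "f holomorphic_on ball 0 1 \<Longrightarrow> self_map \<phi> \<Longrightarrow> (\<lambda>z. f (\<phi> z)) holomorphic_on ball 0 1"
  unfolding self_map_def using holomorphic_on_compose_gen[of \<phi> "ball 0 1" f "ball 0 1"] by (simp add: o_def)

text \<open>The index set is arbitrary: the empty set gives a single composition operator, so one
  transfer lemma serves both boundedness and compactness.\<close>

definition comp_diff :: "(complex \<Rightarrow> complex) \<Rightarrow> ('i \<Rightarrow> complex \<Rightarrow> complex) \<Rightarrow> 'i set \<Rightarrow> (complex \<Rightarrow> complex) \<Rightarrow> complex \<Rightarrow> complex" where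
  "comp_diff \<phi> \<psi> I f z = f (\<phi> z) - (\<Sum>i\<in>I. f (\<psi> i z))"

lemma comp_diff_holomorphic:
  assumes "f holomorphic_on ball 0 1" "self_map \<phi>" "\<And>i. i \<in> I \<Longrightarrow> self_map (\<psi> i)"
  shows "comp_diff \<phi> \<psi> I f holomorphic_on ball 0 1"
  unfolding comp_diff_def by (intro holomorphic_on_diff holomorphic_on_sum holomorphic_compose_self_map[OF assms(1)]) (use assms in auto)

lemma continuous_on_dilate:
  assumes "g holomorphic_on ball 0 1" "0 \<le> r" "r < 1"
  shows "continuous_on UNIV (\<lambda>\<theta>. g (of_real r * cis \<theta>))"
  using assms by (intro continuous_on_compose2[OF holomorphic_on_imp_continuous_on[OF assms(1)]] continuous_intros)
    (auto simp: norm_mult)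

lemma measurable_dilate:
  assumes "g holomorphic_on ball 0 1" "0 \<le> r" "r < 1"
  shows "(\<lambda>\<theta>. g (of_real r * cis \<theta>)) \<in> borel_measurable borel"
  by (intro borel_measurable_continuous_onI continuous_on_dilate assms)

lemma bounded_dilate:
  assumes "g holomorphic_on ball 0 1" "0 \<le> r" "r < 1"
  shows "\<exists>B. \<forall>\<theta>. cmod (g (of_real r * cis \<theta>)) \<le> B"
proof -
  have "continuous_on (sphere 0 r) g"
    using assms by (intro continuous_on_subset[OF holomorphic_on_imp_continuous_on[OF assms(1)]]) auto
  then have "bounded (g ` sphere 0 r)" by (intro compact_imp_bounded compact_continuous_image) auto
  then obtain B where "\<forall>x\<in>sphere 0 r. cmod (g x) \<le> B" unfolding bounded_iff by auto
  then show ?thesis using assms by (intro exI[of _ B]) (auto simp: norm_mult)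
qed

lemma self_map_dilate_bound:
  assumes "self_map \<phi>" "0 \<le> r" "r < 1"
  shows "\<exists>\<rho>. 0 \<le> \<rho> \<and> \<rho> < 1 \<and> (\<forall>\<theta>. cmod (\<phi> (of_real r * cis \<theta>)) \<le> \<rho>)"
proof -
  have "continuous_on (sphere 0 r) (\<lambda>z. cmod (\<phi> z))"
    using assms unfolding self_map_def
    by (intro continuous_on_norm continuous_on_subset[OF holomorphic_on_imp_continuous_on[of \<phi> "ball 0 1"]]) auto
  moreover have "sphere (0::complex) r \<noteq> {}" using assms by simp
  ultimately obtain z where z: "z \<in> sphere 0 r" "\<forall>y\<in>sphere 0 r. cmod (\<phi> y) \<le> cmod (\<phi> z)"
    using continuous_attains_sup[of "sphere (0::complex) r" "\<lambda>z. cmod (\<phi> z)"] by auto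
  then show ?thesis using assms self_map_norm[OF assms(1), of z]
    by (intro exI[of _ "cmod (\<phi> z)"]) (auto simp: norm_mult)
qed

text \<open>Reduction to polynomials. On a fixed circle of radius r < 1 the self-maps stay in a disc
  of radius \<rho> < 1, where the Taylor sections of \<open>f\<close> converge and are uniformly
  bounded; the estimate passes to \<open>f\<close> there by dominated convergence, and then to the
  norm as r tends to 1.\<close>

lemma comp_diff_H2I:
  assumes f: "f \<in> H2" and \<phi>: "self_map \<phi>" "\<And>i. i \<in> I \<Longrightarrow> self_map (\<psi> i)"
    and le: "\<And>n r. 0 < r \<Longrightarrow> r < 1 \<Longrightarrow>
      (\<integral>\<theta>. (cmod (comp_diff \<phi> \<psi> I (poly (coeff_poly (taylor f) n)) (of_real r * cis \<theta>)))\<^sup>2 \<partial>circ)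
        \<le> C * circ_norm2 (coeff_poly (taylor f) n)"
  shows "comp_diff \<phi> \<psi> I f \<in> H2" "(h2norm (comp_diff \<phi> \<psi> I f))\<^sup>2 \<le> C * (h2norm f)\<^sup>2"
proof -
  let ?T = "comp_diff \<phi> \<psi> I" and ?p = "\<lambda>n. poly (coeff_poly (taylor f) n)"
  have fh: "f holomorphic_on ball 0 1" by (rule H2_holomorphic[OF f])
  have bound: "(\<integral>\<theta>. (cmod (?T f (of_real r * cis \<theta>)))\<^sup>2 \<partial>circ) \<le> C * (h2norm f)\<^sup>2" if r: "0 < r" "r < 1" for r
  proof (rule LIMSEQ_le)
    have "\<exists>B. \<forall>n \<theta>. cmod (?p n (\<eta> (of_real r * cis \<theta>))) \<le> B" if eta: "self_map \<eta>" for \<eta>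
    proof -
      obtain \<rho> where \<rho>: "0 \<le> \<rho>" "\<rho> < 1" "\<And>\<theta>. cmod (\<eta> (of_real r * cis \<theta>)) \<le> \<rho>"
        using self_map_dilate_bound[OF eta, of r] r by auto
      have s: "summable (\<lambda>k. norm (taylor f k * of_real \<rho> ^ k))"
        using taylor_summable_norm[OF fh, of "of_real \<rho>"] \<rho> by simp
      have "cmod (?p n (\<eta> (of_real r * cis \<theta>))) \<le> (\<Sum>k. norm (taylor f k * of_real \<rho> ^ k))" for n \<theta>
      proof -
        have "cmod (?p n (\<eta> (of_real r * cis \<theta>))) \<le> (\<Sum>k<n. norm (taylor f k * of_real \<rho> ^ k))"
          unfolding poly_coeff_poly using \<rho>
          by (intro sum_norm_le) (auto simp: norm_mult norm_divide norm_power intro!: mult_left_mono divide_right_mono power_mono)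
        also have "\<dots> \<le> (\<Sum>k. norm (taylor f k * of_real \<rho> ^ k))" by (intro sum_le_suminf s) auto
        finally show ?thesis .
      qed
      then show ?thesis by blast
    qed
    then obtain B where B: "\<And>\<eta> n \<theta>. self_map \<eta> \<Longrightarrow> cmod (?p n (\<eta> (of_real r * cis \<theta>))) \<le> B \<eta>" by metis
    have bd: "cmod (?T (?p n) (of_real r * cis \<theta>)) \<le> B \<phi> + (\<Sum>i\<in>I. B (\<psi> i))" for n \<theta>
      unfolding comp_diff_def
      by (rule order_trans[OF norm_triangle_ineq4]) (intro add_mono sum_norm_le B \<phi>)
    have ph: "?p n holomorphic_on ball 0 1" for n by (intro holomorphic_intros)
    have m: "(\<lambda>\<theta>. ?T g (of_real r * cis \<theta>)) \<in> borel_measurable borel" if "g holomorphic_on ball 0 1" for g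
      by (rule measurable_dilate[OF comp_diff_holomorphic[where \<phi> = \<phi> and \<psi> = \<psi> and I = I, OF that \<phi>]]) (use r in auto)
    show "(\<lambda>n. \<integral>\<theta>. (cmod (?T (?p n) (of_real r * cis \<theta>)))\<^sup>2 \<partial>circ) \<longlonglongrightarrow> (\<integral>\<theta>. (cmod (?T f (of_real r * cis \<theta>)))\<^sup>2 \<partial>circ)"
    proof (rule integral_dominated_convergence[where w = "\<lambda>_. (B \<phi> + (\<Sum>i\<in>I. B (\<psi> i)))\<^sup>2"])
      show "(\<lambda>\<theta>. (cmod (?T f (of_real r * cis \<theta>)))\<^sup>2) \<in> borel_measurable circ"
           "\<And>n. (\<lambda>\<theta>. (cmod (?T (?p n) (of_real r * cis \<theta>)))\<^sup>2) \<in> borel_measurable circ"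
        using m[OF fh] m[OF ph] by auto
      have "(\<lambda>n. ?T (?p n) z) \<longlonglongrightarrow> ?T f z" if "cmod z < 1" for z
      proof -
        have t: "(\<lambda>n. ?p n w) \<longlonglongrightarrow> f w" if "cmod w < 1" for w
          unfolding poly_coeff_poly using taylor_sums[OF fh that] by (simp only: sums_def)
        show ?thesis unfolding comp_diff_def
          by (intro tendsto_diff tendsto_sum) (simp_all add: t self_map_norm[OF \<phi>(1) that] self_map_norm[OF \<phi>(2) that])
      qed
      then show "AE \<theta> in circ. (\<lambda>n. (cmod (?T (?p n) (of_real r * cis \<theta>)))\<^sup>2) \<longlonglongrightarrow> (cmod (?T f (of_real r * cis \<theta>)))\<^sup>2"
        using r by (intro AE_I2 tendsto_intros) (auto simp: norm_mult)
      show "AE \<theta> in circ. norm ((cmod (?T (?p n) (of_real r * cis \<theta>)))\<^sup>2) \<le> (B \<phi> + (\<Sum>i\<in>I. B (\<psi> i)))\<^sup>2" for n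
        using bd by (auto intro!: power_mono)
    qed auto
    show "(\<lambda>n. C * (\<Sum>k<n. (cmod (taylor f k))\<^sup>2)) \<longlonglongrightarrow> C * (h2norm f)\<^sup>2"
      by (intro tendsto_mult tendsto_const H2_norm_sums[OF f, unfolded sums_def])
    show "\<exists>N. \<forall>n\<ge>N. (\<integral>\<theta>. (cmod (?T (?p n) (of_real r * cis \<theta>)))\<^sup>2 \<partial>circ) \<le> C * (\<Sum>k<n. (cmod (taylor f k))\<^sup>2)"
      using le[OF r] unfolding circ_norm2_coeff_poly by blast
  qed
  have lim: "(\<lambda>j. 1 - inverse (real (Suc (Suc j)))) \<longlonglongrightarrow> 1"
    using tendsto_diff[OF tendsto_const LIMSEQ_Suc[OF LIMSEQ_inverse_real_of_nat], of 1] by simp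
  have r: "0 < 1 - inverse (real (Suc (Suc j)))" "1 - inverse (real (Suc (Suc j))) < 1" for j
    by (auto simp: field_simps)
  note b = less_imp_le[OF r(1)] r(2) lim bound[OF r] tendsto_const
  show "?T f \<in> H2"
    by (rule H2_boundI(1)[OF comp_diff_holomorphic[where \<phi> = \<phi> and \<psi> = \<psi> and I = I, OF fh \<phi>] b])
  show "(h2norm (?T f))\<^sup>2 \<le> C * (h2norm f)\<^sup>2"
    by (rule H2_boundI(2)[OF comp_diff_holomorphic[where \<phi> = \<phi> and \<psi> = \<psi> and I = I, OF fh \<phi>] b])
qed

section \<open>A compactness criterion for differences of composition operators\<close>

lemma poly_holomorphic_ball2: "poly q holomorphic_on ball 0 2"
  by (intro holomorphic_intros)

lemmas measurable_poly_circle [measurable] = measurable_circle[OF poly_holomorphic_ball2, simplified]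

lemma bounded_poly_circle: "\<exists>B. \<forall>\<theta>. cmod (poly q (cis \<theta>)) \<le> B"
  by (rule bounded_circle[OF poly_holomorphic_ball2]) simp

lemma poisson_circle_bound:
  "cmod w < 1 \<Longrightarrow> \<bar>poisson w (cis \<theta>)\<bar> \<le> (1 + cmod w) / (1 - cmod w)"
  using poisson_le[of w "cis \<theta>"] poisson_nonneg[of w "cis \<theta>"] by simp

lemma integrable_poisson_times:
  fixes f :: "real \<Rightarrow> 'a::{banach, second_countable_topology, real_normed_algebra_1}"
  assumes "cmod w < 1" "f \<in> borel_measurable borel" "\<And>\<theta>. norm (f \<theta>) \<le> B"
  shows "integrable circ (\<lambda>\<theta>. of_real (poisson w (cis \<theta>)) * f \<theta>)"
proof (rule integrable_circ_bounded[where B = "(1 + cmod w) / (1 - cmod w) * B"])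
  show "(\<lambda>\<theta>. of_real (poisson w (cis \<theta>)) * f \<theta>) \<in> borel_measurable borel"
    using assms(2) by measurable
  fix x
  have "norm (of_real (poisson w (cis x)) * f x) \<le> norm (of_real (poisson w (cis x)) :: 'a) * norm (f x)"
    by (rule norm_mult_ineq)
  also have "\<dots> \<le> (1 + cmod w) / (1 - cmod w) * B"
    using poisson_circle_bound[OF assms(1), of x] assms
    by (intro mult_mono) (auto intro: order_trans[OF abs_ge_zero])
  finally show "norm (of_real (poisson w (cis x)) * f x) \<le> (1 + cmod w) / (1 - cmod w) * B" .
qed

text \<open>Subharmonicity of the squared modulus, obtained by expanding the nonnegative Poisson
  integral of |q - q(w)|^2 and using that the kernel has mass 1.\<close>

lemma poly_poisson_bound:
  assumes w: "cmod w < 1"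
  shows "(cmod (poly q w))\<^sup>2 \<le> (\<integral>\<theta>. poisson w (cis \<theta>) * (cmod (poly q (cis \<theta>)))\<^sup>2 \<partial>circ)"
proof -
  obtain B where B: "\<And>\<theta>. cmod (poly q (cis \<theta>)) \<le> B" using bounded_poly_circle by blast
  define c where "c = poly q w"
  have i1: "integrable circ (\<lambda>\<theta>. poisson w (cis \<theta>) * (cmod (poly q (cis \<theta>)))\<^sup>2)"
    using integrable_poisson_times[OF w, of "\<lambda>\<theta>. (cmod (poly q (cis \<theta>)))\<^sup>2" "B\<^sup>2"] power_mono[OF B norm_ge_zero]
    by auto
  have i2: "integrable circ (\<lambda>\<theta>. of_real (poisson w (cis \<theta>)) * poly q (cis \<theta>))"
    using integrable_poisson_times[OF w, of "\<lambda>\<theta>. poly q (cis \<theta>)" B] B by auto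
  have i3: "integrable circ (\<lambda>\<theta>. poisson w (cis \<theta>))"
    using integrable_poisson_times[OF w, of "\<lambda>\<theta>. 1::real" 1] by auto
  have i4: "integrable circ (\<lambda>\<theta>. Re (cnj c * (of_real (poisson w (cis \<theta>)) * poly q (cis \<theta>))))"
    using i2 by (intro integrable_Re integrable_mult_right)
  have ex: "poisson w (cis \<theta>) * (cmod (poly q (cis \<theta>) - c))\<^sup>2 = poisson w (cis \<theta>) * (cmod (poly q (cis \<theta>)))\<^sup>2
     - 2 * Re (cnj c * (of_real (poisson w (cis \<theta>)) * poly q (cis \<theta>))) + (cmod c)\<^sup>2 * poisson w (cis \<theta>)" for \<theta>
    unfolding cmod_power2 by (simp add: algebra_simps power2_eq_square)
  have "0 \<le> (\<integral>\<theta>. poisson w (cis \<theta>) * (cmod (poly q (cis \<theta>) - c))\<^sup>2 \<partial>circ)"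
    using w by (intro Bochner_Integration.integral_nonneg) (auto intro!: mult_nonneg_nonneg poisson_nonneg)
  also have "\<dots> = (\<integral>\<theta>. poisson w (cis \<theta>) * (cmod (poly q (cis \<theta>)))\<^sup>2 \<partial>circ)
     - 2 * (\<integral>\<theta>. Re (cnj c * (of_real (poisson w (cis \<theta>)) * poly q (cis \<theta>))) \<partial>circ) + (cmod c)\<^sup>2 * (\<integral>\<theta>. poisson w (cis \<theta>) \<partial>circ)"
    unfolding ex by (simp only: Bochner_Integration.integral_add[OF Bochner_Integration.integrable_diff[OF i1 integrable_mult_right[OF i4]] integrable_mult_right[OF i3]]
      Bochner_Integration.integral_diff[OF i1 integrable_mult_right[OF i4]] integral_mult_right_zero)
  also have "(\<integral>\<theta>. Re (cnj c * (of_real (poisson w (cis \<theta>)) * poly q (cis \<theta>))) \<partial>circ) = (cmod c)\<^sup>2"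
  proof -
    have "(\<integral>\<theta>. Re (cnj c * (of_real (poisson w (cis \<theta>)) * poly q (cis \<theta>))) \<partial>circ) = Re (cnj c * c)"
      using i2 circ_poisson_complex[OF poly_holomorphic_ball2 _ w, of q]
      by (subst integral_Re) (auto simp: c_def)
    moreover have "Re (cnj c * c) = (cmod c)\<^sup>2" unfolding cmod_power2 by (simp add: power2_eq_square)
    ultimately show ?thesis by simp
  qed
  finally show ?thesis by (simp add: circ_poisson_1[OF w] c_def)
qed

lemma circ_cauchy_schwarz:
  fixes f g :: "real \<Rightarrow> real"
  assumes [measurable]: "f \<in> borel_measurable borel" "g \<in> borel_measurable borel"
    and f: "\<And>x. 0 \<le> f x" "\<And>x. f x \<le> B" and g: "\<And>x. 0 \<le> g x" "\<And>x. g x \<le> C"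
  shows "(\<integral>x. f x * g x \<partial>circ)\<^sup>2 \<le> (\<integral>x. (f x)\<^sup>2 \<partial>circ) * (\<integral>x. (g x)\<^sup>2 \<partial>circ)"
proof -
  have B: "0 \<le> B" "0 \<le> C" using order_trans[OF f(1)[of 0] f(2)] order_trans[OF g(1)[of 0] g(2)] by auto
  have i: "integrable circ (\<lambda>x. f x * g x)" "integrable circ (\<lambda>x. (f x)\<^sup>2)" "integrable circ (\<lambda>x. (g x)\<^sup>2)"
    by (rule integrable_circ_bounded[where B = "B * C"] integrable_circ_bounded[where B = "B\<^sup>2"]
       integrable_circ_bounded[where B = "C\<^sup>2"]; use f g B in \<open>auto intro!: mult_mono power_mono\<close>)+
  have "(\<integral>\<^sup>+x. ennreal (f x) * ennreal (g x) \<partial>circ)\<^sup>2 \<le> (\<integral>\<^sup>+x. (ennreal (f x))\<^sup>2 \<partial>circ) * (\<integral>\<^sup>+x. (ennreal (g x))\<^sup>2 \<partial>circ)"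
    by (rule Cauchy_Schwarz_nn_integral) auto
  then show ?thesis
    using i f g by (simp add: ennreal_mult[symmetric] ennreal_power nn_integral_eq_integral Bochner_Integration.integral_nonneg)
qed

text \<open>Cauchy's formula writes q(w) - q(w') as an integral of q against w - w' over a product
  of two denominators. Cauchy-Schwarz pairs |q|^2 with the denominator of \<open>w\<close>, and the
  one of \<open>w'\<close> integrates to a constant. The bound is left asymmetric so that it can be
  swept to the circle along \<open>w\<close> alone.\<close>

lemma poly_diff_bound:
  assumes w: "cmod w < 1" and w': "cmod w' < 1"
  shows "(cmod (poly q w - poly q w'))\<^sup>2 \<le> (cmod (w - w'))\<^sup>2 / ((1 - (cmod w)\<^sup>2) * (1 - (cmod w')\<^sup>2))
    * (\<integral>\<theta>. poisson w (cis \<theta>) * (cmod (poly q (cis \<theta>)))\<^sup>2 \<partial>circ)"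
proof -
  obtain B where B: "\<And>\<theta>. cmod (poly q (cis \<theta>)) \<le> B" using bounded_poly_circle by blast
  have nz: "cmod (1 - v * cnj (cis \<theta>)) = cmod (cis \<theta> - v)" "1 - v * cnj (cis \<theta>) \<noteq> 0" "0 < cmod (cis \<theta> - v)" "1 - cmod v \<le> cmod (cis \<theta> - v)" if "cmod v < 1" for v \<theta>
  proof -
    have "cis \<theta> * (1 - v * cnj (cis \<theta>)) = cis \<theta> - v * (cis \<theta> * cnj (cis \<theta>))" by (simp add: algebra_simps)
    also have "cis \<theta> * cnj (cis \<theta>) = 1" by (simp add: complex_norm_square[symmetric])
    finally have "cmod (cis \<theta> * (1 - v * cnj (cis \<theta>))) = cmod (cis \<theta> - v)" by simp
    then show 1: "cmod (1 - v * cnj (cis \<theta>)) = cmod (cis \<theta> - v)" by (simp add: norm_mult)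
    show 2: "0 < cmod (cis \<theta> - v)" using that by auto
    show "1 - v * cnj (cis \<theta>) \<noteq> 0" using 1 2 by auto
    show "1 - cmod v \<le> cmod (cis \<theta> - v)" by (rule norm_circle_diff_ge) simp
  qed
  have ic: "integrable circ (\<lambda>\<theta>. poly q (cis \<theta>) * (1 / (1 - v * cnj (cis \<theta>))))" if "cmod v < 1" for v
  proof (rule integrable_circ_bounded[where B = "B * (1 / (1 - cmod v))"])
    show "cmod (poly q (cis x) * (1 / (1 - v * cnj (cis x)))) \<le> B * (1 / (1 - cmod v))" for x
      unfolding norm_mult norm_divide nz(1)[OF that] using nz[OF that, of x] that
      by (intro mult_mono B frac_le order_trans[OF norm_ge_zero B]) auto
  qed measurable
  have pos: "0 < 1 - (cmod v)\<^sup>2" if "cmod v < 1" for v using that by (simp add: abs_square_less_1)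
  define f where "f = (\<lambda>\<theta>. cmod (poly q (cis \<theta>)) / cmod (cis \<theta> - w))"
  define g where "g = (\<lambda>\<theta>. cmod (w - w') / cmod (cis \<theta> - w'))"
  have "poly q w - poly q w' = (\<integral>\<theta>. poly q (cis \<theta>) * (1 / (1 - w * cnj (cis \<theta>))) - poly q (cis \<theta>) * (1 / (1 - w' * cnj (cis \<theta>))) \<partial>circ)"
    using circ_cauchy[OF poly_holomorphic_ball2, of w q] circ_cauchy[OF poly_holomorphic_ball2, of w' q] w w'
    by (subst Bochner_Integration.integral_diff[OF ic[OF w] ic[OF w']]) simp
  also have "cmod \<dots> \<le> (\<integral>\<theta>. f \<theta> * g \<theta> \<partial>circ)"
  proof (rule order_trans[OF integral_norm_bound], rule eq_refl, intro Bochner_Integration.integral_cong refl)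
    fix \<theta>
    have "poly q (cis \<theta>) * (1 / (1 - w * cnj (cis \<theta>))) - poly q (cis \<theta>) * (1 / (1 - w' * cnj (cis \<theta>)))
      = poly q (cis \<theta>) * (cnj (cis \<theta>) * (w - w')) / ((1 - w * cnj (cis \<theta>)) * (1 - w' * cnj (cis \<theta>)))"
      using nz(2)[OF w, of \<theta>] nz(2)[OF w', of \<theta>] by (simp add: divide_simps) (simp add: algebra_simps)
    then show "cmod (poly q (cis \<theta>) * (1 / (1 - w * cnj (cis \<theta>))) - poly q (cis \<theta>) * (1 / (1 - w' * cnj (cis \<theta>)))) = f \<theta> * g \<theta>"
      by (simp add: f_def g_def norm_divide norm_mult nz[OF w] nz[OF w'])
  qed
  finally have "(cmod (poly q w - poly q w'))\<^sup>2 \<le> (\<integral>\<theta>. f \<theta> * g \<theta> \<partial>circ)\<^sup>2"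
    by (intro power_mono) auto
  also have "\<dots> \<le> (\<integral>\<theta>. (f \<theta>)\<^sup>2 \<partial>circ) * (\<integral>\<theta>. (g \<theta>)\<^sup>2 \<partial>circ)"
  proof (rule circ_cauchy_schwarz)
    show "f \<in> borel_measurable borel" "g \<in> borel_measurable borel" unfolding f_def g_def by measurable
    show "f x \<le> B / (1 - cmod w)" "g x \<le> cmod (w - w') / (1 - cmod w')" for x
      unfolding f_def g_def using nz[OF w] nz[OF w'] w w' by (auto intro!: frac_le B order_trans[OF norm_ge_zero B])
  qed (auto simp: f_def g_def)
  also have "(\<integral>\<theta>. (f \<theta>)\<^sup>2 \<partial>circ) = (\<integral>\<theta>. poisson w (cis \<theta>) * (cmod (poly q (cis \<theta>)))\<^sup>2 / (1 - (cmod w)\<^sup>2) \<partial>circ)"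
    using pos[OF w] by (intro Bochner_Integration.integral_cong) (auto simp: f_def poisson_def power_divide)
  also have "\<dots> = (\<integral>\<theta>. poisson w (cis \<theta>) * (cmod (poly q (cis \<theta>)))\<^sup>2 \<partial>circ) / (1 - (cmod w)\<^sup>2)" by simp
  also have "(\<integral>\<theta>. (g \<theta>)\<^sup>2 \<partial>circ) = (\<integral>\<theta>. (cmod (w - w'))\<^sup>2 / (1 - (cmod w')\<^sup>2) * poisson w' (cis \<theta>) \<partial>circ)"
    using pos[OF w'] by (intro Bochner_Integration.integral_cong) (auto simp: g_def poisson_def power_divide)
  also have "\<dots> = (cmod (w - w'))\<^sup>2 / (1 - (cmod w')\<^sup>2)" using circ_poisson_1[OF w'] by simp
  finally show ?thesis by (simp add: mult.commute)
qed

lemma circ_norm2_nn: "(\<integral>\<^sup>+\<theta>. ennreal ((cmod (poly q (cis \<theta>)))\<^sup>2) \<partial>circ) = ennreal (circ_norm2 q)"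
proof -
  obtain B where B: "\<And>\<theta>. cmod (poly q (cis \<theta>)) \<le> B" using bounded_poly_circle by blast
  then have "integrable circ (\<lambda>\<theta>. (cmod (poly q (cis \<theta>)))\<^sup>2)"
    by (intro integrable_circ_bounded[where B = "B\<^sup>2"]) (auto intro!: power_mono)
  then show ?thesis unfolding circ_norm2_def by (rule nn_integral_eq_integral) auto
qed

lemma circ_norm2_nonneg: "0 \<le> circ_norm2 q"
  unfolding circ_norm2_def by (rule Bochner_Integration.integral_nonneg) auto

lemma poisson_poly_nn:
  assumes "cmod w < 1"
  shows "ennreal (\<integral>\<theta>. poisson w (cis \<theta>) * (cmod (poly q (cis \<theta>)))\<^sup>2 \<partial>circ)
     = (\<integral>\<^sup>+\<theta>. ennreal (poisson w (cis \<theta>)) * ennreal ((cmod (poly q (cis \<theta>)))\<^sup>2) \<partial>circ)"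
proof -
  obtain B where B: "\<And>\<theta>. cmod (poly q (cis \<theta>)) \<le> B" using bounded_poly_circle by blast
  have "integrable circ (\<lambda>\<theta>. poisson w (cis \<theta>) * (cmod (poly q (cis \<theta>)))\<^sup>2)"
    using integrable_poisson_times[OF assms, of "\<lambda>\<theta>. (cmod (poly q (cis \<theta>)))\<^sup>2" "B\<^sup>2"] power_mono[OF B norm_ge_zero]
    by auto
  from nn_integral_eq_integral[OF this] assms show ?thesis
    by (simp add: ennreal_mult'' poisson_nonneg)
qed

text \<open>Sweeping the measure \<open>v d\<theta>\<close> along \<open>w\<close> to the circle turns a bound on its Poisson balayage into a
  Carleson-type embedding.\<close>
lemma balayage:
  fixes v :: "real \<Rightarrow> ennreal" and w :: "real \<Rightarrow> complex"
  assumes [measurable]: "v \<in> borel_measurable borel" "w \<in> borel_measurable borel"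
    and w: "AE \<theta> in circ. cmod (w \<theta>) < 1"
    and K: "\<And>\<alpha>. (\<integral>\<^sup>+\<theta>. v \<theta> * ennreal (poisson (w \<theta>) (cis \<alpha>)) \<partial>circ) \<le> K"
    and G: "AE \<theta> in circ. G \<theta> \<le> v \<theta> * ennreal (\<integral>\<alpha>. poisson (w \<theta>) (cis \<alpha>) * (cmod (poly q (cis \<alpha>)))\<^sup>2 \<partial>circ)"
  shows "(\<integral>\<^sup>+\<theta>. G \<theta> \<partial>circ) \<le> K * ennreal (circ_norm2 q)"
proof -
  interpret pair_sigma_finite circ circ ..
  have "(\<integral>\<^sup>+\<theta>. G \<theta> \<partial>circ) \<le> (\<integral>\<^sup>+\<theta>. (\<integral>\<^sup>+\<alpha>. v \<theta> * (ennreal (poisson (w \<theta>) (cis \<alpha>)) * ennreal ((cmod (poly q (cis \<alpha>)))\<^sup>2)) \<partial>circ) \<partial>circ)"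
    using w G by (intro nn_integral_mono_AE) (auto simp: poisson_poly_nn nn_integral_cmult elim!: AE_mp)
  also have "\<dots> = (\<integral>\<^sup>+\<alpha>. (\<integral>\<^sup>+\<theta>. v \<theta> * (ennreal (poisson (w \<theta>) (cis \<alpha>)) * ennreal ((cmod (poly q (cis \<alpha>)))\<^sup>2)) \<partial>circ) \<partial>circ)"
    by (intro Fubini'[symmetric]) measurable
  also have "\<dots> = (\<integral>\<^sup>+\<alpha>. (\<integral>\<^sup>+\<theta>. v \<theta> * ennreal (poisson (w \<theta>) (cis \<alpha>)) \<partial>circ) * ennreal ((cmod (poly q (cis \<alpha>)))\<^sup>2) \<partial>circ)"
    by (intro nn_integral_cong) (simp add: mult.assoc[symmetric] nn_integral_multc)
  also have "\<dots> \<le> (\<integral>\<^sup>+\<alpha>. K * ennreal ((cmod (poly q (cis \<alpha>)))\<^sup>2) \<partial>circ)"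
    by (intro nn_integral_mono mult_right_mono K) auto
  also have "\<dots> = K * ennreal (circ_norm2 q)" by (simp add: nn_integral_cmult circ_norm2_nn)
  finally show ?thesis .
qed

section \<open>Littlewood subordination for composition operators\<close>

lemma self_map_denominator:
  assumes "cmod \<alpha> = 1" "cmod w < 1" shows "\<alpha> - w \<noteq> 0"
  using assms by auto

text \<open>As a function of z the kernel \<open>poisson (\<phi> z) \<alpha>\<close> is the real
  part of (alpha + phi) / (alpha - phi), hence harmonic, and the mean value property
  applies.\<close>

lemma poisson_self_map_mean:
  assumes \<phi>: "self_map \<phi>" and \<alpha>: "cmod \<alpha> = 1" and r: "0 \<le> r" "r < 1"
  shows "(\<integral>\<^sup>+\<theta>. ennreal (poisson (\<phi> (of_real r * cis \<theta>)) \<alpha>) \<partial>circ) = ennreal (poisson (\<phi> 0) \<alpha>)"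
proof (cases "r = 0")
  case True
  then show ?thesis by (simp add: circ.emeasure_space_1[simplified])
next
  case False
  define g where "g = (\<lambda>z. (\<alpha> + \<phi> (of_real r * z)) / (\<alpha> - \<phi> (of_real r * z)))"
  have lt: "cmod (of_real r * z) < 1" if "cmod z < 1 / r" for z
    using that r False by (simp add: norm_mult field_simps)
  have "(\<lambda>z. \<phi> (of_real r * z)) holomorphic_on ball 0 (1/r)"
    using r False by (intro holomorphic_on_compose_gen[OF _ self_map_holomorphic[OF \<phi>], unfolded o_def] holomorphic_intros)
      (auto intro!: lt)
  then have g: "g holomorphic_on ball 0 (1/r)"
    unfolding g_def by (intro holomorphic_intros self_map_denominator \<alpha> self_map_norm[OF \<phi>] lt) auto
  have R: "1 < 1/r" using r False by simp
  have e: "poisson (\<phi> (of_real r * cis \<theta>)) \<alpha> = Re (g (cis \<theta>))" for \<theta>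
    unfolding g_def using \<alpha> self_map_norm[OF \<phi>, of "of_real r * cis \<theta>"] r
    by (intro poisson_eq_Re) (auto simp: norm_mult)
  have e0: "poisson (\<phi> 0) \<alpha> = Re (g 0)"
    unfolding g_def using \<alpha> self_map_norm[OF \<phi>, of 0] by (subst poisson_eq_Re) auto
  obtain B where B: "\<And>\<theta>. cmod (g (cis \<theta>)) \<le> B" using bounded_circle[OF g R] by blast
  have i: "integrable circ (\<lambda>\<theta>. g (cis \<theta>))" using measurable_circle[OF g R] B by (intro integrable_circ_bounded) auto
  have "(\<integral>\<^sup>+\<theta>. ennreal (poisson (\<phi> (of_real r * cis \<theta>)) \<alpha>) \<partial>circ) = (\<integral>\<^sup>+\<theta>. ennreal (Re (g (cis \<theta>))) \<partial>circ)"
    by (simp only: e)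
  also have "\<dots> = ennreal (\<integral>\<theta>. Re (g (cis \<theta>)) \<partial>circ)"
  proof (rule nn_integral_eq_integral[OF integrable_Re[OF i]], rule AE_I2)
    fix \<theta>
    have "cmod (\<phi> (of_real r * cis \<theta>)) < 1" using r by (intro self_map_norm[OF \<phi>]) (simp add: norm_mult)
    then show "0 \<le> Re (g (cis \<theta>))" unfolding e[symmetric] by (intro poisson_nonneg) auto
  qed
  also have "\<dots> = ennreal (poisson (\<phi> 0) \<alpha>)"
    using i circ_mean[OF g R] by (simp add: e0)
  finally show ?thesis .
qed

text \<open>Harnack's upper bound for \<open>poisson (\<phi> 0)\<close> on the circle. It bounds the
  mass of every Clark measure of \<open>\<phi>\<close> and the squared norm of the composition
  operator.\<close>

definition comp_bound :: "(complex \<Rightarrow> complex) \<Rightarrow> real" where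
  "comp_bound \<phi> = (1 + cmod (\<phi> 0)) / (1 - cmod (\<phi> 0))"

lemma comp_bound_nonneg: "self_map \<phi> \<Longrightarrow> 0 \<le> comp_bound \<phi>"
  using self_map_norm[of \<phi> 0] by (simp add: comp_bound_def)

lemma poisson_le_comp_bound: "self_map \<phi> \<Longrightarrow> cmod \<alpha> = 1 \<Longrightarrow> poisson (\<phi> 0) \<alpha> \<le> comp_bound \<phi>"
  unfolding comp_bound_def using self_map_norm[of \<phi> 0] by (intro poisson_le) auto

text \<open>Balayage with constant weight 1: by the mean value property the swept measure has
  density \<open>poisson (\<phi> 0)\<close>, which is at most
  \<open>comp_bound \<phi>\<close>.\<close>

lemma littlewood_poly:
  assumes \<phi>: "self_map \<phi>" and r: "0 \<le> r" "r < 1"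
  shows "(\<integral>\<theta>. (cmod (poly q (\<phi> (of_real r * cis \<theta>))))\<^sup>2 \<partial>circ) \<le> comp_bound \<phi> * circ_norm2 q"
proof -
  note m = measurable_dilate[OF self_map_holomorphic[OF \<phi>] r]
  have n: "cmod (\<phi> (of_real r * cis \<theta>)) < 1" for \<theta> using r by (intro self_map_norm[OF \<phi>]) (auto simp: norm_mult)
  have "(\<integral>\<^sup>+\<theta>. ennreal ((cmod (poly q (\<phi> (of_real r * cis \<theta>))))\<^sup>2) \<partial>circ) \<le> ennreal (comp_bound \<phi>) * ennreal (circ_norm2 q)"
  proof (rule balayage[where v = "\<lambda>_. 1"])
    show "(\<integral>\<^sup>+\<theta>. 1 * ennreal (poisson (\<phi> (of_real r * cis \<theta>)) (cis \<alpha>)) \<partial>circ) \<le> ennreal (comp_bound \<phi>)" for \<alpha>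
      using poisson_self_map_mean[OF \<phi> _ r, of "cis \<alpha>"] poisson_le_comp_bound[OF \<phi>, of "cis \<alpha>"] by (simp add: ennreal_leI)
  qed (use m n poly_poisson_bound in \<open>auto intro!: ennreal_leI\<close>)
  also have "\<dots> = ennreal (comp_bound \<phi> * circ_norm2 q)"
    by (simp add: ennreal_mult comp_bound_nonneg[OF \<phi>] circ_norm2_nonneg)
  finally show ?thesis
    by (intro integral_real_bounded) (auto simp: comp_bound_nonneg[OF \<phi>] circ_norm2_nonneg)
qed

lemma H2_compose:
  assumes f: "f \<in> H2" and \<phi>: "self_map \<phi>"
  shows "(\<lambda>z. f (\<phi> z)) \<in> H2" "(h2norm (\<lambda>z. f (\<phi> z)))\<^sup>2 \<le> comp_bound \<phi> * (h2norm f)\<^sup>2"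
  using comp_diff_H2I[OF f \<phi>, of "{}" "\<lambda>_. \<phi>" "comp_bound \<phi>"] littlewood_poly[OF \<phi>]
  by (auto simp: comp_diff_def[abs_def])

lemma H2_compose_sum:
  assumes "finite I" "\<And>i. i \<in> I \<Longrightarrow> self_map (\<psi> i)"
  shows "\<exists>K\<ge>0. \<forall>f\<in>H2. (\<lambda>z. \<Sum>i\<in>I. f (\<psi> i z)) \<in> H2 \<and> (h2norm (\<lambda>z. \<Sum>i\<in>I. f (\<psi> i z)))\<^sup>2 \<le> K * (h2norm f)\<^sup>2"
  using assms
proof (induction I rule: finite_induct)
  case empty
  have "(\<lambda>z. 0) \<in> H2 \<and> (h2norm (\<lambda>z. 0))\<^sup>2 = 0"
  proof -
    have "poly 0 = (\<lambda>z::complex. 0)" by auto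
    then show ?thesis using coeff_poly_H2[of "\<lambda>_. 0" 0] by (simp add: coeff_poly_def)
  qed
  then show ?case by (intro exI[of _ 0]) auto
next
  case (insert i I)
  then obtain K where K: "K \<ge> 0" "\<And>f. f \<in> H2 \<Longrightarrow> (\<lambda>z. \<Sum>i\<in>I. f (\<psi> i z)) \<in> H2"
    "\<And>f. f \<in> H2 \<Longrightarrow> (h2norm (\<lambda>z. \<Sum>i\<in>I. f (\<psi> i z)))\<^sup>2 \<le> K * (h2norm f)\<^sup>2" by auto
  have s: "self_map (\<psi> i)" using insert by auto
  have "(\<lambda>z. \<Sum>i\<in>insert i I. f (\<psi> i z)) \<in> H2 \<and>
    (h2norm (\<lambda>z. \<Sum>i\<in>insert i I. f (\<psi> i z)))\<^sup>2 \<le> (2 * comp_bound (\<psi> i) + 2 * K) * (h2norm f)\<^sup>2" if f: "f \<in> H2" for f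
    using H2_add[OF H2_compose(1)[OF f s] K(2)[OF f]] H2_compose(2)[OF f s] K(3)[OF f] insert(1,2)
    by (simp add: algebra_simps)
  then show ?case using K(1) comp_bound_nonneg[OF s] by (intro exI[of _ "2 * comp_bound (\<psi> i) + 2 * K"]) auto
qed

lemma comp_diff_bounded:
  assumes "finite I" "self_map \<phi>" "\<And>i. i \<in> I \<Longrightarrow> self_map (\<psi> i)"
  shows "\<exists>K\<ge>0. \<forall>f\<in>H2. comp_diff \<phi> \<psi> I f \<in> H2 \<and> (h2norm (comp_diff \<phi> \<psi> I f))\<^sup>2 \<le> K * (h2norm f)\<^sup>2"
proof -
  obtain K where K: "K \<ge> 0" "\<And>f. f \<in> H2 \<Longrightarrow> (\<lambda>z. \<Sum>i\<in>I. f (\<psi> i z)) \<in> H2"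
    "\<And>f. f \<in> H2 \<Longrightarrow> (h2norm (\<lambda>z. \<Sum>i\<in>I. f (\<psi> i z)))\<^sup>2 \<le> K * (h2norm f)\<^sup>2"
    using H2_compose_sum[where \<psi> = \<psi> and I = I, OF assms(1,3)] by auto
  have "comp_diff \<phi> \<psi> I f \<in> H2 \<and> (h2norm (comp_diff \<phi> \<psi> I f))\<^sup>2 \<le> (2 * comp_bound \<phi> + 2 * K) * (h2norm f)\<^sup>2" if f: "f \<in> H2" for f
    using H2_diff[OF H2_compose(1)[OF f assms(2)] K(2)[OF f]] H2_compose(2)[OF f assms(2)] K(3)[OF f]
    unfolding comp_diff_def[abs_def] by (simp add: algebra_simps)
  then show ?thesis using K(1) comp_bound_nonneg[OF assms(2)] by (intro exI[of _ "2 * comp_bound \<phi> + 2 * K"]) auto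
qed

section \<open>Compactness from decay on functions with a zero of high order at the origin\<close>

lemma coeff_poly_tail:
  assumes "\<And>k. k < N \<Longrightarrow> a k = 0"
  shows "\<exists>q. coeff_poly a n = monom 1 N * q"
proof -
  have "monom 1 N dvd coeff_poly a n" unfolding coeff_poly_def
  proof (rule dvd_sum)
    fix k
    show "monom 1 N dvd monom (a k) k"
    proof (cases "k < N")
      case False
      then have "monom (a k) k = monom 1 N * monom (a k) (k - N)" by (simp add: mult_monom)
      then show ?thesis by (metis dvd_triv_left)
    qed (simp add: assms)
  qed
  then show ?thesis by (auto simp: dvd_def)
qed

lemma circ_norm2_monom_mult: "circ_norm2 (monom 1 N * q) = circ_norm2 q"
  by (simp add: circ_norm2_def poly_monom norm_mult norm_power)

text \<open>A bounded sequence has a subsequence along which every Taylor coefficient converges. For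
  a difference of two late terms, the head of \<open>N\<close> coefficients is small and stays small
  because the operator is bounded; the remainder is divisible by z^N and is made small by
  \<open>tail\<close>.\<close>

theorem compact_comp_diffI:
  assumes fin: "finite I" and \<phi>: "self_map \<phi>" and \<psi>: "\<And>i. i \<in> I \<Longrightarrow> self_map (\<psi> i)"
    and tail: "\<And>\<epsilon>. \<epsilon> > 0 \<Longrightarrow> \<exists>N. \<forall>q r. 0 < r \<and> r < 1 \<longrightarrow>
      (\<integral>\<theta>. (cmod (comp_diff \<phi> \<psi> I (poly (monom 1 N * q)) (of_real r * cis \<theta>)))\<^sup>2 \<partial>circ) \<le> \<epsilon> * circ_norm2 q"
  shows "H2_compact_op (comp_diff \<phi> \<psi> I)"
proof -
  let ?T = "comp_diff \<phi> \<psi> I"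
  obtain K where K: "K \<ge> 0" "\<And>f. f \<in> H2 \<Longrightarrow> ?T f \<in> H2" "\<And>f. f \<in> H2 \<Longrightarrow> (h2norm (?T f))\<^sup>2 \<le> K * (h2norm f)\<^sup>2"
    using comp_diff_bounded[where \<phi> = \<phi> and \<psi> = \<psi> and I = I, OF fin \<phi> \<psi>] by auto
  have Tdiff: "?T (\<lambda>z. f z - g z) = (\<lambda>z. ?T f z - ?T g z)" for f g
    by (rule ext) (simp add: comp_diff_def sum_subtractf)
  have "\<exists>r::nat\<Rightarrow>nat. strict_mono r \<and> (\<forall>e>0. \<exists>N. \<forall>k\<ge>N. \<forall>l\<ge>N. h2norm (\<lambda>z. ?T (s (r k)) z - ?T (s (r l)) z) < e)"
    if s: "\<And>k. s k \<in> H2" and B0: "\<And>k. h2norm (s k) \<le> B0" for s :: "nat \<Rightarrow> complex \<Rightarrow> complex" and B0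
  proof -
    define B where "B = max 1 B0"
    have B: "B > 0" "\<And>k. h2norm (s k) \<le> B" using B0 by (auto simp: B_def intro: max.coboundedI2)
    have tb: "cmod (taylor (s k) j) \<le> B" for k j
    proof -
      have "(cmod (taylor (s k) j))\<^sup>2 \<le> (h2norm (s k))\<^sup>2"
        using sum_le_suminf[of "\<lambda>j. (cmod (taylor (s k) j))\<^sup>2" "{j}"] H2_norm_sums[OF s[of k]] by (simp add: sums_iff)
      then have "cmod (taylor (s k) j) \<le> h2norm (s k)" using h2norm_nonneg[OF s] by (rule power2_le_imp_le)
      then show ?thesis using B(2) order_trans by blast
    qed
    \<comment> \<open>A diagonal subsequence, legitimate because each coefficient of a function in
      H^2 is at most its norm.\<close>
    obtain \<sigma> where \<sigma>: "strict_mono (\<sigma> :: nat \<Rightarrow> nat)" "\<And>j. \<exists>l. (\<lambda>n. taylor (s (\<sigma> n)) j) \<longlonglongrightarrow> l"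
      using function_convergent_subsequence[of UNIV "\<lambda>k j. taylor (s k) j" B] tb by auto
    define d where "d = (\<lambda>k l z. s (\<sigma> k) z - s (\<sigma> l) z)"
    have dH: "d k l \<in> H2" and dn: "(h2norm (d k l))\<^sup>2 \<le> 4 * B\<^sup>2" for k l
    proof -
      show "d k l \<in> H2" unfolding d_def by (rule H2_diff(1)[OF s s])
      have "(h2norm (s k))\<^sup>2 \<le> B\<^sup>2" for k using h2norm_nonneg[OF s] B by (intro power_mono) auto
      from this[of "\<sigma> k"] this[of "\<sigma> l"] show "(h2norm (d k l))\<^sup>2 \<le> 4 * B\<^sup>2"
        using H2_diff(2)[OF s s, of "\<sigma> k" "\<sigma> l"] unfolding d_def by linarith
    qed
    have dt: "taylor (d k l) j = taylor (s (\<sigma> k)) j - taylor (s (\<sigma> l)) j" for k l j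
      unfolding d_def by (rule taylor_diff[OF H2_holomorphic[OF s] H2_holomorphic[OF s]])
    have "\<exists>M. \<forall>k\<ge>M. \<forall>l\<ge>M. h2norm (?T (d k l)) < e" if e: "e > 0" for e
    proof -
      \<comment> \<open>The tail of a difference has squared norm at most
        \<open>4 * B\<^sup>2\<close>, so this value lets it contribute half of the square of
        \<open>e\<close>. The constant \<open>\<delta>\<close> below makes the head contribute at
        most a quarter.\<close>
      define \<epsilon> where "\<epsilon> = e\<^sup>2 / (16 * B\<^sup>2)"
      have \<epsilon>: "\<epsilon> > 0" using e B by (simp add: \<epsilon>_def)
      obtain N where N: "\<And>q r. 0 < r \<Longrightarrow> r < 1 \<Longrightarrow>
          (\<integral>\<theta>. (cmod (?T (poly (monom 1 N * q)) (of_real r * cis \<theta>)))\<^sup>2 \<partial>circ) \<le> \<epsilon> * circ_norm2 q"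
        using tail[OF \<epsilon>] by blast
      define \<delta> where "\<delta> = e\<^sup>2 / (8 * (K + 1) * (real N + 1))"
      have \<delta>: "\<delta> > 0" using e K by (simp add: \<delta>_def)
      have "\<exists>M. \<forall>k\<ge>M. \<forall>l\<ge>M. \<forall>j<N. (cmod (taylor (d k l) j))\<^sup>2 < \<delta>"
      proof -
        have "\<exists>M. \<forall>k\<ge>M. \<forall>l\<ge>M. cmod (taylor (d k l) j) < sqrt \<delta>" for j
        proof -
          have "Cauchy (\<lambda>n. taylor (s (\<sigma> n)) j)" using \<sigma>(2)[of j] by (auto intro: LIMSEQ_imp_Cauchy)
          then show ?thesis unfolding dt Cauchy_iff using \<delta> by simp
        qed
        then obtain M where M: "\<And>j k l. k \<ge> M j \<Longrightarrow> l \<ge> M j \<Longrightarrow> cmod (taylor (d k l) j) < sqrt \<delta>" by metis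
        have "(cmod (taylor (d k l) j))\<^sup>2 < \<delta>" if "k \<ge> Max (M ` {..N})" "l \<ge> Max (M ` {..N})" "j < N" for k l j
        proof -
          have "M j \<le> Max (M ` {..N})" using that by (intro Max_ge) auto
          then have "cmod (taylor (d k l) j) < sqrt \<delta>" using that by (intro M) auto
          then have "(cmod (taylor (d k l) j))\<^sup>2 < (sqrt \<delta>)\<^sup>2" by (intro power_strict_mono) auto
          then show ?thesis using \<delta> by simp
        qed
        then show ?thesis by blast
      qed
      then obtain M where M: "\<And>k l j. k \<ge> M \<Longrightarrow> l \<ge> M \<Longrightarrow> j < N \<Longrightarrow> (cmod (taylor (d k l) j))\<^sup>2 < \<delta>" by blast
      have "h2norm (?T (d k l)) < e" if kl: "k \<ge> M" "l \<ge> M" for k l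
      proof -
        define P where "P = poly (coeff_poly (taylor (d k l)) N)"
        define Q where "Q = (\<lambda>z. d k l z - P z)"
        have P: "P \<in> H2" "(h2norm P)\<^sup>2 = (\<Sum>j<N. (cmod (taylor (d k l) j))\<^sup>2)"
          unfolding P_def by (rule coeff_poly_H2)+
        have Q: "Q \<in> H2" unfolding Q_def by (rule H2_diff(1)[OF dH P(1)])
        have Qt: "taylor Q j = (if j < N then 0 else taylor (d k l) j)" for j
          unfolding Q_def taylor_diff[OF H2_holomorphic[OF dH] H2_holomorphic[OF P(1)]]
          by (simp add: P_def taylor_coeff_poly)
        have Qn: "(h2norm Q)\<^sup>2 \<le> 4 * B\<^sup>2"
        proof -
          have "(h2norm Q)\<^sup>2 \<le> (h2norm (d k l))\<^sup>2"
            by (rule sums_le[OF _ H2_norm_sums[OF Q] H2_norm_sums[OF dH]]) (simp add: Qt)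
          then show ?thesis using dn order_trans by blast
        qed
        have TQ: "(h2norm (?T Q))\<^sup>2 \<le> \<epsilon> * (h2norm Q)\<^sup>2"
        proof (rule comp_diff_H2I(2)[where \<phi> = \<phi> and \<psi> = \<psi> and I = I, OF Q \<phi> \<psi>])
          fix n r assume r: "0 < (r::real)" "r < 1"
          obtain q where q: "coeff_poly (taylor Q) n = monom 1 N * q"
            using coeff_poly_tail[of N "taylor Q" n] by (auto simp: Qt)
          show "(\<integral>\<theta>. (cmod (?T (poly (coeff_poly (taylor Q) n)) (of_real r * cis \<theta>)))\<^sup>2 \<partial>circ) \<le> \<epsilon> * circ_norm2 (coeff_poly (taylor Q) n)"
            unfolding q circ_norm2_monom_mult by (rule N[OF r])
        qed
        have TP: "(h2norm (?T P))\<^sup>2 \<le> K * (real N * \<delta>)"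
        proof -
          have "(h2norm P)\<^sup>2 \<le> (\<Sum>j<N. \<delta>)" unfolding P(2) using M[OF kl] by (intro sum_mono less_imp_le) auto
          then have "K * (h2norm P)\<^sup>2 \<le> K * (real N * \<delta>)" using K(1) by (intro mult_left_mono) auto
          then show ?thesis using K(3)[OF P(1)] order_trans by blast
        qed
        have "?T (d k l) = (\<lambda>z. ?T P z + ?T Q z)"
          by (rule ext) (simp add: Q_def comp_diff_def sum.distrib[symmetric] algebra_simps sum_subtractf)
        then have "(h2norm (?T (d k l)))\<^sup>2 \<le> 2 * (h2norm (?T P))\<^sup>2 + 2 * (h2norm (?T Q))\<^sup>2"
          using H2_add(2)[OF K(2)[OF P(1)] K(2)[OF Q]] by simp
        also have "\<dots> \<le> 2 * (K * (real N * \<delta>)) + 2 * (\<epsilon> * (4 * B\<^sup>2))"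
          using TP order_trans[OF TQ mult_left_mono[OF Qn less_imp_le[OF \<epsilon>]]] by linarith
        also have "2 * (\<epsilon> * (4 * B\<^sup>2)) = e\<^sup>2 / 2" using B by (simp add: \<epsilon>_def)
        also have "K * (real N * \<delta>) \<le> (K + 1) * ((real N + 1) * \<delta>)"
          using K(1) \<delta> by (intro mult_mono mult_right_mono) auto
        also have "(K + 1) * ((real N + 1) * \<delta>) = e\<^sup>2 / 8"
          using K(1) by (simp add: \<delta>_def divide_simps)
        finally have "(h2norm (?T (d k l)))\<^sup>2 < e\<^sup>2"
          using e by (simp add: field_simps) (smt (verit) zero_less_power)
        then show ?thesis by (rule power2_less_imp_less[OF _ less_imp_le[OF e]])
      qed
      then show ?thesis by (intro exI[of _ M]) simp
    qed
    then have c: "\<forall>e>0. \<exists>N. \<forall>k\<ge>N. \<forall>l\<ge>N. h2norm (\<lambda>z. ?T (s (\<sigma> k)) z - ?T (s (\<sigma> l)) z) < e"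
      unfolding d_def Tdiff by simp
    show ?thesis by (rule exI[of _ \<sigma>]) (rule conjI[OF \<sigma>(1) c])
  qed
  note cauchy = this
  show ?thesis unfolding H2_compact_op_def
  proof (intro conjI ballI allI impI)
    fix s :: "nat \<Rightarrow> complex \<Rightarrow> complex"
    assume "(\<forall>k. s k \<in> H2) \<and> (\<exists>B. \<forall>k. h2norm (s k) \<le> B)"
    then obtain B where "\<And>k. s k \<in> H2" "\<And>k. h2norm (s k) \<le> B" by auto
    then show "\<exists>r::nat\<Rightarrow>nat. strict_mono r \<and> (\<forall>e>0. \<exists>N. \<forall>k\<ge>N. \<forall>l\<ge>N. h2norm (\<lambda>z. ?T (s (r k)) z - ?T (s (r l)) z) < e)"
      by (rule cauchy)
  qed (rule K(2))
qed

section \<open>Clark measures\<close>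

text \<open>The double successor starts the sequence at 1/2 and so keeps all radii positive. A fixed
  sequence of radii suffices for Fatou's lemma and dominated convergence.\<close>

definition rad :: "nat \<Rightarrow> real" where
  "rad n = 1 - inverse (real (Suc (Suc n)))"

lemma rad: "0 < rad n" "0 \<le> rad n" "rad n < 1"
  by (auto simp: rad_def field_simps)

lemma rad_tendsto: "rad \<longlonglongrightarrow> 1"
  unfolding rad_def using tendsto_diff[OF tendsto_const LIMSEQ_Suc[OF LIMSEQ_inverse_real_of_nat], of 1] by simp

section \<open>The Herglotz representation\<close>

lemma herglotz_dilate:
  assumes g: "g holomorphic_on ball 0 1" and r: "0 < r" "r < 1" and z: "cmod z < 1"
  shows "(\<integral>\<theta>. (cis \<theta> + z) / (cis \<theta> - z) * of_real (Re (g (of_real r * cis \<theta>))) \<partial>circ) = g (of_real r * z) - \<i> * of_real (Im (g 0))"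
proof -
  have h: "(\<lambda>z. g (of_real r * z)) holomorphic_on ball 0 (1/r)"
    using r by (intro holomorphic_on_compose_gen[OF _ g, unfolded o_def] holomorphic_intros)
      (auto simp: norm_mult field_simps)
  have R: "1 < 1/r" using r by simp
  show ?thesis using circ_schwarz[OF h R z] by simp
qed

lemma AE_circ_range: "AE \<theta> in circ. \<theta> \<in> {0..2*pi}"
  unfolding circ_def by (rule AE_uniform_measureI) auto

lemma schwarz_kernel_bound:
  assumes "cmod \<xi> = 1" "cmod z < 1"
  shows "cmod ((\<xi> + z) / (\<xi> - z)) \<le> 2 / (1 - cmod z)"
  unfolding norm_divide using norm_circle_diff_ge[of \<xi> z] norm_triangle_ineq[of \<xi> z] assms
  by (intro frac_le) auto

text \<open>The densities Re g on circles of radius r, divided by Re g(0), define probability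
  measures on [0, 2 pi]. They are tight, a weak limit inherits the Schwarz formula because its
  kernel is bounded and continuous for fixed z, and the limit is finally pushed to the circle by
  \<open>cis\<close> and rescaled.\<close>

theorem herglotz:
  assumes g: "g holomorphic_on ball 0 1" and pos: "\<And>z. cmod z < 1 \<Longrightarrow> 0 < Re (g z)"
  shows "\<exists>M. sets M = sets borel \<and> finite_measure M \<and> emeasure M (- sphere 0 1) = 0 \<and>
     (\<forall>z. cmod z < 1 \<longrightarrow> g z = \<i> * of_real (Im (g 0)) + (\<integral>\<xi>. (\<xi> + z) / (\<xi> - z) \<partial>M))"
proof -
  define c where "c = Re (g 0)"
  have c: "c > 0" unfolding c_def by (rule pos) simp
  define u where "u = (\<lambda>n \<theta>. Re (g (of_real (rad n) * cis \<theta>)) / c)"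
  have upos: "0 \<le> u n \<theta>" for n \<theta>
    unfolding u_def using c rad[of n] by (intro divide_nonneg_pos less_imp_le[OF pos]) (auto simp: norm_mult)
  have [measurable]: "u n \<in> borel_measurable borel" for n
    using measurable_dilate[OF g rad(2,3)[of n]] unfolding u_def by measurable
  define \<mu> where "\<mu> = (\<lambda>n. density circ (\<lambda>\<theta>. ennreal (u n \<theta>)))"
  have sets_\<mu> [simp, measurable_cong]: "sets (\<mu> n) = sets borel" for n by (simp add: \<mu>_def)
  have int_\<mu>: "(\<integral>\<theta>. (cis \<theta> + z) / (cis \<theta> - z) \<partial>\<mu> n) = (g (of_real (rad n) * z) - \<i> * of_real (Im (g 0))) / of_real c"
    if "cmod z < 1" for z n
  proof -
    have "(\<integral>\<theta>. (cis \<theta> + z) / (cis \<theta> - z) \<partial>\<mu> n) = (\<integral>\<theta>. u n \<theta> *\<^sub>R ((cis \<theta> + z) / (cis \<theta> - z)) \<partial>circ)"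
      unfolding \<mu>_def using upos by (intro integral_density) auto
    also have "\<dots> = (\<integral>\<theta>. (cis \<theta> + z) / (cis \<theta> - z) * of_real (Re (g (of_real (rad n) * cis \<theta>))) / of_real c \<partial>circ)"
      by (intro Bochner_Integration.integral_cong) (auto simp: u_def scaleR_conv_of_real mult_ac)
    also have "\<dots> = (\<integral>\<theta>. (cis \<theta> + z) / (cis \<theta> - z) * of_real (Re (g (of_real (rad n) * cis \<theta>))) \<partial>circ) / of_real c"
      by (rule integral_divide_zero)
    finally show ?thesis by (simp only: herglotz_dilate[OF g rad(1,3) that])
  qed
  have iu: "integrable circ (u n)" for n
  proof -
    obtain B where B: "\<And>\<theta>. cmod (g (of_real (rad n) * cis \<theta>)) \<le> B" using bounded_dilate[OF g rad(2,3)[of n]] by blast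
    have "\<bar>u n \<theta>\<bar> \<le> B / c" for \<theta>
      unfolding u_def abs_divide using c order_trans[OF abs_Re_le_cmod B[of \<theta>]] by (intro frac_le) auto
    then show ?thesis by (intro integrable_circ_bounded) auto
  qed
  have prob_\<mu>: "prob_space (\<mu> n)" for n
  proof (rule prob_spaceI)
    have "of_real (\<integral>\<theta>. u n \<theta> \<partial>circ) = (\<integral>\<theta>. complex_of_real (u n \<theta>) \<partial>circ)" by (rule integral_complex_of_real[symmetric])
    also have "\<dots> = (\<integral>\<theta>. (cis \<theta> + 0) / (cis \<theta> - 0) \<partial>\<mu> n)"
      unfolding \<mu>_def using upos by (subst integral_density) (auto simp: scaleR_conv_of_real)
    also have "\<dots> = 1" using c by (subst int_\<mu>) (auto simp: c_def complex_eq_iff Re_divide_of_real Im_divide_of_real)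
    finally have 1: "(\<integral>\<theta>. u n \<theta> \<partial>circ) = 1" by (simp only: of_real_eq_1_iff)
    have "emeasure (\<mu> n) (space (\<mu> n)) = (\<integral>\<^sup>+\<theta>. ennreal (u n \<theta>) \<partial>circ)"
      by (simp add: \<mu>_def emeasure_density)
    also have "\<dots> = 1" using iu[of n] upos 1 by (subst nn_integral_eq_integral) auto
    finally show "emeasure (\<mu> n) (space (\<mu> n)) = 1" .
  qed
  have rd: "real_distribution (\<mu> n)" for n
    using prob_\<mu> by (intro real_distribution.intro real_distribution_axioms.intro) auto
  have "tight \<mu>" unfolding tight_def
  proof (intro conjI allI impI rd)
    fix \<epsilon> :: real assume "\<epsilon> > 0"
    \<comment> \<open>Tightness is phrased with intervals open on the left; the endpoint -1 keeps
      the angle 0 inside.\<close>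
    have "measure (\<mu> n) {-1<..2*pi} = 1" for n
    proof -
      interpret prob_space "\<mu> n" by (rule prob_\<mu>)
      have "AE \<theta> in \<mu> n. \<theta> \<in> {-1<..2*pi}"
        unfolding \<mu>_def using AE_circ_range by (subst AE_density) (auto elim!: AE_mp)
      then show ?thesis by (intro prob_eq_1[THEN iffD2]) auto
    qed
    then show "\<exists>a b. a < b \<and> (\<forall>n. 1 - \<epsilon> < measure (\<mu> n) {a<..b})"
      using \<open>\<epsilon> > 0\<close> by (intro exI[of _ "-1"] exI[of _ "2*pi"]) (auto intro: order.strict_trans2[of _ 0])
  qed
  from tight_imp_convergent_subsubsequence[OF this strict_mono_id]
  obtain s \<nu> where s: "strict_mono (s :: nat \<Rightarrow> nat)" and \<nu>: "real_distribution \<nu>" "weak_conv_m (\<lambda>n. \<mu> (s n)) \<nu>"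
    by (auto simp: o_def)
  interpret \<nu>: real_distribution \<nu> by (rule \<nu>(1))
  have int_\<nu>: "(\<integral>\<theta>. (cis \<theta> + z) / (cis \<theta> - z) \<partial>\<nu>) = (g z - \<i> * of_real (Im (g 0))) / of_real c" if z: "cmod z < 1" for z
  proof (rule LIMSEQ_unique)
    show "(\<lambda>n. \<integral>\<theta>. (cis \<theta> + z) / (cis \<theta> - z) \<partial>\<mu> (s n)) \<longlonglongrightarrow> (\<integral>\<theta>. (cis \<theta> + z) / (cis \<theta> - z) \<partial>\<nu>)"
    proof (rule weak_conv_imp_integral_bdd_continuous_conv[OF rd \<nu>])
      show "isCont (\<lambda>\<theta>. (cis \<theta> + z) / (cis \<theta> - z)) x" for x
      proof -
        have "continuous_on UNIV (\<lambda>\<theta>. (cis \<theta> + z) / (cis \<theta> - z))" using z by (intro continuous_intros) auto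
        then show ?thesis by (simp add: continuous_on_eq_continuous_at)
      qed
      show "norm ((cis x + z) / (cis x - z)) \<le> 2 / (1 - cmod z)" for x
        using z by (intro schwarz_kernel_bound) auto
    qed
    have "isCont g z" using holomorphic_on_imp_continuous_on[OF g] z by (simp add: continuous_on_eq_continuous_at)
    moreover have "(\<lambda>n. of_real (rad (s n)) * z) \<longlonglongrightarrow> of_real 1 * z"
      using LIMSEQ_subseq_LIMSEQ[OF rad_tendsto s] by (intro tendsto_intros) (simp add: o_def)
    ultimately have "(\<lambda>n. g (of_real (rad (s n)) * z)) \<longlonglongrightarrow> g z"
      by (intro isCont_tendsto_compose[of z g]) auto
    then show "(\<lambda>n. \<integral>\<theta>. (cis \<theta> + z) / (cis \<theta> - z) \<partial>\<mu> (s n)) \<longlonglongrightarrow> (g z - \<i> * of_real (Im (g 0))) / of_real c"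
      unfolding int_\<mu>[OF z] by (intro tendsto_intros) (use c in auto)
  qed
  define M where "M = density (distr \<nu> borel cis) (\<lambda>_. ennreal c)"
  have [measurable]: "cis \<in> measurable \<nu> borel" by measurable
  show ?thesis
  proof (intro exI[of _ M] conjI allI impI)
    show "sets M = sets borel" by (simp add: M_def)
    show "finite_measure M"
      by (rule finite_measureI) (auto simp: M_def emeasure_density emeasure_distr \<nu>.emeasure_space_1[simplified] ennreal_mult_eq_top_iff)
    have "emeasure M (- sphere 0 1) = (\<integral>\<^sup>+\<xi>. ennreal c * indicator (- sphere 0 1) \<xi> \<partial>distr \<nu> borel cis)"
      unfolding M_def by (rule emeasure_density) auto
    also have "\<dots> = (\<integral>\<^sup>+\<theta>. 0 \<partial>\<nu>)" by (subst nn_integral_distr) auto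
    finally show "emeasure M (- sphere 0 1) = 0" by simp
    fix z assume z: "cmod z < 1"
    have "(\<integral>\<xi>. (\<xi> + z) / (\<xi> - z) \<partial>M) = (\<integral>\<xi>. c *\<^sub>R ((\<xi> + z) / (\<xi> - z)) \<partial>distr \<nu> borel cis)"
      unfolding M_def using c by (intro integral_density) auto
    also have "\<dots> = (\<integral>\<theta>. c *\<^sub>R ((cis \<theta> + z) / (cis \<theta> - z)) \<partial>\<nu>)" by (rule integral_distr) auto
    also have "\<dots> = of_real c * (\<integral>\<theta>. (cis \<theta> + z) / (cis \<theta> - z) \<partial>\<nu>)" by (simp only: scaleR_conv_of_real integral_mult_right_zero)
    finally show "g z = \<i> * of_real (Im (g 0)) + (\<integral>\<xi>. (\<xi> + z) / (\<xi> - z) \<partial>M)"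
      using c by (simp add: int_\<nu>[OF z])
  qed
qed

text \<open>A Clark measure only determines a real part. Limits of difference quotients at atoms
  need the complex formula, whose imaginary constant is recorded here.\<close>

definition clark_herglotz :: "(complex \<Rightarrow> complex) \<Rightarrow> complex \<Rightarrow> complex measure \<Rightarrow> bool" where
  "clark_herglotz \<phi> \<alpha> M \<longleftrightarrow> clark_measure \<phi> \<alpha> M \<and>
     (\<exists>c. \<forall>z. cmod z < 1 \<longrightarrow> (\<alpha> + \<phi> z) / (\<alpha> - \<phi> z) = \<i> * of_real c + (\<integral>\<xi>. (\<xi> + z) / (\<xi> - z) \<partial>M))"

section \<open>Atoms of Clark measures and angular derivatives\<close>

lemma AE_sphere:
  assumes "sets M = sets borel" "emeasure M (- sphere 0 1) = 0"
  shows "AE \<xi> in M. cmod \<xi> = 1"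
proof (rule AE_I)
  show "{x \<in> space M. \<not> cmod x = 1} \<subseteq> - sphere 0 1" by auto
qed (use assms in auto)

lemma integrable_schwarz_kernel:
  assumes "sets M = sets borel" "finite_measure M" "emeasure M (- sphere 0 1) = 0" "cmod z < 1"
  shows "integrable M (\<lambda>\<xi>. (\<xi> + z) / (\<xi> - z))"
proof (rule finite_measure.integrable_const_bound[OF assms(2), where B = "2 / (1 - cmod z)"])
  show "AE \<xi> in M. cmod ((\<xi> + z) / (\<xi> - z)) \<le> 2 / (1 - cmod z)"
    using AE_sphere[OF assms(1,3)] schwarz_kernel_bound[OF _ assms(4)] by (auto elim!: AE_mp)
  note [measurable_cong] = assms(1)
  show "(\<lambda>\<xi>. (\<xi> + z) / (\<xi> - z)) \<in> borel_measurable M" by measurable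
qed

lemma self_map_kernel_holomorphic:
  assumes \<phi>: "self_map \<phi>" and \<alpha>: "cmod \<alpha> = 1"
  shows "(\<lambda>z. (\<alpha> + \<phi> z) / (\<alpha> - \<phi> z)) holomorphic_on ball 0 1"
  using self_map_holomorphic[OF \<phi>] by (intro holomorphic_intros self_map_denominator[OF \<alpha>] self_map_norm[OF \<phi>]) auto

lemma poisson_self_map_Re:
  assumes \<phi>: "self_map \<phi>" and \<alpha>: "cmod \<alpha> = 1" and z: "cmod z < 1"
  shows "Re ((\<alpha> + \<phi> z) / (\<alpha> - \<phi> z)) = poisson (\<phi> z) \<alpha>"
  using self_map_norm[OF \<phi> z] \<alpha> by (subst poisson_eq_Re) auto

lemma clark_herglotz_exists:
  assumes \<phi>: "self_map \<phi>" and \<alpha>: "cmod \<alpha> = 1"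
  shows "\<exists>M. clark_herglotz \<phi> \<alpha> M"
proof -
  obtain M where M: "sets M = sets borel" "finite_measure M" "emeasure M (- sphere 0 1) = 0"
    and H: "\<And>z. cmod z < 1 \<Longrightarrow> (\<alpha> + \<phi> z) / (\<alpha> - \<phi> z) = \<i> * of_real (Im ((\<alpha> + \<phi> 0) / (\<alpha> - \<phi> 0))) + (\<integral>\<xi>. (\<xi> + z) / (\<xi> - z) \<partial>M)"
    using herglotz[OF self_map_kernel_holomorphic[OF assms]] poisson_pos[OF self_map_norm[OF \<phi>] \<alpha>] poisson_self_map_Re[OF assms]
    by auto
  have "Re ((\<alpha> + \<phi> z) / (\<alpha> - \<phi> z)) = (\<integral>\<xi>. (1 - (cmod z)\<^sup>2) / (cmod (\<xi> - z))\<^sup>2 \<partial>M)" if z: "cmod z < 1" for z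
  proof -
    have "Re ((\<alpha> + \<phi> z) / (\<alpha> - \<phi> z)) = Re (\<integral>\<xi>. (\<xi> + z) / (\<xi> - z) \<partial>M)" by (subst H[OF z]) simp
    also have "\<dots> = (\<integral>\<xi>. Re ((\<xi> + z) / (\<xi> - z)) \<partial>M)" by (rule integral_Re[OF integrable_schwarz_kernel[OF M z], symmetric])
    also have "\<dots> = (\<integral>\<xi>. (1 - (cmod z)\<^sup>2) / (cmod (\<xi> - z))\<^sup>2 \<partial>M)"
    proof (rule integral_cong_AE)
      note [measurable_cong] = M(1)
      show "(\<lambda>\<xi>. Re ((\<xi> + z) / (\<xi> - z))) \<in> borel_measurable M" "(\<lambda>\<xi>. (1 - (cmod z)\<^sup>2) / (cmod (\<xi> - z))\<^sup>2) \<in> borel_measurable M"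
        by measurable
      have "Re ((\<xi> + z) / (\<xi> - z)) = (1 - (cmod z)\<^sup>2) / (cmod (\<xi> - z))\<^sup>2" if "cmod \<xi> = 1" for \<xi>
      proof -
        have "\<xi> \<noteq> z" using z that by auto
        then show ?thesis using poisson_eq_Re[OF that, of z] by (simp add: poisson_def)
      qed
      then show "AE \<xi> in M. Re ((\<xi> + z) / (\<xi> - z)) = (1 - (cmod z)\<^sup>2) / (cmod (\<xi> - z))\<^sup>2"
        using AE_sphere[OF M(1,3)] by (auto elim!: AE_mp)
    qed
    finally show ?thesis .
  qed
  then have 1: "clark_measure \<phi> \<alpha> M" unfolding clark_measure_def using M by simp
  have 2: "\<exists>c. \<forall>z. cmod z < 1 \<longrightarrow> (\<alpha> + \<phi> z) / (\<alpha> - \<phi> z) = \<i> * of_real c + (\<integral>\<xi>. (\<xi> + z) / (\<xi> - z) \<partial>M)"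
    by (rule exI) (intro allI impI, rule H)
  show ?thesis unfolding clark_herglotz_def by (rule exI) (rule conjI[OF 1 2])
qed

text \<open>Multiplied by \<zeta> - z, the Schwarz kernel is at most 2 K when |z - zeta| <= K (1 -
  |z|), tends to 2 zeta at the point \<zeta> and to 0 elsewhere; dominated convergence leaves the
  atom.\<close>

lemma atom_limit:
  assumes M: "sets M = sets borel" "finite_measure M" "emeasure M (- sphere 0 1) = 0"
    and \<zeta>: "cmod \<zeta> = 1" and z: "\<And>n. cmod (z n) < 1" "z \<longlonglongrightarrow> \<zeta>" "\<And>n. cmod (z n - \<zeta>) \<le> K * (1 - cmod (z n))"
  shows "(\<lambda>n. (\<zeta> - z n) * (\<integral>\<xi>. (\<xi> + z n) / (\<xi> - z n) \<partial>M)) \<longlonglongrightarrow> of_real (measure M {\<zeta>}) * (2 * \<zeta>)"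
proof -
  interpret finite_measure M by (rule M)
  note [measurable_cong] = M(1)
  have K: "0 \<le> K"
    using z(1)[of 0] order_trans[OF norm_ge_zero z(3)[of 0]] by (simp add: zero_le_mult_iff)
  have "(\<lambda>n. \<integral>\<xi>. (\<zeta> - z n) * ((\<xi> + z n) / (\<xi> - z n)) \<partial>M) \<longlonglongrightarrow> (\<integral>\<xi>. indicator {\<zeta>} \<xi> *\<^sub>R (2 * \<zeta>) \<partial>M)"
  proof (rule integral_dominated_convergence[where w = "\<lambda>_. 2 * K"])
    show "AE \<xi> in M. (\<lambda>n. (\<zeta> - z n) * ((\<xi> + z n) / (\<xi> - z n))) \<longlonglongrightarrow> indicator {\<zeta>} \<xi> *\<^sub>R (2 * \<zeta>)"
    proof (rule AE_I2)
      fix \<xi>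
      show "(\<lambda>n. (\<zeta> - z n) * ((\<xi> + z n) / (\<xi> - z n))) \<longlonglongrightarrow> indicator {\<zeta>} \<xi> *\<^sub>R (2 * \<zeta>)"
      proof (cases "\<xi> = \<zeta>")
        case True
        have "\<zeta> - z n \<noteq> 0" for n using z(1)[of n] \<zeta> by auto
        then have "(\<zeta> - z n) * ((\<xi> + z n) / (\<xi> - z n)) = \<zeta> + z n" for n using True by simp
        then show ?thesis using True z(2) by (auto intro!: tendsto_eq_intros)
      next
        case False
        then have "(\<lambda>n. (\<zeta> - z n) * ((\<xi> + z n) / (\<xi> - z n))) \<longlonglongrightarrow> (\<zeta> - \<zeta>) * ((\<xi> + \<zeta>) / (\<xi> - \<zeta>))"
          by (intro tendsto_intros z) auto
        then show ?thesis using False by simp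
      qed
    qed
    show "AE \<xi> in M. cmod ((\<zeta> - z n) * ((\<xi> + z n) / (\<xi> - z n))) \<le> 2 * K" for n
    proof -
      have "cmod ((\<zeta> - z n) * ((\<xi> + z n) / (\<xi> - z n))) \<le> 2 * K" if "cmod \<xi> = 1" for \<xi>
      proof -
        have "cmod ((\<zeta> - z n) * ((\<xi> + z n) / (\<xi> - z n))) \<le> (K * (1 - cmod (z n))) * (2 / (1 - cmod (z n)))"
          unfolding norm_mult[of "\<zeta> - z n"] using z(3)[of n] z(1)[of n] K
          by (intro mult_mono schwarz_kernel_bound that) (auto simp: norm_minus_commute)
        also have "\<dots> = 2 * K" using z(1)[of n] by simp
        finally show ?thesis .
      qed
      then show ?thesis using AE_sphere[OF M(1,3)] by (auto elim!: AE_mp)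
    qed
  qed auto
  also have "(\<integral>\<xi>. indicator {\<zeta>} \<xi> *\<^sub>R (2 * \<zeta>) \<partial>M) = of_real (measure M {\<zeta>}) * (2 * \<zeta>)"
    using M(1) sets_eq_imp_space_eq[OF M(1)] by (subst integral_scaleR_left) (auto simp: scaleR_conv_of_real less_top[symmetric])
  finally show ?thesis by (simp only: integral_mult_right_zero)
qed

text \<open>Adding 1 to (alpha + phi) / (alpha - phi) gives 2 alpha / (alpha - phi). By
  \<open>atom_limit\<close>, its product with \<zeta> - z has a nonzero limit in every Stolz region,
  and inverting this yields the limit of the difference quotient of \<open>\<phi>\<close>.\<close>

lemma atom_in_F_set:
  assumes \<phi>: "self_map \<phi>" and \<alpha>: "cmod \<alpha> = 1" and M: "clark_herglotz \<phi> \<alpha> M"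
    and \<zeta>: "cmod \<zeta> = 1" and atom: "measure M {\<zeta>} > 0"
  shows "\<zeta> \<in> F_set \<phi>"
proof -
  define g where "g = (\<lambda>z. (\<alpha> + \<phi> z) / (\<alpha> - \<phi> z))"
  obtain c where c: "\<And>z. cmod z < 1 \<Longrightarrow> g z = \<i> * of_real c + (\<integral>\<xi>. (\<xi> + z) / (\<xi> - z) \<partial>M)"
    using M unfolding clark_herglotz_def g_def by auto
  have M': "sets M = sets borel" "finite_measure M" "emeasure M (- sphere 0 1) = 0"
    using M unfolding clark_herglotz_def clark_measure_def by auto
  define m where "m = complex_of_real (measure M {\<zeta>}) * (2 * \<zeta>)"
  have m: "m \<noteq> 0" using atom \<zeta> by (auto simp: m_def)
  have seq: "(\<lambda>n. (\<phi> (z n) - \<alpha>) / (z n - \<zeta>)) \<longlonglongrightarrow> 2 * \<alpha> / m"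
    if z: "\<And>n. cmod (z n) < 1" "z \<longlonglongrightarrow> \<zeta>" "\<And>n. cmod (z n - \<zeta>) \<le> K * (1 - cmod (z n))" for z K
  proof -
    have "(\<lambda>n. (\<zeta> - z n) * (\<i> * of_real c + 1) + (\<zeta> - z n) * (\<integral>\<xi>. (\<xi> + z n) / (\<xi> - z n) \<partial>M)) \<longlonglongrightarrow> (\<zeta> - \<zeta>) * (\<i> * of_real c + 1) + m"
      unfolding m_def by (intro tendsto_add atom_limit[OF M' \<zeta> z] tendsto_mult tendsto_diff z(2) tendsto_const)
    then have "(\<lambda>n. 2 * \<alpha> / ((\<zeta> - z n) * (\<i> * of_real c + 1) + (\<zeta> - z n) * (\<integral>\<xi>. (\<xi> + z n) / (\<xi> - z n) \<partial>M))) \<longlonglongrightarrow> 2 * \<alpha> / ((\<zeta> - \<zeta>) * (\<i> * of_real c + 1) + m)"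
      using m by (intro tendsto_divide tendsto_const) auto
    moreover have "2 * \<alpha> / ((\<zeta> - z n) * (\<i> * of_real c + 1) + (\<zeta> - z n) * (\<integral>\<xi>. (\<xi> + z n) / (\<xi> - z n) \<partial>M)) = (\<phi> (z n) - \<alpha>) / (z n - \<zeta>)" for n
    proof -
      have "(\<zeta> - z n) * (\<i> * of_real c + 1) + (\<zeta> - z n) * (\<integral>\<xi>. (\<xi> + z n) / (\<xi> - z n) \<partial>M) = (\<zeta> - z n) * (g (z n) + 1)"
        using c[OF z(1)[of n]] by (simp add: algebra_simps)
      also have "\<dots> = (\<zeta> - z n) * (2 * \<alpha> / (\<alpha> - \<phi> (z n)))"
        using self_map_denominator[OF \<alpha> self_map_norm[OF \<phi> z(1)[of n]]] by (simp add: g_def field_simps)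
      finally have e: "(\<zeta> - z n) * (\<i> * of_real c + 1) + (\<zeta> - z n) * (\<integral>\<xi>. (\<xi> + z n) / (\<xi> - z n) \<partial>M) = (\<zeta> - z n) * (2 * \<alpha> / (\<alpha> - \<phi> (z n)))" .
      have "2 * a / (x * (2 * a / y)) = (- y) / (- x)" if "a \<noteq> 0" "x \<noteq> 0" "y \<noteq> 0" for a x y :: complex
        using that by simp
      from this[of \<alpha> "\<zeta> - z n" "\<alpha> - \<phi> (z n)"] show ?thesis unfolding e
        using self_map_denominator[OF \<alpha> self_map_norm[OF \<phi> z(1)[of n]]] self_map_denominator[OF \<zeta> z(1)[of n]] \<alpha>
        by auto
    qed
    ultimately show ?thesis by simp
  qed
  have d: "angular_lim (\<lambda>z. (\<phi> z - \<alpha>) / (z - \<zeta>)) \<zeta> (2 * \<alpha> / m)"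
    unfolding angular_lim_def tendsto_at_iff_sequentially o_def
  proof (intro allI impI)
    fix K :: real and z assume "\<forall>i. z i \<in> stolz \<zeta> K - {\<zeta>}" "z \<longlonglongrightarrow> \<zeta>"
    then show "(\<lambda>n. (\<phi> (z n) - \<alpha>) / (z n - \<zeta>)) \<longlonglongrightarrow> 2 * \<alpha> / m"
      by (intro seq[of z K]) (auto simp: stolz_def intro: less_imp_le)
  qed
  have "angular_lim \<phi> \<zeta> \<alpha>" unfolding angular_lim_def
  proof (intro allI impI)
    fix K :: real assume "K > 1"
    then have "((\<lambda>z. \<alpha> + (z - \<zeta>) * ((\<phi> z - \<alpha>) / (z - \<zeta>))) \<longlongrightarrow> \<alpha> + (\<zeta> - \<zeta>) * (2 * \<alpha> / m)) (at \<zeta> within stolz \<zeta> K)"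
      using d unfolding angular_lim_def by (intro tendsto_add tendsto_mult tendsto_diff tendsto_const tendsto_ident_at) auto
    then have "((\<lambda>z. \<alpha> + (z - \<zeta>) * ((\<phi> z - \<alpha>) / (z - \<zeta>))) \<longlongrightarrow> \<alpha>) (at \<zeta> within stolz \<zeta> K)" by simp
    then show "(\<phi> \<longlongrightarrow> \<alpha>) (at \<zeta> within stolz \<zeta> K)"
      by (rule Lim_transform_eventually) (auto simp: eventually_at_filter)
  qed
  with d \<zeta> \<alpha> show ?thesis unfolding F_set_def by blast
qed

text \<open>Harnack applied to the positive function Re (1 - cnj beta phi), where the unimodular
  \<open>\<beta>\<close> rotates the value of \<open>\<phi>\<close> at \<open>z\<close> onto the
  nonnegative axis.\<close>

lemma self_map_boundary_growth:
  assumes \<phi>: "self_map \<phi>" and z: "cmod z < 1"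
  shows "(1 - cmod (\<phi> 0)) / 2 * (1 - cmod z) \<le> 1 - cmod (\<phi> z)"
proof -
  define \<beta> where "\<beta> = (if \<phi> z = 0 then 1 else \<phi> z / of_real (cmod (\<phi> z)))"
  have \<beta>: "cmod \<beta> = 1" by (simp add: \<beta>_def norm_divide)
  have bz: "cnj \<beta> * \<phi> z = of_real (cmod (\<phi> z))"
  proof (cases "\<phi> z = 0")
    case False
    have "\<phi> z * cnj (\<phi> z) = of_real (cmod (\<phi> z)) * of_real (cmod (\<phi> z))"
      unfolding complex_norm_square[symmetric] by (simp add: power2_eq_square)
    then show ?thesis using False by (simp add: \<beta>_def field_simps)
  qed simp
  have le: "Re (cnj \<beta> * w) \<le> cmod w" for w
    using complex_Re_le_cmod[of "cnj \<beta> * w"] \<beta> by (simp add: norm_mult)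
  have "(1 - cmod z) / 2 * Re (1 - cnj \<beta> * \<phi> 0) \<le> Re (1 - cnj \<beta> * \<phi> z)"
  proof (rule circ_harnack[OF _ _ z])
    show "(\<lambda>z. 1 - cnj \<beta> * \<phi> z) holomorphic_on ball 0 1"
      using self_map_holomorphic[OF \<phi>] by (intro holomorphic_intros)
    show "0 \<le> Re (1 - cnj \<beta> * \<phi> w)" if "cmod w < 1" for w
      using le[of "\<phi> w"] self_map_norm[OF \<phi> that] by simp
  qed
  moreover have "(1 - cmod z) / 2 * (1 - cmod (\<phi> 0)) \<le> (1 - cmod z) / 2 * Re (1 - cnj \<beta> * \<phi> 0)"
    using le[of "\<phi> 0"] z by (intro mult_left_mono) auto
  ultimately show ?thesis by (simp add: bz mult_ac)
qed

text \<open>Without an atom, (zeta - z) (omega + phi) / (omega - phi) tends to 0 along the radius.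
  But a finite derivative gives |omega - phi| <= K (1 - r), and
  \<open>self_map_boundary_growth\<close> gives 1 - |phi| >= a (1 - r), so the modulus of this
  product stays above a / K^2.\<close>

lemma F_set_atom:
  assumes \<phi>: "self_map \<phi>" and \<zeta>: "\<zeta> \<in> F_set \<phi>"
  shows "\<exists>\<omega> M. cmod \<omega> = 1 \<and> clark_herglotz \<phi> \<omega> M \<and> measure M {\<zeta>} > 0"
proof -
  obtain \<omega> d where z1: "cmod \<zeta> = 1" and w1: "cmod \<omega> = 1" and d: "angular_lim (\<lambda>z. (\<phi> z - \<omega>) / (z - \<zeta>)) \<zeta> d"
    using \<zeta> unfolding F_set_def by auto
  obtain M where M: "clark_herglotz \<phi> \<omega> M" using clark_herglotz_exists[OF \<phi> w1] by blast
  then have M': "sets M = sets borel" "finite_measure M" "emeasure M (- sphere 0 1) = 0"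
    unfolding clark_herglotz_def clark_measure_def by auto
  obtain c where c: "\<And>z. cmod z < 1 \<Longrightarrow> (\<omega> + \<phi> z) / (\<omega> - \<phi> z) = \<i> * of_real c + (\<integral>\<xi>. (\<xi> + z) / (\<xi> - z) \<partial>M)"
    using M unfolding clark_herglotz_def by auto
  have "measure M {\<zeta>} \<noteq> 0"
  proof
    assume 0: "measure M {\<zeta>} = 0"
    define z where "z = (\<lambda>n. of_real (rad n) * \<zeta>)"
    have zn: "cmod (z n) = rad n" for n using z1 rad(2)[of n] by (simp add: z_def norm_mult)
    have zz: "z n - \<zeta> = - of_real (1 - rad n) * \<zeta>" for n by (simp add: z_def algebra_simps)
    have dist: "cmod (z n - \<zeta>) = 1 - rad n" for n
      unfolding zz norm_mult norm_minus_cancel norm_of_real using rad(3)[of n] z1 by simp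
    have lim: "z \<longlonglongrightarrow> \<zeta>" unfolding z_def using tendsto_mult[OF tendsto_of_real[OF rad_tendsto] tendsto_const, of \<zeta>] by simp
    have "(\<lambda>n. (\<zeta> - z n) * (\<i> * of_real c) + (\<zeta> - z n) * (\<integral>\<xi>. (\<xi> + z n) / (\<xi> - z n) \<partial>M)) \<longlonglongrightarrow> (\<zeta> - \<zeta>) * (\<i> * of_real c) + of_real (measure M {\<zeta>}) * (2 * \<zeta>)"
      by (intro tendsto_add atom_limit[OF M' z1, where K = 1] tendsto_mult tendsto_diff lim tendsto_const) (use rad in \<open>auto simp: zn dist\<close>)
    moreover have "(\<zeta> - z n) * (\<i> * of_real c) + (\<zeta> - z n) * (\<integral>\<xi>. (\<xi> + z n) / (\<xi> - z n) \<partial>M) = (\<zeta> - z n) * ((\<omega> + \<phi> (z n)) / (\<omega> - \<phi> (z n)))" for n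
      using c[of "z n"] rad(3)[of n] by (simp add: zn algebra_simps)
    ultimately have L: "(\<lambda>n. (\<zeta> - z n) * ((\<omega> + \<phi> (z n)) / (\<omega> - \<phi> (z n)))) \<longlonglongrightarrow> 0" using 0 by simp
    have "(\<lambda>n. (\<phi> (z n) - \<omega>) / (z n - \<zeta>)) \<longlonglongrightarrow> d"
    proof -
      have "((\<lambda>z. (\<phi> z - \<omega>) / (z - \<zeta>)) \<longlongrightarrow> d) (at \<zeta> within stolz \<zeta> 2)" using d unfolding angular_lim_def by auto
      moreover have "\<forall>i. z i \<in> stolz \<zeta> 2 - {\<zeta>}" using rad(3) zn dist z1 by (auto simp: stolz_def)
      ultimately show ?thesis using lim unfolding tendsto_at_iff_sequentially o_def by blast
    qed
    then have "Bseq (\<lambda>n. (\<phi> (z n) - \<omega>) / (z n - \<zeta>))" by (intro convergent_imp_Bseq convergentI)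
    then obtain K where K: "K > 0" "\<And>n. cmod ((\<phi> (z n) - \<omega>) / (z n - \<zeta>)) \<le> K" by (auto elim: BseqE)
    define a where "a = (1 - cmod (\<phi> 0)) / 2"
    have a: "a > 0" using self_map_norm[OF \<phi>, of 0] by (simp add: a_def)
    have "a / K\<^sup>2 \<le> cmod ((\<zeta> - z n) * ((\<omega> + \<phi> (z n)) / (\<omega> - \<phi> (z n))))" for n
    proof -
      have r: "0 < 1 - rad n" using rad[of n] by simp
      have zl: "cmod (z n) < 1" using rad(3) zn by simp
      have K': "cmod (\<omega> - \<phi> (z n)) \<le> K * (1 - rad n)"
        using K(2)[of n] unfolding norm_divide dist pos_divide_le_eq[OF r] by (simp only: norm_minus_commute)
      have nz: "0 < cmod (\<omega> - \<phi> (z n))" using self_map_denominator[OF w1 self_map_norm[OF \<phi> zl]] by simp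
      have "a * (1 - rad n) \<le> 1 - cmod (\<phi> (z n))" using self_map_boundary_growth[OF \<phi> zl] by (simp add: a_def zn)
      also have "\<dots> \<le> 1 - (cmod (\<phi> (z n)))\<^sup>2"
        using self_map_norm[OF \<phi> zl] by (simp add: power2_eq_square mult_left_le)
      finally have "a * (1 - rad n) / (K * (1 - rad n))\<^sup>2 \<le> poisson (\<phi> (z n)) \<omega>"
        unfolding poisson_def using K' nz a r power_le_one[of "cmod (\<phi> (z n))" 2] self_map_norm[OF \<phi> zl]
        by (intro frac_le power_mono) auto
      also have "\<dots> = Re ((\<omega> + \<phi> (z n)) / (\<omega> - \<phi> (z n)))" by (rule poisson_self_map_Re[OF \<phi> w1 zl, symmetric])
      also have "\<dots> \<le> cmod ((\<omega> + \<phi> (z n)) / (\<omega> - \<phi> (z n)))" by (rule complex_Re_le_cmod)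
      finally have "(1 - rad n) * (a * (1 - rad n) / (K * (1 - rad n))\<^sup>2) \<le> (1 - rad n) * cmod ((\<omega> + \<phi> (z n)) / (\<omega> - \<phi> (z n)))"
        using r by (intro mult_left_mono) auto
      also have "(1 - rad n) * (a * (1 - rad n) / (K * (1 - rad n))\<^sup>2) = a / K\<^sup>2"
        using r K(1) by (simp add: power2_eq_square)
      also have "(1 - rad n) * cmod ((\<omega> + \<phi> (z n)) / (\<omega> - \<phi> (z n))) = cmod ((\<zeta> - z n) * ((\<omega> + \<phi> (z n)) / (\<omega> - \<phi> (z n))))"
        unfolding norm_mult[of "\<zeta> - z n"] dist[symmetric] by (simp only: norm_minus_commute)
      finally show ?thesis .
    qed
    then have "a / K\<^sup>2 \<le> 0"
      by (intro LIMSEQ_le_const[OF tendsto_norm_zero[OF L]]) auto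
    moreover have "a / K\<^sup>2 > 0" using a K by simp
    ultimately show False by simp
  qed
  then show ?thesis using M w1 by (auto simp: less_le)
qed

section \<open>Arc-null sets and singular supports\<close>

lemma arc_null_UN: "(\<And>n::nat. arc_null (A n)) \<Longrightarrow> arc_null (\<Union>n. A n)"
  unfolding arc_null_def vimage_UN by (rule null_sets_UN') auto

lemma arc_null_Un: "arc_null A \<Longrightarrow> arc_null B \<Longrightarrow> arc_null (A \<union> B)"
  unfolding arc_null_def vimage_Un by auto

lemma arc_null_singleton: "arc_null {\<zeta>}"
proof -
  have "countable (cis -` {\<zeta>})"
  proof (cases "cis -` {\<zeta>} = {}")
    case False
    then obtain \<theta>0 where \<theta>0: "cis \<theta>0 = \<zeta>" by auto
    have "cis -` {\<zeta>} \<subseteq> range (\<lambda>k::int. \<theta>0 + of_int k * 2 * pi)"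
    proof
      fix \<theta> assume "\<theta> \<in> cis -` {\<zeta>}"
      then have "cis (\<theta> - \<theta>0) = 1" using \<theta>0 cis_neq_zero[of \<theta>0] by (auto simp: cis_divide[symmetric])
      then have "cos (\<theta> - \<theta>0) = 1" by (simp add: complex_eq_iff)
      then obtain k :: int where "\<theta> - \<theta>0 = of_int k * 2 * pi" using cos_one_2pi_int by blast
      then have "\<theta> = \<theta>0 + of_int k * 2 * pi" by simp
      then show "\<theta> \<in> range (\<lambda>k::int. \<theta>0 + of_int k * 2 * pi)" by blast
    qed
    then show ?thesis by (rule countable_subset) simp
  qed simp
  then show ?thesis unfolding arc_null_def by (rule countable_imp_null_set_lborel)
qed

text \<open>By periodicity the full preimage under \<open>cis\<close> is covered by countably many
  translates of its part in one period.\<close>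

lemma circ_null_imp_arc_null:
  assumes A: "A \<in> sets borel" and 0: "emeasure circ (cis -` A) = 0"
  shows "arc_null A"
proof -
  define S where "S = {0..2*pi} \<inter> cis -` A"
  have m: "cis -` A \<in> sets borel" using measurable_sets[OF measurable_cis A] by simp
  have "emeasure lborel S / emeasure lborel {0..2*pi} = 0"
    using 0 m unfolding circ_def S_def by (subst (asm) emeasure_uniform_measure) auto
  then have "emeasure lborel S = 0" by (simp add: ennreal_divide_eq_0_iff)
  then have S: "S \<in> null_sets lborel" using m by (auto simp: S_def null_sets_def)
  have "cis -` A \<subseteq> (\<Union>k::int. {x. x - of_int k * (2*pi) \<in> S})"
  proof
    fix x assume x: "x \<in> cis -` A"
    define k where "k = \<lfloor>x / (2*pi)\<rfloor>"
    have "of_int k \<le> x / (2*pi)" "x / (2*pi) < of_int k + 1" unfolding k_def by linarith+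
    then have "0 \<le> x - of_int k * (2*pi)" "x - of_int k * (2*pi) \<le> 2*pi"
      by (auto simp: field_simps)
    moreover have "cis (of_int k * (2*pi)) = 1"
      using sin_int_2pin[of k] cos_int_2pin[of k] by (simp add: complex_eq_iff mult.commute)
    then have "cis (x - of_int k * (2*pi)) = cis x" by (simp add: cis_divide[symmetric])
    ultimately have "x - of_int k * (2*pi) \<in> S" using x by (simp add: S_def)
    then show "x \<in> (\<Union>k::int. {x. x - of_int k * (2*pi) \<in> S})" by blast
  qed
  moreover have "(\<Union>k::int. {x. x - of_int k * (2*pi) \<in> S}) \<in> null_sets lborel"
    by (intro null_sets_UN' null_sets_translation S) auto
  ultimately show ?thesis unfolding arc_null_def using m by (auto intro: null_sets_subset)
qed

text \<open>Exhaustion: a countable union of arc-null sets attains the supremum of their measures.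
  It carries the singular part, as demanded of the witness in \<open>sing_supp\<close>.\<close>

lemma maximal_arc_null:
  assumes M: "sets M = sets borel" "finite_measure M"
  shows "\<exists>N \<in> sets borel. arc_null N \<and> (\<forall>A \<in> sets borel. arc_null A \<longrightarrow> emeasure M (A - N) = 0)"
proof -
  interpret finite_measure M by (rule M)
  define S where "S = {measure M A | A. A \<in> sets borel \<and> arc_null A}"
  have "arc_null {}" by (simp add: arc_null_def)
  then have ne: "S \<noteq> {}" unfolding S_def using sets.empty_sets by blast
  have bdd: "bdd_above S" unfolding S_def by (intro bdd_aboveI[of _ "measure M (space M)"]) (auto intro: bounded_measure)
  have "\<exists>A. A \<in> sets borel \<and> arc_null A \<and> Sup S - inverse (real (Suc n)) < measure M A" for n
  proof -
    have "Sup S - inverse (real (Suc n)) < Sup S" by simp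
    then show ?thesis using less_cSup_iff[OF ne bdd] unfolding S_def by blast
  qed
  then obtain A where A: "\<And>n. A n \<in> sets borel" "\<And>n. arc_null (A n)" "\<And>n. Sup S - inverse (real (Suc n)) < measure M (A n)"
    by metis
  define N where "N = (\<Union>n. A n)"
  have N: "N \<in> sets borel" "arc_null N" unfolding N_def using A arc_null_UN by auto
  have ge: "Sup S \<le> measure M N"
  proof (rule field_le_epsilon)
    fix e :: real assume "e > 0"
    then obtain n where n: "inverse (real (Suc n)) < e" using reals_Archimedean by blast
    have "measure M (A n) \<le> measure M N" using A N M by (intro finite_measure_mono) (auto simp: N_def)
    then show "Sup S \<le> measure M N + e" using A(3)[of n] n by linarith
  qed
  have "emeasure M (B - N) = 0" if B: "B \<in> sets borel" "arc_null B" for B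
  proof -
    have "measure M (N \<union> B) \<le> Sup S"
      using B N arc_null_Un by (intro cSup_upper bdd) (auto simp: S_def)
    moreover have "measure M (N \<union> (B - N)) = measure M N + measure M (B - N)"
      using B N M by (intro finite_measure_Union) auto
    ultimately have "measure M (B - N) \<le> 0" using ge by (simp add: Un_Diff_cancel)
    then show ?thesis by (simp add: emeasure_eq_measure measure_le_0_iff)
  qed
  then show ?thesis using N by blast
qed

lemma clark_herglotzD:
  assumes "clark_herglotz \<phi> \<alpha> M"
  shows "clark_measure \<phi> \<alpha> M" "sets M = sets borel" "finite_measure M" "emeasure M (- sphere 0 1) = 0"
  using assms unfolding clark_herglotz_def clark_measure_def by auto

lemma sing_supp_subset_E_set:
  assumes "cmod \<alpha> = 1" "clark_measure \<phi> \<alpha> M"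
  shows "sing_supp M \<subseteq> E_set \<phi>"
proof -
  have "sing_supp M \<subseteq> (\<Union>\<alpha>\<in>sphere 0 1. \<Union>{sing_supp M | M. clark_measure \<phi> \<alpha> M})"
    using assms by fastforce
  then show ?thesis unfolding E_set_def using closure_subset by blast
qed

text \<open>A contact point is an atom of some Clark measure. Single points are arc-null, so the
  atom lies in the carrier of the singular part and hence in its support. In particular
  \<open>F_set \<phi>\<close> is finite whenever \<open>E_set \<phi>\<close> is.\<close>

lemma F_set_subset_E_set:
  assumes \<phi>: "self_map \<phi>"
  shows "F_set \<phi> \<subseteq> E_set \<phi>"
proof
  fix \<zeta> assume "\<zeta> \<in> F_set \<phi>"
  then obtain \<omega> M where w: "cmod \<omega> = 1" and M: "clark_herglotz \<phi> \<omega> M" and atom: "measure M {\<zeta>} > 0"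
    using F_set_atom[OF \<phi>] by blast
  note MD = clark_herglotzD[OF M]
  interpret finite_measure M by (rule MD)
  obtain N where N: "N \<in> sets borel" "arc_null N" "\<And>A. A \<in> sets borel \<Longrightarrow> arc_null A \<Longrightarrow> emeasure M (A - N) = 0"
    using maximal_arc_null[OF MD(2,3)] by blast
  have "\<zeta> \<in> N"
  proof (rule ccontr)
    assume "\<zeta> \<notin> N"
    then have "emeasure M {\<zeta>} = 0" using N(3)[OF _ arc_null_singleton, of \<zeta>] by (simp add: insert_Diff_if)
    then show False using atom by (simp add: measure_def)
  qed
  have "emeasure M (ball \<zeta> e \<inter> N) > 0" if "e > 0" for e
  proof -
    have "0 < emeasure M {\<zeta>}" using atom by (simp add: emeasure_eq_measure)
    also have "\<dots> \<le> emeasure M (ball \<zeta> e \<inter> N)"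
      using \<open>\<zeta> \<in> N\<close> that MD(2) N(1) by (intro emeasure_mono) auto
    finally show ?thesis .
  qed
  then have "\<zeta> \<in> sing_supp M" unfolding sing_supp_def using N by blast
  then show "\<zeta> \<in> E_set \<phi>" using sing_supp_subset_E_set[OF w MD(1)] by blast
qed

text \<open>Outside the carrier \<open>N\<close> an arc-null set has measure 0. Points of
  \<open>N\<close> outside \<open>E_set \<phi>\<close> have neighbourhoods without singular mass.
  The remaining points of \<open>E_set \<phi>\<close> outside \<open>F_set \<phi>\<close> are
  finitely many; one on the circle could have mass only as an atom, and \<open>atom_in_F_set\<close>
  excludes that.\<close>

lemma clark_abs_cont_off_F_set:
  assumes \<phi>: "self_map \<phi>" and E: "finite (E_set \<phi>)" and \<alpha>: "cmod \<alpha> = 1" and M: "clark_herglotz \<phi> \<alpha> M"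
    and A: "A \<in> sets borel" "emeasure circ (cis -` A) = 0"
  shows "emeasure M (A - F_set \<phi>) = 0"
proof -
  note MD = clark_herglotzD[OF M]
  note sM [simp] = MD(2)
  interpret finite_measure M by (rule MD)
  have F: "F_set \<phi> \<in> sets borel"
    using finite_subset[OF F_set_subset_E_set[OF \<phi>] E] by (intro borel_closed finite_imp_closed)
  have Eb: "E_set \<phi> \<in> sets borel" using E by (intro borel_closed finite_imp_closed)
  obtain N where N: "N \<in> sets borel" "arc_null N" "\<And>A. A \<in> sets borel \<Longrightarrow> arc_null A \<Longrightarrow> emeasure M (A - N) = 0"
    using maximal_arc_null[OF MD(2,3)] by blast
  have 1: "A - N \<in> null_sets M" using N(3)[OF A(1) circ_null_imp_arc_null[OF A]] A N by (auto simp: null_sets_def)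
  have "\<exists>e>0. emeasure M (ball \<xi> e \<inter> N) = 0" if "\<xi> \<notin> E_set \<phi>" for \<xi>
  proof -
    have "\<xi> \<notin> sing_supp M" using that sing_supp_subset_E_set[OF \<alpha> MD(1)] by blast
    then show ?thesis unfolding sing_supp_def using N by (auto simp: zero_less_iff_neq_zero)
  qed
  then obtain e where e: "\<And>\<xi>. \<xi> \<notin> E_set \<phi> \<Longrightarrow> e \<xi> > 0" "\<And>\<xi>. \<xi> \<notin> E_set \<phi> \<Longrightarrow> emeasure M (ball \<xi> (e \<xi>) \<inter> N) = 0"
    by metis
  \<comment> \<open>The null neighbourhoods are uncountably many; Lindeloef's theorem reduces the
    cover to a countable one.\<close>
  have "\<And>S. S \<in> (\<lambda>\<xi>. ball \<xi> (e \<xi>)) ` (- E_set \<phi>) \<Longrightarrow> openin (top_of_set UNIV) S" by (auto simp: open_openin[symmetric])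
  then obtain \<F> where \<F>: "\<F> \<subseteq> (\<lambda>\<xi>. ball \<xi> (e \<xi>)) ` (- E_set \<phi>)" "countable \<F>" "\<Union>\<F> = \<Union>((\<lambda>\<xi>. ball \<xi> (e \<xi>)) ` (- E_set \<phi>))"
    using Lindelof_openin[of "(\<lambda>\<xi>. ball \<xi> (e \<xi>)) ` (- E_set \<phi>)" UNIV] by metis
  have "(\<Union>B\<in>\<F>. B \<inter> N) \<in> null_sets M"
  proof (rule null_sets_UN'[OF \<F>(2)])
    fix B assume "B \<in> \<F>"
    then obtain \<xi> where "\<xi> \<notin> E_set \<phi>" "B = ball \<xi> (e \<xi>)" using \<F>(1) by blast
    then show "B \<inter> N \<in> null_sets M" using e(2) N(1) by (auto simp: null_sets_def)
  qed
  moreover have "N - E_set \<phi> \<subseteq> (\<Union>B\<in>\<F>. B \<inter> N)"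
  proof
    fix \<xi> assume \<xi>: "\<xi> \<in> N - E_set \<phi>"
    then have "\<xi> \<in> \<Union>\<F>" unfolding \<F>(3) using e(1) by (auto intro!: bexI[of _ \<xi>])
    then show "\<xi> \<in> (\<Union>B\<in>\<F>. B \<inter> N)" using \<xi> by blast
  qed
  ultimately have 2: "N - E_set \<phi> \<in> null_sets M" using N(1) Eb by (auto intro: null_sets_subset)
  have 3: "(\<Union>\<zeta>\<in>E_set \<phi> - F_set \<phi>. {\<zeta>}) \<in> null_sets M"
  proof (rule null_sets_UN')
    show "countable (E_set \<phi> - F_set \<phi>)" using E by (simp add: countable_finite)
    fix \<zeta> assume \<zeta>: "\<zeta> \<in> E_set \<phi> - F_set \<phi>"
    show "{\<zeta>} \<in> null_sets M"
    proof (cases "cmod \<zeta> = 1")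
      case True
      then have "\<not> measure M {\<zeta>} > 0" using atom_in_F_set[OF \<phi> \<alpha> M] \<zeta> by blast
      then show ?thesis by (auto simp: null_sets_def emeasure_eq_measure measure_le_0_iff not_less)
    next
      case False
      then show ?thesis using MD(4) by (intro null_sets_subset[of "- sphere 0 1" M "{\<zeta>}"]) (auto simp: null_sets_def)
    qed
  qed
  have "(A - N) \<union> (N - E_set \<phi>) \<union> (\<Union>\<zeta>\<in>E_set \<phi> - F_set \<phi>. {\<zeta>}) \<in> null_sets M" using 1 2 3 by auto
  then have "A - F_set \<phi> \<in> null_sets M" using A F by (auto intro: null_sets_subset)
  then show ?thesis by auto
qed

section \<open>Boundary values and uniform decay away from the contact points\<close>

definition boundary_fun :: "(complex \<Rightarrow> complex) \<Rightarrow> (real \<Rightarrow> complex) \<Rightarrow> bool" where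
  "boundary_fun \<phi> b \<longleftrightarrow> b \<in> borel_measurable borel \<and> (AE \<theta> in circ. radial_lim \<phi> \<theta> (b \<theta>) \<and> cmod (b \<theta>) < 1)"

lemma AE_circI: "AE \<theta> in lborel. P \<theta> \<Longrightarrow> AE \<theta> in circ. P \<theta>"
  unfolding circ_def by (rule AE_uniform_measureI) auto

lemma filterlim_rad: "filterlim rad (at_left 1) sequentially"
  unfolding filterlim_at using rad rad_tendsto by (auto simp: less_imp_neq)

lemma radial_lim_seq: "radial_lim \<phi> \<theta> v \<Longrightarrow> (\<lambda>n. \<phi> (of_real (rad n) * cis \<theta>)) \<longlonglongrightarrow> v"
  unfolding radial_lim_def by (rule filterlim_compose[OF _ filterlim_rad])

lemma radial_lim_unique: "radial_lim \<phi> \<theta> v \<Longrightarrow> radial_lim \<phi> \<theta> w \<Longrightarrow> v = w"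
  using radial_lim_seq LIMSEQ_unique by blast

lemma boundary_fun_exists:
  assumes \<phi>: "self_map \<phi>" and AE: "AE \<theta> in lborel. \<exists>v. radial_lim \<phi> \<theta> v \<and> cmod v < 1"
  shows "\<exists>b. boundary_fun \<phi> b"
proof -
  define b where "b = (\<lambda>\<theta>. lim (\<lambda>n. \<phi> (of_real (rad n) * cis \<theta>)))"
  have "b \<in> borel_measurable borel" unfolding b_def
    by (rule borel_measurable_lim_metric) (rule measurable_dilate[OF self_map_holomorphic[OF \<phi>] rad(2,3)])
  moreover have "AE \<theta> in circ. radial_lim \<phi> \<theta> (b \<theta>) \<and> cmod (b \<theta>) < 1"
    using AE_circI[OF AE]
  proof (rule AE_mp, intro AE_I2 impI)
    fix \<theta> assume "\<exists>v. radial_lim \<phi> \<theta> v \<and> cmod v < 1"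
    then obtain v where v: "radial_lim \<phi> \<theta> v" "cmod v < 1" by blast
    then have "b \<theta> = v" unfolding b_def by (intro limI radial_lim_seq)
    then show "radial_lim \<phi> \<theta> (b \<theta>) \<and> cmod (b \<theta>) < 1" using v by simp
  qed
  ultimately show ?thesis unfolding boundary_fun_def by blast
qed

lemma tendsto_poisson:
  assumes "(f \<longlongrightarrow> w) F" "w \<noteq> \<alpha>"
  shows "((\<lambda>x. poisson (f x) \<alpha>) \<longlongrightarrow> poisson w \<alpha>) F"
  unfolding poisson_def using assms by (intro tendsto_intros) auto

lemma boundary_fun_AE_seq:
  assumes "boundary_fun \<phi> b"
  shows "AE \<theta> in circ. (\<lambda>n. \<phi> (of_real (rad n) * cis \<theta>)) \<longlonglongrightarrow> b \<theta> \<and> cmod (b \<theta>) < 1"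
  using assms radial_lim_seq unfolding boundary_fun_def by (auto elim!: AE_mp)

text \<open>Mass can be lost in the limit to the singular part of the Clark measure, so only an
  inequality holds for a general weight.\<close>

lemma boundary_fatou:
  assumes \<phi>: "self_map \<phi>" and b: "boundary_fun \<phi> b" and \<alpha>: "cmod \<alpha> = 1" and [measurable]: "\<chi>' \<in> borel_measurable borel"
  shows "(\<integral>\<^sup>+\<theta>. ennreal (\<chi>' (cis \<theta>) * poisson (b \<theta>) \<alpha>) \<partial>circ)
    \<le> liminf (\<lambda>n. \<integral>\<^sup>+\<theta>. ennreal (\<chi>' (cis \<theta>) * poisson (\<phi> (of_real (rad n) * cis \<theta>)) \<alpha>) \<partial>circ)"
proof -
  note [measurable] = measurable_dilate[OF self_map_holomorphic[OF \<phi>] rad(2,3)]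
  have "(\<integral>\<^sup>+\<theta>. ennreal (\<chi>' (cis \<theta>) * poisson (b \<theta>) \<alpha>) \<partial>circ)
    = (\<integral>\<^sup>+\<theta>. liminf (\<lambda>n. ennreal (\<chi>' (cis \<theta>) * poisson (\<phi> (of_real (rad n) * cis \<theta>)) \<alpha>)) \<partial>circ)"
  proof (rule nn_integral_cong_AE, rule AE_mp[OF boundary_fun_AE_seq[OF b]], intro AE_I2 impI)
    fix \<theta> assume \<theta>: "(\<lambda>n. \<phi> (of_real (rad n) * cis \<theta>)) \<longlonglongrightarrow> b \<theta> \<and> cmod (b \<theta>) < 1"
    then have "(\<lambda>n. ennreal (\<chi>' (cis \<theta>) * poisson (\<phi> (of_real (rad n) * cis \<theta>)) \<alpha>)) \<longlonglongrightarrow> ennreal (\<chi>' (cis \<theta>) * poisson (b \<theta>) \<alpha>)"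
      using \<alpha> by (intro tendsto_ennrealI tendsto_mult tendsto_const tendsto_poisson) auto
    from lim_imp_Liminf[OF _ this] show "ennreal (\<chi>' (cis \<theta>) * poisson (b \<theta>) \<alpha>) = liminf (\<lambda>n. ennreal (\<chi>' (cis \<theta>) * poisson (\<phi> (of_real (rad n) * cis \<theta>)) \<alpha>))"
      by simp
  qed
  also have "\<dots> \<le> liminf (\<lambda>n. \<integral>\<^sup>+\<theta>. ennreal (\<chi>' (cis \<theta>) * poisson (\<phi> (of_real (rad n) * cis \<theta>)) \<alpha>) \<partial>circ)"
    by (rule nn_integral_liminf) measurable
  finally show ?thesis .
qed

lemma boundary_poisson_le:
  assumes \<phi>: "self_map \<phi>" and b: "boundary_fun \<phi> b" and \<alpha>: "cmod \<alpha> = 1"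
  shows "(\<integral>\<^sup>+\<theta>. ennreal (poisson (b \<theta>) \<alpha>) \<partial>circ) \<le> ennreal (poisson (\<phi> 0) \<alpha>)"
  using boundary_fatou[OF \<phi> b \<alpha>, of "\<lambda>_. 1"] poisson_self_map_mean[OF \<phi> \<alpha> rad(2,3)] by (simp add: Liminf_const)

text \<open>On the circle the squared distance to \<eta> is the real part of 2 - 2 cnj eta z, so the
  Poisson formula evaluates its mean exactly.\<close>

lemma poisson_mean_dist:
  assumes \<eta>: "cmod \<eta> = 1" and r: "0 \<le> r" "r < 1"
  shows "(\<integral>\<theta>. poisson (of_real r * \<eta>) (cis \<theta>) * (cmod (cis \<theta> - \<eta>))\<^sup>2 \<partial>circ) = 2 * (1 - r)"
proof -
  have h: "(\<lambda>z. 2 - 2 * cnj \<eta> * z) holomorphic_on ball 0 2" by (intro holomorphic_intros)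
  have e: "Re (2 - 2 * cnj \<eta> * cis \<theta>) = (cmod (cis \<theta> - \<eta>))\<^sup>2" for \<theta>
  proof -
    have "(Re \<eta>)\<^sup>2 + (Im \<eta>)\<^sup>2 = 1" using \<eta> cmod_power2[of \<eta>] by simp
    moreover have "(cos \<theta>)\<^sup>2 + (sin \<theta>)\<^sup>2 = 1" by simp
    moreover have "(cmod (cis \<theta> - \<eta>))\<^sup>2 = ((cos \<theta>)\<^sup>2 + (sin \<theta>)\<^sup>2) + ((Re \<eta>)\<^sup>2 + (Im \<eta>)\<^sup>2) - 2 * (Re \<eta> * cos \<theta> + Im \<eta> * sin \<theta>)"
      unfolding cmod_power2 by (simp add: power2_eq_square algebra_simps)
    ultimately show ?thesis by simp
  qed
  have "\<eta> * cnj \<eta> = 1" using \<eta> by (simp add: complex_norm_square[symmetric])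
  then have c: "2 * cnj \<eta> * (of_real r * \<eta>) = of_real (2 * r)" by (simp add: mult_ac)
  have e2: "Re (2 - 2 * cnj \<eta> * (of_real r * \<eta>)) = 2 * (1 - r)" unfolding c by simp
  have "cmod (of_real r * \<eta>) < 1" using \<eta> r by (simp add: norm_mult)
  from circ_poisson_Re[OF h _ this] show ?thesis unfolding e e2 by simp
qed

text \<open>The weights that are later made to vanish at the contact points. The Lipschitz bound
  gives their Poisson averages an explicit rate of convergence, uniform on the circle.\<close>

locale circle_lipschitz =
  fixes \<chi>' :: "complex \<Rightarrow> real" and L B :: real
  assumes lip: "\<And>\<xi> \<eta>. cmod \<xi> = 1 \<Longrightarrow> cmod \<eta> = 1 \<Longrightarrow> \<bar>\<chi>' \<xi> - \<chi>' \<eta>\<bar> \<le> L * cmod (\<xi> - \<eta>)"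
    and nonneg: "\<And>\<xi>. 0 \<le> \<chi>' \<xi>" and bound: "\<And>\<xi>. cmod \<xi> = 1 \<Longrightarrow> \<chi>' \<xi> \<le> B" and L: "0 \<le> L"
    and meas [measurable]: "\<chi>' \<in> borel_measurable borel"
begin

lemma integrable_poisson:
  assumes "cmod w < 1"
  shows "integrable circ (\<lambda>\<theta>. poisson w (cis \<theta>) * \<chi>' (cis \<theta>))"
  using integrable_poisson_times[OF assms, of "\<lambda>\<theta>. \<chi>' (cis \<theta>)" B] bound nonneg by auto

text \<open>The mean squared distance is 2 (1 - r). The inequality x <= s/2 + x^2 / (2 s), with s
  the square root of 1 - r, converts it into a mean distance of order s; the sum 3/2 L s is rounded
  up to 2 L s.\<close>

lemma poisson_close:
  assumes \<eta>: "cmod \<eta> = 1" and r: "0 \<le> r" "r < 1"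
  shows "\<bar>(\<integral>\<theta>. poisson (of_real r * \<eta>) (cis \<theta>) * \<chi>' (cis \<theta>) \<partial>circ) - \<chi>' \<eta>\<bar> \<le> 2 * L * sqrt (1 - r)"
proof -
  define s where "s = sqrt (1 - r)"
  have s: "s > 0" "s\<^sup>2 = 1 - r" using r by (auto simp: s_def)
  have w: "cmod (of_real r * \<eta>) < 1" using \<eta> r by (simp add: norm_mult)
  let ?P = "\<lambda>\<theta>. poisson (of_real r * \<eta>) (cis \<theta>)"
  have iP: "integrable circ ?P" using integrable_poisson_times[OF w, of "\<lambda>\<theta>. 1::real" 1] by auto
  have dle: "cmod (cis \<theta> - \<eta>) \<le> 2" for \<theta> using norm_triangle_ineq4[of "cis \<theta>" \<eta>] \<eta> by simp
  have iD: "integrable circ (\<lambda>\<theta>. ?P \<theta> * (cmod (cis \<theta> - \<eta>))\<^sup>2)"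
    using integrable_poisson_times[OF w, of "\<lambda>\<theta>. (cmod (cis \<theta> - \<eta>))\<^sup>2" "2\<^sup>2"] power_mono[OF dle norm_ge_zero, where n = 2] by auto
  have "(\<integral>\<theta>. ?P \<theta> * \<chi>' (cis \<theta>) \<partial>circ) - \<chi>' \<eta> = (\<integral>\<theta>. ?P \<theta> * \<chi>' (cis \<theta>) - ?P \<theta> * \<chi>' \<eta> \<partial>circ)"
    using integrable_poisson[OF w] iP circ_poisson_1[OF w] by simp
  also have "\<bar>\<dots>\<bar> \<le> (\<integral>\<theta>. \<bar>?P \<theta> * \<chi>' (cis \<theta>) - ?P \<theta> * \<chi>' \<eta>\<bar> \<partial>circ)"
    by (rule integral_abs_bound)
  also have "\<dots> \<le> (\<integral>\<theta>. (L * s / 2) * ?P \<theta> + (L / (2 * s)) * (?P \<theta> * (cmod (cis \<theta> - \<eta>))\<^sup>2) \<partial>circ)"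
  proof (rule integral_mono)
    show "integrable circ (\<lambda>\<theta>. \<bar>?P \<theta> * \<chi>' (cis \<theta>) - ?P \<theta> * \<chi>' \<eta>\<bar>)"
      using integrable_poisson[OF w] iP by (intro integrable_abs Bochner_Integration.integrable_diff integrable_mult_left) auto
    show "integrable circ (\<lambda>\<theta>. (L * s / 2) * ?P \<theta> + (L / (2 * s)) * (?P \<theta> * (cmod (cis \<theta> - \<eta>))\<^sup>2))"
      using iP iD by (intro Bochner_Integration.integrable_add integrable_mult_right)
    fix \<theta>
    have P0: "0 \<le> ?P \<theta>" using w by (intro poisson_nonneg) auto
    let ?x = "cmod (cis \<theta> - \<eta>)"
    have "0 \<le> (?x - s)\<^sup>2" by simp
    then have x: "?x \<le> s / 2 + ?x\<^sup>2 / (2 * s)" using s(1) by (simp add: power2_eq_square field_simps)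
    have "\<bar>?P \<theta> * \<chi>' (cis \<theta>) - ?P \<theta> * \<chi>' \<eta>\<bar> = ?P \<theta> * \<bar>\<chi>' (cis \<theta>) - \<chi>' \<eta>\<bar>"
      using P0 by (simp add: abs_mult right_diff_distrib[symmetric])
    also have "\<dots> \<le> ?P \<theta> * (L * (s / 2 + ?x\<^sup>2 / (2 * s)))"
      using lip[of "cis \<theta>" \<eta>] \<eta> x L by (intro mult_left_mono P0) (auto intro: order_trans mult_left_mono)
    also have "\<dots> = (L * s / 2) * ?P \<theta> + (L / (2 * s)) * (?P \<theta> * ?x\<^sup>2)" by (simp add: algebra_simps)
    finally show "\<bar>?P \<theta> * \<chi>' (cis \<theta>) - ?P \<theta> * \<chi>' \<eta>\<bar> \<le> (L * s / 2) * ?P \<theta> + (L / (2 * s)) * (?P \<theta> * ?x\<^sup>2)" .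
  qed
  also have "\<dots> = (L * s / 2) * 1 + (L / (2 * s)) * (2 * (1 - r))"
    by (subst Bochner_Integration.integral_add[OF integrable_mult_right[OF iP] integrable_mult_right[OF iD]])
      (simp only: integral_mult_right_zero circ_poisson_1[OF w] poisson_mean_dist[OF \<eta> r])
  also have "\<dots> = 3 / 2 * (L * s)" using s by (simp add: power2_eq_square[symmetric] s(2)[symmetric]) (simp add: power2_eq_square field_simps)
  also have "\<dots> \<le> 2 * L * s" using L s by simp
  finally show ?thesis by (simp add: s_def)
qed

end

lemma clark_poisson_nn:
  assumes \<phi>: "self_map \<phi>" and \<alpha>: "cmod \<alpha> = 1" and M: "clark_herglotz \<phi> \<alpha> M" and z: "cmod z < 1"
  shows "(\<integral>\<^sup>+\<xi>. ennreal (poisson z \<xi>) \<partial>M) = ennreal (poisson (\<phi> z) \<alpha>)"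
proof -
  note MD = clark_herglotzD[OF M]
  note [measurable_cong] = MD(2)
  have i: "integrable M (\<lambda>\<xi>. poisson z \<xi>)"
  proof (rule finite_measure.integrable_const_bound[OF MD(3), where B = "(1 + cmod z) / (1 - cmod z)"])
    show "AE \<xi> in M. norm (poisson z \<xi>) \<le> (1 + cmod z) / (1 - cmod z)"
      using AE_sphere[OF MD(2,4)]
    proof (rule AE_mp, intro AE_I2 impI)
      fix \<xi> assume "cmod \<xi> = 1"
      then show "norm (poisson z \<xi>) \<le> (1 + cmod z) / (1 - cmod z)"
        using poisson_le[OF z] poisson_nonneg[of z \<xi>] z by auto
    qed
  qed measurable
  have "(\<integral>\<^sup>+\<xi>. ennreal (poisson z \<xi>) \<partial>M) = ennreal (\<integral>\<xi>. poisson z \<xi> \<partial>M)"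
    using z by (intro nn_integral_eq_integral[OF i] AE_I2 poisson_nonneg) auto
  also have "(\<integral>\<xi>. poisson z \<xi> \<partial>M) = poisson (\<phi> z) \<alpha>"
  proof -
    have "Re ((\<alpha> + \<phi> z) / (\<alpha> - \<phi> z)) = (\<integral>\<xi>. poisson z \<xi> \<partial>M)"
      using MD(1) z unfolding clark_measure_def poisson_def by simp
    then show ?thesis using poisson_self_map_Re[OF \<phi> \<alpha> z] by simp
  qed
  finally show ?thesis .
qed

lemma clark_mass:
  assumes \<phi>: "self_map \<phi>" and \<alpha>: "cmod \<alpha> = 1" and M: "clark_herglotz \<phi> \<alpha> M"
  shows "emeasure M (space M) \<le> ennreal (comp_bound \<phi>)"
proof -
  note MD = clark_herglotzD[OF M]
  have "(\<integral>\<^sup>+\<xi>. ennreal (poisson 0 \<xi>) \<partial>M) = (\<integral>\<^sup>+\<xi>. 1 \<partial>M)"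
    using AE_sphere[OF MD(2,4)] by (intro nn_integral_cong_AE) (auto elim!: AE_mp simp: poisson_def)
  then have "emeasure M (space M) = ennreal (poisson (\<phi> 0) \<alpha>)"
    using clark_poisson_nn[OF assms, of 0] by simp
  then show ?thesis using poisson_le_comp_bound[OF \<phi> \<alpha>] by (simp add: ennreal_leI)
qed

context circle_lipschitz
begin

definition err :: "nat \<Rightarrow> real" where "err n = 2 * L * sqrt (1 - rad n)"

lemma err_nonneg: "0 \<le> err n"
  unfolding err_def using L rad(3)[of n] by simp

lemma err_tendsto: "err \<longlonglongrightarrow> 0"
  unfolding err_def using tendsto_mult[OF tendsto_const tendsto_real_sqrt[OF tendsto_diff[OF tendsto_const rad_tendsto]], of "2 * L" 1] by simp

lemma poisson_nn_close:
  assumes \<eta>: "cmod \<eta> = 1"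
  shows "(\<integral>\<^sup>+\<theta>. ennreal (\<chi>' (cis \<theta>) * poisson (of_real (rad n) * \<eta>) (cis \<theta>)) \<partial>circ) \<le> ennreal (\<chi>' \<eta>) + ennreal (err n)"
    "ennreal (\<chi>' \<eta>) \<le> (\<integral>\<^sup>+\<theta>. ennreal (\<chi>' (cis \<theta>) * poisson (of_real (rad n) * \<eta>) (cis \<theta>)) \<partial>circ) + ennreal (err n)"
proof -
  have w: "cmod (of_real (rad n) * \<eta>) < 1" using \<eta> rad[of n] by (simp add: norm_mult)
  let ?I = "\<integral>\<theta>. poisson (of_real (rad n) * \<eta>) (cis \<theta>) * \<chi>' (cis \<theta>) \<partial>circ"
  have pn: "0 \<le> poisson (of_real (rad n) * \<eta>) (cis \<theta>) * \<chi>' (cis \<theta>)" for \<theta>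
    using w by (intro mult_nonneg_nonneg poisson_nonneg nonneg) auto
  have e: "(\<integral>\<^sup>+\<theta>. ennreal (\<chi>' (cis \<theta>) * poisson (of_real (rad n) * \<eta>) (cis \<theta>)) \<partial>circ) = ennreal ?I"
    using nn_integral_eq_integral[OF integrable_poisson[OF w]] pn by (simp add: mult.commute)
  have I0: "0 \<le> ?I" by (rule Bochner_Integration.integral_nonneg) (rule pn)
  have c: "\<bar>?I - \<chi>' \<eta>\<bar> \<le> err n" unfolding err_def by (rule poisson_close[OF \<eta> rad(2,3)])
  show "(\<integral>\<^sup>+\<theta>. ennreal (\<chi>' (cis \<theta>) * poisson (of_real (rad n) * \<eta>) (cis \<theta>)) \<partial>circ) \<le> ennreal (\<chi>' \<eta>) + ennreal (err n)"
    unfolding e ennreal_plus[OF nonneg err_nonneg, symmetric] using c by (intro ennreal_leI) linarith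
  show "ennreal (\<chi>' \<eta>) \<le> (\<integral>\<^sup>+\<theta>. ennreal (\<chi>' (cis \<theta>) * poisson (of_real (rad n) * \<eta>) (cis \<theta>)) \<partial>circ) + ennreal (err n)"
    unfolding e ennreal_plus[OF I0 err_nonneg, symmetric] using c by (intro ennreal_leI) linarith
qed

text \<open>The Poisson integral of the Clark measure is \<open>poisson (\<phi> z) \<alpha>\<close>.
  Fubini and the symmetry of the kernel then turn the dilation of \<open>\<phi>\<close> into a
  Poisson average of the weight.\<close>

lemma clark_dilate_swap:
  assumes \<phi>: "self_map \<phi>" and \<alpha>: "cmod \<alpha> = 1" and M: "clark_herglotz \<phi> \<alpha> M"
  shows "(\<integral>\<^sup>+\<theta>. ennreal (\<chi>' (cis \<theta>) * poisson (\<phi> (of_real (rad n) * cis \<theta>)) \<alpha>) \<partial>circ)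
    = (\<integral>\<^sup>+\<xi>. (\<integral>\<^sup>+\<theta>. ennreal (\<chi>' (cis \<theta>) * poisson (of_real (rad n) * \<xi>) (cis \<theta>)) \<partial>circ) \<partial>M)"
proof -
  note MD = clark_herglotzD[OF M]
  note [measurable_cong] = MD(2)
  interpret M: finite_measure M by (rule MD)
  interpret pair_sigma_finite circ M ..
  have "(\<integral>\<^sup>+\<theta>. ennreal (\<chi>' (cis \<theta>) * poisson (\<phi> (of_real (rad n) * cis \<theta>)) \<alpha>) \<partial>circ)
      = (\<integral>\<^sup>+\<theta>. (\<integral>\<^sup>+\<xi>. ennreal (\<chi>' (cis \<theta>)) * ennreal (poisson (of_real (rad n) * cis \<theta>) \<xi>) \<partial>M) \<partial>circ)"
  proof (intro nn_integral_cong)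
    fix \<theta>
    have "cmod (of_real (rad n) * cis \<theta>) < 1" using rad[of n] by (simp add: norm_mult)
    from clark_poisson_nn[OF assms this]
    show "ennreal (\<chi>' (cis \<theta>) * poisson (\<phi> (of_real (rad n) * cis \<theta>)) \<alpha>) = (\<integral>\<^sup>+\<xi>. ennreal (\<chi>' (cis \<theta>)) * ennreal (poisson (of_real (rad n) * cis \<theta>) \<xi>) \<partial>M)"
      by (subst nn_integral_cmult) (auto simp: ennreal_mult' nonneg)
  qed
  also have "\<dots> = (\<integral>\<^sup>+\<xi>. (\<integral>\<^sup>+\<theta>. ennreal (\<chi>' (cis \<theta>)) * ennreal (poisson (of_real (rad n) * cis \<theta>) \<xi>) \<partial>circ) \<partial>M)"
    by (intro Fubini'[symmetric]) measurable
  also have "\<dots> = (\<integral>\<^sup>+\<xi>. (\<integral>\<^sup>+\<theta>. ennreal (\<chi>' (cis \<theta>) * poisson (of_real (rad n) * \<xi>) (cis \<theta>)) \<partial>circ) \<partial>M)"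
    using AE_sphere[OF MD(2,4)]
  proof (intro nn_integral_cong_AE, elim AE_mp, intro AE_I2 impI nn_integral_cong)
    fix \<xi> \<theta> assume "cmod \<xi> = 1"
    then show "ennreal (\<chi>' (cis \<theta>)) * ennreal (poisson (of_real (rad n) * cis \<theta>) \<xi>) = ennreal (\<chi>' (cis \<theta>) * poisson (of_real (rad n) * \<xi>) (cis \<theta>))"
      using poisson_symmetric[of \<xi> "cis \<theta>" "rad n"] by (simp add: ennreal_mult' nonneg)
  qed
  finally show ?thesis .
qed

text \<open>The averaged weight differs from the weight by at most \<open>err n\<close>, and
  \<open>comp_bound \<phi>\<close> bounds all Clark masses, so the error does not depend on
  \<alpha>.\<close>

lemma clark_dilate_close:
  assumes \<phi>: "self_map \<phi>" and \<alpha>: "cmod \<alpha> = 1" and M: "clark_herglotz \<phi> \<alpha> M"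
  shows "(\<integral>\<^sup>+\<theta>. ennreal (\<chi>' (cis \<theta>) * poisson (\<phi> (of_real (rad n) * cis \<theta>)) \<alpha>) \<partial>circ) \<le> (\<integral>\<^sup>+\<xi>. ennreal (\<chi>' \<xi>) \<partial>M) + ennreal (err n) * ennreal (comp_bound \<phi>)"
    "(\<integral>\<^sup>+\<xi>. ennreal (\<chi>' \<xi>) \<partial>M) \<le> (\<integral>\<^sup>+\<theta>. ennreal (\<chi>' (cis \<theta>) * poisson (\<phi> (of_real (rad n) * cis \<theta>)) \<alpha>) \<partial>circ) + ennreal (err n) * ennreal (comp_bound \<phi>)"
proof -
  note MD = clark_herglotzD[OF M]
  note [measurable_cong] = MD(2)
  interpret M: finite_measure M by (rule MD)
  interpret pair_sigma_finite circ M ..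
  let ?J = "\<lambda>\<xi>. \<integral>\<^sup>+\<theta>. ennreal (\<chi>' (cis \<theta>) * poisson (of_real (rad n) * \<xi>) (cis \<theta>)) \<partial>circ"
  have J: "?J \<in> borel_measurable M" by measurable
  have mass: "ennreal (err n) * emeasure M (space M) \<le> ennreal (err n) * ennreal (comp_bound \<phi>)"
    by (intro mult_left_mono clark_mass[OF assms]) auto
  have "(\<integral>\<^sup>+\<xi>. ?J \<xi> \<partial>M) \<le> (\<integral>\<^sup>+\<xi>. ennreal (\<chi>' \<xi>) + ennreal (err n) \<partial>M)"
    using AE_sphere[OF MD(2,4)] poisson_nn_close(1) by (intro nn_integral_mono_AE) (auto elim!: AE_mp)
  also have "\<dots> = (\<integral>\<^sup>+\<xi>. ennreal (\<chi>' \<xi>) \<partial>M) + ennreal (err n) * emeasure M (space M)"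
    by (subst nn_integral_add) auto
  finally show "(\<integral>\<^sup>+\<theta>. ennreal (\<chi>' (cis \<theta>) * poisson (\<phi> (of_real (rad n) * cis \<theta>)) \<alpha>) \<partial>circ) \<le> (\<integral>\<^sup>+\<xi>. ennreal (\<chi>' \<xi>) \<partial>M) + ennreal (err n) * ennreal (comp_bound \<phi>)"
    unfolding clark_dilate_swap[OF assms] using mass by (meson add_left_mono order_trans)
  have "(\<integral>\<^sup>+\<xi>. ennreal (\<chi>' \<xi>) \<partial>M) \<le> (\<integral>\<^sup>+\<xi>. ?J \<xi> + ennreal (err n) \<partial>M)"
    using AE_sphere[OF MD(2,4)] poisson_nn_close(2) by (intro nn_integral_mono_AE) (auto elim!: AE_mp)
  also have "\<dots> = (\<integral>\<^sup>+\<xi>. ?J \<xi> \<partial>M) + ennreal (err n) * emeasure M (space M)"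
    using J by (subst nn_integral_add) auto
  finally show "(\<integral>\<^sup>+\<xi>. ennreal (\<chi>' \<xi>) \<partial>M) \<le> (\<integral>\<^sup>+\<theta>. ennreal (\<chi>' (cis \<theta>) * poisson (\<phi> (of_real (rad n) * cis \<theta>)) \<alpha>) \<partial>circ) + ennreal (err n) * ennreal (comp_bound \<phi>)"
    unfolding clark_dilate_swap[OF assms] using mass by (meson add_left_mono order_trans)
qed

text \<open>The converse of \<open>boundary_fatou\<close> for a weight vanishing on
  \<open>F_set \<phi>\<close>. Off that set the Clark measure has a density with respect to arc
  length. A truncation of the density at height k has Poisson integral at most k and at most
  \<open>poisson (\<phi> z) \<alpha>\<close>, so passage to the boundary is dominated; afterwards k
  tends to infinity.\<close>

lemma clark_le_boundary:
  assumes \<phi>: "self_map \<phi>" and E: "finite (E_set \<phi>)" and \<alpha>: "cmod \<alpha> = 1" and M: "clark_herglotz \<phi> \<alpha> M"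
    and b: "boundary_fun \<phi> b" and zero: "\<And>\<zeta>. \<zeta> \<in> F_set \<phi> \<Longrightarrow> \<chi>' \<zeta> = 0"
  shows "(\<integral>\<^sup>+\<xi>. ennreal (\<chi>' \<xi>) \<partial>M) \<le> (\<integral>\<^sup>+\<theta>. ennreal (\<chi>' (cis \<theta>) * poisson (b \<theta>) \<alpha>) \<partial>circ)"
proof -
  note MD = clark_herglotzD[OF M]
  note [measurable_cong] = MD(2)
  note [measurable] = measurable_dilate[OF self_map_holomorphic[OF \<phi>] rad(2,3)]
  have [measurable]: "b \<in> borel_measurable borel" using b by (simp add: boundary_fun_def)
  have F [measurable]: "F_set \<phi> \<in> sets borel"
    using finite_subset[OF F_set_subset_E_set[OF \<phi>] E] by (intro borel_closed finite_imp_closed)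
  define \<sigma> where "\<sigma> = distr circ borel cis"
  have sets_\<sigma> [measurable_cong, simp]: "sets \<sigma> = sets borel" by (simp add: \<sigma>_def)
  interpret \<sigma>: prob_space \<sigma> unfolding \<sigma>_def by (rule circ.prob_space_distr) simp
  \<comment> \<open>Deleting the contact points removes possible atoms, and leaves the weighted
    integral unchanged because the weight is zero there.\<close>
  define M' where "M' = density M (indicator (- F_set \<phi>))"
  have sets_M' [measurable_cong, simp]: "sets M' = sets borel" by (simp add: M'_def MD(2))
  have nn_\<sigma>: "(\<integral>\<^sup>+\<xi>. g \<xi> \<partial>\<sigma>) = (\<integral>\<^sup>+\<theta>. g (cis \<theta>) \<partial>circ)" if "g \<in> borel_measurable borel" for g
    unfolding \<sigma>_def using that by (intro nn_integral_distr) auto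
  have "absolutely_continuous \<sigma> M'" unfolding absolutely_continuous_def
  proof
    fix A assume "A \<in> null_sets \<sigma>"
    then have A: "A \<in> sets borel" "emeasure circ (cis -` A) = 0"
      by (auto simp: null_sets_def \<sigma>_def emeasure_distr)
    have "emeasure M' A = (\<integral>\<^sup>+\<xi>. indicator (- F_set \<phi>) \<xi> * indicator A \<xi> \<partial>M)"
      unfolding M'_def using A(1) MD(2) by (intro emeasure_density) auto
    also have "\<dots> = (\<integral>\<^sup>+\<xi>. indicator (A - F_set \<phi>) \<xi> \<partial>M)"
      by (intro nn_integral_cong) (auto split: split_indicator)
    also have "\<dots> = 0" using clark_abs_cont_off_F_set[OF \<phi> E \<alpha> M A] A(1) MD(2) by simp
    finally show "A \<in> null_sets M'" using A(1) by (simp add: null_sets_def)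
  qed
  then have "\<exists>f\<in>borel_measurable \<sigma>. density \<sigma> f = M'" by (rule \<sigma>.Radon_Nikodym) simp
  then obtain f where "f \<in> borel_measurable \<sigma>" and f2: "density \<sigma> f = M'" by (elim bexE)
  then have f: "f \<in> borel_measurable borel" "density \<sigma> f = M'" by (simp_all add: measurable_cong_sets[OF sets_\<sigma> refl])
  note [measurable] = f(1)
  have nn_M': "(\<integral>\<^sup>+\<xi>. g \<xi> \<partial>M') = (\<integral>\<^sup>+\<theta>. f (cis \<theta>) * g (cis \<theta>) \<partial>circ)" if [measurable]: "g \<in> borel_measurable borel" for g
    unfolding f(2)[symmetric] by (subst nn_integral_density) (auto intro!: nn_\<sigma>)
  have nn_M'_le: "(\<integral>\<^sup>+\<xi>. g \<xi> \<partial>M') \<le> (\<integral>\<^sup>+\<xi>. g \<xi> \<partial>M)" if [measurable]: "g \<in> borel_measurable borel" for g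
    unfolding M'_def by (subst nn_integral_density) (auto intro!: nn_integral_mono simp: indicator_def)
  have "(\<integral>\<^sup>+\<xi>. ennreal (\<chi>' \<xi>) \<partial>M) = (\<integral>\<^sup>+\<xi>. ennreal (\<chi>' \<xi>) \<partial>M')"
    unfolding M'_def using zero by (subst nn_integral_density) (auto intro!: nn_integral_cong simp: indicator_def)
  also have "\<dots> = (\<integral>\<^sup>+\<theta>. f (cis \<theta>) * ennreal (\<chi>' (cis \<theta>)) \<partial>circ)" by (rule nn_M') measurable
  also have "\<dots> \<le> (\<integral>\<^sup>+\<theta>. ennreal (\<chi>' (cis \<theta>) * poisson (b \<theta>) \<alpha>) \<partial>circ)" (is "_ \<le> ?R")
  proof -
    define fk where "fk = (\<lambda>k::nat. \<lambda>\<xi>. min (f \<xi>) (of_nat k))"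
    have [measurable]: "fk k \<in> borel_measurable borel" for k unfolding fk_def by measurable
    have fk: "(\<integral>\<^sup>+\<theta>. fk k (cis \<theta>) * ennreal (\<chi>' (cis \<theta>)) \<partial>circ) \<le> ?R" for k
    proof -
      let ?P = "\<lambda>n \<theta>. poisson (\<phi> (of_real (rad n) * cis \<theta>)) \<alpha>"
      \<comment> \<open>The weight is replaced by its Poisson average, at a cost of
        \<open>err n\<close> times the height k of the truncated density. Exchanging the integrals
        then moves the average onto that density.\<close>
      have step: "(\<integral>\<^sup>+\<theta>. fk k (cis \<theta>) * ennreal (\<chi>' (cis \<theta>)) \<partial>circ)
         \<le> (\<integral>\<^sup>+\<theta>. ennreal (\<chi>' (cis \<theta>) * min (?P n \<theta>) (real k)) \<partial>circ) + ennreal (err n) * of_nat k" for n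
      proof -
        interpret pair_sigma_finite circ circ ..
        let ?K = "\<lambda>t \<theta>. ennreal (\<chi>' (cis \<theta>) * poisson (of_real (rad n) * cis t) (cis \<theta>))"
        have "(\<integral>\<^sup>+t. fk k (cis t) * ennreal (\<chi>' (cis t)) \<partial>circ) \<le> (\<integral>\<^sup>+t. fk k (cis t) * (\<integral>\<^sup>+\<theta>. ?K t \<theta> \<partial>circ) + of_nat k * ennreal (err n) \<partial>circ)"
        proof (rule nn_integral_mono)
          fix t
          have "fk k (cis t) * ennreal (\<chi>' (cis t)) \<le> fk k (cis t) * ((\<integral>\<^sup>+\<theta>. ?K t \<theta> \<partial>circ) + ennreal (err n))"
            by (intro mult_left_mono poisson_nn_close(2)) auto
          also have "\<dots> \<le> fk k (cis t) * (\<integral>\<^sup>+\<theta>. ?K t \<theta> \<partial>circ) + of_nat k * ennreal (err n)"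
            unfolding distrib_left by (intro add_left_mono mult_right_mono) (auto simp: fk_def)
          finally show "fk k (cis t) * ennreal (\<chi>' (cis t)) \<le> fk k (cis t) * (\<integral>\<^sup>+\<theta>. ?K t \<theta> \<partial>circ) + of_nat k * ennreal (err n)" .
        qed
        also have "\<dots> = (\<integral>\<^sup>+t. (\<integral>\<^sup>+\<theta>. fk k (cis t) * ?K t \<theta> \<partial>circ) \<partial>circ) + of_nat k * ennreal (err n)"
          by (subst nn_integral_add) (auto simp: circ.emeasure_space_1[simplified] nn_integral_cmult)
        also have "(\<integral>\<^sup>+t. (\<integral>\<^sup>+\<theta>. fk k (cis t) * ?K t \<theta> \<partial>circ) \<partial>circ) = (\<integral>\<^sup>+\<theta>. (\<integral>\<^sup>+t. fk k (cis t) * ?K t \<theta> \<partial>circ) \<partial>circ)"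
          by (intro Fubini'[symmetric]) measurable
        also have "\<dots> \<le> (\<integral>\<^sup>+\<theta>. ennreal (\<chi>' (cis \<theta>) * min (?P n \<theta>) (real k)) \<partial>circ)"
        proof (rule nn_integral_mono)
          fix \<theta>
          define w where "w = of_real (rad n) * cis \<theta>"
          have w: "cmod w < 1" using rad[of n] by (simp add: w_def norm_mult)
          have "(\<integral>\<^sup>+t. fk k (cis t) * ?K t \<theta> \<partial>circ) = (\<integral>\<^sup>+t. ennreal (\<chi>' (cis \<theta>)) * (fk k (cis t) * ennreal (poisson w (cis t))) \<partial>circ)"
            using poisson_symmetric[of "cis \<theta>" _ "rad n"] by (intro nn_integral_cong) (simp add: ennreal_mult' nonneg w_def mult_ac)
          also have "\<dots> = ennreal (\<chi>' (cis \<theta>)) * (\<integral>\<^sup>+t. fk k (cis t) * ennreal (poisson w (cis t)) \<partial>circ)"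
            by (rule nn_integral_cmult) measurable
          \<comment> \<open>The truncated density is bounded both by k, against a kernel of mass 1,
            and by the density of \<open>M'\<close>, whose Poisson integral is at most that of
            \<open>M\<close>.\<close>
          also have "(\<integral>\<^sup>+t. fk k (cis t) * ennreal (poisson w (cis t)) \<partial>circ) \<le> ennreal (min (?P n \<theta>) (real k))"
          proof -
            have "(\<integral>\<^sup>+t. fk k (cis t) * ennreal (poisson w (cis t)) \<partial>circ) \<le> (\<integral>\<^sup>+t. of_nat k * ennreal (poisson w (cis t)) \<partial>circ)"
              by (intro nn_integral_mono mult_right_mono) (auto simp: fk_def)
            also have "\<dots> = of_nat k * (\<integral>\<^sup>+t. ennreal (poisson w (cis t)) \<partial>circ)" by (rule nn_integral_cmult) measurable
            also have "(\<integral>\<^sup>+t. ennreal (poisson w (cis t)) \<partial>circ) = 1"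
              using integrable_poisson_times[OF w, of "\<lambda>_. 1::real" 1] w circ_poisson_1[OF w]
              by (subst nn_integral_eq_integral) (auto intro!: AE_I2 poisson_nonneg)
            finally have 1: "(\<integral>\<^sup>+t. fk k (cis t) * ennreal (poisson w (cis t)) \<partial>circ) \<le> ennreal (real k)"
              by (simp add: ennreal_of_nat_eq_real_of_nat)
            have "(\<integral>\<^sup>+t. fk k (cis t) * ennreal (poisson w (cis t)) \<partial>circ) \<le> (\<integral>\<^sup>+t. f (cis t) * ennreal (poisson w (cis t)) \<partial>circ)"
              by (intro nn_integral_mono mult_right_mono) (auto simp: fk_def)
            also have "\<dots> = (\<integral>\<^sup>+\<xi>. ennreal (poisson w \<xi>) \<partial>M')" by (rule nn_M'[symmetric]) measurable
            also have "\<dots> \<le> (\<integral>\<^sup>+\<xi>. ennreal (poisson w \<xi>) \<partial>M)" by (rule nn_M'_le) measurable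
            also have "\<dots> = ennreal (?P n \<theta>)" unfolding clark_poisson_nn[OF \<phi> \<alpha> M w] by (simp add: w_def)
            finally show ?thesis using 1 by (simp add: min_def)
          qed
          finally show "(\<integral>\<^sup>+t. fk k (cis t) * ?K t \<theta> \<partial>circ) \<le> ennreal (\<chi>' (cis \<theta>) * min (?P n \<theta>) (real k))"
            by (simp add: ennreal_mult' nonneg mult_left_mono)
        qed
        finally show ?thesis by (simp add: mult.commute)
      qed
      have lim: "(\<lambda>n. \<integral>\<^sup>+\<theta>. ennreal (\<chi>' (cis \<theta>) * min (?P n \<theta>) (real k)) \<partial>circ) \<longlonglongrightarrow> (\<integral>\<^sup>+\<theta>. ennreal (\<chi>' (cis \<theta>) * min (poisson (b \<theta>) \<alpha>) (real k)) \<partial>circ)"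
      proof (rule nn_integral_dominated_convergence[where w = "\<lambda>_. ennreal (B * real k)"])
        show "AE \<theta> in circ. ennreal (\<chi>' (cis \<theta>) * min (?P n \<theta>) (real k)) \<le> ennreal (B * real k)" for n
          using bound nonneg by (intro AE_I2 ennreal_leI order_trans[OF mult_left_mono[OF min.cobounded2 nonneg] mult_right_mono]) auto
        show "AE \<theta> in circ. (\<lambda>n. ennreal (\<chi>' (cis \<theta>) * min (?P n \<theta>) (real k))) \<longlonglongrightarrow> ennreal (\<chi>' (cis \<theta>) * min (poisson (b \<theta>) \<alpha>) (real k))"
        proof (rule AE_mp[OF boundary_fun_AE_seq[OF b]], intro AE_I2 impI)
          fix \<theta> assume "(\<lambda>n. \<phi> (of_real (rad n) * cis \<theta>)) \<longlonglongrightarrow> b \<theta> \<and> cmod (b \<theta>) < 1"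
          then show "(\<lambda>n. ennreal (\<chi>' (cis \<theta>) * min (?P n \<theta>) (real k))) \<longlonglongrightarrow> ennreal (\<chi>' (cis \<theta>) * min (poisson (b \<theta>) \<alpha>) (real k))"
            using \<alpha> by (intro tendsto_ennrealI tendsto_mult tendsto_const tendsto_min tendsto_poisson) auto
        qed
      qed (auto simp: circ.emeasure_space_1[simplified])
      have "(\<lambda>n. (\<integral>\<^sup>+\<theta>. ennreal (\<chi>' (cis \<theta>) * min (?P n \<theta>) (real k)) \<partial>circ) + ennreal (err n) * of_nat k)
         \<longlonglongrightarrow> (\<integral>\<^sup>+\<theta>. ennreal (\<chi>' (cis \<theta>) * min (poisson (b \<theta>) \<alpha>) (real k)) \<partial>circ) + ennreal 0 * of_nat k"
        by (intro tendsto_add lim tendsto_mult_ennreal tendsto_ennrealI err_tendsto tendsto_const) auto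
      then have "(\<integral>\<^sup>+\<theta>. fk k (cis \<theta>) * ennreal (\<chi>' (cis \<theta>)) \<partial>circ) \<le> (\<integral>\<^sup>+\<theta>. ennreal (\<chi>' (cis \<theta>) * min (poisson (b \<theta>) \<alpha>) (real k)) \<partial>circ)"
        using step by (intro LIMSEQ_le_const) auto
      also have "\<dots> \<le> ?R" by (intro nn_integral_mono ennreal_leI mult_left_mono nonneg) auto
      finally show ?thesis .
    qed
    have "(\<integral>\<^sup>+\<theta>. f (cis \<theta>) * ennreal (\<chi>' (cis \<theta>)) \<partial>circ) = (\<integral>\<^sup>+\<theta>. liminf (\<lambda>k. fk k (cis \<theta>) * ennreal (\<chi>' (cis \<theta>))) \<partial>circ)"
    proof (intro nn_integral_cong)
      fix \<theta>
      have "(\<lambda>k. fk k (cis \<theta>)) \<longlonglongrightarrow> min (f (cis \<theta>)) top"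
        unfolding fk_def by (intro tendsto_min tendsto_const of_nat_tendsto_top_ennreal)
      then have "(\<lambda>k. fk k (cis \<theta>) * ennreal (\<chi>' (cis \<theta>))) \<longlonglongrightarrow> f (cis \<theta>) * ennreal (\<chi>' (cis \<theta>))"
      \<comment> \<open>Where the weight vanishes the density may be infinite, and multiplication of
        extended reals is not continuous at such a pair.\<close>
      proof (cases "\<chi>' (cis \<theta>) = 0")
        case False
        then have "ennreal (\<chi>' (cis \<theta>)) \<noteq> 0" using nonneg[of "cis \<theta>"] by (simp add: ennreal_eq_0_iff)
        with \<open>(\<lambda>k. fk k (cis \<theta>)) \<longlonglongrightarrow> min (f (cis \<theta>)) top\<close> show ?thesis
          by (intro tendsto_mult_ennreal tendsto_const) auto
      qed simp
      from lim_imp_Liminf[OF _ this] show "f (cis \<theta>) * ennreal (\<chi>' (cis \<theta>)) = liminf (\<lambda>k. fk k (cis \<theta>) * ennreal (\<chi>' (cis \<theta>)))"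
        by simp
    qed
    also have "\<dots> \<le> liminf (\<lambda>k. \<integral>\<^sup>+\<theta>. fk k (cis \<theta>) * ennreal (\<chi>' (cis \<theta>)) \<partial>circ)"
      by (rule nn_integral_liminf) measurable
    also have "\<dots> \<le> liminf (\<lambda>k. ?R)" by (intro Liminf_mono always_eventually allI fk)
    finally show ?thesis by (simp add: Liminf_const)
  qed
  finally show ?thesis .
qed

end

section \<open>Continuity in the Clark parameter and uniform decay\<close>

lemma one_minus_power_le:
  fixes x :: real
  assumes "0 \<le> x" "x \<le> 1"
  shows "1 - x ^ n \<le> real n * (1 - x)"
proof (induction n)
  case (Suc n)
  have "1 - x ^ Suc n = (1 - x ^ n) + x ^ n * (1 - x)" by (simp add: algebra_simps)
  also have "\<dots> \<le> real n * (1 - x) + 1 * (1 - x)"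
    using assms by (intro add_mono Suc mult_right_mono power_le_one) auto
  finally show ?case by (simp add: algebra_simps)
qed simp

text \<open>The factor 1 - |w|^(2N) vanishes to first order at the circle and cancels the 1 / (1 -
  |w|) growth of the Poisson kernel.\<close>

lemma poisson_defect_bound:
  assumes w: "cmod w < 1" and \<alpha>: "cmod \<alpha> = 1"
  shows "(1 - (cmod w) ^ (2 * N)) * poisson w \<alpha> \<le> 4 * real N"
proof -
  let ?x = "cmod w"
  have "(1 - ?x ^ (2*N)) * poisson w \<alpha> \<le> (real (2*N) * (1 - ?x)) * ((1 + ?x) / (1 - ?x))"
    using w one_minus_power_le[of ?x "2*N"] by (intro mult_mono poisson_le[OF w \<alpha>] poisson_nonneg) auto
  also have "\<dots> = real (2*N) * (1 + ?x)" using w by simp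
  also have "\<dots> \<le> real (2*N) * 2" using w by (intro mult_left_mono) auto
  finally show ?thesis by simp
qed

context circle_lipschitz
begin

lemma bound_nonneg: "0 \<le> B"
  using order_trans[OF nonneg bound[of 1]] by simp

definition boundary_mass :: "(real \<Rightarrow> complex) \<Rightarrow> complex \<Rightarrow> real" where
  "boundary_mass b \<alpha> = (\<integral>\<theta>. \<chi>' (cis \<theta>) * poisson (b \<theta>) \<alpha> \<partial>circ)"

definition dilate_mass :: "(complex \<Rightarrow> complex) \<Rightarrow> nat \<Rightarrow> complex \<Rightarrow> real" where
  "dilate_mass \<phi> n \<alpha> = (\<integral>\<theta>. \<chi>' (cis \<theta>) * poisson (\<phi> (of_real (rad n) * cis \<theta>)) \<alpha> \<partial>circ)"

lemma dilate_kernel_bound: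
  assumes \<phi>: "self_map \<phi>"
  shows "\<exists>C. \<forall>\<alpha> \<theta>. cmod \<alpha> = 1 \<longrightarrow> \<bar>\<chi>' (cis \<theta>) * poisson (\<phi> (of_real (rad n) * cis \<theta>)) \<alpha>\<bar> \<le> C"
proof -
  obtain \<rho> where \<rho>: "0 \<le> \<rho>" "\<rho> < 1" "\<And>\<theta>. cmod (\<phi> (of_real (rad n) * cis \<theta>)) \<le> \<rho>"
    using self_map_dilate_bound[OF \<phi> rad(2,3)] by blast
  have "\<bar>\<chi>' (cis \<theta>) * poisson (\<phi> (of_real (rad n) * cis \<theta>)) \<alpha>\<bar> \<le> B * ((1 + \<rho>) / (1 - \<rho>))" if \<alpha>: "cmod \<alpha> = 1" for \<alpha> \<theta>
  proof -
    let ?w = "\<phi> (of_real (rad n) * cis \<theta>)"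
    have w: "cmod ?w < 1" using \<rho>(2) \<rho>(3)[of \<theta>] by linarith
    have "\<bar>poisson ?w \<alpha>\<bar> \<le> (1 + cmod ?w) / (1 - cmod ?w)" using poisson_le[OF w \<alpha>] poisson_nonneg[of ?w \<alpha>] w by simp
    also have "\<dots> \<le> (1 + \<rho>) / (1 - \<rho>)" using \<rho>(2) \<rho>(3)[of \<theta>] \<rho>(1) by (intro frac_le) auto
    finally show ?thesis using bound[of "cis \<theta>"] nonneg[of "cis \<theta>"]
      unfolding abs_mult by (intro mult_mono) auto
  qed
  then show ?thesis by blast
qed

lemma dilate_mass_nn:
  assumes \<phi>: "self_map \<phi>" and \<alpha>: "cmod \<alpha> = 1"
  shows "(\<integral>\<^sup>+\<theta>. ennreal (\<chi>' (cis \<theta>) * poisson (\<phi> (of_real (rad n) * cis \<theta>)) \<alpha>) \<partial>circ) = ennreal (dilate_mass \<phi> n \<alpha>)"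
    "0 \<le> dilate_mass \<phi> n \<alpha>"
proof -
  note [measurable] = measurable_dilate[OF self_map_holomorphic[OF \<phi>] rad(2,3)]
  obtain C where C: "\<And>\<theta>. \<bar>\<chi>' (cis \<theta>) * poisson (\<phi> (of_real (rad n) * cis \<theta>)) \<alpha>\<bar> \<le> C"
    using dilate_kernel_bound[OF \<phi>, of n] \<alpha> by blast
  have pn: "0 \<le> \<chi>' (cis \<theta>) * poisson (\<phi> (of_real (rad n) * cis \<theta>)) \<alpha>" for \<theta>
    using self_map_norm[OF \<phi>, of "of_real (rad n) * cis \<theta>"] rad[of n]
    by (intro mult_nonneg_nonneg nonneg poisson_nonneg) (auto simp: norm_mult)
  have "integrable circ (\<lambda>\<theta>. \<chi>' (cis \<theta>) * poisson (\<phi> (of_real (rad n) * cis \<theta>)) \<alpha>)"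
    using C by (intro integrable_circ_bounded[where B = C]) auto
  then show "(\<integral>\<^sup>+\<theta>. ennreal (\<chi>' (cis \<theta>) * poisson (\<phi> (of_real (rad n) * cis \<theta>)) \<alpha>) \<partial>circ) = ennreal (dilate_mass \<phi> n \<alpha>)"
    unfolding dilate_mass_def by (rule nn_integral_eq_integral) (use pn in auto)
  show "0 \<le> dilate_mass \<phi> n \<alpha>" unfolding dilate_mass_def by (rule Bochner_Integration.integral_nonneg) (rule pn)
qed

lemma continuous_on_dilate_mass:
  assumes \<phi>: "self_map \<phi>"
  shows "continuous_on (sphere 0 1) (dilate_mass \<phi> n)"
  unfolding continuous_on_def tendsto_at_iff_sequentially o_def
proof (intro ballI allI impI)
  fix \<alpha> :: complex and A :: "nat \<Rightarrow> complex" assume \<alpha>: "\<alpha> \<in> sphere 0 1" and A: "\<forall>i. A i \<in> sphere 0 1 - {\<alpha>}" "A \<longlonglongrightarrow> \<alpha>"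
  note [measurable] = measurable_dilate[OF self_map_holomorphic[OF \<phi>] rad(2,3)]
  obtain C where C: "\<And>\<theta> \<alpha>. cmod \<alpha> = 1 \<Longrightarrow> \<bar>\<chi>' (cis \<theta>) * poisson (\<phi> (of_real (rad n) * cis \<theta>)) \<alpha>\<bar> \<le> C"
    using dilate_kernel_bound[OF \<phi>, of n] by blast
  show "(\<lambda>i. dilate_mass \<phi> n (A i)) \<longlonglongrightarrow> dilate_mass \<phi> n \<alpha>"
    unfolding dilate_mass_def
  proof (rule integral_dominated_convergence[where w = "\<lambda>_. C"])
    have "(\<lambda>i. poisson (\<phi> (of_real (rad n) * cis \<theta>)) (A i)) \<longlonglongrightarrow> poisson (\<phi> (of_real (rad n) * cis \<theta>)) \<alpha>" for \<theta>
      unfolding poisson_def using A(2) \<alpha> self_map_norm[OF \<phi>, of "of_real (rad n) * cis \<theta>"] rad[of n]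
      by (intro tendsto_intros) (auto simp: norm_mult)
    then show "AE \<theta> in circ. (\<lambda>i. \<chi>' (cis \<theta>) * poisson (\<phi> (of_real (rad n) * cis \<theta>)) (A i)) \<longlonglongrightarrow> \<chi>' (cis \<theta>) * poisson (\<phi> (of_real (rad n) * cis \<theta>)) \<alpha>"
      by (intro AE_I2 tendsto_mult tendsto_const)
    show "AE \<theta> in circ. norm (\<chi>' (cis \<theta>) * poisson (\<phi> (of_real (rad n) * cis \<theta>)) (A i)) \<le> C" for i
      using C A(1) by auto
  qed auto
qed

text \<open>The weighted mass \<open>X\<close> of the Clark measure is approximated by the dilated
  masses at the rate of \<open>clark_dilate_close\<close>. Fatou gives \<open>Y \<le> X\<close> for
  the boundary integral \<open>Y\<close>, and absolute continuity off the zeros of the weight gives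
  \<open>X \<le> Y\<close>.\<close>

lemma boundary_mass_close:
  assumes \<phi>: "self_map \<phi>" and E: "finite (E_set \<phi>)" and \<alpha>: "cmod \<alpha> = 1"
    and b: "boundary_fun \<phi> b" and zero: "\<And>\<zeta>. \<zeta> \<in> F_set \<phi> \<Longrightarrow> \<chi>' \<zeta> = 0"
  shows "integrable circ (\<lambda>\<theta>. \<chi>' (cis \<theta>) * poisson (b \<theta>) \<alpha>)"
    "\<bar>boundary_mass b \<alpha> - dilate_mass \<phi> n \<alpha>\<bar> \<le> err n * comp_bound \<phi>"
proof -
  have [measurable]: "b \<in> borel_measurable borel" using b by (simp add: boundary_fun_def)
  obtain M where M: "clark_herglotz \<phi> \<alpha> M" using clark_herglotz_exists[OF \<phi> \<alpha>] by blast
  define e where "e = (\<lambda>n. err n * comp_bound \<phi>)"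
  have e: "0 \<le> e n" "ennreal (err n) * ennreal (comp_bound \<phi>) = ennreal (e n)" for n
    using err_nonneg comp_bound_nonneg[OF \<phi>] by (auto simp: e_def ennreal_mult)
  have elim: "e \<longlonglongrightarrow> 0" unfolding e_def using tendsto_mult[OF err_tendsto tendsto_const] by simp
  define X where "X = (\<integral>\<^sup>+\<xi>. ennreal (\<chi>' \<xi>) \<partial>M)"
  define Y where "Y = (\<integral>\<^sup>+\<theta>. ennreal (\<chi>' (cis \<theta>) * poisson (b \<theta>) \<alpha>) \<partial>circ)"
  have up: "ennreal (dilate_mass \<phi> n \<alpha>) \<le> X + ennreal (e n)" and lo: "X \<le> ennreal (dilate_mass \<phi> n \<alpha>) + ennreal (e n)" for n
    using clark_dilate_close[OF \<phi> \<alpha> M, of n] unfolding dilate_mass_nn[OF \<phi> \<alpha>] e(2) X_def by auto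
  have "X < top" using lo[of 0] by (simp add: ennreal_plus[symmetric] dilate_mass_nn(2)[OF \<phi> \<alpha>] e(1) order.strict_trans1 del: ennreal_plus)
  then obtain x where x: "X = ennreal x" "0 \<le> x" by (cases X) auto
  have "Y \<le> X"
  proof -
    have "Y \<le> liminf (\<lambda>n. ennreal (dilate_mass \<phi> n \<alpha>))"
      unfolding Y_def using boundary_fatou[OF \<phi> b \<alpha> meas] unfolding dilate_mass_nn[OF \<phi> \<alpha>] .
    also have "\<dots> \<le> liminf (\<lambda>n. ennreal (x + e n))"
      using up x e(1) by (intro Liminf_mono always_eventually allI) (simp add: ennreal_plus[symmetric] del: ennreal_plus)
    also have "\<dots> = ennreal x"
      using tendsto_ennrealI[OF tendsto_add[OF tendsto_const elim], of x] by (intro lim_imp_Liminf) auto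
    finally show ?thesis using x by simp
  qed
  moreover have "X \<le> Y" unfolding X_def Y_def by (rule clark_le_boundary[OF \<phi> E \<alpha> M b zero])
  ultimately have Y: "Y = ennreal x" using x by simp
  have ae: "AE \<theta> in circ. 0 \<le> \<chi>' (cis \<theta>) * poisson (b \<theta>) \<alpha>"
    using boundary_fun_AE_seq[OF b] by (rule AE_mp) (auto intro!: AE_I2 mult_nonneg_nonneg nonneg poisson_nonneg)
  show i: "integrable circ (\<lambda>\<theta>. \<chi>' (cis \<theta>) * poisson (b \<theta>) \<alpha>)"
    using Y ae unfolding Y_def by (intro integrableI_nonneg) auto
  have "boundary_mass b \<alpha> = x"
    using nn_integral_eq_integral[OF i ae] Y x(2) integral_nonneg_AE[OF ae] unfolding Y_def boundary_mass_def by simp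
  then show "\<bar>boundary_mass b \<alpha> - dilate_mass \<phi> n \<alpha>\<bar> \<le> err n * comp_bound \<phi>"
    using up[of n] lo[of n] x e(1)[of n] dilate_mass_nn(2)[OF \<phi> \<alpha>, of n]
    by (simp add: ennreal_plus[symmetric] e_def del: ennreal_plus)
qed

text \<open>The dilated masses are continuous and their distance to the boundary mass is bounded
  independently of \<alpha>, so the limit is uniform on the circle.\<close>

lemma continuous_on_boundary_mass:
  assumes \<phi>: "self_map \<phi>" and E: "finite (E_set \<phi>)"
    and b: "boundary_fun \<phi> b" and zero: "\<And>\<zeta>. \<zeta> \<in> F_set \<phi> \<Longrightarrow> \<chi>' \<zeta> = 0"
  shows "continuous_on (sphere 0 1) (boundary_mass b)"
proof (rule uniform_limit_theorem[where F = sequentially and f = "dilate_mass \<phi>"])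
  show "\<forall>\<^sub>F n in sequentially. continuous_on (sphere 0 1) (dilate_mass \<phi> n)"
    using continuous_on_dilate_mass[OF \<phi>] by simp
  show "uniform_limit (sphere 0 1) (dilate_mass \<phi>) (boundary_mass b) sequentially"
  proof (rule uniform_limitI)
    fix e :: real assume "e > 0"
    moreover have "(\<lambda>n. err n * comp_bound \<phi>) \<longlonglongrightarrow> 0" using tendsto_mult[OF err_tendsto tendsto_const] by simp
    ultimately have "\<forall>\<^sub>F n in sequentially. err n * comp_bound \<phi> < e" by (auto dest: order_tendstoD(2))
    then show "\<forall>\<^sub>F n in sequentially. \<forall>x\<in>sphere 0 1. dist (dilate_mass \<phi> n x) (boundary_mass b x) < e"
    proof eventually_elim
      case (elim n)
      show ?case
      proof
        fix x :: complex assume "x \<in> sphere 0 1"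
        then have "\<bar>boundary_mass b x - dilate_mass \<phi> n x\<bar> \<le> err n * comp_bound \<phi>"
          by (intro boundary_mass_close(2)[OF \<phi> E _ b zero]) auto
        then show "dist (dilate_mass \<phi> n x) (boundary_mass b x) < e" using elim by (simp add: dist_real_def abs_minus_commute)
      qed
    qed
  qed
qed simp

text \<open>Since \<open>(1 - \<bar>w\<bar>^(2N)) P_w\<close> is bounded, each function below is continuous in \<open>\<alpha>\<close>; they decrease to \<open>0\<close>,
  so Dini's argument on the compact circle applies.\<close>
lemma boundary_tail_uniform:
  assumes \<phi>: "self_map \<phi>" and E: "finite (E_set \<phi>)"
    and b: "boundary_fun \<phi> b" and zero: "\<And>\<zeta>. \<zeta> \<in> F_set \<phi> \<Longrightarrow> \<chi>' \<zeta> = 0" and \<epsilon>: "\<epsilon> > 0"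
  shows "\<exists>N. \<forall>\<alpha>. cmod \<alpha> = 1 \<longrightarrow> (\<integral>\<theta>. (cmod (b \<theta>)) ^ (2 * N) * (\<chi>' (cis \<theta>) * poisson (b \<theta>) \<alpha>) \<partial>circ) \<le> \<epsilon>"
proof (rule ccontr)
  define h where "h = (\<lambda>N \<alpha>. \<integral>\<theta>. (cmod (b \<theta>)) ^ (2 * N) * (\<chi>' (cis \<theta>) * poisson (b \<theta>) \<alpha>) \<partial>circ)"
  define D where "D = (\<lambda>N \<alpha>. \<integral>\<theta>. (1 - (cmod (b \<theta>)) ^ (2 * N)) * (\<chi>' (cis \<theta>) * poisson (b \<theta>) \<alpha>) \<partial>circ)"
  have [measurable]: "b \<in> borel_measurable borel" using b by (simp add: boundary_fun_def)
  note ae = boundary_fun_AE_seq[OF b]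
  note i = boundary_mass_close(1)[OF \<phi> E _ b zero]
  have ib: "integrable circ (\<lambda>\<theta>. (cmod (b \<theta>)) ^ n * (\<chi>' (cis \<theta>) * poisson (b \<theta>) \<alpha>))" if "cmod \<alpha> = 1" for n \<alpha>
  proof (rule Bochner_Integration.integrable_bound[OF i[OF that]])
    show "AE \<theta> in circ. norm ((cmod (b \<theta>)) ^ n * (\<chi>' (cis \<theta>) * poisson (b \<theta>) \<alpha>)) \<le> norm (\<chi>' (cis \<theta>) * poisson (b \<theta>) \<alpha>)"
      using ae
    proof (rule AE_mp, intro AE_I2 impI)
      fix \<theta> assume "(\<lambda>n. \<phi> (of_real (rad n) * cis \<theta>)) \<longlonglongrightarrow> b \<theta> \<and> cmod (b \<theta>) < 1"
      then have "(cmod (b \<theta>)) ^ n * norm (\<chi>' (cis \<theta>) * poisson (b \<theta>) \<alpha>) \<le> 1 * norm (\<chi>' (cis \<theta>) * poisson (b \<theta>) \<alpha>)"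
        by (intro mult_right_mono power_le_one) auto
      then show "norm ((cmod (b \<theta>)) ^ n * (\<chi>' (cis \<theta>) * poisson (b \<theta>) \<alpha>)) \<le> norm (\<chi>' (cis \<theta>) * poisson (b \<theta>) \<alpha>)"
        by (simp add: abs_mult)
    qed
  qed measurable
  have hD: "h N \<alpha> = boundary_mass b \<alpha> - D N \<alpha>" if "cmod \<alpha> = 1" for N \<alpha>
    unfolding h_def D_def boundary_mass_def left_diff_distrib mult_1
    using Bochner_Integration.integral_diff[OF i[OF that] ib[OF that, of "2 * N"]] by simp
  assume "\<not> (\<exists>N. \<forall>\<alpha>. cmod \<alpha> = 1 \<longrightarrow> (\<integral>\<theta>. (cmod (b \<theta>)) ^ (2 * N) * (\<chi>' (cis \<theta>) * poisson (b \<theta>) \<alpha>) \<partial>circ) \<le> \<epsilon>)"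
  then have "\<forall>N. \<exists>\<alpha>. cmod \<alpha> = 1 \<and> \<epsilon> < h N \<alpha>" unfolding h_def by (simp add: not_le)
  then obtain A where A: "\<And>N. cmod (A N) = 1" "\<And>N. \<epsilon> < h N (A N)" by metis
  have "compact (sphere (0::complex) 1)" by simp
  then obtain \<alpha> s where s: "\<alpha> \<in> sphere 0 1" "strict_mono (s :: nat \<Rightarrow> nat)" "(A \<circ> s) \<longlonglongrightarrow> \<alpha>"
    using A(1) unfolding compact_def by (metis dist_0_norm mem_sphere)
  have \<alpha>: "cmod \<alpha> = 1" using s by simp
  \<comment> \<open>For j >= N monotonicity gives \<epsilon> < h N (A (s j)), and continuity of
    \<open>h N\<close> carries this to the limit point. As N was arbitrary, this contradicts the
    pointwise decay of \<open>h N \<alpha>\<close>.\<close>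
  have "\<epsilon> \<le> h N \<alpha>" for N
  proof -
    have D: "(\<lambda>j. D N (A (s j))) \<longlonglongrightarrow> D N \<alpha>" unfolding D_def
    proof (rule integral_dominated_convergence[where w = "\<lambda>_. B * (4 * real N)"])
      show "AE \<theta> in circ. (\<lambda>j. (1 - (cmod (b \<theta>)) ^ (2 * N)) * (\<chi>' (cis \<theta>) * poisson (b \<theta>) (A (s j)))) \<longlonglongrightarrow> (1 - (cmod (b \<theta>)) ^ (2 * N)) * (\<chi>' (cis \<theta>) * poisson (b \<theta>) \<alpha>)"
        using ae
      proof (rule AE_mp, intro AE_I2 impI)
        fix \<theta> assume "(\<lambda>n. \<phi> (of_real (rad n) * cis \<theta>)) \<longlonglongrightarrow> b \<theta> \<and> cmod (b \<theta>) < 1"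
        then have "(\<lambda>j. poisson (b \<theta>) (A (s j))) \<longlonglongrightarrow> poisson (b \<theta>) \<alpha>"
          unfolding poisson_def using s(3) \<alpha> by (intro tendsto_intros) (auto simp: o_def)
        then show "(\<lambda>j. (1 - (cmod (b \<theta>)) ^ (2 * N)) * (\<chi>' (cis \<theta>) * poisson (b \<theta>) (A (s j)))) \<longlonglongrightarrow> (1 - (cmod (b \<theta>)) ^ (2 * N)) * (\<chi>' (cis \<theta>) * poisson (b \<theta>) \<alpha>)"
          by (intro tendsto_mult tendsto_const)
      qed
      show "AE \<theta> in circ. norm ((1 - (cmod (b \<theta>)) ^ (2 * N)) * (\<chi>' (cis \<theta>) * poisson (b \<theta>) (A (s j)))) \<le> B * (4 * real N)" for j
        using ae
      proof (rule AE_mp, intro AE_I2 impI)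
        fix \<theta> assume "(\<lambda>n. \<phi> (of_real (rad n) * cis \<theta>)) \<longlonglongrightarrow> b \<theta> \<and> cmod (b \<theta>) < 1"
        then have w: "cmod (b \<theta>) < 1" by simp
        have 0: "0 \<le> (1 - (cmod (b \<theta>)) ^ (2 * N)) * poisson (b \<theta>) (A (s j))"
          using w by (intro mult_nonneg_nonneg poisson_nonneg) (auto simp: power_le_one)
        have "norm ((1 - (cmod (b \<theta>)) ^ (2 * N)) * (\<chi>' (cis \<theta>) * poisson (b \<theta>) (A (s j)))) = \<chi>' (cis \<theta>) * ((1 - (cmod (b \<theta>)) ^ (2 * N)) * poisson (b \<theta>) (A (s j)))"
          using mult_nonneg_nonneg[OF nonneg[of "cis \<theta>"] 0] by (simp add: mult_ac)
        also have "\<dots> \<le> B * (4 * real N)"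
          using 0 bound_nonneg by (intro mult_mono bound poisson_defect_bound[OF w A(1)]) auto
        finally show "norm ((1 - (cmod (b \<theta>)) ^ (2 * N)) * (\<chi>' (cis \<theta>) * poisson (b \<theta>) (A (s j)))) \<le> B * (4 * real N)" .
      qed
    qed auto
    have "(\<lambda>j. boundary_mass b (A (s j))) \<longlonglongrightarrow> boundary_mass b \<alpha>"
      using continuous_on_tendsto_compose[OF continuous_on_boundary_mass[OF \<phi> E b zero] s(3) s(1)] A(1) by (simp add: o_def)
    from tendsto_diff[OF this D] have L: "(\<lambda>j. h N (A (s j))) \<longlonglongrightarrow> h N \<alpha>" using hD A(1) \<alpha> by simp
    have "\<epsilon> \<le> h N (A (s j))" if "j \<ge> N" for j
    proof -
      have "\<epsilon> < h (s j) (A (s j))" by (rule A)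
      also have "\<dots> \<le> h N (A (s j))" unfolding h_def
      proof (rule integral_mono_AE[OF ib[OF A(1)] ib[OF A(1)]])
        show "AE \<theta> in circ. (cmod (b \<theta>)) ^ (2 * s j) * (\<chi>' (cis \<theta>) * poisson (b \<theta>) (A (s j))) \<le> (cmod (b \<theta>)) ^ (2 * N) * (\<chi>' (cis \<theta>) * poisson (b \<theta>) (A (s j)))"
          using ae
        proof (rule AE_mp, intro AE_I2 impI)
          fix \<theta> assume "(\<lambda>n. \<phi> (of_real (rad n) * cis \<theta>)) \<longlonglongrightarrow> b \<theta> \<and> cmod (b \<theta>) < 1"
          moreover have "2 * N \<le> 2 * s j" using that seq_suble[OF s(2), of j] by simp
          ultimately show "(cmod (b \<theta>)) ^ (2 * s j) * (\<chi>' (cis \<theta>) * poisson (b \<theta>) (A (s j))) \<le> (cmod (b \<theta>)) ^ (2 * N) * (\<chi>' (cis \<theta>) * poisson (b \<theta>) (A (s j)))"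
            by (intro mult_right_mono power_decreasing mult_nonneg_nonneg nonneg poisson_nonneg) auto
        qed
      qed
      finally show ?thesis by simp
    qed
    then show ?thesis by (intro LIMSEQ_le_const[OF L]) blast
  qed
  moreover have "(\<lambda>N. h N \<alpha>) \<longlonglongrightarrow> (\<integral>\<theta>. 0 \<partial>circ)" unfolding h_def
  proof (rule integral_dominated_convergence[where w = "\<lambda>\<theta>. norm (\<chi>' (cis \<theta>) * poisson (b \<theta>) \<alpha>)"])
    show "AE \<theta> in circ. (\<lambda>N. (cmod (b \<theta>)) ^ (2 * N) * (\<chi>' (cis \<theta>) * poisson (b \<theta>) \<alpha>)) \<longlonglongrightarrow> 0"
      using ae
    proof (rule AE_mp, intro AE_I2 impI)
      fix \<theta> assume "(\<lambda>n. \<phi> (of_real (rad n) * cis \<theta>)) \<longlonglongrightarrow> b \<theta> \<and> cmod (b \<theta>) < 1"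
      then have "(\<lambda>N. ((cmod (b \<theta>))\<^sup>2) ^ N) \<longlonglongrightarrow> 0" by (intro LIMSEQ_power_zero) (auto simp: power_less_one_iff abs_square_less_1)
      from tendsto_mult[OF this tendsto_const] show "(\<lambda>N. (cmod (b \<theta>)) ^ (2 * N) * (\<chi>' (cis \<theta>) * poisson (b \<theta>) \<alpha>)) \<longlonglongrightarrow> 0"
        by (simp add: power_mult)
    qed
    show "AE \<theta> in circ. norm ((cmod (b \<theta>)) ^ (2 * N) * (\<chi>' (cis \<theta>) * poisson (b \<theta>) \<alpha>)) \<le> norm (\<chi>' (cis \<theta>) * poisson (b \<theta>) \<alpha>)" for N
      using ae
    proof (rule AE_mp, intro AE_I2 impI)
      fix \<theta> assume "(\<lambda>n. \<phi> (of_real (rad n) * cis \<theta>)) \<longlonglongrightarrow> b \<theta> \<and> cmod (b \<theta>) < 1"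
      then have "(cmod (b \<theta>)) ^ (2 * N) * norm (\<chi>' (cis \<theta>) * poisson (b \<theta>) \<alpha>) \<le> 1 * norm (\<chi>' (cis \<theta>) * poisson (b \<theta>) \<alpha>)"
        by (intro mult_right_mono power_le_one) auto
      then show "norm ((cmod (b \<theta>)) ^ (2 * N) * (\<chi>' (cis \<theta>) * poisson (b \<theta>) \<alpha>)) \<le> norm (\<chi>' (cis \<theta>) * poisson (b \<theta>) \<alpha>)"
        by (simp add: abs_mult)
    qed
    show "integrable circ (\<lambda>\<theta>. norm (\<chi>' (cis \<theta>) * poisson (b \<theta>) \<alpha>))" using i[OF \<alpha>] by (rule integrable_norm)
  qed auto
  ultimately have "\<epsilon> \<le> 0" by (intro LIMSEQ_le_const[where X = "\<lambda>N. h N \<alpha>"]) auto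
  then show False using \<epsilon> by simp
qed

end

section \<open>Compactness from local models\<close>

text \<open>The weight used below: it vanishes exactly at the given points and has a positive lower
  bound where all of them are at distance at least delta.\<close>

lemma circle_lipschitz_prod:
  assumes "finite F" "F \<subseteq> sphere 0 1"
  shows "\<exists>L B. circle_lipschitz (\<lambda>\<xi>. \<Prod>\<zeta>\<in>F. cmod (\<xi> - \<zeta>)) L B"
  using assms
proof (induction F rule: finite_induct)
  case empty
  have "circle_lipschitz (\<lambda>\<xi>. \<Prod>\<zeta>\<in>{}. cmod (\<xi> - \<zeta>)) 0 1" by unfold_locales auto
  then show ?case by blast
next
  case (insert \<zeta> F)
  then obtain L B where LB: "circle_lipschitz (\<lambda>\<xi>. \<Prod>\<zeta>\<in>F. cmod (\<xi> - \<zeta>)) L B" by auto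
  then interpret circle_lipschitz "\<lambda>\<xi>. \<Prod>\<zeta>\<in>F. cmod (\<xi> - \<zeta>)" L B .
  have \<zeta>: "cmod \<zeta> = 1" using insert by auto
  define c where "c = (\<lambda>\<xi>. \<Prod>\<zeta>\<in>F. cmod (\<xi> - \<zeta>))"
  have e: "(\<Prod>\<zeta>\<in>insert \<zeta> F. cmod (\<xi> - \<zeta>)) = cmod (\<xi> - \<zeta>) * c \<xi>" for \<xi>
    using insert by (simp add: c_def)
  have le2: "cmod (\<xi> - \<zeta>) \<le> 2" if "cmod \<xi> = 1" for \<xi> using norm_triangle_ineq4[of \<xi> \<zeta>] \<zeta> that by simp
  have "circle_lipschitz (\<lambda>\<xi>. \<Prod>\<zeta>\<in>insert \<zeta> F. cmod (\<xi> - \<zeta>)) (2 * L + B) (2 * B)"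
  proof
    fix \<xi> \<eta> :: complex assume u: "cmod \<xi> = 1" "cmod \<eta> = 1"
    have "\<bar>cmod (\<xi> - \<zeta>) * c \<xi> - cmod (\<eta> - \<zeta>) * c \<eta>\<bar> = \<bar>cmod (\<xi> - \<zeta>) * (c \<xi> - c \<eta>) + (cmod (\<xi> - \<zeta>) - cmod (\<eta> - \<zeta>)) * c \<eta>\<bar>"
      by (simp add: algebra_simps)
    also have "\<dots> \<le> cmod (\<xi> - \<zeta>) * \<bar>c \<xi> - c \<eta>\<bar> + \<bar>cmod (\<xi> - \<zeta>) - cmod (\<eta> - \<zeta>)\<bar> * c \<eta>"
      using nonneg[of \<eta>] by (intro order_trans[OF abs_triangle_ineq]) (auto simp: abs_mult c_def)
    also have "\<dots> \<le> 2 * (L * cmod (\<xi> - \<eta>)) + cmod (\<xi> - \<eta>) * B"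
      using lip[OF u] norm_triangle_ineq3[of "\<xi> - \<zeta>" "\<eta> - \<zeta>"] bound[OF u(2)] nonneg[of \<eta>]
      by (intro add_mono mult_mono le2 u) (auto simp: c_def)
    finally show "\<bar>(\<Prod>\<zeta>\<in>insert \<zeta> F. cmod (\<xi> - \<zeta>)) - (\<Prod>\<zeta>\<in>insert \<zeta> F. cmod (\<eta> - \<zeta>))\<bar> \<le> (2 * L + B) * cmod (\<xi> - \<eta>)"
      unfolding e by (simp add: algebra_simps)
  next
    fix \<xi> :: complex assume "cmod \<xi> = 1"
    then show "(\<Prod>\<zeta>\<in>insert \<zeta> F. cmod (\<xi> - \<zeta>)) \<le> 2 * B"
      unfolding e using bound[of \<xi>] nonneg[of \<xi>] by (intro mult_mono le2) (auto simp: c_def)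
  next
    show "0 \<le> 2 * L + B" using L bound_nonneg by simp
  qed (auto intro!: prod_nonneg)
  then show ?case by blast
qed

lemma poly_shift_bound:
  assumes w: "cmod w < 1"
  shows "(cmod (poly (monom 1 N * q) w))\<^sup>2 \<le> (cmod w) ^ (2 * N) * (\<integral>\<theta>. poisson w (cis \<theta>) * (cmod (poly q (cis \<theta>)))\<^sup>2 \<partial>circ)"
proof -
  have "(cmod (poly (monom 1 N * q) w))\<^sup>2 = (cmod w) ^ (2 * N) * (cmod (poly q w))\<^sup>2"
    by (simp add: poly_monom norm_mult norm_power power_mult_distrib power_even_eq)
  also have "\<dots> \<le> (cmod w) ^ (2 * N) * (\<integral>\<theta>. poisson w (cis \<theta>) * (cmod (poly q (cis \<theta>)))\<^sup>2 \<partial>circ)"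
    by (intro mult_left_mono poly_poisson_bound[OF w]) auto
  finally show ?thesis .
qed

text \<open>For values in the disc of radius s the factor z^N decays geometrically, uniformly in
  \<open>q\<close>. This disposes of each model away from its own contact point.\<close>

lemma poly_shift_bound_const:
  assumes w: "cmod w \<le> s" and s: "s < 1"
  shows "(cmod (poly (monom 1 N * q) w))\<^sup>2 \<le> s ^ (2 * N) * ((1 + s) / (1 - s)) * circ_norm2 q"
proof -
  have w1: "cmod w < 1" using w s by linarith
  have s0: "0 \<le> s" using w norm_ge_zero order_trans by blast
  obtain B where B: "\<And>\<theta>. cmod (poly q (cis \<theta>)) \<le> B" using bounded_poly_circle by blast
  have i: "integrable circ (\<lambda>\<theta>. (cmod (poly q (cis \<theta>)))\<^sup>2)"
    using power_mono[OF B norm_ge_zero, of _ 2] by (intro integrable_circ_bounded[where B = "B\<^sup>2"]) auto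
  have i1: "integrable circ (\<lambda>\<theta>. poisson w (cis \<theta>) * (cmod (poly q (cis \<theta>)))\<^sup>2)"
    using integrable_poisson_times[OF w1, of "\<lambda>\<theta>. (cmod (poly q (cis \<theta>)))\<^sup>2" "B\<^sup>2"] power_mono[OF B norm_ge_zero] by auto
  have "(\<integral>\<theta>. poisson w (cis \<theta>) * (cmod (poly q (cis \<theta>)))\<^sup>2 \<partial>circ) \<le> (\<integral>\<theta>. (1 + s) / (1 - s) * (cmod (poly q (cis \<theta>)))\<^sup>2 \<partial>circ)"
  proof (rule integral_mono[OF i1])
    show "integrable circ (\<lambda>\<theta>. (1 + s) / (1 - s) * (cmod (poly q (cis \<theta>)))\<^sup>2)" using i by (rule integrable_mult_right)
    fix \<theta>
    have "poisson w (cis \<theta>) \<le> (1 + cmod w) / (1 - cmod w)" by (rule poisson_le[OF w1]) simp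
    also have "\<dots> \<le> (1 + s) / (1 - s)" using w s s0 by (intro frac_le) auto
    finally show "poisson w (cis \<theta>) * (cmod (poly q (cis \<theta>)))\<^sup>2 \<le> (1 + s) / (1 - s) * (cmod (poly q (cis \<theta>)))\<^sup>2"
      by (rule mult_right_mono) simp
  qed
  also have "\<dots> = (1 + s) / (1 - s) * circ_norm2 q" unfolding circ_norm2_def by (rule integral_mult_right_zero)
  finally have "(cmod w) ^ (2 * N) * (\<integral>\<theta>. poisson w (cis \<theta>) * (cmod (poly q (cis \<theta>)))\<^sup>2 \<partial>circ) \<le> s ^ (2 * N) * ((1 + s) / (1 - s) * circ_norm2 q)"
    using s0 s w1 by (intro mult_mono power_mono w) (auto intro!: Bochner_Integration.integral_nonneg mult_nonneg_nonneg poisson_nonneg circ_norm2_nonneg divide_nonneg_nonneg)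
  then show ?thesis using poly_shift_bound[OF w1, of N q] by (simp add: mult.assoc)
qed

lemma sup_off_point:
  assumes c: "continuous_on (sphere 0 1) g" and lt: "\<And>\<xi>. cmod \<xi> = 1 \<Longrightarrow> \<xi> \<noteq> \<zeta> \<Longrightarrow> cmod (g \<xi>) < 1" and \<delta>: "\<delta> > 0"
  shows "\<exists>s. 0 \<le> s \<and> s < 1 \<and> (\<forall>\<xi>. cmod \<xi> = 1 \<and> \<delta> \<le> cmod (\<xi> - \<zeta>) \<longrightarrow> cmod (g \<xi>) \<le> s)"
proof (cases "\<exists>\<xi>. cmod \<xi> = 1 \<and> \<delta> \<le> cmod (\<xi> - \<zeta>)")
  case True
  define S where "S = sphere 0 1 \<inter> {\<xi>. \<delta> \<le> cmod (\<xi> - \<zeta>)}"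
  have "compact S" unfolding S_def
    by (intro compact_Int_closed closed_Collect_le continuous_intros) auto
  moreover have "S \<noteq> {}" using True by (auto simp: S_def)
  moreover have "continuous_on S (\<lambda>\<xi>. cmod (g \<xi>))" using c by (intro continuous_on_norm) (auto simp: S_def intro: continuous_on_subset)
  ultimately obtain x where x: "x \<in> S" "\<forall>y\<in>S. cmod (g y) \<le> cmod (g x)" using continuous_attains_sup[of S "\<lambda>\<xi>. cmod (g \<xi>)"] by auto
  have "cmod (g x) < 1" using x(1) \<delta> by (intro lt) (auto simp: S_def)
  then show ?thesis using x by (intro exI[of _ "cmod (g x)"]) (auto simp: S_def)
next
  case False
  then show ?thesis by (intro exI[of _ 0]) auto
qed

lemma poly_bounded_disc: "\<exists>B. \<forall>z. cmod z \<le> 1 \<longrightarrow> cmod (poly p z) \<le> B"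
proof -
  have "bounded (poly p ` cball 0 1)" by (intro compact_imp_bounded compact_continuous_image continuous_intros) auto
  then obtain B where "\<forall>x\<in>cball 0 1. cmod (poly p x) \<le> B" unfolding bounded_iff by auto
  then show ?thesis by (intro exI[of _ B]) auto
qed

text \<open>The circle is split into disjoint short arcs around the contact points and the rest. On
  the arc at \<zeta> only the model \<open>\<psi> \<zeta>\<close> competes with
  \<open>\<phi>\<close>, and \<open>near\<close> with \<open>poly_diff_bound\<close> controls their
  difference. On the rest \<open>\<phi>\<close> stands alone and is handled by
  \<open>boundary_tail_uniform\<close>. All other models have values in a disc of radius s <
  1.\<close>

theorem compact_of_local_models:
  assumes \<phi>: "self_map \<phi>" and bdry: "AE \<theta> in lborel. \<exists>v. radial_lim \<phi> \<theta> v \<and> cmod v < 1" and E: "finite (E_set \<phi>)"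
    and \<psi>: "\<And>\<zeta>. \<zeta> \<in> F_set \<phi> \<Longrightarrow> self_map (\<psi> \<zeta>)"
    and cont: "\<And>\<zeta>. \<zeta> \<in> F_set \<phi> \<Longrightarrow> continuous_on (cball 0 1) (\<psi> \<zeta>)"
    and lt: "\<And>\<zeta> \<xi>. \<zeta> \<in> F_set \<phi> \<Longrightarrow> cmod \<xi> = 1 \<Longrightarrow> \<xi> \<noteq> \<zeta> \<Longrightarrow> cmod (\<psi> \<zeta> \<xi>) < 1"
    and near: "\<And>\<zeta> \<eta>. \<zeta> \<in> F_set \<phi> \<Longrightarrow> \<eta> > 0 \<Longrightarrow> \<exists>\<delta>>0. AE \<theta> in lborel. 0 < cmod (cis \<theta> - \<zeta>) \<and> cmod (cis \<theta> - \<zeta>) < \<delta> \<longrightarrow>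
       (\<forall>v. radial_lim \<phi> \<theta> v \<longrightarrow> cmod v < 1 \<longrightarrow> (cmod (v - \<psi> \<zeta> (cis \<theta>)))\<^sup>2 \<le> \<eta> * ((1 - (cmod v)\<^sup>2) * (1 - (cmod (\<psi> \<zeta> (cis \<theta>)))\<^sup>2)))"
  shows "H2_compact_op (comp_diff \<phi> \<psi> (F_set \<phi>))"
proof (rule compact_comp_diffI)
  define F where "F = F_set \<phi>"
  have finF: "finite F" unfolding F_def by (rule finite_subset[OF F_set_subset_E_set[OF \<phi>] E])
  then show "finite (F_set \<phi>)" unfolding F_def .
  have F1: "cmod \<zeta> = 1" if "\<zeta> \<in> F" for \<zeta> using that unfolding F_def F_set_def by auto
  obtain b where b: "boundary_fun \<phi> b" using boundary_fun_exists[OF \<phi> bdry] by blast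
  have [measurable]: "b \<in> borel_measurable borel" using b by (simp add: boundary_fun_def)
  fix \<epsilon> :: real assume \<epsilon>: "\<epsilon> > 0"
  define K where "K = comp_bound \<phi>"
  have K: "0 \<le> K" unfolding K_def by (rule comp_bound_nonneg[OF \<phi>])
  \<comment> \<open>Balayage multiplies the near part by at most 2 \<eta> K, which this choice keeps
    below \<epsilon>/4.\<close>
  define \<eta> where "\<eta> = \<epsilon> / (8 * (K + 1))"
  have \<eta>: "\<eta> > 0" using \<epsilon> K by (simp add: \<eta>_def)
  define near' where "near' = (\<lambda>\<zeta> \<delta>. AE \<theta> in circ. 0 < cmod (cis \<theta> - \<zeta>) \<and> cmod (cis \<theta> - \<zeta>) < \<delta> \<longrightarrow>
      (cmod (b \<theta> - \<psi> \<zeta> (cis \<theta>)))\<^sup>2 \<le> \<eta> * ((1 - (cmod (b \<theta>))\<^sup>2) * (1 - (cmod (\<psi> \<zeta> (cis \<theta>)))\<^sup>2)))"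
  have "\<exists>\<delta>>0. near' \<zeta> \<delta>" if z: "\<zeta> \<in> F" for \<zeta>
  proof -
    obtain \<delta> where \<delta>: "\<delta> > 0" "AE \<theta> in lborel. 0 < cmod (cis \<theta> - \<zeta>) \<and> cmod (cis \<theta> - \<zeta>) < \<delta> \<longrightarrow>
       (\<forall>v. radial_lim \<phi> \<theta> v \<longrightarrow> cmod v < 1 \<longrightarrow> (cmod (v - \<psi> \<zeta> (cis \<theta>)))\<^sup>2 \<le> \<eta> * ((1 - (cmod v)\<^sup>2) * (1 - (cmod (\<psi> \<zeta> (cis \<theta>)))\<^sup>2)))"
      using near[OF z[unfolded F_def] \<eta>] by blast
    have "AE \<theta> in circ. radial_lim \<phi> \<theta> (b \<theta>) \<and> cmod (b \<theta>) < 1" using b by (simp add: boundary_fun_def)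
    then have "near' \<zeta> \<delta>" unfolding near'_def using AE_circI[OF \<delta>(2)] by eventually_elim auto
    then show ?thesis using \<delta>(1) by blast
  qed
  then obtain d where d: "\<And>\<zeta>. \<zeta> \<in> F \<Longrightarrow> d \<zeta> > 0" "\<And>\<zeta>. \<zeta> \<in> F \<Longrightarrow> near' \<zeta> (d \<zeta>)" by metis
  obtain \<delta>0 where \<delta>0: "\<delta>0 > 0" "\<And>x y. x \<in> F \<Longrightarrow> y \<in> F \<Longrightarrow> x \<noteq> y \<Longrightarrow> \<delta>0 \<le> dist x y"
  proof -
    define S where "S = insert 1 ((\<lambda>(x, y). dist x y) ` {(x, y) \<in> F \<times> F. x \<noteq> y})"
    have S: "finite S" "S \<noteq> {}" unfolding S_def using finF
      by (auto intro!: finite_imageI intro: finite_subset[of _ "F \<times> F"])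
    show ?thesis
    proof (rule that[of "Min S"])
      show "Min S > 0" using S by (subst Min_gr_iff) (auto simp: S_def)
      show "Min S \<le> dist x y" if "x \<in> F" "y \<in> F" "x \<noteq> y" for x y
        using S that by (intro Min_le) (auto simp: S_def image_iff)
    qed
  qed
  \<comment> \<open>With at most half of the minimal separation, a point within \<delta> of one
    contact point is at distance at least \<delta> from all the others.\<close>
  define \<delta> where "\<delta> = Min (insert (\<delta>0 / 2) (d ` F))"
  have \<delta>: "\<delta> > 0" "\<delta> \<le> \<delta>0 / 2" "\<And>\<zeta>. \<zeta> \<in> F \<Longrightarrow> \<delta> \<le> d \<zeta>"
  proof -
    show "\<delta> > 0" unfolding \<delta>_def using finF d(1) \<delta>0(1) by (subst Min_gr_iff) auto
    show "\<delta> \<le> \<delta>0 / 2" unfolding \<delta>_def by (rule Min_le) (use finF in auto)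
    show "\<delta> \<le> d \<zeta>" if "\<zeta> \<in> F" for \<zeta> unfolding \<delta>_def by (rule Min_le) (use finF that in auto)
  qed
  have sep: "\<delta> \<le> cmod (\<xi> - \<zeta>')" if "\<zeta> \<in> F" "\<zeta>' \<in> F" "\<zeta>' \<noteq> \<zeta>" "cmod (\<xi> - \<zeta>) < \<delta>" for \<xi> \<zeta> \<zeta>'
  proof -
    have "\<delta>0 \<le> cmod (\<zeta> - \<zeta>')" using \<delta>0(2)[of \<zeta> \<zeta>'] that by (auto simp: dist_norm)
    also have "\<dots> \<le> cmod (\<xi> - \<zeta>) + cmod (\<xi> - \<zeta>')" using norm_triangle_ineq4[of "\<xi> - \<zeta>'" "\<xi> - \<zeta>"] by simp
    finally show ?thesis using that(4) \<delta>(2) by linarith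
  qed
  have "\<exists>s. 0 \<le> s \<and> s < 1 \<and> (\<forall>\<xi>. cmod \<xi> = 1 \<and> \<delta> \<le> cmod (\<xi> - \<zeta>) \<longrightarrow> cmod (\<psi> \<zeta> \<xi>) \<le> s)" if "\<zeta> \<in> F" for \<zeta>
  proof (rule sup_off_point[OF _ _ \<delta>(1)])
    show "continuous_on (sphere 0 1) (\<psi> \<zeta>)" using cont[of \<zeta>] that by (auto simp: F_def intro: continuous_on_subset)
  qed (use lt that in \<open>auto simp: F_def\<close>)
  then obtain S where S: "\<And>\<zeta>. \<zeta> \<in> F \<Longrightarrow> 0 \<le> S \<zeta>" "\<And>\<zeta>. \<zeta> \<in> F \<Longrightarrow> S \<zeta> < 1"
    "\<And>\<zeta> \<xi>. \<zeta> \<in> F \<Longrightarrow> cmod \<xi> = 1 \<Longrightarrow> \<delta> \<le> cmod (\<xi> - \<zeta>) \<Longrightarrow> cmod (\<psi> \<zeta> \<xi>) \<le> S \<zeta>" by metis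
  define s where "s = Max (insert 0 (S ` F))"
  have s: "0 \<le> s" "s < 1" unfolding s_def using finF S by auto
  have sle: "cmod (\<psi> \<zeta> \<xi>) \<le> s" if "\<zeta> \<in> F" "cmod \<xi> = 1" "\<delta> \<le> cmod (\<xi> - \<zeta>)" for \<zeta> \<xi>
    using S(3)[OF that] finF that(1) unfolding s_def by (auto intro: order_trans[OF _ Max_ge])
  define c where "c = (\<lambda>\<xi>. \<Prod>\<zeta>\<in>F. cmod (\<xi> - \<zeta>))"
  obtain L B where LB: "circle_lipschitz c L B"
    using circle_lipschitz_prod[OF finF] F1 unfolding c_def by (auto simp: subset_iff)
  interpret circle_lipschitz c L B by (rule LB)
  define m where "m = card F"
  have clow: "\<delta> ^ m \<le> c \<xi>" if "\<And>\<zeta>. \<zeta> \<in> F \<Longrightarrow> \<delta> \<le> cmod (\<xi> - \<zeta>)" for \<xi>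
  proof -
    have "\<delta> ^ m = (\<Prod>\<zeta>\<in>F. \<delta>)" by (simp add: m_def)
    also have "\<dots> \<le> c \<xi>" unfolding c_def using that \<delta>(1) by (intro prod_mono) auto
    finally show ?thesis .
  qed
  have c0: "c \<zeta> = 0" if "\<zeta> \<in> F_set \<phi>" for \<zeta> using that finF by (auto simp: c_def F_def)
  \<comment> \<open>On the far set the weight is at least \<delta> to the power m, so C * c >= 1
    there and the weight may be inserted at the cost of the constant C. The tail bound \<epsilon> /
    (8 C) chosen next absorbs this constant.\<close>
  define C where "C = 1 / \<delta> ^ m"
  have C: "C > 0" using \<delta>(1) by (simp add: C_def)
  obtain N1 where N1: "\<And>\<alpha>. cmod \<alpha> = 1 \<Longrightarrow> (\<integral>\<theta>. (cmod (b \<theta>)) ^ (2 * N1) * (c (cis \<theta>) * poisson (b \<theta>) \<alpha>) \<partial>circ) \<le> \<epsilon> / (8 * C)"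
    using boundary_tail_uniform[OF \<phi> E b c0, of "\<epsilon> / (8 * C)"] \<epsilon> C by auto
  have "(\<lambda>N. 2 * (real m)\<^sup>2 * ((s\<^sup>2) ^ N * ((1 + s) / (1 - s)))) \<longlonglongrightarrow> 2 * (real m)\<^sup>2 * (0 * ((1 + s) / (1 - s)))"
    using s by (intro tendsto_mult tendsto_const LIMSEQ_power_zero) (auto simp: abs_square_less_1)
  then have "\<forall>\<^sub>F N in sequentially. 2 * (real m)\<^sup>2 * ((s\<^sup>2) ^ N * ((1 + s) / (1 - s))) < \<epsilon> / 4"
    using \<epsilon> by (intro order_tendstoD(2)) auto
  then obtain N where N: "N \<ge> N1" "2 * (real m)\<^sup>2 * ((s\<^sup>2) ^ N * ((1 + s) / (1 - s))) < \<epsilon> / 4"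
    using eventually_happens[OF eventually_conj[OF _ eventually_ge_at_top[of N1]]] by fastforce
  define \<tau> where "\<tau> = s ^ (2 * N) * ((1 + s) / (1 - s))"
  have \<tau>: "0 \<le> \<tau>" "2 * (real m)\<^sup>2 * \<tau> \<le> \<epsilon> / 4" using N(2) s by (auto simp: \<tau>_def power_mult)
  show "\<exists>N. \<forall>q r. 0 < r \<and> r < 1 \<longrightarrow> (\<integral>\<theta>. (cmod (comp_diff \<phi> \<psi> (F_set \<phi>) (poly (monom 1 N * q)) (of_real r * cis \<theta>)))\<^sup>2 \<partial>circ) \<le> \<epsilon> * circ_norm2 q"
  proof (rule exI[of _ N], intro allI impI)
    fix q :: "complex poly" and r :: real assume r: "0 < r \<and> r < 1"
    define p where "p = monom 1 N * q"
    define I where "I = (\<lambda>w. \<integral>\<alpha>. poisson w (cis \<alpha>) * (cmod (poly q (cis \<alpha>)))\<^sup>2 \<partial>circ)"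
    have Ip: "I w = (\<integral>\<alpha>. poisson w (cis \<alpha>) * (cmod (poly p (cis \<alpha>)))\<^sup>2 \<partial>circ)" for w
      by (simp add: I_def p_def poly_monom norm_mult norm_power)
    have I0: "0 \<le> I w" if "cmod w < 1" for w
      unfolding I_def using that by (intro Bochner_Integration.integral_nonneg mult_nonneg_nonneg poisson_nonneg) auto
    define n2 where "n2 = circ_norm2 q"
    have n2: "0 \<le> n2" unfolding n2_def by (rule circ_norm2_nonneg)
    define g where "g = (\<lambda>\<theta>. poly p (b \<theta>) - (\<Sum>\<zeta>\<in>F. poly p (\<psi> \<zeta> (cis \<theta>))))"
    have small: "(\<Sum>\<zeta>\<in>G. cmod (poly p (\<psi> \<zeta> (cis \<theta>))))\<^sup>2 \<le> (real m)\<^sup>2 * (\<tau> * n2)"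
      if G: "G \<subseteq> F" "\<And>\<zeta>. \<zeta> \<in> G \<Longrightarrow> \<delta> \<le> cmod (cis \<theta> - \<zeta>)" for G \<theta>
    proof -
      have "cmod (poly p (\<psi> \<zeta> (cis \<theta>))) \<le> sqrt (\<tau> * n2)" if "\<zeta> \<in> G" for \<zeta>
      proof (rule real_le_rsqrt)
        have "cmod (\<psi> \<zeta> (cis \<theta>)) \<le> s" using G that by (intro sle) auto
        from poly_shift_bound_const[OF this s(2)] show "(cmod (poly p (\<psi> \<zeta> (cis \<theta>))))\<^sup>2 \<le> \<tau> * n2"
          unfolding p_def \<tau>_def n2_def .
      qed
      then have "(\<Sum>\<zeta>\<in>G. cmod (poly p (\<psi> \<zeta> (cis \<theta>)))) \<le> real (card G) * sqrt (\<tau> * n2)" by (rule sum_bounded_above)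
      also have "\<dots> \<le> real m * sqrt (\<tau> * n2)"
        using card_mono[OF finF G(1)] \<tau>(1) n2 by (intro mult_right_mono) (auto simp: m_def)
      finally have "(\<Sum>\<zeta>\<in>G. cmod (poly p (\<psi> \<zeta> (cis \<theta>))))\<^sup>2 \<le> (real m * sqrt (\<tau> * n2))\<^sup>2"
        by (intro power_mono sum_nonneg) auto
      also have "\<dots> = (real m)\<^sup>2 * (\<tau> * n2)" using \<tau>(1) n2 by (simp add: power_mult_distrib)
      finally show ?thesis .
    qed
    \<comment> \<open>One density covers both cases: \<eta> serves near a contact point, the
      weighted tail serves far from them, and 2 comes from the square of a sum of two terms. Each
      part contributes at most \<epsilon>/4 after balayage, and the remaining models at most another
      \<epsilon>/4.\<close>
    define v where "v = (\<lambda>\<theta>. 2 * (\<eta> + C * ((cmod (b \<theta>)) ^ (2 * N1) * c (cis \<theta>))))"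
    have v0: "0 \<le> v \<theta>" for \<theta> unfolding v_def using \<eta> C nonneg[of "cis \<theta>"] by auto
    have point: "AE \<theta> in circ. (cmod (g \<theta>))\<^sup>2 \<le> v \<theta> * I (b \<theta>) + 2 * ((real m)\<^sup>2 * (\<tau> * n2))"
    proof -
      have "AE \<theta> in circ. \<forall>\<zeta>\<in>F. 0 < cmod (cis \<theta> - \<zeta>) \<and> cmod (cis \<theta> - \<zeta>) < d \<zeta> \<longrightarrow>
        (cmod (b \<theta> - \<psi> \<zeta> (cis \<theta>)))\<^sup>2 \<le> \<eta> * ((1 - (cmod (b \<theta>))\<^sup>2) * (1 - (cmod (\<psi> \<zeta> (cis \<theta>)))\<^sup>2))"
        using d(2) finF unfolding near'_def by (intro AE_finite_allI) auto
      moreover have "AE \<theta> in circ. \<forall>\<zeta>\<in>F. cis \<theta> \<noteq> \<zeta>"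
      proof (intro AE_finite_allI finF)
        fix \<zeta> assume "\<zeta> \<in> F"
        have "AE \<theta> in lborel. cis \<theta> \<noteq> \<zeta>"
          using AE_not_in[OF arc_null_singleton[of \<zeta>, unfolded arc_null_def]] by auto
        then show "AE \<theta> in circ. cis \<theta> \<noteq> \<zeta>" by (rule AE_circI)
      qed
      moreover have "AE \<theta> in circ. cmod (b \<theta>) < 1" using boundary_fun_AE_seq[OF b] by eventually_elim auto
      ultimately show ?thesis
      proof eventually_elim
        case (elim \<theta>)
        have cn: "0 \<le> C * ((cmod (b \<theta>)) ^ (2 * N1) * c (cis \<theta>))" using C nonneg[of "cis \<theta>"] by auto
        show ?case
        proof (cases "\<exists>\<zeta>\<in>F. cmod (cis \<theta> - \<zeta>) < \<delta>")
          case True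
          then obtain \<zeta> where \<zeta>: "\<zeta> \<in> F" "cmod (cis \<theta> - \<zeta>) < \<delta>" by blast
          have ne: "cis \<theta> \<noteq> \<zeta>" using elim(2) \<zeta> by blast
          have l1: "cmod (\<psi> \<zeta> (cis \<theta>)) < 1" using lt[of \<zeta> "cis \<theta>"] \<zeta> ne by (simp add: F_def)
          have pos: "0 < 1 - (cmod (b \<theta>))\<^sup>2" "0 < 1 - (cmod (\<psi> \<zeta> (cis \<theta>)))\<^sup>2"
            using elim(3) l1 by (auto simp: abs_square_less_1)
          have "(cmod (b \<theta> - \<psi> \<zeta> (cis \<theta>)))\<^sup>2 \<le> \<eta> * ((1 - (cmod (b \<theta>))\<^sup>2) * (1 - (cmod (\<psi> \<zeta> (cis \<theta>)))\<^sup>2))"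
            using elim(1) \<zeta> \<delta>(3)[OF \<zeta>(1)] ne by auto
          then have "(cmod (b \<theta> - \<psi> \<zeta> (cis \<theta>)))\<^sup>2 / ((1 - (cmod (b \<theta>))\<^sup>2) * (1 - (cmod (\<psi> \<zeta> (cis \<theta>)))\<^sup>2)) \<le> \<eta>"
            using pos by (subst pos_divide_le_eq) auto
          then have "(cmod (b \<theta> - \<psi> \<zeta> (cis \<theta>)))\<^sup>2 / ((1 - (cmod (b \<theta>))\<^sup>2) * (1 - (cmod (\<psi> \<zeta> (cis \<theta>)))\<^sup>2)) * I (b \<theta>) \<le> \<eta> * I (b \<theta>)"
            by (rule mult_right_mono[OF _ I0[OF elim(3)]])
          then have 1: "(cmod (poly p (b \<theta>) - poly p (\<psi> \<zeta> (cis \<theta>))))\<^sup>2 \<le> \<eta> * I (b \<theta>)"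
            using poly_diff_bound[OF elim(3) l1, of p] unfolding Ip by linarith
          have 2: "(cmod (\<Sum>\<zeta>\<in>F - {\<zeta>}. poly p (\<psi> \<zeta> (cis \<theta>))))\<^sup>2 \<le> (real m)\<^sup>2 * (\<tau> * n2)"
            by (rule order_trans[OF power_mono[OF norm_sum] small]) (use sep[OF \<zeta>(1) _ _ \<zeta>(2)] in auto)
          have "g \<theta> = (poly p (b \<theta>) - poly p (\<psi> \<zeta> (cis \<theta>))) + - (\<Sum>\<zeta>\<in>F - {\<zeta>}. poly p (\<psi> \<zeta> (cis \<theta>)))"
            unfolding g_def using sum.remove[OF finF \<zeta>(1), of "\<lambda>\<zeta>. poly p (\<psi> \<zeta> (cis \<theta>))"] by simp
          then have "(cmod (g \<theta>))\<^sup>2 \<le> 2 * (\<eta> * I (b \<theta>)) + 2 * ((real m)\<^sup>2 * (\<tau> * n2))"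
            using square_norm_sum_le[of "poly p (b \<theta>) - poly p (\<psi> \<zeta> (cis \<theta>))" "- (\<Sum>\<zeta>\<in>F - {\<zeta>}. poly p (\<psi> \<zeta> (cis \<theta>)))"] 1 2 by simp
          moreover have "2 * (\<eta> * I (b \<theta>)) \<le> v \<theta> * I (b \<theta>)"
            unfolding v_def using mult_right_mono[OF cn I0[OF elim(3)]] by (simp add: algebra_simps)
          ultimately show ?thesis by linarith
        next
          case False
          then have far: "\<And>\<zeta>. \<zeta> \<in> F \<Longrightarrow> \<delta> \<le> cmod (cis \<theta> - \<zeta>)" by (auto simp: not_less)
          have "(cmod (poly p (b \<theta>)))\<^sup>2 \<le> (cmod (b \<theta>)) ^ (2 * N) * I (b \<theta>)"
            unfolding p_def I_def by (rule poly_shift_bound[OF elim(3)])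
          also have "\<dots> \<le> (C * ((cmod (b \<theta>)) ^ (2 * N1) * c (cis \<theta>))) * I (b \<theta>)"
          proof (rule mult_right_mono[OF _ I0[OF elim(3)]])
            have "1 \<le> C * c (cis \<theta>)" using clow[OF far] \<delta>(1) by (simp add: C_def field_simps)
            then have "(cmod (b \<theta>)) ^ (2 * N1) * 1 \<le> (cmod (b \<theta>)) ^ (2 * N1) * (C * c (cis \<theta>))" by (intro mult_left_mono) auto
            moreover have "(cmod (b \<theta>)) ^ (2 * N) \<le> (cmod (b \<theta>)) ^ (2 * N1)" using elim(3) N(1) by (intro power_decreasing) auto
            ultimately show "(cmod (b \<theta>)) ^ (2 * N) \<le> C * ((cmod (b \<theta>)) ^ (2 * N1) * c (cis \<theta>))" by (simp add: mult_ac)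
          qed
          finally have 1: "(cmod (poly p (b \<theta>)))\<^sup>2 \<le> (C * ((cmod (b \<theta>)) ^ (2 * N1) * c (cis \<theta>))) * I (b \<theta>)" .
          have 2: "(cmod (\<Sum>\<zeta>\<in>F. poly p (\<psi> \<zeta> (cis \<theta>))))\<^sup>2 \<le> (real m)\<^sup>2 * (\<tau> * n2)"
            by (rule order_trans[OF power_mono[OF norm_sum] small]) (use far in auto)
          have "(cmod (g \<theta>))\<^sup>2 \<le> 2 * ((C * ((cmod (b \<theta>)) ^ (2 * N1) * c (cis \<theta>))) * I (b \<theta>)) + 2 * ((real m)\<^sup>2 * (\<tau> * n2))"
            using square_norm_sum_le[of "poly p (b \<theta>)" "- (\<Sum>\<zeta>\<in>F. poly p (\<psi> \<zeta> (cis \<theta>)))"] 1 2 by (simp add: g_def)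
          moreover have "2 * ((C * ((cmod (b \<theta>)) ^ (2 * N1) * c (cis \<theta>))) * I (b \<theta>)) \<le> v \<theta> * I (b \<theta>)"
            unfolding v_def using mult_right_mono[OF less_imp_le[OF \<eta>] I0[OF elim(3)]] by (simp add: algebra_simps)
          ultimately show ?thesis by linarith
        qed
      qed
    qed
    have vK: "(\<integral>\<^sup>+\<theta>. ennreal (v \<theta>) * ennreal (poisson (b \<theta>) (cis \<alpha>)) \<partial>circ) \<le> ennreal (\<epsilon> / 2)" for \<alpha>
    proof -
      let ?h = "\<lambda>\<theta>. (cmod (b \<theta>)) ^ (2 * N1) * (c (cis \<theta>) * poisson (b \<theta>) (cis \<alpha>))"
      have ae: "AE \<theta> in circ. 0 \<le> poisson (b \<theta>) (cis \<alpha>)"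
        using boundary_fun_AE_seq[OF b] by eventually_elim (auto intro!: poisson_nonneg)
      have ih: "integrable circ ?h"
      proof (rule Bochner_Integration.integrable_bound[OF boundary_mass_close(1)[OF \<phi> E _ b c0, of "cis \<alpha>"]])
        show "AE \<theta> in circ. norm (?h \<theta>) \<le> norm (c (cis \<theta>) * poisson (b \<theta>) (cis \<alpha>))"
          using boundary_fun_AE_seq[OF b]
        proof eventually_elim
          case (elim \<theta>)
          then have "(cmod (b \<theta>)) ^ (2 * N1) * norm (c (cis \<theta>) * poisson (b \<theta>) (cis \<alpha>)) \<le> 1 * norm (c (cis \<theta>) * poisson (b \<theta>) (cis \<alpha>))"
            by (intro mult_right_mono power_le_one) auto
          then show ?case by (simp add: abs_mult)
        qed
      qed auto
      have "(\<integral>\<^sup>+\<theta>. ennreal (v \<theta>) * ennreal (poisson (b \<theta>) (cis \<alpha>)) \<partial>circ) = (\<integral>\<^sup>+\<theta>. ennreal (2 * \<eta>) * ennreal (poisson (b \<theta>) (cis \<alpha>)) + ennreal (2 * C) * ennreal (?h \<theta>) \<partial>circ)"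
      proof (rule nn_integral_cong_AE, use ae in eventually_elim)
        case (elim \<theta>)
        have "ennreal (v \<theta>) * ennreal (poisson (b \<theta>) (cis \<alpha>)) = ennreal (2 * \<eta> * poisson (b \<theta>) (cis \<alpha>) + 2 * C * ?h \<theta>)"
          using v0 elim by (simp add: ennreal_mult[symmetric] v_def algebra_simps)
        also have "\<dots> = ennreal (2 * \<eta>) * ennreal (poisson (b \<theta>) (cis \<alpha>)) + ennreal (2 * C) * ennreal (?h \<theta>)"
          using elim \<eta> C nonneg[of "cis \<theta>"] by (simp add: ennreal_mult)
        finally show ?case .
      qed
      also have "\<dots> = ennreal (2 * \<eta>) * (\<integral>\<^sup>+\<theta>. ennreal (poisson (b \<theta>) (cis \<alpha>)) \<partial>circ) + ennreal (2 * C) * (\<integral>\<^sup>+\<theta>. ennreal (?h \<theta>) \<partial>circ)"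
        by (subst nn_integral_add) (auto simp: nn_integral_cmult)
      also have "(\<integral>\<^sup>+\<theta>. ennreal (?h \<theta>) \<partial>circ) = ennreal (\<integral>\<theta>. ?h \<theta> \<partial>circ)"
        by (rule nn_integral_eq_integral[OF ih], use ae in eventually_elim) (auto intro!: mult_nonneg_nonneg nonneg)
      also have "ennreal (2 * \<eta>) * (\<integral>\<^sup>+\<theta>. ennreal (poisson (b \<theta>) (cis \<alpha>)) \<partial>circ) + ennreal (2 * C) * ennreal (\<integral>\<theta>. ?h \<theta> \<partial>circ) \<le> ennreal (2 * \<eta>) * ennreal K + ennreal (2 * C) * ennreal (\<epsilon> / (8 * C))"
        using N1[of "cis \<alpha>"] order_trans[OF boundary_poisson_le[OF \<phi> b, of "cis \<alpha>"] ennreal_leI[OF poisson_le_comp_bound[OF \<phi>, of "cis \<alpha>"]]]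
        unfolding K_def by (intro add_mono mult_left_mono ennreal_leI) auto
      also have "\<dots> = ennreal (2 * \<eta> * K + 2 * C * (\<epsilon> / (8 * C)))"
        using \<eta> K C \<epsilon> by (simp add: ennreal_mult[symmetric] ennreal_plus[symmetric] del: ennreal_plus)
      also have "\<dots> \<le> ennreal (\<epsilon> / 2)"
      proof (rule ennreal_leI)
        have "2 * \<eta> * K \<le> 2 * (\<eta> * (K + 1))" using \<eta> by (simp add: algebra_simps)
        also have "\<dots> = \<epsilon> / 4" using K by (simp add: \<eta>_def field_simps)
        finally show "2 * \<eta> * K + 2 * C * (\<epsilon> / (8 * C)) \<le> \<epsilon> / 2" using C by simp
      qed
      finally show ?thesis .
    qed
    have gm: "(\<lambda>\<theta>. g \<theta>) \<in> borel_measurable borel"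
    proof -
      have "(\<lambda>\<theta>. \<psi> \<zeta> (cis \<theta>)) \<in> borel_measurable borel" if "\<zeta> \<in> F" for \<zeta>
      proof (rule borel_measurable_continuous_onI)
        show "continuous_on UNIV (\<lambda>\<theta>. \<psi> \<zeta> (cis \<theta>))"
          by (rule continuous_on_compose2[OF cont[OF that[unfolded F_def]]]) (auto intro: continuous_intros)
      qed
      then have "(\<lambda>\<theta>. poly p (\<psi> \<zeta> (cis \<theta>))) \<in> borel_measurable borel" if "\<zeta> \<in> F" for \<zeta>
        using that by (intro borel_measurable_continuous_on[OF continuous_on_poly[OF continuous_on_id, simplified id_def]])
      moreover have "(\<lambda>\<theta>. poly p (b \<theta>)) \<in> borel_measurable borel"
        by (intro borel_measurable_continuous_on[OF continuous_on_poly[OF continuous_on_id, simplified id_def]]) auto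
      ultimately show ?thesis unfolding g_def by (intro borel_measurable_diff borel_measurable_sum) auto
    qed
    have nn: "(\<integral>\<^sup>+\<theta>. ennreal ((cmod (g \<theta>))\<^sup>2) \<partial>circ) \<le> ennreal (\<epsilon> * n2)"
    proof -
      have bl: "(\<integral>\<^sup>+\<theta>. ennreal (v \<theta> * I (b \<theta>)) \<partial>circ) \<le> ennreal (\<epsilon> / 2) * ennreal (circ_norm2 q)"
      proof (rule balayage[where v = "\<lambda>\<theta>. ennreal (v \<theta>)" and w = b, OF _ _ _ vK])
        show "(\<lambda>\<theta>. ennreal (v \<theta>)) \<in> borel_measurable borel" unfolding v_def by measurable
        show "AE \<theta> in circ. cmod (b \<theta>) < 1" using boundary_fun_AE_seq[OF b] by eventually_elim auto
        show "AE \<theta> in circ. ennreal (v \<theta> * I (b \<theta>)) \<le> ennreal (v \<theta>) * ennreal (\<integral>\<alpha>. poisson (b \<theta>) (cis \<alpha>) * (cmod (poly q (cis \<alpha>)))\<^sup>2 \<partial>circ)"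
          unfolding I_def using v0 by (simp add: ennreal_mult')
      qed auto
      have "(\<integral>\<^sup>+\<theta>. ennreal ((cmod (g \<theta>))\<^sup>2) \<partial>circ) \<le> (\<integral>\<^sup>+\<theta>. ennreal (v \<theta> * I (b \<theta>) + 2 * ((real m)\<^sup>2 * (\<tau> * n2))) \<partial>circ)"
        by (rule nn_integral_mono_AE, use point in eventually_elim) (rule ennreal_leI)
      also have "\<dots> = (\<integral>\<^sup>+\<theta>. ennreal (v \<theta> * I (b \<theta>)) + ennreal (2 * ((real m)\<^sup>2 * (\<tau> * n2))) \<partial>circ)"
      proof (rule nn_integral_cong_AE, use boundary_fun_AE_seq[OF b] in eventually_elim)
        case (elim \<theta>)
        then show ?case using v0[of \<theta>] I0[of "b \<theta>"] \<tau>(1) n2 by (intro ennreal_plus) auto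
      qed
      also have "\<dots> = (\<integral>\<^sup>+\<theta>. ennreal (v \<theta> * I (b \<theta>)) \<partial>circ) + ennreal (2 * ((real m)\<^sup>2 * (\<tau> * n2)))"
      proof (subst nn_integral_add)
        have "(\<lambda>\<theta>. \<integral>\<alpha>. poisson (b \<theta>) (cis \<alpha>) * (cmod (poly q (cis \<alpha>)))\<^sup>2 \<partial>circ) \<in> borel_measurable circ"
          by (rule circ.borel_measurable_lebesgue_integral) measurable
        then show "(\<lambda>\<theta>. ennreal (v \<theta> * I (b \<theta>))) \<in> borel_measurable circ"
          unfolding I_def v_def by measurable
      qed (auto simp: circ.emeasure_space_1[simplified])
      also have "\<dots> \<le> ennreal (\<epsilon> / 2) * ennreal (circ_norm2 q) + ennreal (2 * ((real m)\<^sup>2 * (\<tau> * n2)))"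
        by (intro add_right_mono bl)
      also have "\<dots> = ennreal (\<epsilon> / 2 * n2 + 2 * ((real m)\<^sup>2 * (\<tau> * n2)))"
      proof -
        have "ennreal (\<epsilon> / 2 * n2) = ennreal (\<epsilon> / 2) * ennreal (circ_norm2 q)" unfolding n2_def using \<epsilon> by (intro ennreal_mult') auto
        moreover have "ennreal (\<epsilon> / 2 * n2 + 2 * ((real m)\<^sup>2 * (\<tau> * n2))) = ennreal (\<epsilon> / 2 * n2) + ennreal (2 * ((real m)\<^sup>2 * (\<tau> * n2)))"
          using \<epsilon> n2 \<tau>(1) by (intro ennreal_plus) auto
        ultimately show ?thesis by (simp only:)
      qed
      also have "\<dots> \<le> ennreal (\<epsilon> * n2)"
      proof (rule ennreal_leI)
        have "2 * ((real m)\<^sup>2 * (\<tau> * n2)) \<le> \<epsilon> / 4 * n2" using mult_right_mono[OF \<tau>(2) n2] by (simp add: mult_ac)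
        then show "\<epsilon> / 2 * n2 + 2 * ((real m)\<^sup>2 * (\<tau> * n2)) \<le> \<epsilon> * n2"
          using mult_nonneg_nonneg[OF less_imp_le[OF \<epsilon>] n2] by (simp add: algebra_simps)
      qed
      finally show ?thesis .
    qed
    have real: "(\<integral>\<theta>. (cmod (g \<theta>))\<^sup>2 \<partial>circ) \<le> \<epsilon> * n2"
      using nn \<epsilon> n2 by (intro integral_real_bounded) auto
    let ?T = "comp_diff \<phi> \<psi> (F_set \<phi>) (poly p)"
    have hol: "?T holomorphic_on ball 0 1"
      by (rule comp_diff_holomorphic[where \<phi> = \<phi> and \<psi> = \<psi> and I = "F_set \<phi>"]) (use \<phi> \<psi> in \<open>auto intro: holomorphic_intros\<close>)
    obtain Bp where Bp: "\<And>z. cmod z \<le> 1 \<Longrightarrow> cmod (poly p z) \<le> Bp" using poly_bounded_disc by blast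
    \<comment> \<open>Polynomials are bounded on the disc, so the boundary integral is the limit of
      the integrals over the circles of radius \<open>rad j\<close>. It thus bounds the squared
      norm, which in turn bounds the mean over every circle of radius r.\<close>
    have lim: "(\<lambda>j. \<integral>\<theta>. (cmod (?T (of_real (rad j) * cis \<theta>)))\<^sup>2 \<partial>circ) \<longlonglongrightarrow> (\<integral>\<theta>. (cmod (g \<theta>))\<^sup>2 \<partial>circ)"
    proof (rule integral_dominated_convergence[where w = "\<lambda>_. (Bp + (\<Sum>\<zeta>\<in>F. Bp))\<^sup>2"])
      show "(\<lambda>\<theta>. (cmod (?T (of_real (rad j) * cis \<theta>)))\<^sup>2) \<in> borel_measurable circ" for j
        using measurable_dilate[OF hol rad(2,3)[of j]] by measurable
      show "(\<lambda>\<theta>. (cmod (g \<theta>))\<^sup>2) \<in> borel_measurable circ" using gm by measurable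
      have bdT: "cmod (?T z) \<le> Bp + (\<Sum>\<zeta>\<in>F. Bp)" if "cmod z < 1" for z
        unfolding comp_diff_def F_def[symmetric]
      proof (rule order_trans[OF norm_triangle_ineq4], intro add_mono sum_norm_le)
        show "cmod (poly p (\<phi> z)) \<le> Bp" using self_map_norm[OF \<phi> that] by (intro Bp) auto
        show "cmod (poly p (\<psi> \<zeta> z)) \<le> Bp" if "\<zeta> \<in> F" for \<zeta>
          using self_map_norm[OF \<psi>[OF that[unfolded F_def]] \<open>cmod z < 1\<close>] by (intro Bp) auto
      qed
      have "(cmod (?T (of_real (rad j) * cis \<theta>)))\<^sup>2 \<le> (Bp + (\<Sum>\<zeta>\<in>F. Bp))\<^sup>2" for j \<theta>
        using rad[of j] by (intro power_mono bdT) (auto simp: norm_mult)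
      then show "AE \<theta> in circ. norm ((cmod (?T (of_real (rad j) * cis \<theta>)))\<^sup>2) \<le> (Bp + (\<Sum>\<zeta>\<in>F. Bp))\<^sup>2" for j by simp
      show "AE \<theta> in circ. (\<lambda>j. (cmod (?T (of_real (rad j) * cis \<theta>)))\<^sup>2) \<longlonglongrightarrow> (cmod (g \<theta>))\<^sup>2"
        using boundary_fun_AE_seq[OF b]
      proof eventually_elim
        case (elim \<theta>)
        have "(\<lambda>j. \<psi> \<zeta> (of_real (rad j) * cis \<theta>)) \<longlonglongrightarrow> \<psi> \<zeta> (cis \<theta>)" if "\<zeta> \<in> F" for \<zeta>
        proof (rule continuous_on_tendsto_compose[OF cont[OF that[unfolded F_def]]])
          show "(\<lambda>j. of_real (rad j) * cis \<theta>) \<longlonglongrightarrow> cis \<theta>"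
            using tendsto_mult[OF tendsto_of_real[OF rad_tendsto] tendsto_const, of "cis \<theta>"] by simp
        qed (use rad in \<open>auto simp: norm_mult less_imp_le\<close>)
        then have "(\<lambda>j. ?T (of_real (rad j) * cis \<theta>)) \<longlonglongrightarrow> g \<theta>"
          unfolding comp_diff_def F_def[symmetric] g_def using elim
          by (intro tendsto_diff tendsto_sum tendsto_poly) auto
        then show ?case by (intro tendsto_power tendsto_norm)
      qed
    qed auto
    have H: "?T \<in> H2" "(h2norm ?T)\<^sup>2 \<le> (\<integral>\<theta>. (cmod (g \<theta>))\<^sup>2 \<partial>circ)"
      by (rule H2_boundI(1)[OF hol rad(2) rad(3) rad_tendsto order_refl lim], rule H2_boundI(2)[OF hol rad(2) rad(3) rad_tendsto order_refl lim])
    have "(\<integral>\<theta>. (cmod (?T (of_real r * cis \<theta>)))\<^sup>2 \<partial>circ) \<le> (h2norm ?T)\<^sup>2"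
      using r by (intro H2_circle_mean_le[OF H(1)]) auto
    then show "(\<integral>\<theta>. (cmod (comp_diff \<phi> \<psi> (F_set \<phi>) (poly (monom 1 N * q)) (of_real r * cis \<theta>)))\<^sup>2 \<partial>circ) \<le> \<epsilon> * circ_norm2 q"
      using H(2) real unfolding p_def n2_def by linarith
  qed
qed (use \<phi> \<psi> in auto)

section \<open>Continued fractions of polynomials\<close>

text \<open>Numerator and denominator of the fraction obtained from \<open>N / D\<close> by the steps
  \<open>R \<mapsto> 1 / (A / t - \<beta> - R)\<close> for the pairs \<open>(A, \<beta>)\<close> of the list, where \<open>t = \<i> (1 - z) / (1 + z)\<close>,
  cleared of denominators.\<close>
fun cf_num cf_den :: "(real \<times> real) list \<Rightarrow> complex poly \<Rightarrow> complex poly \<Rightarrow> complex poly" where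
  "cf_num [] N D = N"
| "cf_den [] N D = D"
| "cf_num (x # l) N D = [:\<i>, -\<i>:] * cf_den l N D"
| "cf_den (x # l) N D = [:of_real (fst x) - \<i> * of_real (snd x), of_real (fst x) + \<i> * of_real (snd x):] * cf_den l N D - [:\<i>, -\<i>:] * cf_num l N D"

text \<open>Each step acts linearly on the pair of numerator and denominator. This isolates the free
  parameter of the last fraction as the coefficient of a pencil.\<close>

lemma cf_linear:
  "cf_num l (a * N + N') (a * D + D') = a * cf_num l N D + cf_num l N' D'"
  "cf_den l (a * N + N') (a * D + D') = a * cf_den l N D + cf_den l N' D'"
proof (induction l)
  case (Cons x l)
  define u :: "complex poly" where "u = [:\<i>, -\<i>:]"
  define b where "b = [:of_real (fst x) - \<i> * of_real (snd x), of_real (fst x) + \<i> * of_real (snd x):]"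
  { case 1 show ?case unfolding cf_num.simps Cons(2) u_def[symmetric] by (simp add: algebra_simps)
  next case 2 show ?case unfolding cf_den.simps Cons u_def[symmetric] b_def[symmetric] by (simp add: algebra_simps) }
qed simp_all

text \<open>Each step is a 2 by 2 polynomial matrix with determinant the square of
  \<open>[:\<i>, -\<i>:]\<close>. Common roots of two denominators, for starting pairs whose
  determinant vanishes only at 1, can therefore only occur at 1.\<close>

lemma cf_determinant:
  "cf_num l N D * cf_den l N' D' - cf_num l N' D' * cf_den l N D = (N * D' - N' * D) * [:\<i>, -\<i>:] ^ (2 * length l)"
proof (induction l)
  case (Cons x l)
  define u :: "complex poly" where "u = [:\<i>, -\<i>:]"
  define a where "a = [:of_real (fst x) - \<i> * of_real (snd x), of_real (fst x) + \<i> * of_real (snd x):]"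
  have "cf_num (x # l) N D * cf_den (x # l) N' D' - cf_num (x # l) N' D' * cf_den (x # l) N D
    = u\<^sup>2 * (cf_num l N D * cf_den l N' D' - cf_num l N' D' * cf_den l N D)"
    by (simp add: u_def[symmetric] a_def[symmetric] algebra_simps power2_eq_square)
  also have "\<dots> = (N * D' - N' * D) * u ^ (2 * length (x # l))"
    unfolding Cons u_def[symmetric] by (simp add: power2_eq_square mult_ac)
  finally show ?case by (simp add: u_def)
qed simp

lemma degree_linear_factor: "degree [:a, b:] \<le> 1"
  by simp

lemma degree_cf:
  assumes "degree N \<le> d" "degree D \<le> d"
  shows "degree (cf_num l N D) \<le> d + length l" "degree (cf_den l N D) \<le> d + length l"
proof (induction l)
  case (Cons x l)
  {
    case 1
    show ?case using degree_mult_le[of "[:\<i>, -\<i>:]" "cf_den l N D"] Cons(2) degree_linear_factor[of \<i> "-\<i>"] by simp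
  next
    case 2
    show ?case unfolding cf_den.simps
    proof (rule degree_diff_le)
      show "degree ([:of_real (fst x) - \<i> * of_real (snd x), of_real (fst x) + \<i> * of_real (snd x):] * cf_den l N D) \<le> d + length (x # l)"
        using degree_mult_le[of "[:of_real (fst x) - \<i> * of_real (snd x), of_real (fst x) + \<i> * of_real (snd x):]" "cf_den l N D"] Cons(2)
          degree_linear_factor[of "of_real (fst x) - \<i> * of_real (snd x)" "of_real (fst x) + \<i> * of_real (snd x)"] by simp
      show "degree ([:\<i>, -\<i>:] * cf_num l N D) \<le> d + length (x # l)"
        using degree_mult_le[of "[:\<i>, -\<i>:]" "cf_num l N D"] Cons(1) degree_linear_factor[of \<i> "-\<i>"] by simp
    qed
  }
qed (use assms in auto)

text \<open>At 1 the factor \<open>[:\<i>, -\<i>:]\<close> vanishes and each step multiplies the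
  denominator by twice \<open>fst x\<close>. Positive entries thus keep it nonzero there if
  \<open>D\<close> is nonzero at 1.\<close>

lemma poly_cf_den_1: "poly (cf_den l N D) 1 = (\<Prod>x\<leftarrow>l. 2 * of_real (fst x)) * poly D 1"
  by (induction l) (auto simp: algebra_simps)

lemma poly_cf_den_1_nonzero:
  assumes "\<And>x. x \<in> set l \<Longrightarrow> fst x > 0" "poly D 1 \<noteq> 0"
  shows "poly (cf_den l N D) 1 \<noteq> 0"
  using assms unfolding poly_cf_den_1 by (force simp: prod_list_zero_iff)

lemma coeff_mult_top:
  assumes "degree p \<le> m" "degree q \<le> n"
  shows "coeff (p * q) (m + n) = coeff p m * coeff q n"
proof -
  have "coeff (p * q) (m + n) = (\<Sum>i\<le>m + n. coeff p i * coeff q (m + n - i))" by (rule coeff_mult)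
  also have "\<dots> = (\<Sum>i\<le>m + n. if i = m then coeff p m * coeff q n else 0)"
  proof (intro sum.cong refl)
    fix i
    show "coeff p i * coeff q (m + n - i) = (if i = m then coeff p m * coeff q n else 0)"
    proof (cases i m rule: linorder_cases)
      case less
      then show ?thesis using assms by (simp add: coeff_eq_0)
    next
      case greater
      then show ?thesis using assms by (simp add: coeff_eq_0)
    qed simp
  qed
  finally show ?thesis by simp
qed

section \<open>Square-free members of a pencil of polynomials\<close>

lemma card_roots_squarefree:
  fixes p :: "complex poly"
  assumes "p \<noteq> 0" "\<And>z. poly p z = 0 \<Longrightarrow> poly (pderiv p) z \<noteq> 0"
  shows "card {z. poly p z = 0} = degree p"
proof -
  have r: "rsquarefree p" using assms unfolding rsquarefree_roots by auto
  have "degree p = size (proots p)" by (simp add: size_proots_complex)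
  also have "\<dots> = (\<Sum>z\<in>set_mset (proots p). count (proots p) z)" by (simp add: size_multiset_overloaded_eq)
  also have "\<dots> = (\<Sum>z\<in>{z. poly p z = 0}. 1)"
  proof (intro sum.cong)
    fix z assume "z \<in> {z. poly p z = 0}"
    then have "order z p \<noteq> 0" using assms(1) by (simp add: order_root)
    moreover have "order z p = 0 \<or> order z p = 1" using r by (simp add: rsquarefree_def)
    ultimately show "count (proots p) z = 1" using assms(1) by simp
  qed (use assms in auto)
  finally show ?thesis by simp
qed

lemma coprime_no_common_root:
  fixes p q :: "complex poly"
  assumes "\<And>z. poly p z = 0 \<Longrightarrow> poly q z \<noteq> 0"
  shows "coprime p q"
proof (rule coprimeI)
  fix c assume c: "c dvd p" "c dvd q"
  show "is_unit c"
  proof (cases "degree c = 0")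
    case True
    have "c \<noteq> 0" using c assms[of 0] by auto
    then show ?thesis using True by (simp add: is_unit_iff_degree)
  next
    case False
    then have "\<not> constant (poly c)" by (simp add: constant_degree)
    then obtain z where "poly c z = 0" using fundamental_theorem_of_algebra by blast
    then have "poly p z = 0" "poly q z = 0" using c by (auto elim!: dvdE)
    then show ?thesis using assms by blast
  qed
qed

text \<open>At a root of \<open>U\<close> the order of \<open>pderiv U\<close> is one less than that
  of \<open>U\<close>, while \<open>W\<close> does not vanish, so the two sides of the equation
  would have different orders.\<close>

lemma wronskian_zero_imp_constant:
  fixes U W :: "complex poly"
  assumes e: "U * pderiv W = W * pderiv U" and nc: "\<And>z. poly U z = 0 \<Longrightarrow> poly W z \<noteq> 0"
  shows "degree U = 0"
proof (rule ccontr)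
  assume d: "degree U \<noteq> 0"
  then have "\<not> constant (poly U)" by (simp add: constant_degree)
  then obtain a where a: "poly U a = 0" using fundamental_theorem_of_algebra by blast
  have U': "pderiv U \<noteq> 0" using d by (simp add: pderiv_eq_0_iff)
  have U0: "U \<noteq> 0" using d by auto
  have W: "order a W = 0" "W \<noteq> 0" using nc[OF a] by (auto simp: order_root)
  have o: "order a U = Suc (order a (pderiv U))" by (rule order_pderiv[OF U0 a])
  have nz: "W * pderiv U \<noteq> 0" using W U' by simp
  have "order a U \<le> order a (U * pderiv W)"
    using nz unfolding e[symmetric] by (subst order_mult) auto
  also have "\<dots> = order a (pderiv U)" unfolding e using nz W by (subst order_mult) auto
  finally show False using o by simp
qed

text \<open>A multiple root z of U + c W is a root of the Wronskian and determines c = - U(z) /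
  W(z). The Wronskian is a nonzero polynomial, so only finitely many c arise this way; one more
  value may cancel the leading coefficient.\<close>

lemma pencil_squarefree:
  fixes U W :: "complex poly"
  assumes d: "degree U \<le> d" "degree W \<le> d" "0 < d" and top: "coeff U d \<noteq> 0 \<or> coeff W d \<noteq> 0"
    and nc: "\<And>z. poly U z = 0 \<Longrightarrow> poly W z \<noteq> 0"
  shows "finite {c. \<not> (degree (U + smult c W) = d \<and> card {z. poly (U + smult c W) z = 0} = d)}"
proof -
  define Z where "Z = U * pderiv W - W * pderiv U"
  have "Z \<noteq> 0"
  proof
    assume "Z = 0"
    then have e: "U * pderiv W = W * pderiv U" by (simp add: Z_def)
    have 1: "degree U = 0" by (rule wronskian_zero_imp_constant[OF e nc])
    have 2: "degree W = 0" by (rule wronskian_zero_imp_constant[OF e[symmetric]]) (use nc in blast)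
    show False using 1 2 top d(3) by (simp add: coeff_eq_0)
  qed
  define S where "S = (\<lambda>z. - poly U z / poly W z) ` {z. poly Z z = 0} \<union> {- coeff U d / coeff W d}"
  have "finite S" unfolding S_def using poly_roots_finite[OF \<open>Z \<noteq> 0\<close>] by simp
  moreover have "degree (U + smult c W) = d \<and> card {z. poly (U + smult c W) z = 0} = d" if c: "c \<notin> S" for c
  proof -
    define P where "P = U + smult c W"
    have "coeff P d \<noteq> 0"
    proof
      assume "coeff P d = 0"
      then have e: "coeff U d + c * coeff W d = 0" by (simp add: P_def)
      with top have "coeff W d \<noteq> 0" by auto
      then have "c = - coeff U d / coeff W d" using e by (simp add: field_simps add_eq_0_iff)
      then show False using c by (simp add: S_def)
    qed
    moreover have "degree P \<le> d" unfolding P_def using d by (intro degree_add_le order_trans[OF degree_smult_le])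
    ultimately have dP: "degree P = d" by (simp add: le_antisym le_degree)
    have "P \<noteq> 0" using \<open>coeff P d \<noteq> 0\<close> by auto
    moreover have "poly (pderiv P) z \<noteq> 0" if z: "poly P z = 0" for z
    proof
      assume z': "poly (pderiv P) z = 0"
      have e1: "poly U z = - c * poly W z" using z by (simp add: P_def add_eq_0_iff)
      have e2: "poly (pderiv U) z = - c * poly (pderiv W) z" using z' by (simp add: P_def pderiv_add pderiv_smult add_eq_0_iff)
      have w: "poly W z \<noteq> 0" using e1 nc[of z] by auto
      have "poly Z z = 0" unfolding Z_def using e1 e2 by simp
      moreover have "c = - poly U z / poly W z" using e1 w by simp
      ultimately show False using c by (auto simp: S_def)
    qed
    ultimately have "card {z. poly P z = 0} = d" unfolding dP[symmetric] by (rule card_roots_squarefree)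
    then show ?thesis using dP by (simp add: P_def)
  qed
  ultimately show ?thesis by (auto intro: finite_subset[of _ S])
qed

text \<open>The last fraction is w + c (1 - z) / (z - rho), with value w at 1 whatever c is and with
  its pole outside the closed disc. This denominator becomes a factor of the numerator one step
  higher, whose roots are the preimages of the contact value; they must be distinct and of full
  number.\<close>

lemma cf_den_generic:
  assumes A: "\<And>x. x \<in> set l \<Longrightarrow> fst x > 0"
  shows "\<exists>\<rho>. cmod \<rho> \<ge> 3 \<and> finite {c. \<not> (degree (cf_den l (smult w [:-\<rho>, 1:] + smult c [:1, -1:]) [:-\<rho>, 1:]) = Suc (length l) \<and>
     card {z. poly (cf_den l (smult w [:-\<rho>, 1:] + smult c [:1, -1:]) [:-\<rho>, 1:]) z = 0} = Suc (length l))}"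
proof (cases "l = []")
  \<comment> \<open>With an empty list the denominator is \<open>[:-\<rho>, 1:]\<close> for every c,
    so no parameter is exceptional.\<close>
  case True
  have "card {z. poly [:-3, 1:] z = (0::complex)} = 1"
    using card_1_singleton_iff[of "{z. poly [:-3, 1:] z = (0::complex)}"] by (auto simp: add_eq_0_iff intro!: exI[of _ 3])
  then show ?thesis using True by (intro exI[of _ 3]) simp
next
  case False
  define n where "n = length l"
  define V where "V = cf_den l [:w:] 1"
  define W where "W = cf_den l [:1, -1:] 0"
  have dV: "degree V \<le> n" using degree_cf(2)[of "[:w:]" 0 1 l] by (simp add: V_def n_def)
  have dW: "degree W \<le> Suc n" using degree_cf(2)[of "[:1, -1:]" 1 0 l] by (simp add: W_def n_def)
  have det: "cf_num l [:w:] 1 * W - cf_num l [:1, -1:] 0 * V = - [:1, -1:] * [:\<i>, -\<i>:] ^ (2 * n)"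
    using cf_determinant[of l "[:w:]" 1 "[:1, -1:]" 0] by (simp add: V_def W_def n_def)
  have V1: "poly V 1 \<noteq> 0" unfolding V_def by (rule poly_cf_den_1_nonzero[OF A]) auto
  have nc: "poly W z \<noteq> 0" if "poly V z = 0" for z
  proof
    assume "poly W z = 0"
    with that arg_cong[OF det, of "\<lambda>p. poly p z"] have "(z - 1) * (\<i> - \<i> * z) ^ (2 * n) = 0" by (simp add: poly_power algebra_simps)
    then have "z = 1" by (auto simp: right_diff_distrib[symmetric])
    then show False using V1 that by simp
  qed
  \<comment> \<open>Otherwise both products in the determinant identity would lose their coefficient
    of degree 2n + 1, whereas the right-hand side has exactly that degree.\<close>
  have top: "coeff V n \<noteq> 0 \<or> coeff W (Suc n) \<noteq> 0"
  proof (rule ccontr)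
    assume "\<not> (coeff V n \<noteq> 0 \<or> coeff W (Suc n) \<noteq> 0)"
    then have 0: "coeff V n = 0" "coeff W (Suc n) = 0" by auto
    have "coeff (cf_num l [:w:] 1 * W) (n + Suc n) = 0"
      using coeff_mult_top[OF _ dW, of "cf_num l [:w:] 1" n] degree_cf(1)[of "[:w:]" 0 1 l] 0 by (simp add: n_def)
    moreover have "coeff (cf_num l [:1, -1:] 0 * V) (Suc n + n) = 0"
      using coeff_mult_top[OF _ dV, of "cf_num l [:1, -1:] 0" "Suc n"] degree_cf(1)[of "[:1, -1:]" 1 0 l] 0 by (simp add: n_def)
    ultimately have "coeff (- [:1, -1:] * [:\<i>, -\<i>:] ^ (2 * n)) (Suc (2 * n)) = 0"
      unfolding det[symmetric] by (simp add: mult_2)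
    moreover have nz: "- [:1, -1:] * [:\<i>, -\<i>:] ^ (2 * n) \<noteq> 0" unfolding mult_eq_0_iff by simp
    moreover have "degree ([:\<i>, -\<i>:] ^ (2 * n)) = 2 * n" by (simp add: degree_power_eq)
    then have "degree (- [:1, -1:] * [:\<i>, -\<i>:] ^ (2 * n)) = Suc (2 * n)"
      by (subst degree_mult_eq) (simp_all del: mult_pCons_left)
    ultimately show False by (metis leading_coeff_0_iff)
  qed
  have "W \<noteq> 0"
  proof
    assume "W = 0"
    have "degree V = 0"
    proof (rule ccontr)
      assume "degree V \<noteq> 0"
      then have "\<not> constant (poly V)" by (simp add: constant_degree)
      then obtain z where "poly V z = 0" using fundamental_theorem_of_algebra by blast
      then show False using nc[of z] \<open>W = 0\<close> by simp
    qed
    then show False using top \<open>W = 0\<close> False by (simp add: n_def coeff_eq_0)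
  qed
  \<comment> \<open>The pole is taken among the integers from 3 on, avoiding the roots of
    \<open>W\<close>: the factor z - \<rho> then introduces no common root into the pencil.\<close>
  have "infinite ((of_nat :: nat \<Rightarrow> complex) ` {3..})"
    by (subst finite_image_iff) (auto simp: infinite_Ici intro: inj_on_subset[OF inj_of_nat])
  then obtain \<rho> where \<rho>: "\<rho> \<in> (of_nat :: nat \<Rightarrow> complex) ` {3..}" "poly W \<rho> \<noteq> 0"
    using poly_roots_finite[OF \<open>W \<noteq> 0\<close>] finite_subset[of "of_nat ` {3..}" "{z. poly W z = 0}"] by blast
  have \<rho>3: "cmod \<rho> \<ge> 3" using \<rho>(1) by auto
  define e :: "complex poly" where "e = [:-\<rho>, 1:]"
  have "finite {c. \<not> (degree (e * V + smult c W) = Suc n \<and> card {z. poly (e * V + smult c W) z = 0} = Suc n)}"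
  proof (rule pencil_squarefree)
    show "degree (e * V) \<le> Suc n" using degree_mult_le[of e V] dV by (simp add: e_def)
    show "coeff (e * V) (Suc n) \<noteq> 0 \<or> coeff W (Suc n) \<noteq> 0"
      using coeff_mult_top[of e 1 V n] dV top by (simp add: e_def)
    show "poly W z \<noteq> 0" if "poly (e * V) z = 0" for z
      using that nc[of z] \<rho>(2) by (auto simp: e_def add_eq_0_iff)
  qed (use dW in auto)
  moreover have "cf_den l (smult w e + smult c [:1, -1:]) e = e * V + smult c W" for c
  proof -
    have "cf_den l (e * [:w:] + [:c:] * [:1, -1:]) (e * 1 + 0) = e * V + cf_den l ([:c:] * [:1, -1:]) 0"
      unfolding V_def by (rule cf_linear(2))
    also have "cf_den l ([:c:] * [:1, -1:]) 0 = [:c:] * W + cf_den l 0 0"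
      using cf_linear(2)[of l "[:c:]" "[:1, -1:]" 0 0 0] by (simp add: W_def)
    also have "cf_den l 0 0 = 0" using cf_linear(2)[of l 0 0 0 0 0] cf_linear(2)[of l "-1" 0 0 0 0] by simp
    finally show ?thesis by (simp add: mult.commute)
  qed
  ultimately show ?thesis using \<rho>3 by (intro exI[of _ \<rho>]) (simp add: e_def n_def)
qed

section \<open>Boundary expansions in the upper half plane\<close>

text \<open>The Cayley coordinate: it sends 1 to 0, the disc to the upper half plane, and the circle
  without -1 to the real line.\<close>

definition tz :: "complex \<Rightarrow> complex" where "tz z = \<i> * (1 - z) / (1 + z)"

abbreviation disc1 :: "complex filter" where "disc1 \<equiv> at 1 within ball 0 1"

lemma one_plus_nonzero: "cmod z < 1 \<Longrightarrow> 1 + z \<noteq> 0"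
  by (metis add_eq_0_iff less_irrefl norm_minus_cancel norm_one)

lemma tz_nonzero: "cmod z < 1 \<Longrightarrow> tz z \<noteq> 0"
  using one_plus_nonzero[of z] by (auto simp: tz_def)

lemma Im_tz: "Im (tz z) = (1 - (cmod z)\<^sup>2) / (cmod (1 + z))\<^sup>2"
proof -
  have "tz z = \<i> * ((1 - z) / (1 + z))" by (simp add: tz_def)
  then have "Im (tz z) = Re ((1 - z) / (1 + z))" by (simp only: Im_i_times)
  also have "\<dots> = (Re (1 - z) * Re (1 + z) + Im (1 - z) * Im (1 + z)) / (cmod (1 + z))\<^sup>2"
    unfolding Re_divide cmod_power2 ..
  also have "Re (1 - z) * Re (1 + z) + Im (1 - z) * Im (1 + z) = 1 - (cmod z)\<^sup>2"
    unfolding cmod_power2 by (simp add: algebra_simps power2_eq_square)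
  finally show ?thesis .
qed

lemma Im_tz_pos: "cmod z < 1 \<Longrightarrow> Im (tz z) > 0"
  unfolding Im_tz using one_plus_nonzero[of z] by (auto simp: abs_square_less_1)

lemma Im_inverse_tz:
  assumes "z \<noteq> 1"
  shows "Im (1 / tz z) = - ((1 - (cmod z)\<^sup>2) / (cmod (1 - z))\<^sup>2)"
proof -
  have "1 / (\<i> * a / b) = - (\<i> * (b / a))" for a b :: complex by (simp add: divide_inverse)
  then have "1 / tz z = - (\<i> * ((1 + z) / (1 - z)))" unfolding tz_def .
  then have "Im (1 / tz z) = - Re ((1 + z) / (1 - z))" by (simp only: Im_i_times uminus_complex.sel)
  also have "Re ((1 + z) / (1 - z)) = (Re (1 + z) * Re (1 - z) + Im (1 + z) * Im (1 - z)) / (cmod (1 - z))\<^sup>2"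
    unfolding Re_divide cmod_power2 ..
  also have "Re (1 + z) * Re (1 - z) + Im (1 + z) * Im (1 - z) = 1 - (cmod z)\<^sup>2"
    unfolding cmod_power2 by (simp add: algebra_simps power2_eq_square)
  finally show ?thesis by simp
qed

lemma disc1_nontrivial: "disc1 \<noteq> bot"
  by (simp add: trivial_limit_within islimpt_ball)

lemma eventually_disc1: "(\<And>z. cmod z < 1 \<Longrightarrow> P z) \<Longrightarrow> eventually P disc1"
  unfolding eventually_at_filter by (intro always_eventually) auto

lemma tz_tendsto: "(tz \<longlongrightarrow> 0) disc1"
  unfolding tz_def by (auto intro!: tendsto_eq_intros)

lemma tendsto_poly_tz: "((\<lambda>z. poly P (tz z)) \<longlongrightarrow> poly P 0) disc1"
  by (intro tendsto_poly tz_tendsto)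

lemma radial_disc1: "filterlim complex_of_real disc1 (at_left 1)"
proof -
  have "eventually (\<lambda>r::real. r \<in> {0<..<1}) (at_left 1)" by (rule eventually_at_left_real) simp
  then have "eventually (\<lambda>r::real. complex_of_real r \<in> ball 0 1 \<and> complex_of_real r \<noteq> 1) (at_left 1)"
    by eventually_elim (auto simp: complex_eq_iff)
  moreover have "(complex_of_real \<longlongrightarrow> 1) (at_left 1)" by (auto intro!: tendsto_eq_intros)
  ultimately show ?thesis unfolding filterlim_at by blast
qed

text \<open>The variable is \<open>tz z\<close> instead of z - 1 because it is real on the circle.
  Terms of \<open>P\<close> of degree above \<open>n\<close> do not affect the condition, so sums
  and products of expansions need no truncation.\<close>

definition expn :: "nat \<Rightarrow> (complex \<Rightarrow> complex) \<Rightarrow> complex poly \<Rightarrow> bool" where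
  "expn n f P \<longleftrightarrow> ((\<lambda>z. (f z - poly P (tz z)) / tz z ^ n) \<longlongrightarrow> 0) disc1"

text \<open>Stated along an arbitrary filter: it is applied to limits inside the disc and also to
  sequences of real points, where only boundary information is available.\<close>

lemma poly_tendsto_zero_coeff:
  assumes lim: "((\<lambda>x. poly P (g x) / g x ^ n) \<longlongrightarrow> (0::complex)) F" and g: "(g \<longlongrightarrow> 0) F" "eventually (\<lambda>x. g x \<noteq> 0) F" and F: "F \<noteq> bot"
    and j: "j \<le> n"
  shows "coeff P j = 0"
  using lim j
proof (induction n arbitrary: P j)
  case 0
  have "((\<lambda>x. poly P (g x)) \<longlongrightarrow> poly P 0) F" by (intro tendsto_poly g)
  then have "poly P 0 = 0" using 0(1) tendsto_unique[OF F] by simp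
  then show ?case using 0 by (simp add: poly_0_coeff_0)
next
  case (Suc n)
  have "((\<lambda>x. poly P (g x) / g x ^ Suc n * g x ^ Suc n) \<longlongrightarrow> 0 * 0 ^ Suc n) F" by (intro tendsto_mult Suc(2) tendsto_power g)
  then have "((\<lambda>x. poly P (g x) / g x ^ Suc n * g x ^ Suc n) \<longlongrightarrow> 0) F" by simp
  then have "((\<lambda>x. poly P (g x)) \<longlongrightarrow> 0) F"
    by (rule Lim_transform_eventually) (rule eventually_mono[OF g(2)], simp)
  moreover have "((\<lambda>x. poly P (g x)) \<longlongrightarrow> poly P 0) F" by (intro tendsto_poly g)
  ultimately have "poly P 0 = 0" using tendsto_unique[OF F] by blast
  then obtain Q where P: "P = pCons 0 Q" by (metis pCons_cases poly_0_coeff_0 coeff_pCons_0)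
  have "((\<lambda>x. poly Q (g x) / g x ^ n) \<longlongrightarrow> 0) F"
    using Suc(2) by (rule Lim_transform_eventually) (rule eventually_mono[OF g(2)], simp add: P)
  then have "coeff Q i = 0" if "i \<le> n" for i using Suc(1) that by blast
  then show ?case using Suc(3) by (cases j) (auto simp: P)
qed

lemma expn_tendsto:
  assumes "expn n f P"
  shows "(f \<longlongrightarrow> poly P 0) disc1"
proof -
  have "((\<lambda>z. (f z - poly P (tz z)) / tz z ^ n * tz z ^ n + poly P (tz z)) \<longlongrightarrow> 0 * 0 ^ n + poly P 0) disc1"
    by (intro tendsto_add tendsto_mult tendsto_power tz_tendsto tendsto_poly_tz assms[unfolded expn_def])
  then have "((\<lambda>z. (f z - poly P (tz z)) / tz z ^ n * tz z ^ n + poly P (tz z)) \<longlongrightarrow> poly P 0) disc1" by simp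
  then show ?thesis by (rule Lim_transform_eventually) (rule eventually_disc1, simp add: tz_nonzero)
qed

lemma expn_cong:
  assumes "expn n f P" "\<And>z. cmod z < 1 \<Longrightarrow> f z = g z"
  shows "expn n g P"
  using assms(1) unfolding expn_def by (rule Lim_transform_eventually) (rule eventually_disc1, simp add: assms(2))

lemma expn_poly: "expn n (\<lambda>z. poly P (tz z)) P"
  by (simp add: expn_def)

lemma expn_const: "expn n (\<lambda>_. c) [:c:]"
  by (simp add: expn_def)

lemma expn_add:
  assumes "expn n f P" "expn n g Q"
  shows "expn n (\<lambda>z. f z + g z) (P + Q)"
  using tendsto_add[OF assms[unfolded expn_def]] unfolding expn_def
  by (simp add: add_divide_distrib[symmetric] algebra_simps)

lemma expn_mult:
  assumes f: "expn n f P" and g: "expn n g Q"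
  shows "expn n (\<lambda>z. f z * g z) (P * Q)"
proof -
  have "((\<lambda>z. (f z - poly P (tz z)) / tz z ^ n * g z + poly P (tz z) * ((g z - poly Q (tz z)) / tz z ^ n)) \<longlongrightarrow> 0 * poly Q 0 + poly P 0 * 0) disc1"
    by (intro tendsto_add tendsto_mult tendsto_poly_tz expn_tendsto[OF g] f[unfolded expn_def] g[unfolded expn_def])
  then have "((\<lambda>z. (f z - poly P (tz z)) / tz z ^ n * g z + poly P (tz z) * ((g z - poly Q (tz z)) / tz z ^ n)) \<longlongrightarrow> 0) disc1" by simp
  then show ?thesis unfolding expn_def
    by (rule Lim_transform_eventually) (rule eventually_disc1, simp add: tz_nonzero field_simps)
qed

text \<open>Truncated inversion of a power series: each step cancels the lowest remaining
  coefficient of the error.\<close>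

lemma poly_inverse_mod:
  fixes P :: "'a::field poly"
  assumes "poly P 0 \<noteq> 0"
  shows "\<exists>Q S. P * Q = 1 + monom 1 (Suc n) * S"
proof (induction n)
  case 0
  have "poly (P * [:1 / poly P 0:] - 1) 0 = 0" using assms by simp
  then obtain S where "P * [:1 / poly P 0:] - 1 = pCons 0 S" by (metis pCons_cases poly_0_coeff_0 coeff_pCons_0)
  then have "P * [:1 / poly P 0:] = 1 + monom 1 (Suc 0) * S"
    by (metis add.commute diff_add_cancel monom_Suc monom_0 mult_pCons_left smult_0_left add_0 mult_1 one_pCons)
  then show ?case by blast
next
  case (Suc n)
  then obtain Q S where QS: "P * Q = 1 + monom 1 (Suc n) * S" by blast
  define c where "c = poly S 0 / poly P 0"
  have "poly (S - smult c P) 0 = 0" using assms by (simp add: c_def)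
  then obtain S' where S': "S - smult c P = pCons 0 S'" by (metis pCons_cases poly_0_coeff_0 coeff_pCons_0)
  have "P * (Q - monom c (Suc n)) = 1 + monom 1 (Suc n) * (S - smult c P)"
  proof -
    have "monom c (Suc n) = monom 1 (Suc n) * [:c:]" by (simp add: smult_monom)
    then show ?thesis using QS by (simp add: algebra_simps)
  qed
  also have "pCons 0 S' = monom 1 1 * S'" by (simp add: monom_Suc)
  then have "monom 1 (Suc n) * (S - smult c P) = monom 1 (Suc (Suc n)) * S'" unfolding S' by (simp add: mult.assoc[symmetric] mult_monom)
  finally show ?case by blast
qed

lemma expn_inverse:
  assumes f: "expn n f P" and P: "poly P 0 \<noteq> 0"
  shows "\<exists>Q. expn n (\<lambda>z. 1 / f z) Q"
proof -
  obtain Q S where QS: "P * Q = 1 + monom 1 (Suc n) * S" using poly_inverse_mod[OF P] by blast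
  have fQ: "expn n (\<lambda>z. f z * poly Q (tz z)) (P * Q)" by (intro expn_mult f expn_poly)
  have "((\<lambda>z. (- ((f z * poly Q (tz z) - poly (P * Q) (tz z)) / tz z ^ n) - tz z * poly S (tz z)) / f z) \<longlongrightarrow> (- 0 - 0 * poly S 0) / poly P 0) disc1"
    using P by (intro tendsto_divide tendsto_diff tendsto_minus tendsto_mult tz_tendsto tendsto_poly_tz fQ[unfolded expn_def] expn_tendsto[OF f])
  then have L: "((\<lambda>z. (- ((f z * poly Q (tz z) - poly (P * Q) (tz z)) / tz z ^ n) - tz z * poly S (tz z)) / f z) \<longlongrightarrow> 0) disc1" by simp
  have "eventually (\<lambda>z. f z \<noteq> 0) disc1" using tendsto_imp_eventually_ne[OF expn_tendsto[OF f] P] .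
  moreover have "eventually (\<lambda>z. tz z \<noteq> 0) disc1" by (rule eventually_disc1[OF tz_nonzero])
  ultimately have "eventually (\<lambda>z. (- ((f z * poly Q (tz z) - poly (P * Q) (tz z)) / tz z ^ n) - tz z * poly S (tz z)) / f z = (1 / f z - poly Q (tz z)) / tz z ^ n) disc1"
  proof eventually_elim
    case (elim z)
    have e: "poly (P * Q) (tz z) = 1 + tz z ^ n * tz z * poly S (tz z)" unfolding QS by (simp add: poly_monom)
    show ?case unfolding e using elim by (simp add: field_simps)
  qed
  then have "expn n (\<lambda>z. 1 / f z) Q" unfolding expn_def by (rule Lim_transform_eventually[OF L])
  then show ?thesis by blast
qed

section \<open>Contact in the upper half plane and the Nevanlinna step\<close>

abbreviation cpoly :: "real poly \<Rightarrow> complex poly" where "cpoly \<equiv> map_poly complex_of_real"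

lemma poly_cpoly_of_real: "poly (cpoly p) (of_real x) = of_real (poly p x)"
  by (induction p) (auto simp: map_poly_pCons)

lemma coeff_cpoly: "coeff (cpoly p) n = of_real (coeff p n)"
  by (simp add: coeff_map_poly)

lemma cpoly_mult: "cpoly (p * q) = cpoly p * cpoly q"
  by (rule poly_eqI) (simp add: coeff_map_poly coeff_mult)

lemma cpoly_add: "cpoly (p + q) = cpoly p + cpoly q"
  by (rule poly_eqI) (simp add: coeff_map_poly)

lemma cpoly_monom: "cpoly (monom c n) = monom (of_real c) n"
  by (rule poly_eqI) (simp add: coeff_map_poly)

text \<open>Contact of order \<open>2 k\<close> at the point \<open>1\<close> of a map from the disc to the upper half plane, read off in
  the coordinate \<open>tz\<close>, which is real on the circle.\<close>
definition contact_uhp :: "nat \<Rightarrow> (complex \<Rightarrow> complex) \<Rightarrow> bool" where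
  "contact_uhp k h \<longleftrightarrow> h holomorphic_on ball 0 1 \<and> (\<forall>z. cmod z < 1 \<longrightarrow> Im (h z) > 0) \<and>
     (\<exists>p \<kappa>. \<kappa> > 0 \<and> poly p 0 = 0 \<and> expn (2 * k) h (cpoly p + monom (\<i> * of_real \<kappa>) (2 * k)))"

text \<open>On the radius tz is \<i> (1 - r) / (1 + r), so the real part of h / tz is Im h times (1
  + r) / (1 - r). Harnack bounds Im h below by (1 - r) / 2 times Im h(0), and the limit is at least
  Im h(0) / 2.\<close>

lemma uhp_derivative_pos:
  assumes h: "h holomorphic_on ball 0 1" "\<And>z. cmod z < 1 \<Longrightarrow> Im (h z) > 0"
    and lim: "((\<lambda>z. h z / tz z) \<longlongrightarrow> of_real B) disc1"
  shows "B > 0"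
proof -
  have "Im (h 0) / 2 \<le> B"
  proof (rule tendsto_lowerbound)
    have "((\<lambda>r. Re (h (of_real r) / tz (of_real r))) \<longlongrightarrow> Re (of_real B)) (at_left 1)"
      by (intro tendsto_Re filterlim_compose[OF lim radial_disc1])
    then show "((\<lambda>r. Re (h (of_real r) / tz (of_real r))) \<longlongrightarrow> B) (at_left 1)" by simp
    have "eventually (\<lambda>r::real. r \<in> {0<..<1}) (at_left 1)" by (rule eventually_at_left_real) simp
    then show "eventually (\<lambda>r. Im (h 0) / 2 \<le> Re (h (of_real r) / tz (of_real r))) (at_left 1)"
    proof eventually_elim
      case (elim r)
      have "(1 - cmod (of_real r)) / 2 * Re (- \<i> * h 0) \<le> Re (- \<i> * h (of_real r))"
        using h elim by (intro circ_harnack[where g = "\<lambda>z. - \<i> * h z"] holomorphic_intros) (auto intro: less_imp_le)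
      then have i: "(1 - r) / 2 * Im (h 0) \<le> Im (h (of_real r))" using elim by simp
      have "h (of_real r) / tz (of_real r) = - \<i> * h (of_real r) * of_real ((1 + r) / (1 - r))"
      proof -
        have "tz (of_real r) = \<i> * of_real ((1 - r) / (1 + r))" by (simp add: tz_def)
        then show ?thesis using elim by (simp add: field_simps)
      qed
      moreover have "Re (- \<i> * w * of_real c) = Im w * c" for w c by simp
      ultimately have e: "Re (h (of_real r) / tz (of_real r)) = Im (h (of_real r)) * ((1 + r) / (1 - r))" by (simp only:)
      have "Im (h 0) / 2 = ((1 - r) / 2 * Im (h 0)) * (1 / (1 - r))"
      proof -
        have alg: "x / 2 = (a / 2 * x) * (1 / a)" if "a \<noteq> 0" for a x :: real using that by simp
        show ?thesis by (rule alg) (use elim in auto)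
      qed
      also have "\<dots> \<le> Im (h (of_real r)) * ((1 + r) / (1 - r))"
        using i elim h(2)[of "of_real r"] by (intro mult_mono divide_right_mono) (auto intro: less_imp_le)
      finally show ?case using e by simp
    qed
  qed simp
  then show ?thesis using h(2)[of 0] by simp
qed


lemma uhp_constant_or_open:
  assumes h: "h holomorphic_on ball 0 1" "\<And>z. cmod z < 1 \<Longrightarrow> Im (h z) \<ge> 0" and z0: "cmod z0 < 1" "Im (h z0) = 0"
  shows "\<exists>c. \<forall>z. cmod z < 1 \<longrightarrow> h z = c"
proof (rule ccontr)
  assume nc: "\<not> (\<exists>c. \<forall>z. cmod z < 1 \<longrightarrow> h z = c)"
  have "\<not> h constant_on ball 0 1" using nc unfolding constant_on_def by (metis mem_ball_0)
  then have "open (h ` ball 0 1)"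
    by (intro open_mapping_thm[OF h(1)]) auto
  moreover have "h z0 \<in> h ` ball 0 1" using z0 by simp
  ultimately obtain e where e: "e > 0" "ball (h z0) e \<subseteq> h ` ball 0 1" using open_contains_ball by blast
  have "h z0 - \<i> * of_real (e / 2) \<in> ball (h z0) e" using e(1) by (simp add: dist_norm norm_mult)
  then have "h z0 - \<i> * of_real (e / 2) \<in> h ` ball 0 1" using e(2) by blast
  then obtain z where z: "h z0 - \<i> * of_real (e / 2) = h z" "z \<in> ball 0 1" by (elim imageE)
  have "Im (h z) = - (e / 2)" unfolding z(1)[symmetric] using z0(2) by simp
  then show False using h(2)[of z] z(2) e(1) by simp
qed

text \<open>A form of Julia's lemma, from the maximum principle. On a circle of radius s near 1 the
  term -1/h has nonnegative imaginary part, and that of A / tz tends to 0 away from the point 1, as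
  s tends to 1. Close to the point 1 the assumed limit gives the lower bound.\<close>

lemma uhp_julia:
  assumes h: "h holomorphic_on ball 0 1" "\<And>z. cmod z < 1 \<Longrightarrow> Im (h z) > 0" and A: "A > 0"
    and lim: "((\<lambda>z. of_real A / tz z - of_real \<beta> - 1 / h z) \<longlongrightarrow> L) disc1" and L: "Im L \<ge> 0" and z0: "cmod z0 < 1"
  shows "Im (of_real A / tz z0 - of_real \<beta> - 1 / h z0) \<ge> 0"
proof -
  define g where "g = (\<lambda>z. of_real A / tz z - of_real \<beta> - 1 / h z)"
  have hn: "h z \<noteq> 0" if "cmod z < 1" for z using h(2)[OF that] by auto
  have "tz holomorphic_on ball 0 1" unfolding tz_def using one_plus_nonzero by (intro holomorphic_intros) auto
  then have gh: "g holomorphic_on ball 0 1" unfolding g_def using h(1) hn tz_nonzero by (intro holomorphic_intros) auto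
  have "- \<epsilon> \<le> Im (g z0)" if \<epsilon>: "\<epsilon> > 0" for \<epsilon>
  proof -
    have "((\<lambda>z. Im (g z)) \<longlongrightarrow> Im L) disc1" unfolding g_def by (intro tendsto_Im lim)
    then have "eventually (\<lambda>z. - \<epsilon> < Im (g z)) disc1" using L \<epsilon> by (intro order_tendstoD(1)) auto
    then obtain \<delta> where \<delta>: "\<delta> > 0" "\<And>z. cmod z < 1 \<Longrightarrow> z \<noteq> 1 \<Longrightarrow> dist z 1 < \<delta> \<Longrightarrow> - \<epsilon> < Im (g z)"
      unfolding eventually_at by auto
    have "((\<lambda>s::real. A * (1 - s\<^sup>2) / \<delta>\<^sup>2) \<longlongrightarrow> A * (1 - 1\<^sup>2) / \<delta>\<^sup>2) (at_left 1)" using \<delta>(1) by (intro tendsto_intros) auto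
    then have "eventually (\<lambda>s::real. A * (1 - s\<^sup>2) / \<delta>\<^sup>2 < \<epsilon>) (at_left 1)" using \<epsilon> by (intro order_tendstoD(2)) auto
    moreover have "eventually (\<lambda>s. s \<in> {cmod z0<..<1}) (at_left 1)" by (rule eventually_at_left_real[OF z0])
    ultimately have "eventually (\<lambda>s::real. A * (1 - s\<^sup>2) / \<delta>\<^sup>2 < \<epsilon> \<and> cmod z0 < s \<and> s < 1) (at_left 1)" by eventually_elim auto
    then obtain s :: real where s: "A * (1 - s\<^sup>2) / \<delta>\<^sup>2 < \<epsilon>" "cmod z0 < s" "s < 1"
      using eventually_happens[of _ "at_left (1::real)"] by auto
    have s0: "0 \<le> s" "0 < s" using s(2) norm_ge_zero[of z0] by linarith+
    have bd: "- \<epsilon> \<le> Im (g z)" if z: "cmod z = s" for z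
    proof (cases "dist z 1 < \<delta>")
      case True
      then show ?thesis using \<delta>(2)[of z] z s(3) by (cases "z = 1") auto
    next
      case False
      have z1: "cmod z < 1" "z \<noteq> 1" using z s(3) by auto
      have "Im (- 1 / h z) \<ge> 0" using h(2)[OF z1(1)] by (simp add: Im_divide)
      moreover have "Im (of_real A / tz z) = A * Im (1 / tz z)" by (simp add: Im_divide)
      moreover have "A * Im (1 / tz z) \<ge> - \<epsilon>"
      proof -
        have d: "\<delta> \<le> cmod (1 - z)" using False by (simp add: dist_norm norm_minus_commute)
        have "A * ((1 - s\<^sup>2) / (cmod (1 - z))\<^sup>2) \<le> A * ((1 - s\<^sup>2) / \<delta>\<^sup>2)"
          using A s(3) s0 d \<delta>(1) by (intro mult_left_mono divide_left_mono power_mono mult_pos_pos zero_less_power) (auto simp: power_le_one)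
        then show ?thesis unfolding Im_inverse_tz[OF z1(2)] z mult_minus_right using s(1) by simp
      qed
      ultimately show ?thesis unfolding g_def by simp
    qed
    \<comment> \<open>A lower bound for the imaginary part of \<open>g\<close> is an upper bound for
      the modulus of exp (\<i> g), to which the maximum modulus principle applies.\<close>
    have "cmod (exp (\<i> * g z0)) \<le> exp \<epsilon>"
    proof (rule maximum_modulus_frontier[where S = "ball 0 s" and f = "\<lambda>z. exp (\<i> * g z)"])
      show "(\<lambda>z. exp (\<i> * g z)) holomorphic_on interior (ball 0 s)"
        using s(3) by (intro holomorphic_intros holomorphic_on_subset[OF gh]) auto
      show "continuous_on (closure (ball 0 s)) (\<lambda>z. exp (\<i> * g z))"
        using s s0 by (intro continuous_intros continuous_on_subset[OF holomorphic_on_imp_continuous_on[OF gh]]) (auto simp: closure_ball)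
      show "cmod (exp (\<i> * g z)) \<le> exp \<epsilon>" if "z \<in> frontier (ball 0 s)" for z
      proof -
        have "s > 0" using s(2) norm_ge_zero[of z0] by linarith
        then have "cmod z = s" using that by (simp add: frontier_ball)
        then show ?thesis using bd[of z] by (simp add: norm_exp_eq_Re)
      qed
    qed (use s in auto)
    then show ?thesis by (simp add: norm_exp_eq_Re)
  qed
  note lower = this
  have "- Im (g z0) \<le> 0"
  proof (rule field_le_epsilon)
    fix e :: real assume "0 < e"
    from lower[OF this] show "- Im (g z0) \<le> 0 + e" by linarith
  qed
  then show ?thesis by (simp add: g_def)
qed

text \<open>One step of the Nevanlinna (continued fraction) algorithm at a boundary point: it lowers the order of
  contact by two, and \<open>uhp_julia\<close> keeps the values in the upper half plane.\<close>
lemma contact_uhp_step: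
  assumes "contact_uhp (Suc k) h"
  shows "\<exists>A \<beta>. A > 0 \<and> contact_uhp k (\<lambda>z. of_real A / tz z - of_real \<beta> - 1 / h z)"
proof -
  obtain p \<kappa> where h: "h holomorphic_on ball 0 1" "\<And>z. cmod z < 1 \<Longrightarrow> Im (h z) > 0"
    and \<kappa>: "\<kappa> > 0" and p0: "poly p 0 = 0"
    and ex: "expn (2 * Suc k) h (cpoly p + monom (\<i> * of_real \<kappa>) (2 * Suc k))"
    using assms unfolding contact_uhp_def by blast
  obtain p1 where p: "p = pCons 0 p1" using p0 by (metis pCons_cases poly_0_coeff_0 coeff_pCons_0)
  define \<epsilon> where "\<epsilon> = (\<lambda>z. (h z - poly (cpoly p + monom (\<i> * of_real \<kappa>) (2 * Suc k)) (tz z)) / tz z ^ (2 * Suc k))"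
  have \<epsilon>: "(\<epsilon> \<longlongrightarrow> 0) disc1" using ex unfolding expn_def \<epsilon>_def .
  define g where "g = (\<lambda>z. poly (cpoly p1) (tz z) + \<i> * of_real \<kappa> * tz z ^ (2 * k + 1) + \<epsilon> z * tz z ^ (2 * k + 1))"
  have hg: "h z = tz z * g z" if "cmod z < 1" for z
  proof -
    have "\<epsilon> z * tz z ^ (2 * Suc k) = h z - poly (cpoly p + monom (\<i> * of_real \<kappa>) (2 * Suc k)) (tz z)"
      using tz_nonzero[OF that] by (simp add: \<epsilon>_def)
    then have "h z = tz z * poly (cpoly p1) (tz z) + \<i> * of_real \<kappa> * tz z ^ (2 * Suc k) + \<epsilon> z * tz z ^ (2 * Suc k)"
      by (simp add: p map_poly_pCons poly_monom algebra_simps)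
    then show ?thesis by (simp add: g_def algebra_simps)
  qed
  define B where "B = poly p1 0"
  have "(g \<longlongrightarrow> poly (cpoly p1) 0 + \<i> * of_real \<kappa> * 0 ^ (2 * k + 1) + 0 * 0 ^ (2 * k + 1)) disc1"
    unfolding g_def by (intro tendsto_add tendsto_mult tendsto_power tz_tendsto tendsto_poly_tz tendsto_const \<epsilon>)
  then have gB: "(g \<longlongrightarrow> of_real B) disc1" using poly_cpoly_of_real[of p1 0] by (simp add: B_def)
  have l: "((\<lambda>z. h z / tz z) \<longlongrightarrow> of_real B) disc1"
    by (rule Lim_transform_eventually[OF gB], rule eventually_disc1) (simp add: hg tz_nonzero)
  have B: "B > 0" by (rule uhp_derivative_pos[OF h l])
  \<comment> \<open>\<open>Q\<close> inverts \<open>p1\<close> up to order 2k + 2, so 1/h begins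
    like Q/t: \<open>A\<close> is its polar coefficient and \<open>q1\<close> its constant term. The
    step must remove exactly these, so -q1 is the \<beta> of the statement; both numbers are real
    because \<open>p1\<close> is.\<close>
  obtain Q S where QS: "p1 * Q = 1 + monom 1 (Suc (2 * k + 1)) * S" using poly_inverse_mod[of p1 "2 * k + 1"] B by (auto simp: B_def)
  define A where "A = poly Q 0"
  have AB: "B * A = 1" using arg_cong[OF QS, of "\<lambda>p. poly p 0"] by (simp add: B_def A_def poly_monom)
  then have A: "A > 0" using zero_less_mult_pos[of B A] B by simp
  obtain q1 Q2 where Q: "Q = pCons A (pCons q1 Q2)" by (metis A_def pCons_cases poly_0_coeff_0 coeff_pCons_0)
  define h' where "h' = (\<lambda>z. of_real A / tz z - of_real (- q1) - 1 / h z)"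
  \<comment> \<open>A term \<open>\<i> * \<kappa> * t ^ (2 * k + 2)\<close> of h changes -1/h by its
    quotient with h^2. Since h behaves like B t and A = 1/B, the new leading coefficient is \<kappa>
    A^2, again positive.\<close>
  have ex': "expn (2 * k) h' (cpoly (pCons 0 (- Q2)) + monom (\<i> * of_real (\<kappa> * A\<^sup>2)) (2 * k))"
    unfolding expn_def
  proof (rule Lim_transform_eventually)
    let ?f = "\<lambda>z. (tz z * poly (cpoly S) (tz z) + \<i> * of_real \<kappa> * poly (cpoly Q) (tz z) + \<epsilon> z * poly (cpoly Q) (tz z)) / g z - \<i> * of_real (\<kappa> * A\<^sup>2)"
    have "(?f \<longlongrightarrow> (0 * poly (cpoly S) 0 + \<i> * of_real \<kappa> * poly (cpoly Q) 0 + 0 * poly (cpoly Q) 0) / of_real B - \<i> * of_real (\<kappa> * A\<^sup>2)) disc1"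
      using B by (intro tendsto_diff tendsto_divide tendsto_add tendsto_mult tz_tendsto tendsto_poly_tz tendsto_const \<epsilon> gB) auto
    moreover have "poly (cpoly Q) 0 = of_real A" using poly_cpoly_of_real[of Q 0] by (simp add: A_def)
    moreover have "complex_of_real A / of_real B = of_real (A\<^sup>2)"
    proof -
      have "A / B = A\<^sup>2" using AB B by (simp add: field_simps power2_eq_square)
      then show ?thesis by (metis of_real_divide)
    qed
    moreover have "(0 * poly (cpoly S) 0 + \<i> * of_real \<kappa> * x + 0 * y) / b - \<i> * of_real (\<kappa> * A\<^sup>2) = 0" if "x / b = complex_of_real (A\<^sup>2)" for x y b
    proof -
      have "(0 * poly (cpoly S) 0 + \<i> * of_real \<kappa> * x + 0 * y) / b = \<i> * of_real \<kappa> * (x / b)" by simp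
      then show ?thesis unfolding that by simp
    qed
    ultimately show "(?f \<longlongrightarrow> 0) disc1" by (simp only:)
    show "eventually (\<lambda>z. ?f z = (h' z - poly (cpoly (pCons 0 (- Q2)) + monom (\<i> * of_real (\<kappa> * A\<^sup>2)) (2 * k)) (tz z)) / tz z ^ (2 * k)) disc1"
    proof (rule eventually_disc1)
      fix z assume z: "cmod z < 1"
      define t where "t = tz z"
      have t: "t \<noteq> 0" using tz_nonzero[OF z] by (simp add: t_def)
      have hz: "h z = t * g z" using hg[OF z] by (simp add: t_def)
      have gz: "g z \<noteq> 0" using h(2)[OF z] hz by auto
      have Qt: "poly (cpoly Q) t = of_real A + t * (of_real q1 + t * poly (cpoly Q2) t)"
        unfolding Q by (simp add: map_poly_pCons)
      have "poly (cpoly (p1 * Q)) t = 1 + t ^ (2 * k + 2) * poly (cpoly S) t"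
        unfolding QS by (simp add: cpoly_add cpoly_mult cpoly_monom poly_monom map_poly_1)
      then have p1Q: "poly (cpoly p1) t * poly (cpoly Q) t = 1 + t ^ (2 * k + 2) * poly (cpoly S) t" by (simp add: cpoly_mult)
      have gQ: "g z * poly (cpoly Q) t = 1 + t ^ (2 * k + 1) * (t * poly (cpoly S) t + \<i> * of_real \<kappa> * poly (cpoly Q) t + \<epsilon> z * poly (cpoly Q) t)"
        unfolding g_def t_def[symmetric] distrib_right p1Q by (simp add: algebra_simps)
      have P': "poly (cpoly (pCons 0 (- Q2)) + monom (\<i> * of_real (\<kappa> * A\<^sup>2)) (2 * k)) t = - t * poly (cpoly Q2) t + \<i> * of_real (\<kappa> * A\<^sup>2) * t ^ (2 * k)"
      proof -
        have "cpoly (- Q2) = - cpoly Q2" by (rule poly_eqI) (simp add: coeff_map_poly)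
        then show ?thesis by (simp add: map_poly_pCons poly_monom)
      qed
      define X where "X = t * poly (cpoly S) t + \<i> * of_real \<kappa> * poly (cpoly Q) t + \<epsilon> z * poly (cpoly Q) t"
      have "h' z - (- t * poly (cpoly Q2) t + \<i> * of_real (\<kappa> * A\<^sup>2) * t ^ (2 * k)) = poly (cpoly Q) t / t - 1 / (t * g z) - \<i> * of_real (\<kappa> * A\<^sup>2) * t ^ (2 * k)"
        unfolding h'_def t_def[symmetric] hz Qt using t by (simp add: field_simps)
      also have "poly (cpoly Q) t / t - 1 / (t * g z) = (g z * poly (cpoly Q) t - 1) / (t * g z)" using t gz by (simp add: field_simps)
      also have "\<dots> = t ^ (2 * k) * (X / g z)" unfolding gQ X_def[symmetric] using t gz by (simp add: field_simps)
      finally have "h' z - (- t * poly (cpoly Q2) t + \<i> * of_real (\<kappa> * A\<^sup>2) * t ^ (2 * k)) = t ^ (2 * k) * (X / g z - \<i> * of_real (\<kappa> * A\<^sup>2))"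
        by (simp add: right_diff_distrib)
      then show "?f z = (h' z - poly (cpoly (pCons 0 (- Q2)) + monom (\<i> * of_real (\<kappa> * A\<^sup>2)) (2 * k)) (tz z)) / tz z ^ (2 * k)"
        unfolding t_def[symmetric] P' X_def[symmetric] using t by simp
    qed
  qed
  have hn: "h z \<noteq> 0" if "cmod z < 1" for z using h(2)[OF that] by auto
  have "tz holomorphic_on ball 0 1" unfolding tz_def using one_plus_nonzero by (intro holomorphic_intros) auto
  then have hol': "h' holomorphic_on ball 0 1" unfolding h'_def using h(1) hn tz_nonzero by (intro holomorphic_intros) auto
  define P' where "P' = cpoly (pCons 0 (- Q2)) + monom (\<i> * of_real (\<kappa> * A\<^sup>2)) (2 * k)"
  have ImP': "Im (poly P' 0) \<ge> 0" "Im (coeff P' (2 * k)) > 0"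
  proof -
    show "Im (poly P' 0) \<ge> 0" using \<kappa> A by (auto simp: P'_def map_poly_pCons poly_monom power_0_left)
    show "Im (coeff P' (2 * k)) > 0" unfolding P'_def coeff_add coeff_cpoly coeff_monom using \<kappa> A by simp
  qed
  have lim': "((\<lambda>z. of_real A / tz z - of_real (- q1) - 1 / h z) \<longlongrightarrow> poly P' 0) disc1"
    using expn_tendsto[OF ex'] unfolding P'_def h'_def .
  have ge: "Im (h' z) \<ge> 0" if "cmod z < 1" for z
    unfolding h'_def by (rule uhp_julia[OF h A lim' ImP'(1) that])
  \<comment> \<open>A real value at an interior point would make h' a real constant by the open
    mapping theorem. Uniqueness of the expansion then contradicts the positive imaginary part of the
    coefficient of degree 2k.\<close>
  have "Im (h' z) > 0" if z: "cmod z < 1" for z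
  proof (rule ccontr)
    assume "\<not> Im (h' z) > 0"
    then have "Im (h' z) = 0" using ge[OF z] by simp
    then obtain c where c: "\<And>z. cmod z < 1 \<Longrightarrow> h' z = c" using uhp_constant_or_open[OF hol' ge z] by blast
    then have cIm: "Im c = 0" using \<open>Im (h' z) = 0\<close> z by auto
    have "expn (2 * k) (\<lambda>_. c) P'" by (rule expn_cong[OF ex'[folded P'_def]]) (use c in auto)
    then have "((\<lambda>z. poly ([:c:] - P') (tz z) / tz z ^ (2 * k)) \<longlongrightarrow> 0) disc1" unfolding expn_def by simp
    then have "coeff ([:c:] - P') (2 * k) = 0"
      by (rule poly_tendsto_zero_coeff[OF _ tz_tendsto eventually_disc1[OF tz_nonzero] disc1_nontrivial]) auto
    then have "coeff P' (2 * k) = coeff [:c:] (2 * k)" by simp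
    then have "Im (coeff P' (2 * k)) = 0" using cIm by (cases k) auto
    then show False using ImP'(2) by simp
  qed
  then have pos': "\<forall>z. cmod z < 1 \<longrightarrow> Im (h' z) > 0" by blast
  have "\<kappa> * A\<^sup>2 > 0" "poly (pCons 0 (- Q2)) 0 = 0" using \<kappa> A by auto
  with ex' have "\<exists>p \<kappa>. \<kappa> > 0 \<and> poly p 0 = 0 \<and> expn (2 * k) h' (cpoly p + monom (\<i> * of_real \<kappa>) (2 * k))" by blast
  then have "contact_uhp k h'" unfolding contact_uhp_def using hol' pos' by (intro conjI)
  then show ?thesis using A unfolding h'_def by blast
qed

section \<open>Rational models\<close>

text \<open>The point 1 is exempt in the second clause because every continued fraction step
  produces a fraction that vanishes there.\<close>

definition adm :: "complex poly \<Rightarrow> complex poly \<Rightarrow> bool" where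
  "adm N D \<longleftrightarrow> (\<forall>z. cmod z \<le> 1 \<longrightarrow> poly D z \<noteq> 0) \<and> (\<forall>z. cmod z \<le> 1 \<longrightarrow> z \<noteq> 1 \<longrightarrow> Im (poly N z / poly D z) > 0)"

lemma cf_den_eval:
  assumes "z \<noteq> 1" "poly (cf_den l N D) z \<noteq> 0"
  shows "poly (cf_den (x # l) N D) z = \<i> * (1 - z) * poly (cf_den l N D) z *
    (of_real (fst x) / tz z - of_real (snd x) - poly (cf_num l N D) z / poly (cf_den l N D) z)"
proof -
  have t: "\<i> * (1 - z) * (of_real a / tz z) = of_real a * (1 + z)" for a
  proof (cases "1 + z = 0")
    case False
    then show ?thesis using assms(1) by (simp add: tz_def)
  qed (simp add: tz_def)
  have "\<i> * (1 - z) * poly (cf_den l N D) z * (of_real (fst x) / tz z - of_real (snd x) - poly (cf_num l N D) z / poly (cf_den l N D) z)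
    = poly (cf_den l N D) z * (\<i> * (1 - z) * (of_real (fst x) / tz z)) - \<i> * (1 - z) * of_real (snd x) * poly (cf_den l N D) z - \<i> * (1 - z) * poly (cf_num l N D) z"
  proof -
    have "u * d * (s - b - n / d) = d * (u * s) - u * b * d - u * n" if "d \<noteq> 0" for u d s b n :: complex
      using that by (simp add: field_simps)
    then show ?thesis using assms(2) .
  qed
  also have "\<dots> = poly (cf_den (x # l) N D) z" unfolding t by (simp add: algebra_simps)
  finally show ?thesis by simp
qed

lemma cf_num_eval: "poly (cf_num (x # l) N D) z = \<i> * (1 - z) * poly (cf_den l N D) z"
  by (simp add: algebra_simps)

text \<open>On the closed disc away from 1, Im (1 / tz) <= 0, so A / tz - beta - R has negative
  imaginary part if R has a positive one; its reciprocal lies in the upper half plane. At 1 the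
  denominator is controlled by \<open>poly_cf_den_1_nonzero\<close>.\<close>

lemma adm_cf:
  assumes "adm N D" "\<And>x. x \<in> set l \<Longrightarrow> fst x > 0"
  shows "adm (cf_num l N D) (cf_den l N D)"
  using assms(2)
proof (induction l)
  case Nil
  then show ?case using assms(1) by simp
next
  case (Cons x l)
  then have IH: "adm (cf_num l N D) (cf_den l N D)" and A: "fst x > 0" by auto
  have D0: "poly (cf_den l N D) z \<noteq> 0" if "cmod z \<le> 1" for z using IH that by (auto simp: adm_def)
  have X: "Im (of_real (fst x) / tz z - of_real (snd x) - poly (cf_num l N D) z / poly (cf_den l N D) z) < 0" if z: "cmod z \<le> 1" "z \<noteq> 1" for z
  proof -
    have "Im (of_real (fst x) / tz z) = fst x * Im (1 / tz z)" by (simp add: Im_divide)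
    also have "\<dots> \<le> 0" unfolding Im_inverse_tz[OF z(2)] using A z(1) by (simp add: mult_nonneg_nonneg power_le_one)
    finally have 1: "Im (of_real (fst x) / tz z) \<le> 0" .
    have "Im (poly (cf_num l N D) z / poly (cf_den l N D) z) > 0" using IH z by (auto simp: adm_def)
    then show ?thesis unfolding minus_complex.sel Im_complex_of_real using 1 by linarith
  qed
  have den: "poly (cf_den (x # l) N D) z \<noteq> 0" if z: "cmod z \<le> 1" for z
  proof (cases "z = 1")
    case True
    then show ?thesis using poly_cf_den_1_nonzero[of "x # l" D N] Cons(2) assms(1) unfolding adm_def by simp
  next
    case False
    define Y where "Y = of_real (fst x) / tz z - of_real (snd x) - poly (cf_num l N D) z / poly (cf_den l N D) z"
    have "Im Y < 0" unfolding Y_def by (rule X[OF z False])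
    then have "Y \<noteq> 0" by auto
    then show ?thesis unfolding cf_den_eval[OF False D0[OF z]] Y_def[symmetric] using D0[OF z] False by simp
  qed
  have "Im (poly (cf_num (x # l) N D) z / poly (cf_den (x # l) N D) z) > 0" if z: "cmod z \<le> 1" "z \<noteq> 1" for z
  proof -
    define X where "X = of_real (fst x) / tz z - of_real (snd x) - poly (cf_num l N D) z / poly (cf_den l N D) z"
    have "poly (cf_num (x # l) N D) z / poly (cf_den (x # l) N D) z = 1 / X"
      unfolding cf_den_eval[OF z(2) D0[OF z(1)]] cf_num_eval X_def[symmetric] using D0[OF z(1)] z(2) by simp
    moreover have "Im X < 0" unfolding X_def by (rule X[OF z])
    then have "Im (1 / X) > 0" unfolding Im_divide by (auto intro!: divide_neg_pos simp: sum_power2_gt_zero_iff)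
    ultimately show ?thesis by simp
  qed
  with den show ?case unfolding adm_def by blast
qed

lemma contact_uhp_quotient:
  assumes "contact_uhp (Suc k) h"
  shows "\<exists>B. ((\<lambda>z. h z / tz z) \<longlongrightarrow> B) disc1"
proof -
  obtain p \<kappa> where p0: "poly p 0 = 0" and ex: "expn (2 * Suc k) h (cpoly p + monom (\<i> * of_real \<kappa>) (2 * Suc k))"
    using assms unfolding contact_uhp_def by blast
  define P where "P = cpoly p + monom (\<i> * of_real \<kappa>) (2 * Suc k)"
  have "poly P 0 = 0" using p0 poly_cpoly_of_real[of p 0] by (simp add: P_def poly_monom)
  then obtain Q where P: "P = pCons 0 Q" by (metis pCons_cases poly_0_coeff_0 coeff_pCons_0)
  have "((\<lambda>z. (h z - poly P (tz z)) / tz z ^ (2 * Suc k) * tz z ^ (2 * k + 1) + poly Q (tz z)) \<longlongrightarrow> 0 * 0 ^ (2 * k + 1) + poly Q 0) disc1"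
    using ex unfolding expn_def P_def[symmetric] by (intro tendsto_add tendsto_mult tendsto_power tz_tendsto tendsto_poly_tz)
  then have "((\<lambda>z. h z / tz z) \<longlongrightarrow> 0 * 0 ^ (2 * k + 1) + poly Q 0) disc1"
  proof (rule Lim_transform_eventually, intro eventually_disc1)
    fix z assume "cmod z < 1"
    then show "(h z - poly P (tz z)) / tz z ^ (2 * Suc k) * tz z ^ (2 * k + 1) + poly Q (tz z) = h z / tz z"
      using tz_nonzero[of z] by (simp add: P field_simps)
  qed
  then show ?thesis by blast
qed

lemma tendsto_ratio_disc1:
  assumes "poly D 1 \<noteq> 0"
  shows "((\<lambda>z. poly N z / poly D z) \<longlongrightarrow> poly N 1 / poly D 1) disc1"
  using assms by (intro tendsto_intros) auto

text \<open>The list records the steps taken on \<open>h\<close>, and the last fraction need only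
  match the final limit at 1. Unrolling one step gives h - R = (h' - R') h R; as h and R are both of
  order tz, two powers of tz are gained.\<close>

lemma contact_uhp_approx:
  assumes "contact_uhp k h"
  shows "\<exists>l \<kappa>. length l = k \<and> (\<forall>x\<in>set l. fst x > 0) \<and> \<kappa> > 0 \<and>
    (\<forall>N D. adm N D \<longrightarrow> poly N 1 / poly D 1 = \<i> * of_real \<kappa> \<longrightarrow>
      ((\<lambda>z. (h z - poly (cf_num l N D) z / poly (cf_den l N D) z) / tz z ^ (2 * k)) \<longlongrightarrow> 0) disc1)"
  using assms
proof (induction k arbitrary: h)
  case 0
  then obtain p \<kappa> where \<kappa>: "\<kappa> > 0" "poly p 0 = 0" "expn 0 h (cpoly p + monom (\<i> * of_real \<kappa>) 0)"
    unfolding contact_uhp_def by auto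
  have "poly (cpoly p + monom (\<i> * of_real \<kappa>) 0) 0 = \<i> * of_real \<kappa>" using \<kappa>(2) poly_cpoly_of_real[of p 0] by (simp add: poly_monom)
  then have h: "(h \<longlongrightarrow> \<i> * of_real \<kappa>) disc1" using expn_tendsto[OF \<kappa>(3)] by simp
  have "((\<lambda>z. h z - poly N z / poly D z) \<longlongrightarrow> 0) disc1" if "adm N D" "poly N 1 / poly D 1 = \<i> * of_real \<kappa>" for N D
  proof -
    have "poly D 1 \<noteq> 0" using that(1) by (simp add: adm_def)
    from tendsto_diff[OF h tendsto_ratio_disc1[OF this, of N]] show ?thesis unfolding that(2) by simp
  qed
  then show ?case using \<kappa>(1) by (intro exI[of _ "[]"] exI[of _ \<kappa>]) simp
next
  case (Suc k)
  obtain A \<beta> where A: "A > 0" and c: "contact_uhp k (\<lambda>z. of_real A / tz z - of_real \<beta> - 1 / h z)"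
    using contact_uhp_step[OF Suc.prems] by blast
  define h' where "h' = (\<lambda>z. of_real A / tz z - of_real \<beta> - 1 / h z)"
  obtain l \<kappa> where l: "length l = k" "\<And>x. x \<in> set l \<Longrightarrow> fst x > 0" "\<kappa> > 0"
    and ap: "\<And>N D. adm N D \<Longrightarrow> poly N 1 / poly D 1 = \<i> * of_real \<kappa> \<Longrightarrow>
      ((\<lambda>z. (h' z - poly (cf_num l N D) z / poly (cf_den l N D) z) / tz z ^ (2 * k)) \<longlongrightarrow> 0) disc1"
    using Suc.IH[OF c] unfolding h'_def by blast
  obtain B where B: "((\<lambda>z. h z / tz z) \<longlongrightarrow> B) disc1" using contact_uhp_quotient[OF Suc.prems] by blast
  have hpos: "Im (h z) > 0" if "cmod z < 1" for z using Suc.prems that unfolding contact_uhp_def by blast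
  let ?l = "(A, \<beta>) # l"
  have "((\<lambda>z. (h z - poly (cf_num ?l N D) z / poly (cf_den ?l N D) z) / tz z ^ (2 * Suc k)) \<longlongrightarrow> 0) disc1"
    if ND: "adm N D" "poly N 1 / poly D 1 = \<i> * of_real \<kappa>" for N D
  proof -
    define R' where "R' = (\<lambda>z. poly (cf_num l N D) z / poly (cf_den l N D) z)"
    define R where "R = (\<lambda>z. poly (cf_num ?l N D) z / poly (cf_den ?l N D) z)"
    have adl: "adm (cf_num l N D) (cf_den l N D)" by (rule adm_cf[OF ND(1) l(2)])
    have D0: "poly (cf_den l N D) z \<noteq> 0" if "cmod z \<le> 1" for z using adl that by (auto simp: adm_def)
    have adl2: "adm (cf_num ?l N D) (cf_den ?l N D)" by (rule adm_cf[OF ND(1)]) (use l(2) A in auto)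
    have R: "R z = 1 / (of_real A / tz z - of_real \<beta> - R' z)" and Rn: "R z \<noteq> 0" if z: "cmod z < 1" for z
    proof -
      have z1: "z \<noteq> 1" "cmod z \<le> 1" using z by auto
      have "poly (cf_den ?l N D) z \<noteq> 0" using adl2 z1 by (auto simp: adm_def)
      then show "R z = 1 / (of_real A / tz z - of_real \<beta> - R' z)"
        unfolding R_def R'_def cf_num_eval cf_den_eval[OF z1(1) D0[OF z1(2)]] using z1 D0[OF z1(2)] by simp
      have "Im (R z) > 0" using adl2 z1 unfolding R_def adm_def by blast
      then show "R z \<noteq> 0" by auto
    qed
    have R'lim: "(R' \<longlongrightarrow> poly (cf_num l N D) 1 / poly (cf_den l N D) 1) disc1"
      unfolding R'_def by (rule tendsto_ratio_disc1) (use D0[of 1] in simp)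
    have "((\<lambda>z. 1 / (of_real A - of_real \<beta> * tz z - tz z * R' z)) \<longlongrightarrow> 1 / (of_real A - of_real \<beta> * 0 - 0 * (poly (cf_num l N D) 1 / poly (cf_den l N D) 1))) disc1"
      using A by (intro tendsto_divide tendsto_diff tendsto_mult tendsto_const tz_tendsto R'lim) auto
    then have Rlim: "((\<lambda>z. R z / tz z) \<longlongrightarrow> 1 / (of_real A - of_real \<beta> * 0 - 0 * (poly (cf_num l N D) 1 / poly (cf_den l N D) 1))) disc1"
    proof (rule Lim_transform_eventually, intro eventually_disc1)
      fix z assume z: "cmod z < 1"
      have "R z / tz z = 1 / ((of_real A / tz z - of_real \<beta> - R' z) * tz z)" unfolding R[OF z] by simp
      also have "(of_real A / tz z - of_real \<beta> - R' z) * tz z = of_real A - of_real \<beta> * tz z - tz z * R' z"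
        using tz_nonzero[OF z] by (simp add: algebra_simps)
      finally show "1 / (of_real A - of_real \<beta> * tz z - tz z * R' z) = R z / tz z" by simp
    qed
    have "((\<lambda>z. (h' z - R' z) / tz z ^ (2 * k) * (h z / tz z) * (R z / tz z)) \<longlongrightarrow> 0 * B * (1 / (of_real A - of_real \<beta> * 0 - 0 * (poly (cf_num l N D) 1 / poly (cf_den l N D) 1)))) disc1"
      using ap[OF ND] unfolding R'_def[symmetric] by (intro tendsto_mult B Rlim) (simp add: R'_def)
    then have "((\<lambda>z. (h' z - R' z) / tz z ^ (2 * k) * (h z / tz z) * (R z / tz z)) \<longlongrightarrow> 0) disc1" by simp
    then have "((\<lambda>z. (h z - R z) / tz z ^ (2 * Suc k)) \<longlongrightarrow> 0) disc1"
    proof (rule Lim_transform_eventually, intro eventually_disc1)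
      fix z assume z: "cmod z < 1"
      have hn: "h z \<noteq> 0" using hpos[OF z] by auto
      have "1 / h z = of_real A / tz z - of_real \<beta> - h' z" by (simp add: h'_def)
      moreover have "1 / R z = of_real A / tz z - of_real \<beta> - R' z" unfolding R[OF z] by simp
      ultimately have "h' z - R' z = 1 / R z - 1 / h z" by simp
      then have "(h' z - R' z) * (h z * R z) = h z - R z" using hn Rn[OF z] by (simp add: field_simps)
      then show "(h' z - R' z) / tz z ^ (2 * k) * (h z / tz z) * (R z / tz z) = (h z - R z) / tz z ^ (2 * Suc k)"
        by (simp add: power2_eq_square mult.assoc[symmetric] power_Suc2)
    qed
    then show ?thesis unfolding R_def .
  qed
  then show ?case using l A by (intro exI[of _ ?l] exI[of _ \<kappa>]) auto
qed

text \<open>Off the point 1 a common root of the new pair is a common root of the previous one; at 1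
  the new denominator does not vanish.\<close>

lemma cf_no_common_root:
  assumes "\<And>z. poly N z = 0 \<Longrightarrow> poly D z \<noteq> 0" "\<And>x. x \<in> set l \<Longrightarrow> fst x > 0" "poly D 1 \<noteq> 0"
    and "poly (cf_num l N D) z = 0"
  shows "poly (cf_den l N D) z \<noteq> 0"
  using assms(2,4)
proof (induction l)
  case (Cons x l)
  have D1: "poly (cf_den l N D) 1 \<noteq> 0" using Cons(2) assms(3) by (intro poly_cf_den_1_nonzero) auto
  show ?case
  proof (cases "z = 1")
    case True
    then show ?thesis using poly_cf_den_1_nonzero[of "x # l" D N] Cons(2) assms(3) by simp
  next
    case False
    then have "poly (cf_den l N D) z = 0" using Cons(3) unfolding cf_num_eval by simp
    moreover from this have "poly (cf_num l N D) z \<noteq> 0" using Cons(1,2) by auto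
    ultimately show ?thesis using False by (simp add: right_diff_distrib[symmetric])
  qed
qed (use assms in auto)

text \<open>The numerator is \<i> (1 - z) times the denominator of the tail of the list. Its roots
  are 1 and the m generic roots of that denominator, none of which is 1, which gives m + 1 distinct
  roots.\<close>

theorem rational_uhp_model:
  assumes h: "contact_uhp m h" and m: "m > 0"
  shows "\<exists>N D. adm N D \<and> poly N 1 = 0 \<and> degree N = Suc m \<and> degree D \<le> Suc m \<and> card {z. poly N z = 0} = Suc m \<and>
     (\<forall>z. poly N z = 0 \<longrightarrow> poly D z \<noteq> 0) \<and> ((\<lambda>z. (h z - poly N z / poly D z) / tz z ^ (2 * m)) \<longlongrightarrow> 0) disc1"
proof -
  obtain l \<kappa> where l: "length l = m" "\<And>x. x \<in> set l \<Longrightarrow> fst x > 0" and \<kappa>: "\<kappa> > 0"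
    and ap: "\<And>N D. adm N D \<Longrightarrow> poly N 1 / poly D 1 = \<i> * of_real \<kappa> \<Longrightarrow>
      ((\<lambda>z. (h z - poly (cf_num l N D) z / poly (cf_den l N D) z) / tz z ^ (2 * m)) \<longlongrightarrow> 0) disc1"
    using contact_uhp_approx[OF h] by blast
  obtain x l' where ll: "l = x # l'" using l(1) m by (cases l) auto
  define w where "w = \<i> * complex_of_real \<kappa>"
  obtain \<rho> where \<rho>: "cmod \<rho> \<ge> 3" and fin: "finite {c. \<not> (degree (cf_den l' (smult w [:-\<rho>, 1:] + smult c [:1, -1:]) [:-\<rho>, 1:]) = Suc (length l') \<and>
     card {z. poly (cf_den l' (smult w [:-\<rho>, 1:] + smult c [:1, -1:]) [:-\<rho>, 1:]) z = 0} = Suc (length l'))}"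
    using cf_den_generic[of l' w] l(2) ll by auto
  \<comment> \<open>Infinitely many candidates, so one of them avoids the finite exceptional set.
    All are nonzero and smaller than \<kappa>; since |1 - z| <= 2 <= |z - rho| on the closed disc,
    the added term cannot push the imaginary part \<kappa> down to 0.\<close>
  define S where "S = (\<lambda>n::nat. complex_of_real (\<kappa> / (real n + 2))) ` UNIV"
  have "infinite S" unfolding S_def using \<kappa>
    by (intro range_inj_infinite) (auto simp: inj_on_def field_simps)
  then obtain c where c: "c \<in> S" "degree (cf_den l' (smult w [:-\<rho>, 1:] + smult c [:1, -1:]) [:-\<rho>, 1:]) = Suc (length l')"
     "card {z. poly (cf_den l' (smult w [:-\<rho>, 1:] + smult c [:1, -1:]) [:-\<rho>, 1:]) z = 0} = Suc (length l')"
    using finite_subset[OF _ fin, of S] by blast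
  have cn: "c \<noteq> 0" "cmod c < \<kappa>"
  proof -
    obtain n where n: "c = complex_of_real (\<kappa> / (real n + 2))" using c(1) by (auto simp: S_def)
    show "c \<noteq> 0" unfolding n of_real_eq_0_iff using \<kappa> by simp
    have "\<kappa> / (real n + 2) < \<kappa> / 1" using \<kappa> by (intro divide_strict_left_mono) auto
    then show "cmod c < \<kappa>" unfolding n norm_of_real using \<kappa> by simp
  qed
  define D0 where "D0 = [:-\<rho>, 1:]"
  define N0 where "N0 = smult w D0 + smult c [:1, -1:]"
  have pD: "poly D0 z = z - \<rho>" and pN: "poly N0 z = w * (z - \<rho>) + c * (1 - z)" for z by (auto simp: D0_def N0_def algebra_simps)
  have far: "cmod (z - \<rho>) \<ge> 2" if "cmod z \<le> 1" for z
    using norm_triangle_ineq2[of \<rho> z] that \<rho> by (simp add: norm_minus_commute)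
  have ad: "adm N0 D0" unfolding adm_def
  proof (intro conjI allI impI)
    fix z assume z: "cmod z \<le> 1"
    then show D: "poly D0 z \<noteq> 0" using far[of z] by (auto simp: pD)
    have "poly N0 z / poly D0 z = w + c * (1 - z) / (z - \<rho>)" using D unfolding pN pD by (simp add: add_divide_distrib)
    moreover have "cmod (c * (1 - z) / (z - \<rho>)) < \<kappa>"
    proof -
      have "cmod (c * (1 - z) / (z - \<rho>)) = cmod c * (cmod (1 - z) / cmod (z - \<rho>))" by (simp add: norm_mult norm_divide)
      also have "cmod (1 - z) / cmod (z - \<rho>) \<le> 2 / 2"
        using far[OF z] norm_triangle_ineq4[of 1 z] z by (intro frac_le) auto
      finally show ?thesis using cn(2) by (simp add: mult_left_mono)
    qed
    then have "- \<kappa> < Im (c * (1 - z) / (z - \<rho>))" using abs_Im_le_cmod[of "c * (1 - z) / (z - \<rho>)"] by linarith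
    ultimately show "Im (poly N0 z / poly D0 z) > 0" by (simp add: w_def)
  qed
  have r1: "poly N0 1 / poly D0 1 = \<i> * of_real \<kappa>" using far[of 1] unfolding pN pD w_def by auto
  define N where "N = cf_num l N0 D0"
  define D where "D = cf_den l N0 D0"
  define D' where "D' = cf_den l' N0 D0"
  have D': "degree D' = m" "card {z. poly D' z = 0} = m" using c(2,3) l(1) ll by (auto simp: D'_def N0_def D0_def)
  have ND: "N = [:\<i>, -\<i>:] * D'" by (simp add: N_def D'_def ll)
  have D'1: "poly D' 1 \<noteq> 0" unfolding D'_def using l(2) ll far[of 1] by (intro poly_cf_den_1_nonzero) (auto simp: pD)
  have D'0: "D' \<noteq> 0" using D'1 by auto
  have "adm N D" unfolding N_def D_def by (rule adm_cf[OF ad l(2)])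
  moreover have "poly N 1 = 0" unfolding ND by simp
  moreover have "degree N = Suc m" unfolding ND using D'0 D'(1) by (subst degree_mult_eq) auto
  moreover have "degree D \<le> Suc m"
  proof -
    have "degree N0 \<le> 1" unfolding N0_def D0_def by (intro degree_add_le order_trans[OF degree_smult_le]) auto
    then show ?thesis unfolding D_def using degree_cf(2)[of N0 1 D0 l] l(1) by (simp add: D0_def)
  qed
  moreover have "card {z. poly N z = 0} = Suc m"
  proof -
    have "{z. poly N z = 0} = insert 1 {z. poly D' z = 0}"
      unfolding ND by (auto simp: right_diff_distrib[symmetric])
    then show ?thesis using D'(2) D'1 poly_roots_finite[OF D'0] by simp
  qed
  moreover have "poly D z \<noteq> 0" if "poly N z = 0" for z
    unfolding D_def
  proof (rule cf_no_common_root[OF _ l(2)])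
    show "poly D0 z \<noteq> 0" if "poly N0 z = 0" for z
    proof
      assume "poly D0 z = 0"
      then have z: "z = \<rho>" by (simp add: pD)
      then have "c * (1 - \<rho>) = 0" using that by (simp add: pN)
      then have "\<rho> = 1" using cn(1) by simp
      then show False using \<rho> by simp
    qed
    show "poly D0 1 \<noteq> 0" using far[of 1] by (auto simp: pD)
    show "poly (cf_num l N0 D0) z = 0" using that by (simp add: N_def)
  qed
  moreover have "((\<lambda>z. (h z - poly N z / poly D z) / tz z ^ (2 * m)) \<longlongrightarrow> 0) disc1"
    unfolding N_def D_def by (rule ap[OF ad r1])
  ultimately show ?thesis by blast
qed

section \<open>From the half plane model to a basic function\<close>

definition cay :: "complex \<Rightarrow> complex" where "cay w = (1 + \<i> * w) / (1 - \<i> * w)"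

lemma cay_denominator: "Im w \<ge> 0 \<Longrightarrow> cmod (1 - \<i> * w) \<ge> 1"
  using complex_Re_le_cmod[of "1 - \<i> * w"] by simp

lemma cay_norm:
  assumes "Im w \<ge> 0"
  shows "1 - (cmod (cay w))\<^sup>2 = 4 * Im w / (cmod (1 - \<i> * w))\<^sup>2"
proof -
  have n: "(cmod (1 - \<i> * w))\<^sup>2 \<noteq> 0" using cay_denominator[OF assms] by auto
  have "(cmod (1 - \<i> * w))\<^sup>2 - (cmod (1 + \<i> * w))\<^sup>2 = 4 * Im w"
    unfolding cmod_power2 by (simp add: power2_eq_square algebra_simps)
  then show ?thesis using n by (simp add: cay_def norm_divide power_divide divide_simps)
qed

lemma cay_lt_1: "Im w > 0 \<Longrightarrow> cmod (cay w) < 1"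
proof -
  assume w: "Im w > 0"
  have "0 < 4 * Im w / (cmod (1 - \<i> * w))\<^sup>2" using w cay_denominator[of w] by (auto intro!: divide_pos_pos zero_less_power)
  then have "(cmod (cay w))\<^sup>2 < 1\<^sup>2" using cay_norm[of w] w by simp
  then show ?thesis by (rule power2_less_imp_less) simp
qed

text \<open>P - omega Q is a nonzero multiple of N rotated by \<zeta>, so the finite preimages of
  \<omega> correspond to the roots of N. Since N has the full degree m + 1, infinity is not a
  preimage, and m + 1 distinct roots make \<omega> a regular value.\<close>

theorem basic_fun_of_uhp_model:
  assumes ad: "adm N D" and N1: "poly N 1 = 0" and dN: "degree N = Suc m" and dD: "degree D \<le> Suc m"
    and card: "card {z. poly N z = 0} = Suc m" and nc: "\<And>z. poly N z = 0 \<Longrightarrow> poly D z \<noteq> 0"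
    and \<zeta>: "cmod \<zeta> = 1" and \<omega>: "cmod \<omega> = 1"
  shows "\<exists>P Q. basic_fun P Q \<zeta> \<and> rat_deg P Q = Suc m \<and> (\<forall>z. cmod z \<le> 1 \<longrightarrow> rat_fun P Q z = \<omega> * cay (poly N (cnj \<zeta> * z) / poly D (cnj \<zeta> * z)))"
proof -
  define P where "P = smult \<omega> ((D + smult \<i> N) \<circ>\<^sub>p [:0, cnj \<zeta>:])"
  define Q where "Q = (D - smult \<i> N) \<circ>\<^sub>p [:0, cnj \<zeta>:]"
  have zz: "cnj \<zeta> * \<zeta> = 1" using \<zeta> by (simp add: complex_norm_square[symmetric] mult.commute)
  have \<omega>0: "\<omega> \<noteq> 0" and \<zeta>0: "\<zeta> \<noteq> 0" using \<omega> \<zeta> by auto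
  have pP: "poly P z = \<omega> * (poly D (cnj \<zeta> * z) + \<i> * poly N (cnj \<zeta> * z))" and pQ: "poly Q z = poly D (cnj \<zeta> * z) - \<i> * poly N (cnj \<zeta> * z)" for z
    by (auto simp: P_def Q_def poly_pcompose mult.commute)
  have rot: "cmod (cnj \<zeta> * z) = cmod z" for z using \<zeta> by (simp add: norm_mult)
  define R where "R = (\<lambda>z. poly N z / poly D z)"
  have Dn: "poly D z \<noteq> 0" if "cmod z \<le> 1" for z using ad that by (auto simp: adm_def)
  have Rge: "Im (R z) \<ge> 0" if "cmod z \<le> 1" for z using ad that N1 by (cases "z = 1") (auto simp: adm_def R_def intro: less_imp_le)
  have Rgt: "Im (R z) > 0" if "cmod z \<le> 1" "z \<noteq> 1" for z using ad that by (auto simp: adm_def R_def)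
  have Qn: "poly Q z \<noteq> 0" if z: "cmod z \<le> 1" for z
  proof -
    have "poly Q z = poly D (cnj \<zeta> * z) * (1 - \<i> * R (cnj \<zeta> * z))" using Dn[of "cnj \<zeta> * z"] z by (simp add: pQ R_def rot right_diff_distrib)
    moreover have "1 - \<i> * R (cnj \<zeta> * z) \<noteq> 0" using cay_denominator[OF Rge[of "cnj \<zeta> * z"]] z by (auto simp: rot)
    ultimately show ?thesis using Dn[of "cnj \<zeta> * z"] z by (simp add: rot)
  qed
  have rat: "rat_fun P Q z = \<omega> * cay (R (cnj \<zeta> * z))" if z: "cmod z \<le> 1" for z
  proof -
    have d: "poly D (cnj \<zeta> * z) \<noteq> 0" using Dn[of "cnj \<zeta> * z"] z by (simp add: rot)
    have "1 + \<i> * R (cnj \<zeta> * z) = (poly D (cnj \<zeta> * z) + \<i> * poly N (cnj \<zeta> * z)) / poly D (cnj \<zeta> * z)"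
      "1 - \<i> * R (cnj \<zeta> * z) = (poly D (cnj \<zeta> * z) - \<i> * poly N (cnj \<zeta> * z)) / poly D (cnj \<zeta> * z)"
      using d by (auto simp: R_def add_divide_distrib diff_divide_distrib)
    then show ?thesis unfolding rat_fun_def cay_def pP pQ using d by simp
  qed
  have rz: "rat_fun P Q \<zeta> = \<omega>" using rat[of \<zeta>] \<zeta> N1 by (simp add: zz R_def cay_def)
  have diff: "P - smult \<omega> Q = smult (2 * \<i> * \<omega>) (N \<circ>\<^sub>p [:0, cnj \<zeta>:])"
  proof -
    have "poly (P - smult \<omega> Q) = poly (smult (2 * \<i> * \<omega>) (N \<circ>\<^sub>p [:0, cnj \<zeta>:]))"
    proof (rule ext)
      fix z
      have e: "poly (N \<circ>\<^sub>p [:0, cnj \<zeta>:]) z = poly N (cnj \<zeta> * z)" by (simp add: poly_pcompose mult.commute)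
      have alg: "\<omega> * (d + \<i> * n) - \<omega> * (d - \<i> * n) = 2 * \<i> * \<omega> * n" for d n by (simp add: algebra_simps)
      show "poly (P - smult \<omega> Q) z = poly (smult (2 * \<i> * \<omega>) (N \<circ>\<^sub>p [:0, cnj \<zeta>:])) z"
        by (simp only: poly_diff poly_smult pP pQ e alg)
    qed
    then show ?thesis by (simp only: poly_eq_poly_eq_iff)
  qed
  have ddiff: "degree (P - smult \<omega> Q) = Suc m" unfolding diff using \<omega>0 \<zeta>0 dN by (simp add: degree_pcompose)
  have rd: "rat_deg P Q = Suc m"
  proof -
    have "degree P \<le> Suc m" "degree Q \<le> Suc m"
      unfolding P_def Q_def using dN dD \<zeta>0 \<omega>0
      by (auto simp: degree_pcompose intro!: degree_add_le degree_diff_le order_trans[OF degree_smult_le])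
    moreover have "Suc m \<le> max (degree P) (degree Q)"
      using degree_diff_le_max[of P "smult \<omega> Q"] ddiff \<omega>0 by simp
    ultimately show ?thesis unfolding rat_deg_def by simp
  qed
  have "basic_fun P Q \<zeta>" unfolding basic_fun_def
  proof (intro conjI allI impI)
    show "Q \<noteq> 0" using Qn[of 0] by auto
    show "coprime P Q"
    proof (rule coprime_no_common_root)
      fix z assume "poly P z = 0"
      then have 1: "poly D (cnj \<zeta> * z) + \<i> * poly N (cnj \<zeta> * z) = 0" using \<omega>0 by (simp add: pP)
      show "poly Q z \<noteq> 0"
      proof
        assume "poly Q z = 0"
        then have 2: "poly D (cnj \<zeta> * z) - \<i> * poly N (cnj \<zeta> * z) = 0" by (simp add: pQ)
        from 1 2 have "2 * poly D (cnj \<zeta> * z) = 0" by algebra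
        then have "poly D (cnj \<zeta> * z) = 0" by simp
        moreover from this 2 have "poly N (cnj \<zeta> * z) = 0" by simp
        ultimately show False using nc by blast
      qed
    qed
    show "poly Q z \<noteq> 0" if "cmod z \<le> 1" for z by (rule Qn[OF that])
    show "rat_fun P Q ` ball 0 1 \<subseteq> ball 0 1"
    proof (intro image_subsetI)
      fix z :: complex assume z: "z \<in> ball 0 1"
      then have "cnj \<zeta> * z \<noteq> 1" using rot[of z] by auto
      then have "cmod (cay (R (cnj \<zeta> * z))) < 1" using z by (intro cay_lt_1 Rgt) (auto simp: rot)
      then show "rat_fun P Q z \<in> ball 0 1" using z \<omega> by (simp add: rat norm_mult)
    qed
    show "cmod (rat_fun P Q \<zeta>) = 1" using rz \<omega> by simp
    show "rat_fun P Q ` (sphere 0 1 - {\<zeta>}) \<subseteq> ball 0 1"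
    proof (intro image_subsetI)
      fix z :: complex assume z: "z \<in> sphere 0 1 - {\<zeta>}"
      have "cnj \<zeta> * z \<noteq> 1"
      proof
        assume "cnj \<zeta> * z = 1"
        then have "\<zeta> * (cnj \<zeta> * z) = \<zeta>" by simp
        then have "z = \<zeta>" using zz by (simp add: mult.assoc[symmetric] mult.commute[of \<zeta>])
        then show False using z by simp
      qed
      then have "cmod (cay (R (cnj \<zeta> * z))) < 1" using z by (intro cay_lt_1 Rgt) (auto simp: rot)
      then show "rat_fun P Q z \<in> ball 0 1" using z \<omega> by (simp add: rat norm_mult)
    qed
    show "P - smult (rat_fun P Q \<zeta>) Q \<noteq> 0" unfolding rz using ddiff by auto
    have "{z. poly (P - smult \<omega> Q) z = 0} = (\<lambda>z. \<zeta> * z) ` {z. poly N z = 0}"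
    proof -
      have e: "poly (P - smult \<omega> Q) z = 0 \<longleftrightarrow> poly N (cnj \<zeta> * z) = 0" for z
        unfolding diff using \<omega>0 by (simp add: poly_pcompose mult.commute)
      have "\<zeta> * (cnj \<zeta> * z) = z" "cnj \<zeta> * (\<zeta> * z) = z" for z using zz by (simp_all add: mult.assoc[symmetric] mult.commute[of \<zeta>])
      note inv = this
      show ?thesis
      proof (intro set_eqI iffI)
        fix z assume "z \<in> {z. poly (P - smult \<omega> Q) z = 0}"
        then have "cnj \<zeta> * z \<in> {z. poly N z = 0}" by (simp only: mem_Collect_eq e)
        then show "z \<in> (\<lambda>z. \<zeta> * z) ` {z. poly N z = 0}" by (rule rev_image_eqI) (rule inv(1)[symmetric])
      next
        fix z assume "z \<in> (\<lambda>z. \<zeta> * z) ` {z. poly N z = 0}"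
        then obtain y where y: "z = \<zeta> * y" "poly N y = 0" by blast
        show "z \<in> {z. poly (P - smult \<omega> Q) z = 0}" by (simp only: mem_Collect_eq e y(1) inv(2) y(2))
      qed
    qed
    then have "card {z. poly (P - smult \<omega> Q) z = 0} = Suc m"
      using card card_image[of "\<lambda>z. \<zeta> * z" "{z. poly N z = 0}"] \<zeta>0 by (simp add: inj_on_def)
    then show "num_preimages P Q (rat_fun P Q \<zeta>) = rat_deg P Q" unfolding num_preimages_def rz rd ddiff by simp
  qed
  then show ?thesis using rd rat unfolding R_def by blast
qed

section \<open>Order of contact\<close>

text \<open>Every arc around \<zeta> contains an interval of angles of positive length, so almost
  everywhere properties near \<zeta> can be instantiated, at an angle whose point differs from
  \<zeta>.\<close>

lemma arc_AE_exists:
  assumes \<zeta>: "cmod \<zeta> = 1" and P: "AE \<theta> in lborel. P \<theta>" and \<delta>: "\<delta> > 0"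
  shows "\<exists>\<theta>. 0 < cmod (cis \<theta> - \<zeta>) \<and> cmod (cis \<theta> - \<zeta>) < \<delta> \<and> P \<theta>"
proof (rule ccontr)
  assume no: "\<not> ?thesis"
  define \<theta>0 where "\<theta>0 = Arg \<zeta>"
  have "\<zeta> \<noteq> 0" using \<zeta> by auto
  then have \<theta>0: "cis \<theta>0 = \<zeta>" using \<zeta> cis_Arg[of \<zeta>] unfolding \<theta>0_def by (auto simp: sgn_eq)
  have "isCont cis \<theta>0" using continuous_on_cis[OF continuous_on_id, of UNIV] by (simp add: continuous_on_eq_continuous_at)
  then obtain r where r: "r > 0" "\<And>\<theta>. dist \<theta> \<theta>0 < r \<Longrightarrow> dist (cis \<theta>) (cis \<theta>0) < \<delta>"
    using \<delta> unfolding continuous_at_eps_delta by blast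
  have "AE \<theta> in lborel. cis \<theta> \<noteq> \<zeta>" using AE_not_in[OF arc_null_singleton[of \<zeta>, unfolded arc_null_def]] by auto
  with P have "AE \<theta> in lborel. \<theta> \<notin> {\<theta>0<..<\<theta>0 + r}"
  proof eventually_elim
    case (elim \<theta>)
    show ?case
    proof
      assume "\<theta> \<in> {\<theta>0<..<\<theta>0 + r}"
      then have "cmod (cis \<theta> - \<zeta>) < \<delta>" using r(2)[of \<theta>] \<theta>0 by (simp add: dist_norm)
      then show False using no elim by auto
    qed
  qed
  then have "{\<theta>0<..<\<theta>0 + r} \<in> null_sets lborel" by (intro AE_iff_null_sets[THEN iffD2]) auto
  then show False using r(1) by (simp add: null_sets_def)
qed

lemma radial_path: "((\<lambda>r::real. of_real r * cis \<theta>) \<longlongrightarrow> cis \<theta>) (at_left 1)"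
  by (auto intro!: tendsto_eq_intros)

lemma eventually_radial:
  assumes "cmod (cis \<theta> - \<zeta>) < \<delta>"
  shows "eventually (\<lambda>r::real. cmod (of_real r * cis \<theta>) < 1 \<and> cmod (of_real r * cis \<theta> - \<zeta>) < \<delta>) (at_left 1)"
proof -
  have "((\<lambda>r::real. cmod (of_real r * cis \<theta> - \<zeta>)) \<longlongrightarrow> cmod (cis \<theta> - \<zeta>)) (at_left 1)"
    by (intro tendsto_norm tendsto_diff radial_path tendsto_const)
  then have "eventually (\<lambda>r::real. cmod (of_real r * cis \<theta> - \<zeta>) < \<delta>) (at_left 1)" using assms by (rule order_tendstoD(2))
  moreover have "eventually (\<lambda>r::real. r \<in> {0<..<1}) (at_left 1)" by (rule eventually_at_left_real) simp
  ultimately show ?thesis by eventually_elim (auto simp: norm_mult)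
qed

text \<open>Interior estimates pass to radial limits one angle at a time; no continuity of the
  function up to the circle is assumed.\<close>

lemma radial_upper:
  assumes v: "radial_lim F \<theta> v" and b: "\<And>z. cmod z < 1 \<Longrightarrow> cmod (z - \<zeta>) < \<delta> \<Longrightarrow> cmod (F z) \<le> \<epsilon> * cmod (z - \<zeta>) ^ n"
    and \<theta>: "cmod (cis \<theta> - \<zeta>) < \<delta>"
  shows "cmod v \<le> \<epsilon> * cmod (cis \<theta> - \<zeta>) ^ n"
proof (rule tendsto_le[of "at_left (1::real)"])
  show "((\<lambda>r. cmod (F (of_real r * cis \<theta>))) \<longlongrightarrow> cmod v) (at_left 1)" using v unfolding radial_lim_def by (rule tendsto_norm)
  show "((\<lambda>r::real. \<epsilon> * cmod (of_real r * cis \<theta> - \<zeta>) ^ n) \<longlongrightarrow> \<epsilon> * cmod (cis \<theta> - \<zeta>) ^ n) (at_left 1)"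
    by (intro tendsto_mult tendsto_power tendsto_norm tendsto_diff radial_path tendsto_const)
  show "eventually (\<lambda>r. cmod (F (of_real r * cis \<theta>)) \<le> \<epsilon> * cmod (of_real r * cis \<theta> - \<zeta>) ^ n) (at_left 1)"
    using eventually_radial[OF \<theta>] by eventually_elim (use b in auto)
qed simp

lemma radial_lower:
  assumes v: "radial_lim F \<theta> v" and b: "\<And>z. cmod z < 1 \<Longrightarrow> cmod (z - \<zeta>) < \<delta> \<Longrightarrow> c * cmod (z - \<zeta>) \<le> cmod (F z)"
    and \<theta>: "cmod (cis \<theta> - \<zeta>) < \<delta>"
  shows "c * cmod (cis \<theta> - \<zeta>) \<le> cmod v"
proof (rule tendsto_le[of "at_left (1::real)"])
  show "((\<lambda>r. cmod (F (of_real r * cis \<theta>))) \<longlongrightarrow> cmod v) (at_left 1)" using v unfolding radial_lim_def by (rule tendsto_norm)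
  show "((\<lambda>r::real. c * cmod (of_real r * cis \<theta> - \<zeta>)) \<longlongrightarrow> c * cmod (cis \<theta> - \<zeta>)) (at_left 1)"
    by (intro tendsto_mult tendsto_norm tendsto_diff radial_path tendsto_const)
  show "eventually (\<lambda>r. c * cmod (of_real r * cis \<theta> - \<zeta>) \<le> cmod (F (of_real r * cis \<theta>))) (at_left 1)"
    using eventually_radial[OF \<theta>] by eventually_elim (use b in auto)
qed simp

lemma boundary_filter_nontrivial: "cmod \<zeta> = 1 \<Longrightarrow> at \<zeta> within ball 0 1 \<noteq> bot"
  by (simp add: trivial_limit_within islimpt_ball)

lemma eventually_boundary:
  assumes "cmod \<zeta> = 1"
  shows "eventually P (at \<zeta> within ball 0 1) \<longleftrightarrow> (\<exists>\<delta>>0. \<forall>z. cmod z < 1 \<longrightarrow> cmod (z - \<zeta>) < \<delta> \<longrightarrow> P z)"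
proof -
  have "(\<forall>z\<in>ball 0 1. z \<noteq> \<zeta> \<and> cmod (z - \<zeta>) < \<delta> \<longrightarrow> P z) \<longleftrightarrow> (\<forall>z. cmod z < 1 \<longrightarrow> cmod (z - \<zeta>) < \<delta> \<longrightarrow> P z)" for \<delta>
  proof -
    have "z \<noteq> \<zeta>" if "cmod z < 1" for z using assms that by auto
    then show ?thesis by auto
  qed
  then show ?thesis unfolding eventually_at dist_norm by simp
qed

text \<open>Clears the denominators in the definition. A radial limit equal to \<open>w\<close>
  would make the quotient 0, below the positive constant \<open>c\<close>, which explains
  \<open>v \<noteq> w\<close>.\<close>

lemma contact_orderE:
  assumes \<zeta>: "cmod \<zeta> = 1" and c: "contact_order \<phi> \<zeta> n" and lim: "(\<phi> \<longlongrightarrow> w) (at \<zeta> within ball 0 1)"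
  obtains c C \<delta> where "c > 0" "C > 0" "\<delta> > 0" "cmod w = 1"
    "AE \<theta> in lborel. 0 < cmod (cis \<theta> - \<zeta>) \<and> cmod (cis \<theta> - \<zeta>) < \<delta> \<longrightarrow>
       (\<exists>v. radial_lim \<phi> \<theta> v \<and> v \<noteq> w \<and> c * cmod (w - v) ^ n \<le> 1 - (cmod v)\<^sup>2 \<and> 1 - (cmod v)\<^sup>2 \<le> C * cmod (w - v) ^ n)"
proof -
  obtain w' c C \<delta> where w': "cmod w' = 1" "(\<phi> \<longlongrightarrow> w') (at \<zeta> within ball 0 1)" and cC: "c > 0" "C > 0" "\<delta> > 0"
    and ae: "AE \<theta> in lborel. 0 < cmod (cis \<theta> - \<zeta>) \<and> cmod (cis \<theta> - \<zeta>) < \<delta> \<longrightarrow>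
           (\<exists>v. radial_lim \<phi> \<theta> v \<and> c \<le> (1 - (cmod v)\<^sup>2) / (cmod (w' - v)) ^ n \<and> (1 - (cmod v)\<^sup>2) / (cmod (w' - v)) ^ n \<le> C)"
    using c unfolding contact_order_def by blast
  have ww: "w' = w" by (rule tendsto_unique[OF boundary_filter_nontrivial[OF \<zeta>] w'(2) lim])
  have "AE \<theta> in lborel. 0 < cmod (cis \<theta> - \<zeta>) \<and> cmod (cis \<theta> - \<zeta>) < \<delta> \<longrightarrow>
       (\<exists>v. radial_lim \<phi> \<theta> v \<and> v \<noteq> w \<and> c * cmod (w - v) ^ n \<le> 1 - (cmod v)\<^sup>2 \<and> 1 - (cmod v)\<^sup>2 \<le> C * cmod (w - v) ^ n)"
    using ae
  proof eventually_elim
    case (elim \<theta>)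
    show ?case
    proof
      assume "0 < cmod (cis \<theta> - \<zeta>) \<and> cmod (cis \<theta> - \<zeta>) < \<delta>"
      then obtain v where v: "radial_lim \<phi> \<theta> v" "c \<le> (1 - (cmod v)\<^sup>2) / (cmod (w - v)) ^ n" "(1 - (cmod v)\<^sup>2) / (cmod (w - v)) ^ n \<le> C"
        using elim ww by auto
      have vw: "v \<noteq> w" using v(2) cC(1) w'(1) ww by auto
      then have "cmod (w - v) ^ n > 0" by simp
      then show "\<exists>v. radial_lim \<phi> \<theta> v \<and> v \<noteq> w \<and> c * cmod (w - v) ^ n \<le> 1 - (cmod v)\<^sup>2 \<and> 1 - (cmod v)\<^sup>2 \<le> C * cmod (w - v) ^ n"
        using v vw by (intro exI[of _ v]) (auto simp: pos_le_divide_eq pos_divide_le_eq)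
    qed
  qed
  then show ?thesis using that cC w'(1) ww by blast
qed

lemma contact_order_limit:
  assumes "contact_order \<phi> \<zeta> n"
  obtains w where "cmod w = 1" "(\<phi> \<longlongrightarrow> w) (at \<zeta> within ball 0 1)"
  using assms unfolding contact_order_def by blast

text \<open>The unrestricted limit makes all radial limits near \<zeta> close to \<open>w\<close>,
  so one angle can be found that also has a given almost everywhere property.\<close>

lemma small_gap_exists:
  assumes \<zeta>: "cmod \<zeta> = 1" and lim: "(\<phi> \<longlongrightarrow> w) (at \<zeta> within ball 0 1)" and P: "AE \<theta> in lborel. 0 < cmod (cis \<theta> - \<zeta>) \<and> cmod (cis \<theta> - \<zeta>) < \<delta> \<longrightarrow> P \<theta>"
    and \<delta>: "\<delta> > 0" and \<epsilon>: "\<epsilon> > 0"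
  shows "\<exists>\<theta>. P \<theta> \<and> (\<forall>v. radial_lim \<phi> \<theta> v \<longrightarrow> cmod (w - v) \<le> \<epsilon>)"
proof -
  have "eventually (\<lambda>z. dist (\<phi> z) w < \<epsilon>) (at \<zeta> within ball 0 1)" using lim \<epsilon> by (rule tendstoD)
  then obtain \<delta>' where \<delta>': "\<delta>' > 0" "\<And>z. cmod z < 1 \<Longrightarrow> cmod (z - \<zeta>) < \<delta>' \<Longrightarrow> dist (\<phi> z) w < \<epsilon>"
    unfolding eventually_boundary[OF \<zeta>] by blast
  obtain \<theta> where \<theta>: "0 < cmod (cis \<theta> - \<zeta>)" "cmod (cis \<theta> - \<zeta>) < min \<delta> \<delta>'" "0 < cmod (cis \<theta> - \<zeta>) \<and> cmod (cis \<theta> - \<zeta>) < \<delta> \<longrightarrow> P \<theta>"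
    using arc_AE_exists[OF \<zeta> P, of "min \<delta> \<delta>'"] \<delta> \<delta>'(1) by auto
  have "cmod (w - v) \<le> \<epsilon>" if "radial_lim \<phi> \<theta> v" for v
  proof -
    have "radial_lim (\<lambda>z. \<phi> z - w) \<theta> (v - w)" using that unfolding radial_lim_def by (intro tendsto_diff tendsto_const)
    from radial_upper[OF this, where \<zeta> = \<zeta> and \<delta> = \<delta>' and \<epsilon> = \<epsilon> and n = 0] \<delta>'(2) \<theta>(2) show ?thesis
      by (auto simp: dist_norm norm_minus_commute intro: less_imp_le)
  qed
  then show ?thesis using \<theta> by (intro exI[of _ \<theta>]) auto
qed

text \<open>Order 0 would keep 1 - |v|^2 above a positive constant, although radial limits near
  \<zeta> approach the unimodular \<open>w\<close>.\<close>

lemma contact_order_pos: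
  assumes \<zeta>: "cmod \<zeta> = 1" and c: "contact_order \<phi> \<zeta> n"
  shows "n > 0"
proof (rule ccontr)
  assume "\<not> n > 0"
  then have n: "n = 0" by simp
  obtain w where w: "cmod w = 1" "(\<phi> \<longlongrightarrow> w) (at \<zeta> within ball 0 1)" using contact_order_limit[OF c] by blast
  obtain c C \<delta> where cC: "c > 0" "C > 0" "\<delta> > 0" and ae: "AE \<theta> in lborel. 0 < cmod (cis \<theta> - \<zeta>) \<and> cmod (cis \<theta> - \<zeta>) < \<delta> \<longrightarrow>
       (\<exists>v. radial_lim \<phi> \<theta> v \<and> v \<noteq> w \<and> c * cmod (w - v) ^ n \<le> 1 - (cmod v)\<^sup>2 \<and> 1 - (cmod v)\<^sup>2 \<le> C * cmod (w - v) ^ n)"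
    using contact_orderE[OF \<zeta> c w(2)] by blast
  obtain \<theta> v where v: "c * cmod (w - v) ^ n \<le> 1 - (cmod v)\<^sup>2" "cmod (w - v) \<le> c / 4"
    using small_gap_exists[OF \<zeta> w(2) ae cC(3), of "c / 4"] cC(1) by auto
  have "1 - cmod v \<le> cmod (w - v)" using norm_triangle_ineq2[of w v] w by simp
  then have "cmod v \<ge> 1 - c / 4" using v(2) by linarith
  moreover have "(cmod v)\<^sup>2 \<le> 1 - c" using v(1) n by simp
  ultimately show False
  proof -
    assume a: "cmod v \<ge> 1 - c / 4" "(cmod v)\<^sup>2 \<le> 1 - c"
    have "0 \<le> (cmod v - 1)\<^sup>2" by simp
    then have "2 * cmod v - 1 \<le> (cmod v)\<^sup>2" by (simp add: power2_eq_square algebra_simps)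
    then show False using a cC(1) by linarith
  qed
qed

text \<open>Two orders n < n' would give a d^n <= B d^n' for arbitrarily small distances d = |w - v|
  > 0. Uniqueness is what allows a conclusion about every contact order from a single chosen
  one.\<close>

lemma contact_order_unique_le:
  assumes \<zeta>: "cmod \<zeta> = 1" and c: "contact_order \<phi> \<zeta> n" and c': "contact_order \<phi> \<zeta> n'"
  shows "n' \<le> n"
proof (rule ccontr)
  assume "\<not> n' \<le> n"
  then have nn: "n < n'" by simp
  obtain w where w: "cmod w = 1" "(\<phi> \<longlongrightarrow> w) (at \<zeta> within ball 0 1)" using contact_order_limit[OF c] by blast
  obtain a A \<delta> where aA: "a > 0" "A > 0" "\<delta> > 0" and ae: "AE \<theta> in lborel. 0 < cmod (cis \<theta> - \<zeta>) \<and> cmod (cis \<theta> - \<zeta>) < \<delta> \<longrightarrow>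
       (\<exists>v. radial_lim \<phi> \<theta> v \<and> v \<noteq> w \<and> a * cmod (w - v) ^ n \<le> 1 - (cmod v)\<^sup>2 \<and> 1 - (cmod v)\<^sup>2 \<le> A * cmod (w - v) ^ n)"
    using contact_orderE[OF \<zeta> c w(2)] by blast
  obtain b B \<delta>' where bB: "b > 0" "B > 0" "\<delta>' > 0" and be: "AE \<theta> in lborel. 0 < cmod (cis \<theta> - \<zeta>) \<and> cmod (cis \<theta> - \<zeta>) < \<delta>' \<longrightarrow>
       (\<exists>v. radial_lim \<phi> \<theta> v \<and> v \<noteq> w \<and> b * cmod (w - v) ^ n' \<le> 1 - (cmod v)\<^sup>2 \<and> 1 - (cmod v)\<^sup>2 \<le> B * cmod (w - v) ^ n')"
    using contact_orderE[OF \<zeta> c' w(2)] by blast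
  have ce: "AE \<theta> in lborel. 0 < cmod (cis \<theta> - \<zeta>) \<and> cmod (cis \<theta> - \<zeta>) < min \<delta> \<delta>' \<longrightarrow>
      (\<exists>v. radial_lim \<phi> \<theta> v \<and> v \<noteq> w \<and> a * cmod (w - v) ^ n \<le> 1 - (cmod v)\<^sup>2 \<and> 1 - (cmod v)\<^sup>2 \<le> B * cmod (w - v) ^ n')"
    using ae be
  proof eventually_elim
    case (elim \<theta>)
    show ?case
    proof
      assume "0 < cmod (cis \<theta> - \<zeta>) \<and> cmod (cis \<theta> - \<zeta>) < min \<delta> \<delta>'"
      then have "0 < cmod (cis \<theta> - \<zeta>) \<and> cmod (cis \<theta> - \<zeta>) < \<delta>" "0 < cmod (cis \<theta> - \<zeta>) \<and> cmod (cis \<theta> - \<zeta>) < \<delta>'" by auto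
      with elim obtain u v where u: "radial_lim \<phi> \<theta> u" "u \<noteq> w" "a * cmod (w - u) ^ n \<le> 1 - (cmod u)\<^sup>2"
        and v: "radial_lim \<phi> \<theta> v" "1 - (cmod v)\<^sup>2 \<le> B * cmod (w - v) ^ n'" by blast
      have "v = u" by (rule radial_lim_unique[OF v(1) u(1)])
      then show "\<exists>v. radial_lim \<phi> \<theta> v \<and> v \<noteq> w \<and> a * cmod (w - v) ^ n \<le> 1 - (cmod v)\<^sup>2 \<and> 1 - (cmod v)\<^sup>2 \<le> B * cmod (w - v) ^ n'"
        using u v by blast
    qed
  qed
  \<comment> \<open>With d <= 1 the higher power is at most d^(n + 1), and d <= a / (2 B) then
    yields the contradiction a <= a / 2.\<close>
  define \<epsilon> where "\<epsilon> = min 1 (a / (2 * B))"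
  have \<epsilon>: "\<epsilon> > 0" "\<epsilon> \<le> 1" "\<epsilon> \<le> a / (2 * B)" using aA bB by (auto simp: \<epsilon>_def)
  have "min \<delta> \<delta>' > 0" using aA bB by simp
  from small_gap_exists[OF \<zeta> w(2) ce this \<epsilon>(1)]
  obtain v where v: "v \<noteq> w" "a * cmod (w - v) ^ n \<le> 1 - (cmod v)\<^sup>2" "1 - (cmod v)\<^sup>2 \<le> B * cmod (w - v) ^ n'" "cmod (w - v) \<le> \<epsilon>"
    by blast
  define d where "d = cmod (w - v)"
  have d: "d > 0" "d \<le> \<epsilon>" using v by (auto simp: d_def)
  have "a * d ^ n \<le> B * d ^ n'" using v(2,3) unfolding d_def by linarith
  also have "d ^ n' = d ^ n * d ^ (n' - n)" using nn by (simp add: power_add[symmetric])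
  also have "d ^ (n' - n) \<le> d"
    using nn d \<epsilon>(2) power_decreasing[of 1 "n' - n" d] by simp
  finally have "a * d ^ n \<le> B * (d ^ n * d)" using d bB by (simp add: mult_left_mono)
  then have "a \<le> B * d" using d(1) by (simp add: mult_ac)
  also have "\<dots> \<le> B * (a / (2 * B))" using d \<epsilon> bB by (intro mult_left_mono) auto
  also have "\<dots> = a / 2" using bB by simp
  finally show False using aA by simp
qed

lemma contact_order_unique: "cmod \<zeta> = 1 \<Longrightarrow> contact_order \<phi> \<zeta> n \<Longrightarrow> contact_order \<phi> \<zeta> n' \<Longrightarrow> n = n'"
  using contact_order_unique_le[of \<zeta> \<phi> n n'] contact_order_unique_le[of \<zeta> \<phi> n' n] by simp

section \<open>Boundary expansions and the first derivative at a contact point\<close>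

lemma bdry_expansion_poly:
  "bdry_expansion \<phi> \<zeta> n a \<longleftrightarrow>
    ((\<lambda>z. (\<phi> z - poly (\<Sum>k\<le>n. monom (a k) k) (z - \<zeta>)) / (z - \<zeta>) ^ n) \<longlongrightarrow> 0) (at \<zeta> within ball 0 1)"
  unfolding bdry_expansion_def poly_sum poly_monom norm_divide[symmetric] norm_power[symmetric] tendsto_norm_zero_iff ..

lemma bdry_expansion_value:
  assumes \<zeta>: "cmod \<zeta> = 1" and e: "bdry_expansion \<phi> \<zeta> n a" and n: "n > 0" and lim: "(\<phi> \<longlongrightarrow> w) (at \<zeta> within ball 0 1)"
  shows "a 0 = w" "((\<lambda>z. (\<phi> z - w) / (z - \<zeta>)) \<longlongrightarrow> a 1) (at \<zeta> within ball 0 1)"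
proof -
  let ?F = "at \<zeta> within ball 0 1"
  define q where "q = (\<Sum>k\<le>n. monom (a k) k)"
  have cq: "coeff q k = (if k \<le> n then a k else 0)" for k
    by (simp add: q_def coeff_sum)
  have L: "((\<lambda>z. (\<phi> z - poly q (z - \<zeta>)) / (z - \<zeta>) ^ n) \<longlongrightarrow> 0) ?F"
    using e unfolding bdry_expansion_poly q_def .
  have x0: "((\<lambda>z. z - \<zeta>) \<longlongrightarrow> 0) ?F" by (auto intro!: tendsto_eq_intros)
  have nz: "eventually (\<lambda>z. z - \<zeta> \<noteq> 0) ?F" unfolding eventually_at_filter by simp
  have "((\<lambda>z. (\<phi> z - poly q (z - \<zeta>)) / (z - \<zeta>) ^ n * (z - \<zeta>) ^ n + poly q (z - \<zeta>)) \<longlongrightarrow> 0 * 0 ^ n + poly q 0) ?F"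
    by (intro tendsto_add tendsto_mult L tendsto_power x0 tendsto_poly)
  then have "(\<phi> \<longlongrightarrow> 0 * 0 ^ n + poly q 0) ?F"
    by (rule Lim_transform_eventually) (rule eventually_mono[OF nz], simp)
  then have "w = 0 * 0 ^ n + poly q 0" by (rule tendsto_unique[OF boundary_filter_nontrivial[OF \<zeta>] lim])
  then show a0: "a 0 = w" by (simp add: poly_0_coeff_0 cq)
  obtain c q1 where q: "q = pCons c q1" by (cases q)
  have c: "c = w" using cq[of 0] a0 by (simp add: q)
  have q10: "poly q1 0 = a 1" using cq[of 1] n by (simp add: q poly_0_coeff_0)
  have "((\<lambda>z. (\<phi> z - poly q (z - \<zeta>)) / (z - \<zeta>) ^ n * (z - \<zeta>) ^ (n - 1) + poly q1 (z - \<zeta>)) \<longlongrightarrow> 0 * 0 ^ (n - 1) + poly q1 0) ?F"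
    by (intro tendsto_add tendsto_mult L tendsto_power x0 tendsto_poly)
  then have "((\<lambda>z. (\<phi> z - poly q (z - \<zeta>)) / (z - \<zeta>) ^ n * (z - \<zeta>) ^ (n - 1) + poly q1 (z - \<zeta>)) \<longlongrightarrow> a 1) ?F" by (simp add: q10)
  then show "((\<lambda>z. (\<phi> z - w) / (z - \<zeta>)) \<longlongrightarrow> a 1) ?F"
  proof (rule Lim_transform_eventually)
    show "eventually (\<lambda>z. (\<phi> z - poly q (z - \<zeta>)) / (z - \<zeta>) ^ n * (z - \<zeta>) ^ (n - 1) + poly q1 (z - \<zeta>) = (\<phi> z - w) / (z - \<zeta>)) ?F"
      using nz
    proof eventually_elim
      case (elim z)
      have e: "(z - \<zeta>) ^ n = (z - \<zeta>) * (z - \<zeta>) ^ (n - 1)" using n by (cases n) auto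
      have "(f - (w + x * y)) / (x * s) * s + y = (f - w) / x" if "x \<noteq> 0" "s \<noteq> 0" for f x y s using that by (simp add: field_simps)
      from this[OF elim, of "(z - \<zeta>) ^ (n - 1)"] show ?case using elim by (simp add: q c e)
    qed
  qed
qed

text \<open>Along the radius |phi - w| >= 1 - |phi|, which by
  \<open>self_map_boundary_growth\<close> is at least a positive multiple of 1 - r, the distance to
  \<zeta>.\<close>

lemma bdry_derivative_nonzero:
  assumes \<phi>: "self_map \<phi>" and \<zeta>: "cmod \<zeta> = 1" and w: "cmod w = 1" and lim: "((\<lambda>z. (\<phi> z - w) / (z - \<zeta>)) \<longlongrightarrow> d) (at \<zeta> within ball 0 1)"
  shows "d \<noteq> 0"
proof -
  define c where "c = (1 - cmod (\<phi> 0)) / 2"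
  have c: "c > 0" using self_map_norm[OF \<phi>, of 0] by (simp add: c_def)
  have f: "filterlim (\<lambda>r. of_real r * \<zeta>) (at \<zeta> within ball 0 1) (at_left (1::real))"
  proof -
    have "eventually (\<lambda>r::real. r \<in> {0<..<1}) (at_left 1)" by (rule eventually_at_left_real) simp
    then have "eventually (\<lambda>r::real. of_real r * \<zeta> \<in> ball 0 1 \<and> of_real r * \<zeta> \<noteq> \<zeta>) (at_left 1)"
      by (rule eventually_mono) (use \<zeta> in \<open>auto simp: norm_mult\<close>)
    moreover have "((\<lambda>r::real. of_real r * \<zeta>) \<longlongrightarrow> \<zeta>) (at_left 1)" by (auto intro!: tendsto_eq_intros)
    ultimately show ?thesis unfolding filterlim_at by blast
  qed
  have "c \<le> cmod d"
  proof (rule tendsto_lowerbound)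
    show "((\<lambda>r. cmod ((\<phi> (of_real r * \<zeta>) - w) / (of_real r * \<zeta> - \<zeta>))) \<longlongrightarrow> cmod d) (at_left (1::real))"
      by (intro tendsto_norm filterlim_compose[OF lim f])
    have "eventually (\<lambda>r::real. r \<in> {0<..<1}) (at_left 1)" by (rule eventually_at_left_real) simp
    then show "eventually (\<lambda>r::real. c \<le> cmod ((\<phi> (of_real r * \<zeta>) - w) / (of_real r * \<zeta> - \<zeta>))) (at_left 1)"
    proof eventually_elim
      case (elim r)
      have z: "cmod (of_real r * \<zeta>) = r" using elim \<zeta> by (simp add: norm_mult)
      have "c * (1 - r) \<le> 1 - cmod (\<phi> (of_real r * \<zeta>))"
        using self_map_boundary_growth[OF \<phi>, of "of_real r * \<zeta>"] elim z by (simp add: c_def)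
      also have "\<dots> \<le> cmod (\<phi> (of_real r * \<zeta>) - w)" using norm_triangle_ineq2[of w "\<phi> (of_real r * \<zeta>)"] w by (simp add: norm_minus_commute)
      finally have 1: "c * (1 - r) \<le> cmod (\<phi> (of_real r * \<zeta>) - w)" .
      have "of_real r * \<zeta> - \<zeta> = - of_real (1 - r) * \<zeta>" by (simp add: algebra_simps)
      then have 2: "cmod (of_real r * \<zeta> - \<zeta>) = 1 - r" using elim \<zeta> by (simp add: norm_mult del: of_real_diff)
      show ?case unfolding norm_divide 2 using 1 elim by (simp add: pos_le_divide_eq)
    qed
  qed simp
  then show ?thesis using c by auto
qed

text \<open>The derivative at \<zeta> is finite and nonzero, so |v - w| is comparable with the
  distance from \<open>cis \<theta>\<close> to \<zeta>. The contact condition can then be read in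
  terms of that distance, common to all functions compared later.\<close>

lemma contact_bounds:
  assumes \<phi>: "self_map \<phi>" and \<zeta>: "cmod \<zeta> = 1" and co: "contact_order \<phi> \<zeta> n" and ex: "bdry_expansion \<phi> \<zeta> n a"
    and w: "cmod w = 1" "(\<phi> \<longlongrightarrow> w) (at \<zeta> within ball 0 1)"
  obtains c C c1 C1 \<delta> where "c > 0" "C > 0" "c1 > 0" "C1 > 0" "\<delta> > 0" "\<delta> \<le> 1"
    "AE \<theta> in lborel. 0 < cmod (cis \<theta> - \<zeta>) \<and> cmod (cis \<theta> - \<zeta>) < \<delta> \<longrightarrow> (\<exists>v. radial_lim \<phi> \<theta> v \<and>
       c * cmod (cis \<theta> - \<zeta>) ^ n \<le> 1 - (cmod v)\<^sup>2 \<and> 1 - (cmod v)\<^sup>2 \<le> C * cmod (cis \<theta> - \<zeta>) ^ n \<and>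
       c1 * cmod (cis \<theta> - \<zeta>) \<le> cmod (v - w) \<and> cmod (v - w) \<le> C1 * cmod (cis \<theta> - \<zeta>))"
proof -
  have n: "n > 0" by (rule contact_order_pos[OF \<zeta> co])
  define d where "d = a 1"
  have lim: "((\<lambda>z. (\<phi> z - w) / (z - \<zeta>)) \<longlongrightarrow> d) (at \<zeta> within ball 0 1)" unfolding d_def by (rule bdry_expansion_value(2)[OF \<zeta> ex n w(2)])
  have d: "d \<noteq> 0" by (rule bdry_derivative_nonzero[OF \<phi> \<zeta> w(1) lim])
  have "((\<lambda>z. cmod ((\<phi> z - w) / (z - \<zeta>))) \<longlongrightarrow> cmod d) (at \<zeta> within ball 0 1)" by (rule tendsto_norm[OF lim])
  then have "eventually (\<lambda>z. cmod d / 2 < cmod ((\<phi> z - w) / (z - \<zeta>)) \<and> cmod ((\<phi> z - w) / (z - \<zeta>)) < 2 * cmod d) (at \<zeta> within ball 0 1)"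
    using d by (intro eventually_conj order_tendstoD[of _ "cmod d"]) auto
  then obtain \<delta>1 where \<delta>1: "\<delta>1 > 0" "\<And>z. cmod z < 1 \<Longrightarrow> cmod (z - \<zeta>) < \<delta>1 \<Longrightarrow> cmod d / 2 < cmod ((\<phi> z - w) / (z - \<zeta>)) \<and> cmod ((\<phi> z - w) / (z - \<zeta>)) < 2 * cmod d"
    unfolding eventually_boundary[OF \<zeta>] by blast
  have bnd: "cmod d / 2 * cmod (z - \<zeta>) \<le> cmod (\<phi> z - w)" "cmod (\<phi> z - w) \<le> 2 * cmod d * cmod (z - \<zeta>) ^ 1" if z: "cmod z < 1" "cmod (z - \<zeta>) < \<delta>1" for z
  proof -
    have "0 < cmod (z - \<zeta>)" using z(1) \<zeta> by auto
    then show "cmod d / 2 * cmod (z - \<zeta>) \<le> cmod (\<phi> z - w)" "cmod (\<phi> z - w) \<le> 2 * cmod d * cmod (z - \<zeta>) ^ 1"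
      using \<delta>1(2)[OF z] by (auto simp: norm_divide pos_less_divide_eq pos_divide_less_eq)
  qed
  obtain k K \<delta>2 where kK: "k > 0" "K > 0" "\<delta>2 > 0" and ae: "AE \<theta> in lborel. 0 < cmod (cis \<theta> - \<zeta>) \<and> cmod (cis \<theta> - \<zeta>) < \<delta>2 \<longrightarrow>
       (\<exists>v. radial_lim \<phi> \<theta> v \<and> v \<noteq> w \<and> k * cmod (w - v) ^ n \<le> 1 - (cmod v)\<^sup>2 \<and> 1 - (cmod v)\<^sup>2 \<le> K * cmod (w - v) ^ n)"
    using contact_orderE[OF \<zeta> co w(2)] by blast
  show ?thesis
  proof (rule that[of "k * (cmod d / 2) ^ n" "K * (2 * cmod d) ^ n" "cmod d / 2" "2 * cmod d" "min 1 (min \<delta>1 \<delta>2)"])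
    show "AE \<theta> in lborel. 0 < cmod (cis \<theta> - \<zeta>) \<and> cmod (cis \<theta> - \<zeta>) < min 1 (min \<delta>1 \<delta>2) \<longrightarrow> (\<exists>v. radial_lim \<phi> \<theta> v \<and>
       k * (cmod d / 2) ^ n * cmod (cis \<theta> - \<zeta>) ^ n \<le> 1 - (cmod v)\<^sup>2 \<and> 1 - (cmod v)\<^sup>2 \<le> K * (2 * cmod d) ^ n * cmod (cis \<theta> - \<zeta>) ^ n \<and>
       cmod d / 2 * cmod (cis \<theta> - \<zeta>) \<le> cmod (v - w) \<and> cmod (v - w) \<le> 2 * cmod d * cmod (cis \<theta> - \<zeta>))"
      using ae
    proof eventually_elim
      case (elim \<theta>)
      show ?case
      proof
        assume \<theta>: "0 < cmod (cis \<theta> - \<zeta>) \<and> cmod (cis \<theta> - \<zeta>) < min 1 (min \<delta>1 \<delta>2)"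
        then obtain v where v: "radial_lim \<phi> \<theta> v" "k * cmod (v - w) ^ n \<le> 1 - (cmod v)\<^sup>2" "1 - (cmod v)\<^sup>2 \<le> K * cmod (v - w) ^ n"
          using elim by (auto simp: norm_minus_commute)
        have r: "radial_lim (\<lambda>z. \<phi> z - w) \<theta> (v - w)" using v(1) unfolding radial_lim_def by (intro tendsto_diff tendsto_const)
        have lo: "cmod d / 2 * cmod (cis \<theta> - \<zeta>) \<le> cmod (v - w)" using radial_lower[OF r bnd(1)] \<theta> by simp
        have up: "cmod (v - w) \<le> 2 * cmod d * cmod (cis \<theta> - \<zeta>)" using radial_upper[OF r bnd(2)] \<theta> by simp
        have "k * (cmod d / 2) ^ n * cmod (cis \<theta> - \<zeta>) ^ n \<le> k * cmod (v - w) ^ n"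
          unfolding mult.assoc power_mult_distrib[symmetric] using kK(1) d by (intro mult_left_mono power_mono lo) auto
        moreover have "K * cmod (v - w) ^ n \<le> K * (2 * cmod d) ^ n * cmod (cis \<theta> - \<zeta>) ^ n"
          unfolding mult.assoc[of K] power_mult_distrib[symmetric] using kK(2) by (intro mult_left_mono power_mono up) auto
        ultimately show "\<exists>v. radial_lim \<phi> \<theta> v \<and>
          k * (cmod d / 2) ^ n * cmod (cis \<theta> - \<zeta>) ^ n \<le> 1 - (cmod v)\<^sup>2 \<and> 1 - (cmod v)\<^sup>2 \<le> K * (2 * cmod d) ^ n * cmod (cis \<theta> - \<zeta>) ^ n \<and>
          cmod d / 2 * cmod (cis \<theta> - \<zeta>) \<le> cmod (v - w) \<and> cmod (v - w) \<le> 2 * cmod d * cmod (cis \<theta> - \<zeta>)"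
          using v lo up by (intro exI[of _ v]) linarith
      qed
    qed
  qed (use d kK \<delta>1(1) in auto)
qed

section \<open>Expansions in the half plane coordinate\<close>

lemma cay_tz: "cmod z < 1 \<Longrightarrow> cay (tz z) = z"
proof -
  assume "cmod z < 1"
  then have "1 + z \<noteq> 0" by (rule one_plus_nonzero)
  then have "1 + \<i> * tz z = 2 * z / (1 + z)" "1 - \<i> * tz z = 2 / (1 + z)"
    unfolding tz_def by (auto simp: field_simps)
  then show ?thesis using \<open>1 + z \<noteq> 0\<close> by (simp add: cay_def)
qed

text \<open>z is the Cayley transform of \<open>tz z\<close>, hence a quotient of two expansions
  whose denominator tends to 1.\<close>

lemma expn_ident: "\<exists>P. expn n (\<lambda>z. z) P"
proof -
  have "expn n (\<lambda>z. poly [:1, - \<i>:] (tz z)) [:1, - \<i>:]" by (rule expn_poly)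
  then obtain Q where Q: "expn n (\<lambda>z. 1 / poly [:1, - \<i>:] (tz z)) Q" using expn_inverse by fastforce
  have "expn n (\<lambda>z. poly [:1, \<i>:] (tz z) * (1 / poly [:1, - \<i>:] (tz z))) ([:1, \<i>:] * Q)"
    by (intro expn_mult expn_poly Q)
  then have "expn n (\<lambda>z. z) ([:1, \<i>:] * Q)"
  proof (rule expn_cong)
    fix z :: complex assume "cmod z < 1"
    from cay_tz[OF this] show "poly [:1, \<i>:] (tz z) * (1 / poly [:1, - \<i>:] (tz z)) = z"
      by (simp add: cay_def mult.commute)
  qed
  then show ?thesis by blast
qed

lemma expn_poly_arg: "\<exists>P. expn n (poly G) P"
proof (induction G)
  case 0
  show ?case using expn_const[of n 0] by (auto simp: poly_0)
next
  case (pCons a G)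
  then obtain P where P: "expn n (poly G) P" by blast
  obtain I where I: "expn n (\<lambda>z. z) I" using expn_ident by blast
  have "expn n (\<lambda>z. a + z * poly G z) ([:a:] + I * P)" by (intro expn_add expn_mult expn_const P I)
  then show ?case unfolding poly_pCons by blast
qed

text \<open>The two local variables are related by z - 1 = \<i> (1 + z) tz z, and 1 + z tends to 2,
  so errors of order n correspond.\<close>

lemma expn_of_taylor:
  assumes "((\<lambda>z. (f z - poly G z) / (z - 1) ^ n) \<longlongrightarrow> 0) disc1"
  shows "\<exists>P. expn n f P"
proof -
  obtain P where P: "expn n (poly G) P" using expn_poly_arg by blast
  have "((\<lambda>z. (f z - poly G z) / (z - 1) ^ n * (\<i> * (1 + z)) ^ n + (poly G z - poly P (tz z)) / tz z ^ n) \<longlongrightarrow> 0 * (\<i> * (1 + 1)) ^ n + 0) disc1"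
    by (intro tendsto_add tendsto_mult tendsto_power tendsto_const tendsto_ident_at assms P[unfolded expn_def])
  then have "((\<lambda>z. (f z - poly G z) / (z - 1) ^ n * (\<i> * (1 + z)) ^ n + (poly G z - poly P (tz z)) / tz z ^ n) \<longlongrightarrow> 0) disc1" by simp
  then have "expn n f P" unfolding expn_def
  proof (rule Lim_transform_eventually, intro eventually_disc1)
    fix z :: complex assume z: "cmod z < 1"
    then have nz: "1 + z \<noteq> 0" "z - 1 \<noteq> 0" "tz z \<noteq> 0" using one_plus_nonzero tz_nonzero by auto
    have e: "z - 1 = \<i> * (1 + z) * tz z" unfolding tz_def using nz(1) by (simp add: field_simps)
    have "(f z - poly G z) / (z - 1) ^ n * (\<i> * (1 + z)) ^ n = (f z - poly G z) / tz z ^ n"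
      unfolding e power_mult_distrib using nz by (simp add: field_simps)
    then show "(f z - poly G z) / (z - 1) ^ n * (\<i> * (1 + z)) ^ n + (poly G z - poly P (tz z)) / tz z ^ n = (f z - poly P (tz z)) / tz z ^ n"
      by (simp add: add_divide_distrib[symmetric])
  qed
  then show ?thesis by blast
qed

lemma rotate_disc1:
  assumes \<zeta>: "cmod \<zeta> = 1"
  shows "filterlim (\<lambda>z. \<zeta> * z) (at \<zeta> within ball 0 1) disc1"
proof -
  have "eventually (\<lambda>z. \<zeta> * z \<in> ball 0 1 \<and> \<zeta> * z \<noteq> \<zeta>) disc1"
    by (rule eventually_disc1) (use \<zeta> in \<open>auto simp: norm_mult\<close>)
  moreover have "((\<lambda>z. \<zeta> * z) \<longlongrightarrow> \<zeta>) disc1" by (auto intro!: tendsto_eq_intros)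
  ultimately show ?thesis unfolding filterlim_at by blast
qed

lemma uhp_transform_expn:
  assumes \<zeta>: "cmod \<zeta> = 1" and w: "cmod w = 1" "(\<phi> \<longlongrightarrow> w) (at \<zeta> within ball 0 1)" and ex: "bdry_expansion \<phi> \<zeta> n a"
  shows "\<exists>P. expn n (\<lambda>z. tz (cnj w * \<phi> (\<zeta> * z))) P \<and> poly P 0 = 0"
proof -
  define q where "q = (\<Sum>k\<le>n. monom (a k) k)"
  define f where "f = (\<lambda>z. cnj w * \<phi> (\<zeta> * z))"
  have ww: "cnj w * w = 1" using w(1) by (simp add: complex_norm_square[symmetric] mult.commute)
  have "((\<lambda>z. (\<phi> z - poly q (z - \<zeta>)) / (z - \<zeta>) ^ n) \<longlongrightarrow> 0) (at \<zeta> within ball 0 1)"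
    using ex unfolding bdry_expansion_poly q_def .
  from filterlim_compose[OF this rotate_disc1[OF \<zeta>]]
  have "((\<lambda>z. cnj w * \<zeta> ^ n * ((\<phi> (\<zeta> * z) - poly q (\<zeta> * z - \<zeta>)) / (\<zeta> * z - \<zeta>) ^ n)) \<longlongrightarrow> cnj w * \<zeta> ^ n * 0) disc1"
    by (intro tendsto_mult tendsto_const)
  then have "((\<lambda>z. cnj w * \<zeta> ^ n * ((\<phi> (\<zeta> * z) - poly q (\<zeta> * z - \<zeta>)) / (\<zeta> * z - \<zeta>) ^ n)) \<longlongrightarrow> 0) disc1" by simp
  then have "((\<lambda>z. (f z - poly (smult (cnj w) (q \<circ>\<^sub>p [:- \<zeta>, \<zeta>:])) z) / (z - 1) ^ n) \<longlongrightarrow> 0) disc1"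
  proof (rule Lim_transform_eventually, intro eventually_disc1)
    fix z :: complex assume "cmod z < 1"
    have z: "\<zeta> \<noteq> 0" using \<zeta> by auto
    have alg: "c * s * ((A - B) / (s * x)) = (c * A - c * B) / x" if "s \<noteq> 0" for c s A B x :: complex
      using that by (simp add: diff_divide_distrib right_diff_distrib)
    have e: "\<zeta> * z - \<zeta> = \<zeta> * (z - 1)" by (simp add: algebra_simps)
    have e2: "poly (smult (cnj w) (q \<circ>\<^sub>p [:- \<zeta>, \<zeta>:])) z = cnj w * poly q (\<zeta> * (z - 1))" by (simp add: poly_pcompose algebra_simps)
    show "cnj w * \<zeta> ^ n * ((\<phi> (\<zeta> * z) - poly q (\<zeta> * z - \<zeta>)) / (\<zeta> * z - \<zeta>) ^ n) = (f z - poly (smult (cnj w) (q \<circ>\<^sub>p [:- \<zeta>, \<zeta>:])) z) / (z - 1) ^ n"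
      unfolding e e2 f_def power_mult_distrib by (rule alg) (use z in simp)
  qed
  then obtain P where P: "expn n f P" using expn_of_taylor by blast
  have "((\<lambda>z. cnj w * \<phi> (\<zeta> * z)) \<longlongrightarrow> cnj w * w) disc1"
    by (intro tendsto_mult tendsto_const filterlim_compose[OF w(2) rotate_disc1[OF \<zeta>]])
  then have flim: "(f \<longlongrightarrow> 1) disc1" by (simp add: ww f_def)
  have P0: "poly P 0 = 1" by (rule tendsto_unique[OF disc1_nontrivial expn_tendsto[OF P] flim])
  have "expn n (\<lambda>z. 1 + f z) ([:1:] + P)" by (intro expn_add expn_const P)
  then obtain Q where Q: "expn n (\<lambda>z. 1 / (1 + f z)) Q" using expn_inverse[of n "\<lambda>z. 1 + f z" "[:1:] + P"] P0 by auto
  have "expn n (\<lambda>z. \<i> * (1 + (- 1) * f z) * (1 / (1 + f z))) ([:\<i>:] * ([:1:] + [:- 1:] * P) * Q)"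
    by (intro expn_mult expn_add expn_const P Q)
  then have h: "expn n (\<lambda>z. tz (f z)) ([:\<i>:] * ([:1:] + [:- 1:] * P) * Q)" by (rule expn_cong) (simp add: tz_def)
  moreover have "poly ([:\<i>:] * ([:1:] + [:- 1:] * P) * Q) 0 = 0" using P0 by simp
  ultimately show ?thesis unfolding f_def by blast
qed

text \<open>The bounds are known only at a sequence of nonzero points tending to 0, since they come
  from almost every angle. This already annihilates the coefficients below n and makes the one of
  degree n at least k; evenness of n replaces the absolute value by a power of \<tau>
  itself.\<close>

lemma poly_leading_behaviour:
  fixes q :: "real poly" and \<tau> :: "nat \<Rightarrow> real"
  assumes lim: "\<tau> \<longlonglongrightarrow> 0" and nz: "\<And>j. \<tau> j \<noteq> 0" and n: "even n" "n > 0" and k: "k > 0"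
    and lo: "\<And>j. k * \<bar>\<tau> j\<bar> ^ n \<le> poly q (\<tau> j)" and up: "\<And>j. poly q (\<tau> j) \<le> K * \<bar>\<tau> j\<bar> ^ n"
  obtains \<kappa> r where "\<kappa> > 0" "q = monom 1 n * pCons \<kappa> r"
proof -
  have c0: "coeff q j = 0" if "j < n" for j
  proof -
    have "((\<lambda>j. poly (cpoly q) (of_real (\<tau> j)) / of_real (\<tau> j) ^ (n - 1)) \<longlongrightarrow> 0) sequentially"
    proof (rule Lim_null_comparison)
      show "((\<lambda>j. K * \<bar>\<tau> j\<bar>) \<longlongrightarrow> 0) sequentially" using tendsto_mult[OF tendsto_const tendsto_rabs[OF lim]] by simp
      show "eventually (\<lambda>j. cmod (poly (cpoly q) (of_real (\<tau> j)) / of_real (\<tau> j) ^ (n - 1)) \<le> K * \<bar>\<tau> j\<bar>) sequentially"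
      proof (intro always_eventually allI)
        fix j
        have "0 \<le> k * \<bar>\<tau> j\<bar> ^ n" using k by simp
        then have "\<bar>poly q (\<tau> j)\<bar> \<le> K * \<bar>\<tau> j\<bar> ^ n" using lo[of j] up[of j] by linarith
        also have "\<bar>\<tau> j\<bar> ^ n = \<bar>\<tau> j\<bar> * \<bar>\<tau> j\<bar> ^ (n - 1)" using n by (cases n) auto
        finally have "\<bar>poly q (\<tau> j)\<bar> / \<bar>\<tau> j\<bar> ^ (n - 1) \<le> K * \<bar>\<tau> j\<bar>" using nz[of j] by (simp add: pos_divide_le_eq mult.assoc)
        then show "cmod (poly (cpoly q) (of_real (\<tau> j)) / of_real (\<tau> j) ^ (n - 1)) \<le> K * \<bar>\<tau> j\<bar>"
          unfolding poly_cpoly_of_real norm_divide norm_power norm_of_real .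
      qed
    qed
    moreover have "((\<lambda>j. complex_of_real (\<tau> j)) \<longlongrightarrow> 0) sequentially" using tendsto_of_real[OF lim] by simp
    ultimately have "coeff (cpoly q) j = 0"
      using nz that by (intro poly_tendsto_zero_coeff[where g = "\<lambda>j. complex_of_real (\<tau> j)" and n = "n - 1"]) auto
    then show ?thesis by (simp add: coeff_cpoly)
  qed
  then have "monom 1 n dvd q" unfolding monom_1_dvd_iff' by blast
  then obtain q2 where q2: "q = monom 1 n * q2" by (elim dvdE)
  obtain \<kappa> r where r: "q2 = pCons \<kappa> r" by (cases q2)
  have "k \<le> \<kappa>"
  proof (rule tendsto_lowerbound)
    have "((\<lambda>j. poly q2 (\<tau> j)) \<longlongrightarrow> poly q2 0) sequentially" by (intro tendsto_poly lim)
    then show "((\<lambda>j. poly q2 (\<tau> j)) \<longlongrightarrow> \<kappa>) sequentially" by (simp add: r)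
    show "eventually (\<lambda>j. k \<le> poly q2 (\<tau> j)) sequentially"
    proof (intro always_eventually allI)
      fix j
      have p: "\<bar>\<tau> j\<bar> ^ n > 0" "\<bar>\<tau> j\<bar> ^ n = \<tau> j ^ n" using nz[of j] power_even_abs[OF n(1)] by auto
      have "k * \<tau> j ^ n \<le> poly q2 (\<tau> j) * \<tau> j ^ n" using lo[of j] p by (simp add: q2 poly_monom mult.commute)
      then show "k \<le> poly q2 (\<tau> j)" using p by simp
    qed
  qed simp
  then show ?thesis using that[of \<kappa> r] q2 r k by (simp only:)
qed

lemma tz_real_on_circle: "cmod \<xi> = 1 \<Longrightarrow> tz \<xi> = of_real (Re (tz \<xi>))"
  using Im_tz[of \<xi>] by (simp add: complex_eq_iff)

lemma tz_norm_bounds: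
  assumes "cmod (z - 1) \<le> 1"
  shows "cmod (tz z) \<le> cmod (z - 1)" "cmod z \<le> 1 \<Longrightarrow> cmod (z - 1) \<le> 2 * cmod (tz z)" "1 \<le> cmod (1 + z)"
proof -
  have "1 + z = 2 - (1 - z)" by simp
  then have "cmod (1 + z) \<ge> cmod 2 - cmod (1 - z)" using norm_triangle_ineq2[of 2 "1 - z"] by simp
  then show a: "1 \<le> cmod (1 + z)" using assms by (simp add: norm_minus_commute)
  have e: "cmod (tz z) = cmod (z - 1) / cmod (1 + z)" by (simp add: tz_def norm_divide norm_mult norm_minus_commute)
  show "cmod (tz z) \<le> cmod (z - 1)" unfolding e using a mult_left_mono[OF a, of "cmod (z - 1)"] by (simp add: divide_le_eq)
  show "cmod (z - 1) \<le> 2 * cmod (tz z)" if "cmod z \<le> 1"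
  proof -
    have b: "cmod (1 + z) \<le> 2" using norm_triangle_ineq[of 1 z] that by simp
    have "cmod (z - 1) * cmod (1 + z) \<le> cmod (z - 1) * 2" by (intro mult_left_mono b) auto
    moreover have "0 < cmod (1 + z)" using a by linarith
    ultimately have "cmod (z - 1) \<le> cmod (z - 1) * 2 / cmod (1 + z)" by (simp only: pos_le_divide_eq)
    then show ?thesis unfolding e by (simp add: mult.commute)
  qed
qed

lemma expn_bound:
  assumes "expn n h P" "\<epsilon> > 0"
  obtains \<delta> where "\<delta> > 0" "\<delta> \<le> 1" "\<And>z. cmod z < 1 \<Longrightarrow> cmod (z - 1) < \<delta> \<Longrightarrow> cmod (h z - poly P (tz z)) \<le> \<epsilon> * cmod (z - 1) ^ n"
proof -
  have "eventually (\<lambda>z. dist ((h z - poly P (tz z)) / tz z ^ n) 0 < \<epsilon>) disc1" using assms unfolding expn_def by (rule tendstoD)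
  then obtain \<delta> where \<delta>: "\<delta> > 0" "\<And>z. cmod z < 1 \<Longrightarrow> cmod (z - 1) < \<delta> \<Longrightarrow> dist ((h z - poly P (tz z)) / tz z ^ n) 0 < \<epsilon>"
    unfolding eventually_boundary[OF norm_one] by blast
  show ?thesis
  proof (rule that[of "min \<delta> 1"])
    fix z assume z: "cmod z < 1" "cmod (z - 1) < min \<delta> 1"
    then have "cmod (h z - poly P (tz z)) < \<epsilon> * cmod (tz z) ^ n"
      using \<delta>(2)[of z] tz_nonzero[OF z(1)] by (simp add: norm_divide norm_power pos_divide_less_eq)
    also have "\<dots> \<le> \<epsilon> * cmod (z - 1) ^ n" using assms(2) z by (intro mult_left_mono power_mono tz_norm_bounds) auto
    finally show "cmod (h z - poly P (tz z)) \<le> \<epsilon> * cmod (z - 1) ^ n" by simp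
  qed (use \<delta> in auto)
qed

lemma radial_lim_uhp_transform:
  assumes v: "radial_lim \<phi> \<theta> v" and n1: "1 + cnj w * v \<noteq> 0"
  shows "radial_lim (\<lambda>z. tz (cnj w * \<phi> z)) \<theta> (tz (cnj w * v))"
  using v n1 unfolding radial_lim_def tz_def by (auto intro!: tendsto_intros)

lemma cpoly_Re_Im_parts:
  fixes P :: "complex poly"
  shows "P = cpoly (map_poly Re P) + smult \<i> (cpoly (map_poly Im P))"
  by (rule poly_eqI) (simp add: coeff_map_poly complex_eq_iff)

lemma Im_poly_of_real: "Im (poly P (of_real x)) = poly (map_poly Im P) x"
proof -
  have "poly P (of_real x) = of_real (poly (map_poly Re P) x) + \<i> * of_real (poly (map_poly Im P) x)"
    by (subst cpoly_Re_Im_parts) (simp add: poly_cpoly_of_real)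
  then show ?thesis by simp
qed

text \<open>On the circle the imaginary part of tz y, for y = cnj w v, is (1 - |v|^2) / |1 + y|^2,
  which is comparable with x^n for x the distance to \<zeta>. It differs by a small multiple of x^n
  from the imaginary part of \<open>P\<close> at the real point tz \<xi>, whose size is comparable
  with x.\<close>

lemma uhp_transform_boundary:
  assumes \<phi>: "self_map \<phi>" and \<zeta>: "cmod \<zeta> = 1" and co: "contact_order \<phi> \<zeta> n" and ex: "bdry_expansion \<phi> \<zeta> n a"
    and w: "cmod w = 1" "(\<phi> \<longlongrightarrow> w) (at \<zeta> within ball 0 1)"
    and P: "expn n (\<lambda>z. tz (cnj w * \<phi> (\<zeta> * z))) P"
  obtains k K where "k > 0" "\<And>r. r > 0 \<Longrightarrow> \<exists>\<tau>. \<tau> \<noteq> 0 \<and> \<bar>\<tau>\<bar> < r \<and> k * \<bar>\<tau>\<bar> ^ n \<le> poly (map_poly Im P) \<tau> \<and> poly (map_poly Im P) \<tau> \<le> K * \<bar>\<tau>\<bar> ^ n"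
proof -
  obtain c C c1 C1 \<delta> where cC: "c > 0" "C > 0" "c1 > 0" "C1 > 0" "\<delta> > 0" "\<delta> \<le> 1"
    and ae: "AE \<theta> in lborel. 0 < cmod (cis \<theta> - \<zeta>) \<and> cmod (cis \<theta> - \<zeta>) < \<delta> \<longrightarrow> (\<exists>v. radial_lim \<phi> \<theta> v \<and>
       c * cmod (cis \<theta> - \<zeta>) ^ n \<le> 1 - (cmod v)\<^sup>2 \<and> 1 - (cmod v)\<^sup>2 \<le> C * cmod (cis \<theta> - \<zeta>) ^ n \<and>
       c1 * cmod (cis \<theta> - \<zeta>) \<le> cmod (v - w) \<and> cmod (v - w) \<le> C1 * cmod (cis \<theta> - \<zeta>))"
    by (rule contact_bounds[OF \<phi> \<zeta> co ex w])
  \<comment> \<open>As |1 + y| <= 2, the lower bound for the imaginary part is c x^n / 4; an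
    expansion error of half that size leaves c / 8.\<close>
  have c8: "c / 8 > 0" using cC by simp
  obtain \<delta>' where \<delta>': "\<delta>' > 0" "\<delta>' \<le> 1" "\<And>z. cmod z < 1 \<Longrightarrow> cmod (z - 1) < \<delta>' \<Longrightarrow> cmod (tz (cnj w * \<phi> (\<zeta> * z)) - poly P (tz z)) \<le> c / 8 * cmod (z - 1) ^ n"
    using expn_bound[OF P c8] by blast
  have zz: "\<zeta> * cnj \<zeta> = 1" using \<zeta> by (simp add: complex_norm_square[symmetric])
  have zz': "\<zeta> * (cnj \<zeta> * z) = z" for z using zz by (simp add: mult.assoc[symmetric])
  have rot: "cmod (cnj \<zeta> * z - 1) = cmod (z - \<zeta>)" for z
  proof -
    have "cnj \<zeta> * z - 1 = cnj \<zeta> * (z - \<zeta>)" using zz by (simp add: algebra_simps)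
    then show ?thesis using \<zeta> by (simp add: norm_mult)
  qed
  show ?thesis
  proof (rule that[of "c / 8" "(C + c / 8) * 2 ^ n"])
    show "c / 8 > 0" by (rule c8)
    fix r :: real assume r: "r > 0"
    \<comment> \<open>The bound 1 / C1 forces |y - 1| <= 1, which keeps y at distance at least 1
      from the pole -1 of \<open>tz\<close>.\<close>
    define \<rho> where "\<rho> = min (min r (1 / C1)) (min \<delta> \<delta>')"
    have \<rho>: "\<rho> > 0" "\<rho> \<le> r" "\<rho> \<le> 1 / C1" "\<rho> \<le> \<delta>" "\<rho> \<le> \<delta>'" using r cC \<delta>' by (auto simp: \<rho>_def)
    obtain \<theta> v where \<theta>: "0 < cmod (cis \<theta> - \<zeta>)" "cmod (cis \<theta> - \<zeta>) < \<rho>" and v: "radial_lim \<phi> \<theta> v"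
       "c * cmod (cis \<theta> - \<zeta>) ^ n \<le> 1 - (cmod v)\<^sup>2" "1 - (cmod v)\<^sup>2 \<le> C * cmod (cis \<theta> - \<zeta>) ^ n"
       "cmod (v - w) \<le> C1 * cmod (cis \<theta> - \<zeta>)"
      using arc_AE_exists[OF \<zeta> ae \<rho>(1)] \<rho>(4) by fastforce
    define x where "x = cmod (cis \<theta> - \<zeta>)"
    define \<xi> where "\<xi> = cnj \<zeta> * cis \<theta>"
    define \<tau> where "\<tau> = Re (tz \<xi>)"
    have x: "0 < x" "x < \<rho>" "x < 1" using \<theta> \<rho> \<delta>' by (auto simp: x_def)
    have \<xi>1: "cmod \<xi> = 1" using \<zeta> by (simp add: \<xi>_def norm_mult)
    have \<xi>x: "cmod (\<xi> - 1) = x" by (simp add: \<xi>_def x_def rot)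
    have tx: "tz \<xi> = of_real \<tau>" unfolding \<tau>_def by (rule tz_real_on_circle[OF \<xi>1])
    have tb: "\<bar>\<tau>\<bar> \<le> x" "x \<le> 2 * \<bar>\<tau>\<bar>" and \<xi>n: "1 + \<xi> \<noteq> 0"
      using tz_norm_bounds[of \<xi>] \<xi>x \<xi>1 x tx by auto
    define y where "y = cnj w * v"
    have y1: "cmod (y - 1) \<le> 1"
    proof -
      have ww: "cnj w * w = 1" using w(1) by (simp add: complex_norm_square[symmetric] mult.commute)
      have "y - 1 = cnj w * (v - w)" using ww by (simp add: y_def algebra_simps)
      then have "cmod (y - 1) \<le> C1 * x" using v(4) w(1) by (simp add: norm_mult x_def)
      also have "\<dots> \<le> 1" using x(2) \<rho>(3) cC(4) mult_left_mono[of x "1 / C1" C1] by simp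
      finally show ?thesis .
    qed
    have yv: "cmod y = cmod v" using w(1) by (simp add: y_def norm_mult)
    have v1: "(cmod v)\<^sup>2 \<le> 1"
    proof -
      have "0 \<le> c * x ^ n" using cC(1) x(1) by simp
      then show ?thesis using v(2) by (simp add: x_def)
    qed
    then have v1': "cmod v \<le> 1" by (simp add: abs_square_le_1)
    have y2: "1 \<le> cmod (1 + y)" "cmod (1 + y) \<le> 2" using tz_norm_bounds(3)[OF y1] norm_triangle_ineq[of 1 y] yv v1' by auto
    then have yn: "1 + cnj w * v \<noteq> 0" unfolding y_def by auto
    have "radial_lim (\<lambda>z. tz (cnj w * \<phi> z) - poly P (tz (cnj \<zeta> * z))) \<theta> (tz y - poly P (tz \<xi>))"
    proof -
      have "((\<lambda>r. tz (cnj \<zeta> * (of_real r * cis \<theta>))) \<longlongrightarrow> tz \<xi>) (at_left 1)"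
        unfolding tz_def using \<xi>n unfolding \<xi>_def by (intro tendsto_intros radial_path) auto
      then show ?thesis using radial_lim_uhp_transform[OF v(1) yn] unfolding radial_lim_def y_def
        by (intro tendsto_diff tendsto_poly)
    qed
    then have "cmod (tz y - poly P (tz \<xi>)) \<le> c / 8 * cmod (cis \<theta> - \<zeta>) ^ n"
    proof (rule radial_upper[where \<delta> = \<delta>'])
      fix z assume "cmod z < 1" "cmod (z - \<zeta>) < \<delta>'"
      then show "cmod (tz (cnj w * \<phi> z) - poly P (tz (cnj \<zeta> * z))) \<le> c / 8 * cmod (z - \<zeta>) ^ n"
        using \<delta>'(3)[of "cnj \<zeta> * z"] unfolding rot zz' using \<zeta> by (simp add: norm_mult)
    qed (use \<theta> \<rho> in auto)
    then have "\<bar>Im (tz y - poly P (tz \<xi>))\<bar> \<le> c / 8 * x ^ n" using abs_Im_le_cmod[of "tz y - poly P (tz \<xi>)"] by (simp add: x_def)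
    then have b: "\<bar>(1 - (cmod v)\<^sup>2) / (cmod (1 + y))\<^sup>2 - poly (map_poly Im P) \<tau>\<bar> \<le> c / 8 * x ^ n"
      unfolding tx minus_complex.sel Im_poly_of_real Im_tz yv .
    have q1: "(1 - (cmod v)\<^sup>2) / (cmod (1 + y))\<^sup>2 \<le> C * x ^ n"
    proof -
      have "1 \<le> (cmod (1 + y))\<^sup>2" using y2 by simp
      then have "(1 - (cmod v)\<^sup>2) / (cmod (1 + y))\<^sup>2 \<le> 1 - (cmod v)\<^sup>2" using v1 mult_left_mono[of 1 "(cmod (1 + y))\<^sup>2" "1 - (cmod v)\<^sup>2"] by (simp add: divide_le_eq)
      then show ?thesis using v(3) by (simp add: x_def)
    qed
    have q2: "c * x ^ n / 4 \<le> (1 - (cmod v)\<^sup>2) / (cmod (1 + y))\<^sup>2"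
    proof (rule frac_le)
      show "(cmod (1 + y))\<^sup>2 \<le> 4" using power_mono[OF y2(2), of 2] by simp
      show "0 < (cmod (1 + y))\<^sup>2" using y2 by auto
    qed (use v v1 in \<open>auto simp: x_def\<close>)
    have lo: "c / 8 * x ^ n \<le> poly (map_poly Im P) \<tau>" and up: "poly (map_poly Im P) \<tau> \<le> (C + c / 8) * x ^ n"
    proof -
      define A s where "A = (1 - (cmod v)\<^sup>2) / (cmod (1 + y))\<^sup>2" and "s = x ^ n"
      have "A \<le> C * s" "c * s / 4 \<le> A" "\<bar>A - poly (map_poly Im P) \<tau>\<bar> \<le> c / 8 * s" using b q1 q2 unfolding A_def s_def by auto
      then show "c / 8 * x ^ n \<le> poly (map_poly Im P) \<tau>" "poly (map_poly Im P) \<tau> \<le> (C + c / 8) * x ^ n"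
        unfolding s_def[symmetric] abs_le_iff by (auto simp: algebra_simps)
    qed
    have "c / 8 * \<bar>\<tau>\<bar> ^ n \<le> c / 8 * x ^ n" using tb cC by (intro mult_left_mono power_mono) auto
    then have lo': "c / 8 * \<bar>\<tau>\<bar> ^ n \<le> poly (map_poly Im P) \<tau>" using lo by linarith
    have "(C + c / 8) * x ^ n \<le> (C + c / 8) * (2 * \<bar>\<tau>\<bar>) ^ n" using tb cC x by (intro mult_left_mono power_mono) auto
    then have up': "poly (map_poly Im P) \<tau> \<le> (C + c / 8) * 2 ^ n * \<bar>\<tau>\<bar> ^ n" using up by (simp add: power_mult_distrib mult.assoc)
    show "\<exists>\<tau>. \<tau> \<noteq> 0 \<and> \<bar>\<tau>\<bar> < r \<and> c / 8 * \<bar>\<tau>\<bar> ^ n \<le> poly (map_poly Im P) \<tau> \<and> poly (map_poly Im P) \<tau> \<le> (C + c / 8) * 2 ^ n * \<bar>\<tau>\<bar> ^ n"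
      using lo' up' tb x \<rho> by (intro exI[of _ \<tau>]) auto
  qed
qed

text \<open>The imaginary part of the expansion polynomial starts with a positive multiple of
  t^(2m); its further terms are o(t^(2m)) and are absorbed by the error, leaving the shape required
  by \<open>contact_uhp\<close>.\<close>

lemma contact_uhp_of_contact_order:
  assumes \<phi>: "self_map \<phi>" and \<zeta>: "cmod \<zeta> = 1" and m: "m > 0" and co: "contact_order \<phi> \<zeta> (2 * m)" and ex: "bdry_expansion \<phi> \<zeta> (2 * m) a"
    and w: "cmod w = 1" "(\<phi> \<longlongrightarrow> w) (at \<zeta> within ball 0 1)"
  shows "contact_uhp m (\<lambda>z. tz (cnj w * \<phi> (\<zeta> * z)))"
proof -
  let ?h = "\<lambda>z. tz (cnj w * \<phi> (\<zeta> * z))"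
  obtain P where P: "expn (2 * m) ?h P" "poly P 0 = 0" using uhp_transform_expn[OF \<zeta> w ex] by blast
  define q where "q = map_poly Im P"
  obtain k K where k: "k > 0" and ex\<tau>: "\<And>r. r > 0 \<Longrightarrow> \<exists>\<tau>. \<tau> \<noteq> 0 \<and> \<bar>\<tau>\<bar> < r \<and> k * \<bar>\<tau>\<bar> ^ (2 * m) \<le> poly q \<tau> \<and> poly q \<tau> \<le> K * \<bar>\<tau>\<bar> ^ (2 * m)"
    unfolding q_def using uhp_transform_boundary[OF \<phi> \<zeta> co ex w P(1)] by blast
  have "\<forall>j. \<exists>\<tau>. \<tau> \<noteq> 0 \<and> \<bar>\<tau>\<bar> < inverse (real (Suc j)) \<and> k * \<bar>\<tau>\<bar> ^ (2 * m) \<le> poly q \<tau> \<and> poly q \<tau> \<le> K * \<bar>\<tau>\<bar> ^ (2 * m)"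
    by (intro allI ex\<tau>) simp
  then obtain \<tau> :: "nat \<Rightarrow> real" where \<tau>: "\<And>j. \<tau> j \<noteq> 0" "\<And>j. \<bar>\<tau> j\<bar> < inverse (real (Suc j))"
    "\<And>j. k * \<bar>\<tau> j\<bar> ^ (2 * m) \<le> poly q (\<tau> j)" "\<And>j. poly q (\<tau> j) \<le> K * \<bar>\<tau> j\<bar> ^ (2 * m)"
    by metis
  have "\<tau> \<longlonglongrightarrow> 0"
    by (rule Lim_null_comparison[OF _ LIMSEQ_inverse_real_of_nat]) (use \<tau>(2) in \<open>auto intro!: always_eventually less_imp_le\<close>)
  then obtain \<kappa> r where \<kappa>: "\<kappa> > 0" and q: "q = monom 1 (2 * m) * pCons \<kappa> r"
    using poly_leading_behaviour[of \<tau> "2 * m" k q K] \<tau> m k by auto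
  define p where "p = map_poly Re P"
  have PP: "P = cpoly p + smult \<i> (cpoly q)" unfolding p_def q_def by (rule cpoly_Re_Im_parts)
  have p0: "poly p 0 = 0" using P(2) by (simp add: p_def poly_0_coeff_0 coeff_map_poly)
  have ex': "expn (2 * m) ?h (cpoly p + monom (\<i> * of_real \<kappa>) (2 * m))"
  proof -
    have "((\<lambda>z. (?h z - poly P (tz z)) / tz z ^ (2 * m) + \<i> * (tz z * poly (cpoly r) (tz z))) \<longlongrightarrow> 0 + \<i> * (0 * poly (cpoly r) 0)) disc1"
      by (intro tendsto_add tendsto_mult tendsto_const tz_tendsto tendsto_poly_tz P(1)[unfolded expn_def])
    then have "((\<lambda>z. (?h z - poly P (tz z)) / tz z ^ (2 * m) + \<i> * (tz z * poly (cpoly r) (tz z))) \<longlongrightarrow> 0) disc1" by simp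
    then show ?thesis unfolding expn_def
    proof (rule Lim_transform_eventually, intro eventually_disc1)
      fix z :: complex assume z: "cmod z < 1"
      define s where "s = tz z ^ (2 * m)"
      have s: "s \<noteq> 0" using tz_nonzero[OF z] by (simp add: s_def)
      have Pz: "poly P (tz z) = poly (cpoly p) (tz z) + \<i> * (s * (of_real \<kappa> + tz z * poly (cpoly r) (tz z)))"
        unfolding PP q cpoly_mult by (simp add: cpoly_monom map_poly_pCons poly_monom s_def algebra_simps)
      have Mz: "poly (cpoly p + monom (\<i> * of_real \<kappa>) (2 * m)) (tz z) = poly (cpoly p) (tz z) + \<i> * of_real \<kappa> * s"
        by (simp add: poly_monom s_def)
      have alg: "(h - (p + \<i> * (s * (k + y)))) / s + \<i> * y = (h - (p + \<i> * k * s)) / s" for h p k y using s by (simp add: field_simps)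
      show "(?h z - poly P (tz z)) / tz z ^ (2 * m) + \<i> * (tz z * poly (cpoly r) (tz z)) =
        (?h z - poly (cpoly p + monom (\<i> * of_real \<kappa>) (2 * m)) (tz z)) / tz z ^ (2 * m)"
        unfolding Pz Mz s_def[symmetric] by (rule alg)
    qed
  qed
  have lt: "cmod (cnj w * \<phi> (\<zeta> * z)) < 1" if "cmod z < 1" for z
    using self_map_norm[OF \<phi>, of "\<zeta> * z"] that w(1) \<zeta> by (simp add: norm_mult)
  have hol\<phi>: "(\<lambda>z. \<phi> (\<zeta> * z)) holomorphic_on ball 0 1"
  proof -
    have "\<phi> holomorphic_on ball 0 1" using \<phi> unfolding self_map_def by blast
    moreover have "(\<lambda>z. \<zeta> * z) holomorphic_on ball 0 1" by (intro holomorphic_intros)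
    moreover have "(\<lambda>z. \<zeta> * z) ` ball 0 1 \<subseteq> ball 0 1" using \<zeta> by (auto simp: norm_mult)
    ultimately show ?thesis using holomorphic_on_compose_gen[of "\<lambda>z. \<zeta> * z" "ball 0 1" \<phi> "ball 0 1"] by (simp add: o_def)
  qed
  have hol: "?h holomorphic_on ball 0 1"
    unfolding tz_def using lt one_plus_nonzero by (intro holomorphic_intros hol\<phi>) auto
  show ?thesis unfolding contact_uhp_def
    using hol Im_tz_pos[OF lt] \<kappa> p0 ex' by blast
qed

section \<open>Comparison with the basic function\<close>

lemma cay_lipschitz:
  assumes "Im a \<ge> 0" "Im b \<ge> 0"
  shows "cmod (cay a - cay b) \<le> 2 * cmod (a - b)"
proof -
  have d: "cmod (1 - \<i> * a) \<ge> 1" "cmod (1 - \<i> * b) \<ge> 1" using assms cay_denominator by auto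
  then have nz: "1 - \<i> * a \<noteq> 0" "1 - \<i> * b \<noteq> 0" by auto
  have "(2 - x) / x - (2 - y) / y = 2 * (y - x) / (x * y)" if "x \<noteq> 0" "y \<noteq> 0" for x y :: complex
    using that by (simp add: field_simps)
  from this[OF nz] have e: "cay a - cay b = 2 * (\<i> * (a - b)) / ((1 - \<i> * a) * (1 - \<i> * b))" by (simp add: cay_def algebra_simps)
  have "1 * 1 \<le> cmod (1 - \<i> * a) * cmod (1 - \<i> * b)" by (intro mult_mono d) auto
  then have "2 * cmod (a - b) / (cmod (1 - \<i> * a) * cmod (1 - \<i> * b)) \<le> 2 * cmod (a - b) / 1"
    by (intro divide_left_mono) auto
  then show ?thesis unfolding e by (simp add: norm_mult norm_divide)
qed

text \<open>The rational approximation is made in half plane coordinates; the Lipschitz bound for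
  \<open>cay\<close> brings the error back to the disc, where |tz u| <= |z - zeta| near the contact
  point preserves its order.\<close>

lemma basic_fun_model:
  assumes \<phi>: "self_map \<phi>" and \<zeta>: "cmod \<zeta> = 1" and m: "m > 0" and co: "contact_order \<phi> \<zeta> (2 * m)" and ex: "bdry_expansion \<phi> \<zeta> (2 * m) a"
  shows "\<exists>P Q. basic_fun P Q \<zeta> \<and> rat_deg P Q = Suc m \<and> ((\<lambda>z. (\<phi> z - rat_fun P Q z) / (z - \<zeta>) ^ (2 * m)) \<longlongrightarrow> 0) (at \<zeta> within ball 0 1)"
proof -
  obtain w where w: "cmod w = 1" "(\<phi> \<longlongrightarrow> w) (at \<zeta> within ball 0 1)" using contact_order_limit[OF co] by blast
  define h where "h = (\<lambda>z. tz (cnj w * \<phi> (\<zeta> * z)))"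
  have "contact_uhp m h" unfolding h_def by (rule contact_uhp_of_contact_order[OF \<phi> \<zeta> m co ex w])
  then obtain N D where ad: "adm N D" and ND: "poly N 1 = 0" "degree N = Suc m" "degree D \<le> Suc m" "card {z. poly N z = 0} = Suc m"
      "\<And>z. poly N z = 0 \<Longrightarrow> poly D z \<noteq> 0" and lim: "((\<lambda>z. (h z - poly N z / poly D z) / tz z ^ (2 * m)) \<longlongrightarrow> 0) disc1"
    using rational_uhp_model[of m h] m by blast
  obtain P Q where PQ: "basic_fun P Q \<zeta>" "rat_deg P Q = Suc m" and rat: "\<And>z. cmod z \<le> 1 \<Longrightarrow> rat_fun P Q z = w * cay (poly N (cnj \<zeta> * z) / poly D (cnj \<zeta> * z))"
    using basic_fun_of_uhp_model[OF ad ND \<zeta> w(1)] by blast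
  have zz: "\<zeta> * cnj \<zeta> = 1" and ww: "w * cnj w = 1" using \<zeta> w(1) by (simp_all add: complex_norm_square[symmetric])
  have zz': "\<zeta> * (cnj \<zeta> * z) = z" and ww': "w * (cnj w * z) = z" for z using zz ww by (simp_all add: mult.assoc[symmetric])
  have rot: "cmod (cnj \<zeta> * z - 1) = cmod (z - \<zeta>)" for z
  proof -
    have "cnj \<zeta> * z - 1 = cnj \<zeta> * (z - \<zeta>)" using zz by (simp add: algebra_simps)
    then show ?thesis using \<zeta> by (simp add: norm_mult)
  qed
  have f: "filterlim (\<lambda>z. cnj \<zeta> * z) disc1 (at \<zeta> within ball 0 1)"
  proof -
    have "\<forall>z. cmod z < 1 \<longrightarrow> cmod (z - \<zeta>) < 1 \<longrightarrow> cnj \<zeta> * z \<in> ball 0 1 \<and> cnj \<zeta> * z \<noteq> 1"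
    proof (intro allI impI)
      fix z assume "cmod z < 1"
      then have "cmod (cnj \<zeta> * z) < 1" using \<zeta> by (simp add: norm_mult)
      then show "cnj \<zeta> * z \<in> ball 0 1 \<and> cnj \<zeta> * z \<noteq> 1" by auto
    qed
    then have "eventually (\<lambda>z. cnj \<zeta> * z \<in> ball 0 1 \<and> cnj \<zeta> * z \<noteq> 1) (at \<zeta> within ball 0 1)"
      unfolding eventually_boundary[OF \<zeta>] using zero_less_one by blast
    moreover have "((\<lambda>z. cnj \<zeta> * z) \<longlongrightarrow> 1) (at \<zeta> within ball 0 1)" using zz by (auto intro!: tendsto_eq_intros simp: mult.commute)
    ultimately show ?thesis unfolding filterlim_at by blast
  qed
  define e where "e = (\<lambda>z. (h z - poly N z / poly D z) / tz z ^ (2 * m))"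
  have "((\<lambda>z. 2 * cmod (e (cnj \<zeta> * z))) \<longlongrightarrow> 2 * cmod 0) (at \<zeta> within ball 0 1)"
    using lim unfolding e_def[symmetric] by (intro tendsto_mult tendsto_const tendsto_norm filterlim_compose[OF _ f])
  then have e0: "((\<lambda>z. 2 * cmod (e (cnj \<zeta> * z))) \<longlongrightarrow> 0) (at \<zeta> within ball 0 1)" by simp
  have "\<forall>z. cmod z < 1 \<longrightarrow> cmod (z - \<zeta>) < 1 \<longrightarrow> cmod ((\<phi> z - rat_fun P Q z) / (z - \<zeta>) ^ (2 * m)) \<le> 2 * cmod (e (cnj \<zeta> * z))"
  proof (intro allI impI)
    fix z assume z: "cmod z < 1" "cmod (z - \<zeta>) < 1"
    define u where "u = cnj \<zeta> * z"
    have u: "cmod u < 1" using z(1) \<zeta> by (simp add: u_def norm_mult)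
    then have u1: "u \<noteq> 1" by auto
    have f1: "cmod (cnj w * \<phi> z) < 1" using self_map_norm[OF \<phi> z(1)] w(1) by (simp add: norm_mult)
    have hz: "h u = tz (cnj w * \<phi> z)" by (simp add: h_def u_def zz')
    have "\<phi> z = w * cay (h u)" unfolding hz cay_tz[OF f1] ww' ..
    moreover have "rat_fun P Q z = w * cay (poly N u / poly D u)" using rat[of z] z by (simp add: u_def)
    ultimately have "cmod (\<phi> z - rat_fun P Q z) = cmod (cay (h u) - cay (poly N u / poly D u))"
      using w(1) by (simp add: right_diff_distrib[symmetric] norm_mult)
    also have "\<dots> \<le> 2 * cmod (h u - poly N u / poly D u)"
      using Im_tz_pos[OF f1] ad u u1 unfolding adm_def hz by (intro cay_lipschitz) (auto intro: less_imp_le)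
    finally have 1: "cmod (\<phi> z - rat_fun P Q z) \<le> 2 * cmod (h u - poly N u / poly D u)" .
    have "cmod (tz u) \<le> cmod (z - \<zeta>)" using tz_norm_bounds(1)[of u] z(2) by (simp add: u_def rot)
    then have 2: "cmod (tz u) ^ (2 * m) \<le> cmod (z - \<zeta>) ^ (2 * m)" by (intro power_mono) auto
    have 3: "cmod (tz u) ^ (2 * m) > 0" using tz_nonzero[OF u] by simp
    show "cmod ((\<phi> z - rat_fun P Q z) / (z - \<zeta>) ^ (2 * m)) \<le> 2 * cmod (e (cnj \<zeta> * z))"
      unfolding u_def[symmetric] e_def norm_divide norm_power times_divide_eq_right
      by (intro frac_le 1 2 3) auto
  qed
  then have "eventually (\<lambda>z. cmod ((\<phi> z - rat_fun P Q z) / (z - \<zeta>) ^ (2 * m)) \<le> 2 * cmod (e (cnj \<zeta> * z))) (at \<zeta> within ball 0 1)"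
    unfolding eventually_boundary[OF \<zeta>] using zero_less_one by blast
  then have "((\<lambda>z. (\<phi> z - rat_fun P Q z) / (z - \<zeta>) ^ (2 * m)) \<longlongrightarrow> 0) (at \<zeta> within ball 0 1)"
    by (rule Lim_null_comparison[OF _ e0])
  then show ?thesis using PQ by blast
qed

section \<open>Boundary derivatives of the model\<close>

lemma holomorphic_bdry_expansion:
  assumes S: "open S" "\<zeta> \<in> S" "\<psi> holomorphic_on S"
  shows "((\<lambda>z. (\<psi> z - (\<Sum>k\<le>n. (deriv ^^ k) \<psi> \<zeta> / fact k * (z - \<zeta>) ^ k)) / (z - \<zeta>) ^ n) \<longlongrightarrow> 0) (at \<zeta> within T)"
proof -
  obtain r where r: "r > 0" "cball \<zeta> r \<subseteq> S" using S open_contains_cball by blast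
  have hol: "(deriv ^^ k) \<psi> holomorphic_on S" for k by (rule holomorphic_higher_deriv[OF S(3,1)])
  have "continuous_on (cball \<zeta> r) (\<lambda>z. cmod ((deriv ^^ Suc n) \<psi> z))"
    by (intro continuous_on_norm holomorphic_on_imp_continuous_on holomorphic_on_subset[OF hol r(2)])
  then have "bounded ((\<lambda>z. cmod ((deriv ^^ Suc n) \<psi> z)) ` cball \<zeta> r)" by (rule compact_imp_bounded[OF compact_continuous_image]) simp
  then obtain B where B': "\<forall>x\<in>(\<lambda>z. cmod ((deriv ^^ Suc n) \<psi> z)) ` cball \<zeta> r. norm x \<le> B" unfolding bounded_iff by blast
  have B: "cmod ((deriv ^^ Suc n) \<psi> z) \<le> B" if "z \<in> cball \<zeta> r" for z using bspec[OF B' imageI[OF that]] by simp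
  have der: "((deriv ^^ i) \<psi> has_field_derivative (deriv ^^ Suc i) \<psi> x) (at x within cball \<zeta> r)" if "x \<in> cball \<zeta> r" for i x
    using holomorphic_derivI[OF hol[of i] S(1), of x] that r(2) by (auto intro: DERIV_subset)
  have "eventually (\<lambda>z. z \<in> ball \<zeta> r) (at \<zeta> within T)" using r(1) by (intro eventually_at_topological[THEN iffD2] exI[of _ "ball \<zeta> r"]) auto
  moreover have "eventually (\<lambda>z. z \<noteq> \<zeta>) (at \<zeta> within T)" unfolding eventually_at_filter by simp
  ultimately have ev: "eventually (\<lambda>z. cmod ((\<psi> z - (\<Sum>k\<le>n. (deriv ^^ k) \<psi> \<zeta> / fact k * (z - \<zeta>) ^ k)) / (z - \<zeta>) ^ n) \<le> B / fact n * cmod (z - \<zeta>)) (at \<zeta> within T)"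
  proof eventually_elim
    case (elim z)
    have "cmod ((deriv ^^ 0) \<psi> z - (\<Sum>i\<le>n. (deriv ^^ i) \<psi> \<zeta> * (z - \<zeta>) ^ i / fact i)) \<le> B * cmod (z - \<zeta>) ^ Suc n / fact n"
      using elim r(1) B der by (intro complex_Taylor[where S = "cball \<zeta> r"]) auto
    then have "cmod (\<psi> z - (\<Sum>k\<le>n. (deriv ^^ k) \<psi> \<zeta> / fact k * (z - \<zeta>) ^ k)) \<le> B / fact n * cmod (z - \<zeta>) * cmod (z - \<zeta>) ^ n"
      by (simp add: mult_ac)
    then show ?case using elim by (simp add: norm_divide norm_power pos_divide_le_eq)
  qed
  have "((\<lambda>z. B / fact n * cmod (z - \<zeta>)) \<longlongrightarrow> B / fact n * cmod (\<zeta> - \<zeta>)) (at \<zeta> within T)" by (intro tendsto_intros)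
  then have "((\<lambda>z. B / fact n * cmod (z - \<zeta>)) \<longlongrightarrow> 0) (at \<zeta> within T)" by simp
  then show ?thesis by (rule Lim_null_comparison[OF ev])
qed

lemma bdry_expansion_unique:
  assumes \<zeta>: "cmod \<zeta> = 1" and a: "bdry_expansion \<phi> \<zeta> n a" and b: "bdry_expansion \<phi> \<zeta> n b" and k: "k \<le> n"
  shows "a k = b k"
proof -
  define p q where "p = (\<Sum>k\<le>n. monom (a k) k)" and "q = (\<Sum>k\<le>n. monom (b k) k)"
  have "((\<lambda>z. (\<phi> z - poly p (z - \<zeta>)) / (z - \<zeta>) ^ n - (\<phi> z - poly q (z - \<zeta>)) / (z - \<zeta>) ^ n) \<longlongrightarrow> 0 - 0) (at \<zeta> within ball 0 1)"
    using a b unfolding bdry_expansion_poly p_def q_def by (rule tendsto_diff)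
  then have lim: "((\<lambda>z. poly (q - p) (z - \<zeta>) / (z - \<zeta>) ^ n) \<longlongrightarrow> 0) (at \<zeta> within ball 0 1)"
    by (simp add: diff_divide_distrib[symmetric])
  have "((\<lambda>z. z - \<zeta>) \<longlongrightarrow> 0) (at \<zeta> within ball 0 1)" by (auto intro!: tendsto_eq_intros)
  then have "coeff (q - p) k = 0"
    by (rule poly_tendsto_zero_coeff[OF lim _ _ boundary_filter_nontrivial[OF \<zeta>] k]) (simp add: eventually_at_filter)
  then show ?thesis using k by (simp add: p_def q_def coeff_sum)
qed

text \<open>Agreement to order n makes the Taylor polynomial of \<open>\<psi>\<close> at \<zeta> an
  expansion of \<open>\<phi>\<close>. Extending its coefficients by 0 beyond n gives the unique
  sequence picked out by the definite description in \<open>bdry_deriv\<close>.\<close>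

lemma bdry_deriv_eq_deriv:
  assumes \<zeta>: "cmod \<zeta> = 1" and S: "open S" "\<zeta> \<in> S" "\<psi> holomorphic_on S"
    and lim: "((\<lambda>z. (\<phi> z - \<psi> z) / (z - \<zeta>) ^ n) \<longlongrightarrow> 0) (at \<zeta> within ball 0 1)" and k: "k \<le> n"
  shows "(deriv ^^ k) \<psi> \<zeta> = bdry_deriv \<phi> \<zeta> n k"
proof -
  define b where "b = (\<lambda>k. if k \<le> n then (deriv ^^ k) \<psi> \<zeta> / fact k else 0)"
  have pb: "poly (\<Sum>k\<le>n. monom (b k) k) z = (\<Sum>k\<le>n. (deriv ^^ k) \<psi> \<zeta> / fact k * z ^ k)" for z
    unfolding poly_sum by (intro sum.cong) (auto simp: b_def poly_monom)
  have "((\<lambda>z. (\<phi> z - \<psi> z) / (z - \<zeta>) ^ n + (\<psi> z - (\<Sum>k\<le>n. (deriv ^^ k) \<psi> \<zeta> / fact k * (z - \<zeta>) ^ k)) / (z - \<zeta>) ^ n) \<longlongrightarrow> 0 + 0) (at \<zeta> within ball 0 1)"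
    by (intro tendsto_add lim holomorphic_bdry_expansion[OF S])
  then have "bdry_expansion \<phi> \<zeta> n b" unfolding bdry_expansion_poly pb by (simp add: add_divide_distrib[symmetric])
  then have b: "(\<forall>i>n. b i = 0) \<and> bdry_expansion \<phi> \<zeta> n b" by (simp add: b_def)
  have "(THE a. (\<forall>i>n. a i = 0) \<and> bdry_expansion \<phi> \<zeta> n a) = b"
  proof (rule the_equality[of "\<lambda>a. (\<forall>i>n. a i = 0) \<and> bdry_expansion \<phi> \<zeta> n a", OF b])
    fix a assume a: "(\<forall>i>n. a i = 0) \<and> bdry_expansion \<phi> \<zeta> n a"
    show "a = b"
    proof (rule ext)
      fix i show "a i = b i" using bdry_expansion_unique[OF \<zeta>, of \<phi> n a b i] a b by (cases "i \<le> n") auto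
    qed
  qed
  then show ?thesis using k unfolding bdry_deriv_def by (simp add: b_def)
qed

section \<open>Transfer of the contact order and the quadratic estimate\<close>

lemma diff_norm_squares:
  assumes "cmod u \<le> 1" "cmod v \<le> 1"
  shows "\<bar>(cmod u)\<^sup>2 - (cmod v)\<^sup>2\<bar> \<le> 2 * cmod (u - v)"
proof -
  have "\<bar>(cmod u)\<^sup>2 - (cmod v)\<^sup>2\<bar> = \<bar>cmod u - cmod v\<bar> * (cmod u + cmod v)"
    by (simp add: power2_eq_square square_diff_square_factored abs_mult mult.commute)
  also have "\<dots> \<le> cmod (u - v) * 2" using assms by (intro mult_mono norm_triangle_ineq3) auto
  finally show ?thesis by simp
qed

lemma radial_lim_continuous:
  assumes "continuous_on (cball 0 1) \<psi>"
  shows "radial_lim \<psi> \<theta> (\<psi> (cis \<theta>))"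
  unfolding radial_lim_def
proof (rule continuous_on_tendsto_compose[OF assms radial_path])
  have "eventually (\<lambda>r::real. r \<in> {0<..<1}) (at_left 1)" by (rule eventually_at_left_real) simp
  then show "eventually (\<lambda>r::real. of_real r * cis \<theta> \<in> cball 0 1) (at_left 1)"
    by (rule eventually_mono) (auto simp: norm_mult)
qed simp

text \<open>The constants are fixed before \<epsilon> and the neighbourhood after it, which the
  quadratic estimate needs. The two thresholds ensure that an error \<epsilon> x^n costs at most
  half of the lower bounds: squared moduli differ by at most twice the distance of the
  values.\<close>

lemma contact_comparison:
  assumes \<phi>: "self_map \<phi>" and \<zeta>: "cmod \<zeta> = 1" and co: "contact_order \<phi> \<zeta> n" and ex: "bdry_expansion \<phi> \<zeta> n a"
    and \<psi>: "continuous_on (cball 0 1) \<psi>" "\<And>\<xi>. cmod \<xi> = 1 \<Longrightarrow> cmod (\<psi> \<xi>) \<le> 1"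
    and lim: "((\<lambda>z. (\<phi> z - \<psi> z) / (z - \<zeta>) ^ n) \<longlongrightarrow> 0) (at \<zeta> within ball 0 1)"
  obtains c C c1 C1 w where "c > 0" "C > 0" "c1 > 0" "C1 > 0" "cmod w = 1" "(\<phi> \<longlongrightarrow> w) (at \<zeta> within ball 0 1)"
    "\<forall>\<epsilon>. \<epsilon> > 0 \<longrightarrow> \<epsilon> \<le> c / 4 \<longrightarrow> \<epsilon> \<le> c1 / 2 \<longrightarrow> (\<exists>\<delta>>0. AE \<theta> in lborel. 0 < cmod (cis \<theta> - \<zeta>) \<and> cmod (cis \<theta> - \<zeta>) < \<delta> \<longrightarrow> (\<exists>v. radial_lim \<phi> \<theta> v \<and>
       cmod (v - \<psi> (cis \<theta>)) \<le> \<epsilon> * cmod (cis \<theta> - \<zeta>) ^ n \<and> c * cmod (cis \<theta> - \<zeta>) ^ n \<le> 1 - (cmod v)\<^sup>2 \<and>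
       c / 2 * cmod (cis \<theta> - \<zeta>) ^ n \<le> 1 - (cmod (\<psi> (cis \<theta>)))\<^sup>2 \<and> 1 - (cmod (\<psi> (cis \<theta>)))\<^sup>2 \<le> C * cmod (cis \<theta> - \<zeta>) ^ n \<and>
       c1 * cmod (cis \<theta> - \<zeta>) \<le> cmod (w - \<psi> (cis \<theta>)) \<and> cmod (w - \<psi> (cis \<theta>)) \<le> C1 * cmod (cis \<theta> - \<zeta>)))"
proof -
  obtain w where w: "cmod w = 1" "(\<phi> \<longlongrightarrow> w) (at \<zeta> within ball 0 1)" using contact_order_limit[OF co] by blast
  have n: "n > 0" by (rule contact_order_pos[OF \<zeta> co])
  obtain c C c1 C1 \<delta>0 where cC: "c > 0" "C > 0" "c1 > 0" "C1 > 0" "\<delta>0 > 0" "\<delta>0 \<le> 1"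
    and ae: "AE \<theta> in lborel. 0 < cmod (cis \<theta> - \<zeta>) \<and> cmod (cis \<theta> - \<zeta>) < \<delta>0 \<longrightarrow> (\<exists>v. radial_lim \<phi> \<theta> v \<and>
       c * cmod (cis \<theta> - \<zeta>) ^ n \<le> 1 - (cmod v)\<^sup>2 \<and> 1 - (cmod v)\<^sup>2 \<le> C * cmod (cis \<theta> - \<zeta>) ^ n \<and>
       c1 * cmod (cis \<theta> - \<zeta>) \<le> cmod (v - w) \<and> cmod (v - w) \<le> C1 * cmod (cis \<theta> - \<zeta>))"
    by (rule contact_bounds[OF \<phi> \<zeta> co ex w])
  show ?thesis
  proof (rule that[of c "C + c / 2" "c1 / 2" "C1 + c1" w], goal_cases)
    case 7
    show ?case
    proof (intro allI impI)
      fix \<epsilon> :: real assume \<epsilon>: "\<epsilon> > 0" "\<epsilon> \<le> c / 4" "\<epsilon> \<le> c1 / 2 / 2"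
      have "eventually (\<lambda>z. dist ((\<phi> z - \<psi> z) / (z - \<zeta>) ^ n) 0 < \<epsilon>) (at \<zeta> within ball 0 1)" using lim \<epsilon>(1) by (rule tendstoD)
      then obtain \<delta>1 where \<delta>1: "\<delta>1 > 0" "\<And>z. cmod z < 1 \<Longrightarrow> cmod (z - \<zeta>) < \<delta>1 \<Longrightarrow> dist ((\<phi> z - \<psi> z) / (z - \<zeta>) ^ n) 0 < \<epsilon>"
        unfolding eventually_boundary[OF \<zeta>] by blast
      have b: "cmod (\<phi> z - \<psi> z) \<le> \<epsilon> * cmod (z - \<zeta>) ^ n" if z: "cmod z < 1" "cmod (z - \<zeta>) < \<delta>1" for z
      proof -
        have "z \<noteq> \<zeta>" using z(1) \<zeta> by auto
        then show ?thesis using \<delta>1(2)[OF z] by (simp add: norm_divide norm_power pos_divide_less_eq)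
      qed
      show "\<exists>\<delta>>0. AE \<theta> in lborel. 0 < cmod (cis \<theta> - \<zeta>) \<and> cmod (cis \<theta> - \<zeta>) < \<delta> \<longrightarrow> (\<exists>v. radial_lim \<phi> \<theta> v \<and>
         cmod (v - \<psi> (cis \<theta>)) \<le> \<epsilon> * cmod (cis \<theta> - \<zeta>) ^ n \<and> c * cmod (cis \<theta> - \<zeta>) ^ n \<le> 1 - (cmod v)\<^sup>2 \<and>
         c / 2 * cmod (cis \<theta> - \<zeta>) ^ n \<le> 1 - (cmod (\<psi> (cis \<theta>)))\<^sup>2 \<and> 1 - (cmod (\<psi> (cis \<theta>)))\<^sup>2 \<le> (C + c / 2) * cmod (cis \<theta> - \<zeta>) ^ n \<and>
         c1 / 2 * cmod (cis \<theta> - \<zeta>) \<le> cmod (w - \<psi> (cis \<theta>)) \<and> cmod (w - \<psi> (cis \<theta>)) \<le> (C1 + c1) * cmod (cis \<theta> - \<zeta>))"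
      proof (intro exI conjI)
        show "min \<delta>0 \<delta>1 > 0" using cC \<delta>1 by simp
        show "AE \<theta> in lborel. 0 < cmod (cis \<theta> - \<zeta>) \<and> cmod (cis \<theta> - \<zeta>) < min \<delta>0 \<delta>1 \<longrightarrow> (\<exists>v. radial_lim \<phi> \<theta> v \<and>
         cmod (v - \<psi> (cis \<theta>)) \<le> \<epsilon> * cmod (cis \<theta> - \<zeta>) ^ n \<and> c * cmod (cis \<theta> - \<zeta>) ^ n \<le> 1 - (cmod v)\<^sup>2 \<and>
         c / 2 * cmod (cis \<theta> - \<zeta>) ^ n \<le> 1 - (cmod (\<psi> (cis \<theta>)))\<^sup>2 \<and> 1 - (cmod (\<psi> (cis \<theta>)))\<^sup>2 \<le> (C + c / 2) * cmod (cis \<theta> - \<zeta>) ^ n \<and>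
         c1 / 2 * cmod (cis \<theta> - \<zeta>) \<le> cmod (w - \<psi> (cis \<theta>)) \<and> cmod (w - \<psi> (cis \<theta>)) \<le> (C1 + c1) * cmod (cis \<theta> - \<zeta>))"
          using ae
        proof eventually_elim
          case (elim \<theta>)
          show ?case
          proof
            assume \<theta>: "0 < cmod (cis \<theta> - \<zeta>) \<and> cmod (cis \<theta> - \<zeta>) < min \<delta>0 \<delta>1"
            define x where "x = cmod (cis \<theta> - \<zeta>)"
            define u where "u = \<psi> (cis \<theta>)"
            have x: "0 < x" "x < \<delta>0" "x < \<delta>1" "x < 1" using \<theta> cC by (auto simp: x_def)
            obtain v where v: "radial_lim \<phi> \<theta> v" "c * x ^ n \<le> 1 - (cmod v)\<^sup>2" "1 - (cmod v)\<^sup>2 \<le> C * x ^ n" "c1 * x \<le> cmod (v - w)" "cmod (v - w) \<le> C1 * x"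
              using elim \<theta> unfolding x_def by auto
            have "radial_lim \<psi> \<theta> u" unfolding u_def by (rule radial_lim_continuous[OF \<psi>(1)])
            then have "radial_lim (\<lambda>z. \<phi> z - \<psi> z) \<theta> (v - u)" using v(1) unfolding radial_lim_def by (intro tendsto_diff)
            then have vu: "cmod (v - u) \<le> \<epsilon> * x ^ n" unfolding x_def by (rule radial_upper[where \<delta> = \<delta>1]) (use b x in \<open>auto simp: x_def\<close>)
            have xn: "0 < x ^ n" "x ^ n \<le> x" using x n power_decreasing[of 1 n x] by auto
            have "0 \<le> c * x ^ n" using cC(1) xn by simp
            then have "(cmod v)\<^sup>2 \<le> 1" using v(2) by linarith
            then have v1: "cmod v \<le> 1" by (simp add: abs_square_le_1)
            have u1: "cmod u \<le> 1" unfolding u_def by (rule \<psi>(2)) simp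
            have sq: "\<bar>(cmod v)\<^sup>2 - (cmod u)\<^sup>2\<bar> \<le> 2 * (\<epsilon> * x ^ n)" using diff_norm_squares[OF v1 u1] vu by linarith
            have e1: "\<epsilon> * x ^ n \<le> c / 4 * x ^ n" using \<epsilon> xn by (intro mult_right_mono) auto
            have l1: "c / 2 * x ^ n \<le> 1 - (cmod u)\<^sup>2" and l2: "1 - (cmod u)\<^sup>2 \<le> (C + c / 2) * x ^ n"
              using sq e1 v(2,3) unfolding abs_le_iff by (auto simp: algebra_simps)
            have "\<epsilon> * x ^ n \<le> c1 / 2 * x" using \<epsilon> xn cC by (intro mult_mono) auto
            then have vu': "cmod (v - u) \<le> c1 / 2 * x" using vu by linarith
            have t: "cmod (v - w) - cmod (v - u) \<le> cmod (w - u)" "cmod (w - u) \<le> cmod (v - w) + cmod (v - u)"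
            proof -
              have e: "(v - u) - (w - u) = v - w" "(v - u) - (v - w) = w - u" by simp_all
              show "cmod (v - w) - cmod (v - u) \<le> cmod (w - u)" "cmod (w - u) \<le> cmod (v - w) + cmod (v - u)"
                using norm_triangle_ineq4[of "v - u" "w - u"] norm_triangle_ineq4[of "v - u" "v - w"] unfolding e by linarith+
            qed
            have cx: "0 < c1 * x" using cC x by simp
            have l3: "c1 / 2 * x \<le> cmod (w - u)" using t(1) v(4) vu' by simp
            have l4: "cmod (w - u) \<le> (C1 + c1) * x" using t(2) v(5) vu' cx by (simp add: algebra_simps)
            show "\<exists>v. radial_lim \<phi> \<theta> v \<and>
              cmod (v - \<psi> (cis \<theta>)) \<le> \<epsilon> * cmod (cis \<theta> - \<zeta>) ^ n \<and> c * cmod (cis \<theta> - \<zeta>) ^ n \<le> 1 - (cmod v)\<^sup>2 \<and>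
              c / 2 * cmod (cis \<theta> - \<zeta>) ^ n \<le> 1 - (cmod (\<psi> (cis \<theta>)))\<^sup>2 \<and> 1 - (cmod (\<psi> (cis \<theta>)))\<^sup>2 \<le> (C + c / 2) * cmod (cis \<theta> - \<zeta>) ^ n \<and>
              c1 / 2 * cmod (cis \<theta> - \<zeta>) \<le> cmod (w - \<psi> (cis \<theta>)) \<and> cmod (w - \<psi> (cis \<theta>)) \<le> (C1 + c1) * cmod (cis \<theta> - \<zeta>)"
              unfolding x_def[symmetric] u_def[symmetric] using v(1,2) vu l1 l2 l3 l4 by blast
          qed
        qed
      qed
    qed
  qed (use cC w in auto)
qed

text \<open>The bounds for \<open>\<psi>\<close> are in terms of the distance to \<zeta>; dividing
  by the powers of \<open>C1\<close> and \<open>c1\<close> restates them in terms of the distance to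
  \<open>w\<close>.\<close>

lemma contact_order_transfer:
  assumes \<phi>: "self_map \<phi>" and \<zeta>: "cmod \<zeta> = 1" and co: "contact_order \<phi> \<zeta> n" and ex: "bdry_expansion \<phi> \<zeta> n a"
    and \<psi>: "continuous_on (cball 0 1) \<psi>" "\<And>\<xi>. cmod \<xi> = 1 \<Longrightarrow> cmod (\<psi> \<xi>) \<le> 1"
    and lim: "((\<lambda>z. (\<phi> z - \<psi> z) / (z - \<zeta>) ^ n) \<longlongrightarrow> 0) (at \<zeta> within ball 0 1)"
  shows "contact_order \<psi> \<zeta> n"
proof -
  obtain c C c1 C1 w where cC: "c > 0" "C > 0" "c1 > 0" "C1 > 0" and w: "cmod w = 1" "(\<phi> \<longlongrightarrow> w) (at \<zeta> within ball 0 1)"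
    and cmp: "\<forall>\<epsilon>. \<epsilon> > 0 \<longrightarrow> \<epsilon> \<le> c / 4 \<longrightarrow> \<epsilon> \<le> c1 / 2 \<longrightarrow> (\<exists>\<delta>>0. AE \<theta> in lborel. 0 < cmod (cis \<theta> - \<zeta>) \<and> cmod (cis \<theta> - \<zeta>) < \<delta> \<longrightarrow> (\<exists>v. radial_lim \<phi> \<theta> v \<and>
       cmod (v - \<psi> (cis \<theta>)) \<le> \<epsilon> * cmod (cis \<theta> - \<zeta>) ^ n \<and> c * cmod (cis \<theta> - \<zeta>) ^ n \<le> 1 - (cmod v)\<^sup>2 \<and>
       c / 2 * cmod (cis \<theta> - \<zeta>) ^ n \<le> 1 - (cmod (\<psi> (cis \<theta>)))\<^sup>2 \<and> 1 - (cmod (\<psi> (cis \<theta>)))\<^sup>2 \<le> C * cmod (cis \<theta> - \<zeta>) ^ n \<and>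
       c1 * cmod (cis \<theta> - \<zeta>) \<le> cmod (w - \<psi> (cis \<theta>)) \<and> cmod (w - \<psi> (cis \<theta>)) \<le> C1 * cmod (cis \<theta> - \<zeta>)))"
    by (rule contact_comparison[OF \<phi> \<zeta> co ex \<psi> lim])
  define \<epsilon> where "\<epsilon> = min (c / 4) (c1 / 2)"
  have \<epsilon>: "\<epsilon> > 0" "\<epsilon> \<le> c / 4" "\<epsilon> \<le> c1 / 2" using cC by (auto simp: \<epsilon>_def)
  from cmp[rule_format, OF \<epsilon>] obtain \<delta> where \<delta>: "\<delta> > 0" and ae: "AE \<theta> in lborel. 0 < cmod (cis \<theta> - \<zeta>) \<and> cmod (cis \<theta> - \<zeta>) < \<delta> \<longrightarrow> (\<exists>v. radial_lim \<phi> \<theta> v \<and>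
       cmod (v - \<psi> (cis \<theta>)) \<le> \<epsilon> * cmod (cis \<theta> - \<zeta>) ^ n \<and> c * cmod (cis \<theta> - \<zeta>) ^ n \<le> 1 - (cmod v)\<^sup>2 \<and>
       c / 2 * cmod (cis \<theta> - \<zeta>) ^ n \<le> 1 - (cmod (\<psi> (cis \<theta>)))\<^sup>2 \<and> 1 - (cmod (\<psi> (cis \<theta>)))\<^sup>2 \<le> C * cmod (cis \<theta> - \<zeta>) ^ n \<and>
       c1 * cmod (cis \<theta> - \<zeta>) \<le> cmod (w - \<psi> (cis \<theta>)) \<and> cmod (w - \<psi> (cis \<theta>)) \<le> C1 * cmod (cis \<theta> - \<zeta>))"
    by blast
  have "AE \<theta> in lborel. 0 < cmod (cis \<theta> - \<zeta>) \<and> cmod (cis \<theta> - \<zeta>) < \<delta> \<longrightarrow> (\<exists>v. radial_lim \<psi> \<theta> v \<and>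
      c / 2 / C1 ^ n \<le> (1 - (cmod v)\<^sup>2) / (cmod (w - v)) ^ n \<and> (1 - (cmod v)\<^sup>2) / (cmod (w - v)) ^ n \<le> C / c1 ^ n)"
    using ae
  proof eventually_elim
    case (elim \<theta>)
    show ?case
    proof
      assume \<theta>: "0 < cmod (cis \<theta> - \<zeta>) \<and> cmod (cis \<theta> - \<zeta>) < \<delta>"
      define x u where "x = cmod (cis \<theta> - \<zeta>)" and "u = \<psi> (cis \<theta>)"
      have x: "x > 0" using \<theta> by (simp add: x_def)
      have b: "c / 2 * x ^ n \<le> 1 - (cmod u)\<^sup>2" "1 - (cmod u)\<^sup>2 \<le> C * x ^ n" "c1 * x \<le> cmod (w - u)" "cmod (w - u) \<le> C1 * x"
        using elim \<theta> unfolding x_def u_def by auto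
      have r: "radial_lim \<psi> \<theta> u" unfolding u_def by (rule radial_lim_continuous[OF \<psi>(1)])
      have cx: "0 < c1 * x" using cC x by simp
      have p: "(c1 * x) ^ n \<le> cmod (w - u) ^ n" "cmod (w - u) ^ n \<le> (C1 * x) ^ n" "0 < (c1 * x) ^ n"
        using b cx by (auto intro!: power_mono)
      have pos: "0 < cmod (w - u) ^ n" using p by linarith
      have nn: "0 \<le> c / 2 * x ^ n" using cC x by simp
      have "c / 2 / C1 ^ n = c / 2 * x ^ n / (C1 * x) ^ n" using x by (simp add: power_mult_distrib)
      also have "\<dots> \<le> (1 - (cmod u)\<^sup>2) / cmod (w - u) ^ n" using b nn by (intro frac_le p pos) auto
      finally have 1: "c / 2 / C1 ^ n \<le> (1 - (cmod u)\<^sup>2) / cmod (w - u) ^ n" .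
      have "(1 - (cmod u)\<^sup>2) / cmod (w - u) ^ n \<le> C * x ^ n / (c1 * x) ^ n" using b cC x by (intro frac_le p) auto
      also have "\<dots> = C / c1 ^ n" using x by (simp add: power_mult_distrib)
      finally have 2: "(1 - (cmod u)\<^sup>2) / cmod (w - u) ^ n \<le> C / c1 ^ n" .
      show "\<exists>v. radial_lim \<psi> \<theta> v \<and> c / 2 / C1 ^ n \<le> (1 - (cmod v)\<^sup>2) / (cmod (w - v)) ^ n \<and> (1 - (cmod v)\<^sup>2) / (cmod (w - v)) ^ n \<le> C / c1 ^ n"
        using r 1 2 by blast
    qed
  qed
  moreover have "(\<psi> \<longlongrightarrow> w) (at \<zeta> within ball 0 1)"
  proof -
    have "((\<lambda>z. \<phi> z - (\<phi> z - \<psi> z) / (z - \<zeta>) ^ n * (z - \<zeta>) ^ n) \<longlongrightarrow> w - 0 * (\<zeta> - \<zeta>) ^ n) (at \<zeta> within ball 0 1)"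
      by (intro tendsto_diff tendsto_mult tendsto_power tendsto_ident_at tendsto_const w lim)
    then have "((\<lambda>z. \<phi> z - (\<phi> z - \<psi> z) / (z - \<zeta>) ^ n * (z - \<zeta>) ^ n) \<longlongrightarrow> w) (at \<zeta> within ball 0 1)" by simp
    then show ?thesis by (rule Lim_transform_eventually) (simp add: eventually_at_filter)
  qed
  moreover have "0 < c / 2 / C1 ^ n" "0 < C / c1 ^ n" using cC by simp_all
  ultimately show ?thesis unfolding contact_order_def using w(1) \<delta> by blast
qed

text \<open>The squared difference is at most \<epsilon>^2 x^(2n), and each of the two factors on
  the right is at least a fixed multiple of x^n, with x the distance to \<zeta>. A small \<epsilon>
  therefore produces any prescribed \<eta>.\<close>

lemma contact_quadratic_estimate:
  assumes \<phi>: "self_map \<phi>" and \<zeta>: "cmod \<zeta> = 1" and co: "contact_order \<phi> \<zeta> n" and ex: "bdry_expansion \<phi> \<zeta> n a"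
    and \<psi>: "continuous_on (cball 0 1) \<psi>" "\<And>\<xi>. cmod \<xi> = 1 \<Longrightarrow> cmod (\<psi> \<xi>) \<le> 1"
    and lim: "((\<lambda>z. (\<phi> z - \<psi> z) / (z - \<zeta>) ^ n) \<longlongrightarrow> 0) (at \<zeta> within ball 0 1)" and \<eta>: "\<eta> > 0"
  shows "\<exists>\<delta>>0. AE \<theta> in lborel. 0 < cmod (cis \<theta> - \<zeta>) \<and> cmod (cis \<theta> - \<zeta>) < \<delta> \<longrightarrow>
    (\<forall>v. radial_lim \<phi> \<theta> v \<longrightarrow> cmod v < 1 \<longrightarrow> (cmod (v - \<psi> (cis \<theta>)))\<^sup>2 \<le> \<eta> * ((1 - (cmod v)\<^sup>2) * (1 - (cmod (\<psi> (cis \<theta>)))\<^sup>2)))"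
proof -
  obtain c C c1 C1 w where cC: "c > 0" "C > 0" "c1 > 0" "C1 > 0" and w: "cmod w = 1" "(\<phi> \<longlongrightarrow> w) (at \<zeta> within ball 0 1)"
    and cmp: "\<forall>\<epsilon>. \<epsilon> > 0 \<longrightarrow> \<epsilon> \<le> c / 4 \<longrightarrow> \<epsilon> \<le> c1 / 2 \<longrightarrow> (\<exists>\<delta>>0. AE \<theta> in lborel. 0 < cmod (cis \<theta> - \<zeta>) \<and> cmod (cis \<theta> - \<zeta>) < \<delta> \<longrightarrow> (\<exists>v. radial_lim \<phi> \<theta> v \<and>
       cmod (v - \<psi> (cis \<theta>)) \<le> \<epsilon> * cmod (cis \<theta> - \<zeta>) ^ n \<and> c * cmod (cis \<theta> - \<zeta>) ^ n \<le> 1 - (cmod v)\<^sup>2 \<and>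
       c / 2 * cmod (cis \<theta> - \<zeta>) ^ n \<le> 1 - (cmod (\<psi> (cis \<theta>)))\<^sup>2 \<and> 1 - (cmod (\<psi> (cis \<theta>)))\<^sup>2 \<le> C * cmod (cis \<theta> - \<zeta>) ^ n \<and>
       c1 * cmod (cis \<theta> - \<zeta>) \<le> cmod (w - \<psi> (cis \<theta>)) \<and> cmod (w - \<psi> (cis \<theta>)) \<le> C1 * cmod (cis \<theta> - \<zeta>)))"
    by (rule contact_comparison[OF \<phi> \<zeta> co ex \<psi> lim])
  \<comment> \<open>The last entry is chosen so that \<epsilon>^2 is at most \<eta> times c * (c /
    2), the product of the lower bounds for the two factors.\<close>
  define \<epsilon> where "\<epsilon> = min (min (c / 4) (c1 / 2)) (c * sqrt (\<eta> / 2))"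
  have \<epsilon>: "\<epsilon> > 0" "\<epsilon> \<le> c / 4" "\<epsilon> \<le> c1 / 2" "\<epsilon> \<le> c * sqrt (\<eta> / 2)" using cC \<eta> by (auto simp: \<epsilon>_def)
  have "\<epsilon>\<^sup>2 \<le> (c * sqrt (\<eta> / 2))\<^sup>2" using \<epsilon> by (intro power_mono) auto
  also have "\<dots> = \<eta> * (c * (c / 2))" using \<eta> by (simp add: power_mult_distrib power2_eq_square[of c])
  finally have \<epsilon>2: "\<epsilon>\<^sup>2 \<le> \<eta> * (c * (c / 2))" .
  obtain \<delta> where \<delta>: "\<delta> > 0" and ae: "AE \<theta> in lborel. 0 < cmod (cis \<theta> - \<zeta>) \<and> cmod (cis \<theta> - \<zeta>) < \<delta> \<longrightarrow> (\<exists>v. radial_lim \<phi> \<theta> v \<and>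
       cmod (v - \<psi> (cis \<theta>)) \<le> \<epsilon> * cmod (cis \<theta> - \<zeta>) ^ n \<and> c * cmod (cis \<theta> - \<zeta>) ^ n \<le> 1 - (cmod v)\<^sup>2 \<and>
       c / 2 * cmod (cis \<theta> - \<zeta>) ^ n \<le> 1 - (cmod (\<psi> (cis \<theta>)))\<^sup>2 \<and> 1 - (cmod (\<psi> (cis \<theta>)))\<^sup>2 \<le> C * cmod (cis \<theta> - \<zeta>) ^ n \<and>
       c1 * cmod (cis \<theta> - \<zeta>) \<le> cmod (w - \<psi> (cis \<theta>)) \<and> cmod (w - \<psi> (cis \<theta>)) \<le> C1 * cmod (cis \<theta> - \<zeta>))"
    using cmp[rule_format, OF \<epsilon>(1,2,3)] by blast
  have "AE \<theta> in lborel. 0 < cmod (cis \<theta> - \<zeta>) \<and> cmod (cis \<theta> - \<zeta>) < \<delta> \<longrightarrow>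
    (\<forall>v. radial_lim \<phi> \<theta> v \<longrightarrow> cmod v < 1 \<longrightarrow> (cmod (v - \<psi> (cis \<theta>)))\<^sup>2 \<le> \<eta> * ((1 - (cmod v)\<^sup>2) * (1 - (cmod (\<psi> (cis \<theta>)))\<^sup>2)))"
    using ae
  proof eventually_elim
    case (elim \<theta>)
    show ?case
    proof (intro impI allI)
      fix v assume \<theta>: "0 < cmod (cis \<theta> - \<zeta>) \<and> cmod (cis \<theta> - \<zeta>) < \<delta>" and v: "radial_lim \<phi> \<theta> v"
      define s u where "s = cmod (cis \<theta> - \<zeta>) ^ n" and "u = \<psi> (cis \<theta>)"
      have s: "s \<ge> 0" by (simp add: s_def)
      have b: "cmod (v - u) \<le> \<epsilon> * s" "c * s \<le> 1 - (cmod v)\<^sup>2" "c / 2 * s \<le> 1 - (cmod u)\<^sup>2"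
        using elim \<theta> radial_lim_unique[OF v] unfolding s_def u_def by auto
      have nn: "0 \<le> c * s" "0 \<le> c / 2 * s" using cC s by simp_all
      have "(cmod (v - u))\<^sup>2 \<le> (\<epsilon> * s)\<^sup>2" using b(1) by (intro power_mono) auto
      also have "\<dots> = \<epsilon>\<^sup>2 * s\<^sup>2" by (simp add: power_mult_distrib)
      also have "\<dots> \<le> \<eta> * (c * (c / 2)) * s\<^sup>2" using \<epsilon>2 by (intro mult_right_mono) auto
      also have "\<dots> = \<eta> * ((c * s) * (c / 2 * s))" by (simp add: power2_eq_square mult_ac)
      also have "\<dots> \<le> \<eta> * ((1 - (cmod v)\<^sup>2) * (1 - (cmod u)\<^sup>2))" using \<eta> nn b by (intro mult_left_mono mult_mono) auto
      finally show "(cmod (v - \<psi> (cis \<theta>)))\<^sup>2 \<le> \<eta> * ((1 - (cmod v)\<^sup>2) * (1 - (cmod (\<psi> (cis \<theta>)))\<^sup>2))" unfolding u_def .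
    qed
  qed
  then show ?thesis using \<delta> by blast
qed

lemma rat_fun_holomorphic: "(\<And>z. z \<in> S \<Longrightarrow> poly Q z \<noteq> 0) \<Longrightarrow> rat_fun P Q holomorphic_on S"
  unfolding rat_fun_def by (intro holomorphic_intros) auto

lemma basic_fun_disc:
  assumes "basic_fun P Q \<zeta>"
  shows "self_map (rat_fun P Q)" "continuous_on (cball 0 1) (rat_fun P Q)" "\<And>\<xi>. cmod \<xi> = 1 \<Longrightarrow> \<xi> \<noteq> \<zeta> \<Longrightarrow> cmod (rat_fun P Q \<xi>) < 1"
    "\<And>\<xi>. cmod \<xi> = 1 \<Longrightarrow> cmod (rat_fun P Q \<xi>) \<le> 1"
proof -
  have Q: "poly Q z \<noteq> 0" if "cmod z \<le> 1" for z using assms that unfolding basic_fun_def by blast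
  show "self_map (rat_fun P Q)" using assms Q unfolding basic_fun_def self_map_def by (intro conjI rat_fun_holomorphic) auto
  show "continuous_on (cball 0 1) (rat_fun P Q)" by (intro holomorphic_on_imp_continuous_on rat_fun_holomorphic Q) auto
  show lt: "cmod (rat_fun P Q \<xi>) < 1" if "cmod \<xi> = 1" "\<xi> \<noteq> \<zeta>" for \<xi>
  proof -
    have "rat_fun P Q ` (sphere 0 1 - {\<zeta>}) \<subseteq> ball 0 1" using assms unfolding basic_fun_def by blast
    moreover have "\<xi> \<in> sphere 0 1 - {\<zeta>}" using that by simp
    ultimately have "rat_fun P Q \<xi> \<in> ball 0 1" by blast
    then show ?thesis by simp
  qed
  show "cmod (rat_fun P Q \<xi>) \<le> 1" if "cmod \<xi> = 1" for \<xi>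
  proof (cases "\<xi> = \<zeta>")
    case True
    then show ?thesis using assms unfolding basic_fun_def by simp
  qed (use lt that in force)
qed

theorem mainTheorem16:
  fixes \<phi> :: "complex \<Rightarrow> complex"
  assumes "class_S \<phi>"
  shows "\<exists>P Q :: complex \<Rightarrow> complex poly.
     (\<forall>\<zeta>\<in>F_set \<phi>. basic_fun (P \<zeta>) (Q \<zeta>) \<zeta> \<and>
        (\<forall>n. contact_order \<phi> \<zeta> n \<longrightarrow>
           rat_deg (P \<zeta>) (Q \<zeta>) = n div 2 + 1 \<and>
           contact_order (rat_fun (P \<zeta>) (Q \<zeta>)) \<zeta> n \<and>
           (\<forall>k\<le>n. (deriv ^^ k) (rat_fun (P \<zeta>) (Q \<zeta>)) \<zeta> = bdry_deriv \<phi> \<zeta> n k))) \<and>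
     H2_compact_op (\<lambda>f z. f (\<phi> z) - (\<Sum>\<zeta>\<in>F_set \<phi>. f (rat_fun (P \<zeta>) (Q \<zeta>) z)))"
proof -
  have \<phi>: "self_map \<phi>" and ae: "AE \<theta> in lborel. \<exists>v. radial_lim \<phi> \<theta> v \<and> cmod v < 1" and fin: "finite (E_set \<phi>)"
    and ct: "\<And>\<zeta>. \<zeta> \<in> F_set \<phi> \<Longrightarrow> \<exists>n. even n \<and> contact_order \<phi> \<zeta> n \<and> (\<exists>a. bdry_expansion \<phi> \<zeta> n a)"
    using assms unfolding class_S_def self_map_def by auto
  have F1: "cmod \<zeta> = 1" if "\<zeta> \<in> F_set \<phi>" for \<zeta> using that unfolding F_set_def by blast
  \<comment> \<open>The order and the expansion coefficients are chosen together with the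
    polynomials, so that all later facts at a point refer to the same order.\<close>
  define model where "model = (\<lambda>\<zeta> P Q n a. basic_fun P Q \<zeta> \<and> contact_order \<phi> \<zeta> n \<and> bdry_expansion \<phi> \<zeta> n a \<and>
      rat_deg P Q = n div 2 + 1 \<and> ((\<lambda>z. (\<phi> z - rat_fun P Q z) / (z - \<zeta>) ^ n) \<longlongrightarrow> 0) (at \<zeta> within ball 0 1))"
  have "\<exists>P Q n a. model \<zeta> P Q n a" if \<zeta>: "\<zeta> \<in> F_set \<phi>" for \<zeta>
  proof -
    obtain n a where n: "even n" "contact_order \<phi> \<zeta> n" "bdry_expansion \<phi> \<zeta> n a" using ct[OF \<zeta>] by blast
    obtain m where m: "n = 2 * m" using n(1) by (elim evenE)
    have m0: "m > 0" using contact_order_pos[OF F1[OF \<zeta>] n(2)] m by simp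
    from basic_fun_model[OF \<phi> F1[OF \<zeta>] m0 n(2,3)[unfolded m]]
    obtain P Q where "basic_fun P Q \<zeta>" "rat_deg P Q = Suc m" "((\<lambda>z. (\<phi> z - rat_fun P Q z) / (z - \<zeta>) ^ (2 * m)) \<longlongrightarrow> 0) (at \<zeta> within ball 0 1)" by blast
    then show ?thesis using n unfolding m model_def by (intro exI[of _ P] exI[of _ Q] exI[of _ "2 * m"] exI[of _ a]) auto
  qed
  then obtain P Q n a where "\<And>\<zeta>. \<zeta> \<in> F_set \<phi> \<Longrightarrow> model \<zeta> (P \<zeta>) (Q \<zeta>) (n \<zeta>) (a \<zeta>)" by metis
  then have M: "\<zeta> \<in> F_set \<phi> \<Longrightarrow> basic_fun (P \<zeta>) (Q \<zeta>) \<zeta> \<and> contact_order \<phi> \<zeta> (n \<zeta>) \<and> bdry_expansion \<phi> \<zeta> (n \<zeta>) (a \<zeta>) \<and>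
      rat_deg (P \<zeta>) (Q \<zeta>) = n \<zeta> div 2 + 1 \<and> ((\<lambda>z. (\<phi> z - rat_fun (P \<zeta>) (Q \<zeta>) z) / (z - \<zeta>) ^ n \<zeta>) \<longlongrightarrow> 0) (at \<zeta> within ball 0 1)" for \<zeta>
    unfolding model_def .
  have local: "basic_fun (P \<zeta>) (Q \<zeta>) \<zeta> \<and>
        (\<forall>n. contact_order \<phi> \<zeta> n \<longrightarrow>
           rat_deg (P \<zeta>) (Q \<zeta>) = n div 2 + 1 \<and>
           contact_order (rat_fun (P \<zeta>) (Q \<zeta>)) \<zeta> n \<and>
           (\<forall>k\<le>n. (deriv ^^ k) (rat_fun (P \<zeta>) (Q \<zeta>)) \<zeta> = bdry_deriv \<phi> \<zeta> n k))" if \<zeta>: "\<zeta> \<in> F_set \<phi>" for \<zeta>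
  proof (intro conjI allI impI)
    have b: "basic_fun (P \<zeta>) (Q \<zeta>) \<zeta>" and co: "contact_order \<phi> \<zeta> (n \<zeta>)" and ex: "bdry_expansion \<phi> \<zeta> (n \<zeta>) (a \<zeta>)"
      and d: "rat_deg (P \<zeta>) (Q \<zeta>) = n \<zeta> div 2 + 1" and l: "((\<lambda>z. (\<phi> z - rat_fun (P \<zeta>) (Q \<zeta>) z) / (z - \<zeta>) ^ n \<zeta>) \<longlongrightarrow> 0) (at \<zeta> within ball 0 1)"
      using M[OF \<zeta>] by blast+
    show "basic_fun (P \<zeta>) (Q \<zeta>) \<zeta>" by (rule b)
    fix n' assume "contact_order \<phi> \<zeta> n'"
    \<comment> \<open>The claim ranges over every contact order at \<zeta>; uniqueness identifies it
      with the order for which the model was built.\<close>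
    then have n': "n' = n \<zeta>" by (rule contact_order_unique[OF F1[OF \<zeta>] _ co])
    show "rat_deg (P \<zeta>) (Q \<zeta>) = n' div 2 + 1" unfolding n' by (rule d)
    show "contact_order (rat_fun (P \<zeta>) (Q \<zeta>)) \<zeta> n'" unfolding n'
      by (rule contact_order_transfer[OF \<phi> F1[OF \<zeta>] co ex basic_fun_disc(2,4)[OF b] l])
    fix k assume k: "k \<le> n'"
    show "(deriv ^^ k) (rat_fun (P \<zeta>) (Q \<zeta>)) \<zeta> = bdry_deriv \<phi> \<zeta> n' k"
    proof (rule bdry_deriv_eq_deriv[where S = "{z. poly (Q \<zeta>) z \<noteq> 0}"])
      show "open {z. poly (Q \<zeta>) z \<noteq> 0}" by (intro open_Collect_neq continuous_intros)
      show "\<zeta> \<in> {z. poly (Q \<zeta>) z \<noteq> 0}" using b F1[OF \<zeta>] unfolding basic_fun_def by auto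
      show "rat_fun (P \<zeta>) (Q \<zeta>) holomorphic_on {z. poly (Q \<zeta>) z \<noteq> 0}" by (rule rat_fun_holomorphic) simp
    qed (use F1[OF \<zeta>] l k n' in auto)
  qed
  have "H2_compact_op (comp_diff \<phi> (\<lambda>\<zeta>. rat_fun (P \<zeta>) (Q \<zeta>)) (F_set \<phi>))"
  proof (rule compact_of_local_models[OF \<phi> ae fin])
    fix \<zeta> assume \<zeta>: "\<zeta> \<in> F_set \<phi>"
    note b = M[OF \<zeta>, THEN conjunct1]
    show "self_map (rat_fun (P \<zeta>) (Q \<zeta>))" "continuous_on (cball 0 1) (rat_fun (P \<zeta>) (Q \<zeta>))" by (rule basic_fun_disc[OF b])+
    show "cmod (rat_fun (P \<zeta>) (Q \<zeta>) \<xi>) < 1" if "cmod \<xi> = 1" "\<xi> \<noteq> \<zeta>" for \<xi> by (rule basic_fun_disc(3)[OF b that])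
    fix \<eta> :: real assume \<eta>: "\<eta> > 0"
    show "\<exists>\<delta>>0. AE \<theta> in lborel. 0 < cmod (cis \<theta> - \<zeta>) \<and> cmod (cis \<theta> - \<zeta>) < \<delta> \<longrightarrow>
      (\<forall>v. radial_lim \<phi> \<theta> v \<longrightarrow> cmod v < 1 \<longrightarrow> (cmod (v - rat_fun (P \<zeta>) (Q \<zeta>) (cis \<theta>)))\<^sup>2 \<le> \<eta> * ((1 - (cmod v)\<^sup>2) * (1 - (cmod (rat_fun (P \<zeta>) (Q \<zeta>) (cis \<theta>)))\<^sup>2)))"
      using M[OF \<zeta>] by (intro contact_quadratic_estimate[OF \<phi> F1[OF \<zeta>] _ _ basic_fun_disc(2,4)[OF b] _ \<eta>, where n = "n \<zeta>" and a = "a \<zeta>"]) blast+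
  qed
  then have "H2_compact_op (\<lambda>f z. f (\<phi> z) - (\<Sum>\<zeta>\<in>F_set \<phi>. f (rat_fun (P \<zeta>) (Q \<zeta>) z)))" unfolding comp_diff_def[abs_def] .
  then show ?thesis using local by blast
qed

end
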